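(* Let $Q$ be a clause distribution of distribution complexity $r$ and let ${\mathcal Z}_Q$ be the associated planted satisfiability problem. Then ${\mathcal Z}_Q$ can be solved using $O(n^{r/2}\log n)$ random clauses and time linear in this number, and it can be implemented by a statistical algorithm in any of the following ways: (1) using $O(n^{r/2}\log^2 n)$ calls to 1-MSTAT$(n^{\lceil r/2\rceil})$; (2) for even $r$: using $O(\log n)$ calls to ${\rm MVSTAT}(n^{r/2},\, n^{r/2}\log\log n)$; (3) for odd $r$: using $O(\log n)$ calls to ${\rm MVSTAT}(O(n^{\lceil r/2\rceil}),\, O(n^{r/2}\log n))$.
   Context: A $k$-clause is an ordered $k$-tuple of literals from $x_1,\dots,x_n,\bar x_1,\dots,\bar x_n$ with no variable repeated; $X_k$ is the set of all $k$-clauses. For $\sigma\in\{\pm1\}^n$ and $C\in X_k$, $\sigma(C)\in\{\pm1\}^k$ is the vector of values of the literals of $C$ under $\sigma$ ($-1$ = TRUE, $1$ = FALSE). For a probability distribution $Q$ on $\{\pm1\}^k$, $Q_\sigma(C)=Q(\sigma(C))/\sum_{C'\in X_k}Q(\sigma(C'))$. With $\hat Q(S)=2^{-k}\sum_{y}Q(y)\prod_{i\in S}y_i$, the distribution complexity $r$ of $Q$ is the least $r\ge1$ with $\hat Q(S)\neq0$ for some $|S|=r$. The planted satisfiability problem ${\mathcal Z}_Q$: given i.i.d. clauses from $Q_\sigma$ for an unknown $\sigma$ (or oracle access to $Q_\sigma$), recover the planted assignment $\sigma$ with probability $1-o(1)$; in the case $r=1$ the requirement is to find an assignment with non-trivial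 correlation with $\sigma$ (agreeing with $\sigma$ on $n/2+t\sqrt n$ variables for an arbitrary constant $t$). Oracles for a distribution $D$ on $X$: 1-MSTAT$(L)$, given $h:X\to\{0,1,\dots,L-1\}$, returns $h(x)$ for a fresh sample $x\sim D$; ${\rm MVSTAT}(L,t)$, given $h:X\to\{0,\dots,L-1\}$ and a set $\mathcal S$ of subsets of $\{0,\dots,L-1\}$, returns some vector $v\in\mathbb{R}^L$ with $|\sum_{\ell\in Z}v_\ell-p_Z|\le\max\{1/t,\sqrt{p_Z(1-p_Z)/t}\}$ for every $Z\in\mathcal S$, where $p_Z=\Pr_D[h(x)\in Z]$ (answers otherwise arbitrary); the query cost of such a query is $|\mathcal S|$.
   Formalization: For r≥2, −σ also counts as recovered, but only when Q_{−σ}=Q_σ (then the two are indistinguishable). In the sampling algorithm, variables left unassigned get independent uniform values, as for r=1 the time bound is below n and the assignment cannot be written out in full. *)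

theory Defs
  imports "HOL-Probability.Probability" "HOL-Library.Landau_Symbols"
begin

section \<open>Clauses, planted distributions and distribution complexity\<close>

datatype literal = Pos nat | Neg nat

fun lit_var :: "literal \<Rightarrow> nat" where
  "lit_var (Pos i) = i"
| "lit_var (Neg i) = i"

type_synonym clause = "literal list"

text \<open>Truth values are \<open>-1\<close> (true) and \<open>1\<close> (false), so negation is the change of sign.\<close>

type_synonym assignment = "nat \<Rightarrow> int"

definition assignments :: "nat \<Rightarrow> assignment set" where
  "assignments n = {1..n} \<rightarrow>\<^sub>E {-1, 1}"

fun lit_val :: "assignment \<Rightarrow> literal \<Rightarrow> int" where
  "lit_val \<sigma> (Pos i) = \<sigma> i"
| "lit_val \<sigma> (Neg i) = - \<sigma> i"

definition clauses :: "nat \<Rightarrow> nat \<Rightarrow> clause set" where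
  "clauses k n = {C. length C = k \<and> distinct (map lit_var C) \<and> lit_var ` set C \<subseteq> {1..n}}"

definition clause_val :: "assignment \<Rightarrow> clause \<Rightarrow> int list" where
  "clause_val \<sigma> C = map (lit_val \<sigma>) C"

definition cube :: "nat \<Rightarrow> int list set" where
  "cube k = {y. length y = k \<and> set y \<subseteq> {-1, 1}}"

text \<open>The normalising sum is positive as soon as \<open>k \<le> n\<close>, see \<open>pmf_planted\<close> below.\<close>

definition planted :: "nat \<Rightarrow> int list pmf \<Rightarrow> nat \<Rightarrow> assignment \<Rightarrow> clause pmf" where
  "planted k Q n \<sigma> = embed_pmf (\<lambda>C. if C \<in> clauses k n
     then pmf Q (clause_val \<sigma> C) / (\<Sum>C'\<in>clauses k n. pmf Q (clause_val \<sigma> C')) else 0)"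

definition fourier :: "nat \<Rightarrow> int list pmf \<Rightarrow> nat set \<Rightarrow> real" where
  "fourier k Q S = (1 / 2 ^ k) * (\<Sum>y\<in>cube k. pmf Q y * (\<Prod>i\<in>S. real_of_int (y ! i)))"

definition has_distribution_complexity :: "nat \<Rightarrow> int list pmf \<Rightarrow> nat \<Rightarrow> bool" where
  "has_distribution_complexity k Q r \<longleftrightarrow>
     1 \<le> r \<and> (\<exists>S\<subseteq>{..<k}. card S = r \<and> fourier k Q S \<noteq> 0) \<and>
     (\<forall>r'. 1 \<le> r' \<and> (\<exists>S\<subseteq>{..<k}. card S = r' \<and> fourier k Q S \<noteq> 0) \<longrightarrow> r \<le> r')"

lemma finite_clauses: "finite (clauses k n)"
proof -
  have "clauses k n \<subseteq> {C. set C \<subseteq> Pos ` {1..n} \<union> Neg ` {1..n} \<and> length C = k}"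
  proof
    fix C assume C: "C \<in> clauses k n"
    have "l \<in> Pos ` {1..n} \<union> Neg ` {1..n}" if "l \<in> set C" for l
      using C that by (cases l) (force simp: clauses_def)+
    with C show "C \<in> {C. set C \<subseteq> Pos ` {1..n} \<union> Neg ` {1..n} \<and> length C = k}"
      by (auto simp: clauses_def)
  qed
  then show ?thesis
    by (rule finite_subset) (rule finite_lists_length_eq, simp)
qed

lemma planted_normaliser_pos:
  assumes Q: "set_pmf Q \<subseteq> cube k" and kn: "k \<le> n" and \<sigma>: "\<sigma> \<in> assignments n"
  shows "0 < (\<Sum>C\<in>clauses k n. pmf Q (clause_val \<sigma> C))"
proof -
  obtain y where y: "y \<in> set_pmf Q" using set_pmf_not_empty[of Q] by blast
  with Q have yk: "length y = k" "set y \<subseteq> {-1, 1}" by (auto simp: cube_def)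
  define C where "C = map (\<lambda>i. if y ! i = \<sigma> (Suc i) then Pos (Suc i) else Neg (Suc i)) [0..<k]"
  have lv: "map lit_var C = map Suc [0..<k]"
    by (auto simp: C_def)
  have "lit_var ` set C = set (map lit_var C)" by simp
  also have "\<dots> \<subseteq> {1..n}" using kn unfolding lv by auto
  finally have "lit_var ` set C \<subseteq> {1..n}" .
  moreover have "distinct (map lit_var C)" unfolding lv by (simp add: distinct_map)
  ultimately have CX: "C \<in> clauses k n"
    by (simp add: clauses_def) (simp add: C_def)
  have "clause_val \<sigma> C = y"
  proof (rule nth_equalityI)
    show "length (clause_val \<sigma> C) = length y" by (simp add: clause_val_def C_def yk)
    fix i assume "i < length (clause_val \<sigma> C)"
    then have i: "i < k" by (simp add: clause_val_def C_def)
    then have a: "y ! i \<in> {-1, 1}" using yk nth_mem by blast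
    have b: "\<sigma> (Suc i) \<in> {-1, 1}" using \<sigma> i kn by (auto simp: assignments_def PiE_def Pi_def)
    show "clause_val \<sigma> C ! i = y ! i"
      using i a b by (auto simp: clause_val_def C_def)
  qed
  then have "0 < pmf Q (clause_val \<sigma> C)" using y by (simp add: pmf_positive)
  then show ?thesis
    by (intro sum_pos2[OF finite_clauses CX]) auto
qed

lemma pmf_planted:
  assumes "set_pmf Q \<subseteq> cube k" "k \<le> n" "\<sigma> \<in> assignments n"
  shows "pmf (planted k Q n \<sigma>) C = (if C \<in> clauses k n
     then pmf Q (clause_val \<sigma> C) / (\<Sum>C'\<in>clauses k n. pmf Q (clause_val \<sigma> C')) else 0)"
proof -
  define N where "N = (\<Sum>C'\<in>clauses k n. pmf Q (clause_val \<sigma> C'))"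
  define f where "f = (\<lambda>C. if C \<in> clauses k n then pmf Q (clause_val \<sigma> C) / N else 0)"
  have N: "0 < N" unfolding N_def by (rule planted_normaliser_pos[OF assms])
  have f0: "0 \<le> f C" for C using N by (simp add: f_def)
  have "(\<integral>\<^sup>+C. ennreal (f C) \<partial>count_space UNIV) = (\<Sum>C\<in>clauses k n. ennreal (f C))"
    by (rule nn_integral_count_space'[OF finite_clauses]) (auto simp: f_def)
  also have "\<dots> = ennreal (\<Sum>C\<in>clauses k n. f C)"
    using f0 by (simp add: sum_ennreal)
  also have "(\<Sum>C\<in>clauses k n. f C) = 1"
    using N by (simp add: f_def sum_divide_distrib[symmetric]) (simp add: N_def)
  finally have "pmf (embed_pmf f) C = f C"
    by (intro pmf_embed_pmf) (simp_all add: f0)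
  then show ?thesis unfolding planted_def f_def N_def .
qed

section \<open>The planted satisfiability problem\<close>

text \<open>If every nonzero Fourier coefficient of \<open>Q\<close> sits on a set of even size, then \<open>\<sigma>\<close> and
  \<open>-\<sigma>\<close> induce the same clause distribution and no algorithm can tell them apart.
  Exactly in that case \<open>-\<sigma>\<close> counts as the planted assignment too.\<close>

definition planted_solution ::
  "nat \<Rightarrow> int list pmf \<Rightarrow> nat \<Rightarrow> real \<Rightarrow> nat \<Rightarrow> assignment \<Rightarrow> assignment \<Rightarrow> bool" where
  "planted_solution k Q r t n \<sigma> \<tau> \<longleftrightarrow> \<tau> \<in> assignments n \<and>
     (if r = 1
      then real (card {i \<in> {1..n}. \<tau> i = \<sigma> i}) \<ge> real n / 2 + t * sqrt (real n)
      else \<tau> = \<sigma> \<or>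
        (\<tau> = restrict (\<lambda>i. - \<sigma> i) {1..n} \<and> planted k Q n \<tau> = planted k Q n \<sigma>))"

section \<open>Random access machines sampling clauses\<close>

text \<open>\<open>Load\<close> and \<open>Store\<close> are the indirect accesses; \<open>Coin\<close> writes a fair bit; \<open>Draw d\<close> writes a
  fresh random clause to the cells \<open>d, d + 1, \<dots>\<close>; \<open>Assign a b\<close> gives the variable whose index is
  in cell \<open>a\<close> the sign of cell \<open>b\<close>. Each instruction takes one unit of time. The machine
  halts by leaving the program text.\<close>

datatype instr =
    Const nat int
  | Add nat nat nat
  | Sub nat nat nat
  | Mul nat nat nat
  | Div nat nat nat
  | Load nat nat
  | Store nat nat
  | JumpPos nat nat
  | Coin nat
  | Draw nat
  | Assign nat nat

record config =
  pc :: nat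
  mem :: "nat \<Rightarrow> int"
  answer :: "nat \<Rightarrow> int"
  drawn :: nat

fun lit_code :: "literal \<Rightarrow> int" where
  "lit_code (Pos i) = int i"
| "lit_code (Neg i) = - int i"

definition write_block :: "nat \<Rightarrow> int list \<Rightarrow> (nat \<Rightarrow> int) \<Rightarrow> nat \<Rightarrow> int" where
  "write_block d xs m = (\<lambda>a. if d \<le> a \<and> a < d + length xs then xs ! (a - d) else m a)"

definition set_cell :: "nat \<Rightarrow> int \<Rightarrow> config \<Rightarrow> config" where
  "set_cell d v c = c\<lparr>pc := Suc (pc c), mem := (mem c)(d := v)\<rparr>"

fun exec :: "clause pmf \<Rightarrow> instr \<Rightarrow> config \<Rightarrow> config pmf" where
  "exec D (Const d v) c = return_pmf (set_cell d v c)"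
| "exec D (Add d a b) c = return_pmf (set_cell d (mem c a + mem c b) c)"
| "exec D (Sub d a b) c = return_pmf (set_cell d (mem c a - mem c b) c)"
| "exec D (Mul d a b) c = return_pmf (set_cell d (mem c a * mem c b) c)"
| "exec D (Div d a b) c = return_pmf (set_cell d (mem c a div mem c b) c)"
| "exec D (Load d a) c = return_pmf (set_cell d (mem c (nat (mem c a))) c)"
| "exec D (Store a b) c = return_pmf (set_cell (nat (mem c a)) (mem c b) c)"
| "exec D (JumpPos a l) c = return_pmf (c\<lparr>pc := (if mem c a > 0 then l else Suc (pc c))\<rparr>)"
| "exec D (Coin d) c = map_pmf (\<lambda>v. set_cell d v c) (pmf_of_set {0, 1})"
| "exec D (Draw d) c = map_pmf (\<lambda>C. c\<lparr>pc := Suc (pc c),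
     mem := write_block d (map lit_code C) (mem c), drawn := Suc (drawn c)\<rparr>) D"
| "exec D (Assign a b) c = return_pmf (c\<lparr>pc := Suc (pc c),
     answer := (answer c)(nat (mem c a) := sgn (mem c b))\<rparr>)"

definition halted :: "instr list \<Rightarrow> config \<Rightarrow> bool" where
  "halted P c \<longleftrightarrow> length P \<le> pc c"

definition step :: "instr list \<Rightarrow> clause pmf \<Rightarrow> config \<Rightarrow> config pmf" where
  "step P D c = (if halted P c then return_pmf c else exec D (P ! pc c) c)"

definition init_config :: "nat \<Rightarrow> config" where
  "init_config n = \<lparr>pc = 0, mem = (\<lambda>_. 0)(0 := int n), answer = (\<lambda>_. 0), drawn = 0\<rparr>"

primrec run :: "instr list \<Rightarrow> clause pmf \<Rightarrow> nat \<Rightarrow> nat \<Rightarrow> config pmf" where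
  "run P D n 0 = return_pmf (init_config n)"
| "run P D n (Suc s) = bind_pmf (run P D n s) (step P D)"

text \<open>Variables that the machine leaves undecided get independent uniform values. (For complexity
  \<open>1\<close> the time bound is below \<open>n\<close>, so most variables cannot even be written.)\<close>

definition complete_answer :: "nat \<Rightarrow> (nat \<Rightarrow> int) \<Rightarrow> assignment pmf" where
  "complete_answer n out = Pi_pmf {1..n} undefined
     (\<lambda>i. if out i = 0 then pmf_of_set {-1, 1} else return_pmf (out i))"

text \<open>One program serves all \<open>n\<close>. On every run it halts within \<open>T n\<close> steps, draws at most \<open>m n\<close>
  clauses and works with words of \<open>O(log n)\<close> bits.\<close>

definition solved_from_samples ::
  "nat \<Rightarrow> int list pmf \<Rightarrow> nat \<Rightarrow> real \<Rightarrow> (nat \<Rightarrow> nat) \<Rightarrow> (nat \<Rightarrow> nat) \<Rightarrow> bool" where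
  "solved_from_samples k Q r t m T \<longleftrightarrow> (\<exists>P b \<delta>. \<delta> \<longlonglongrightarrow> (0::real) \<and>
     (\<forall>\<^sub>F n in sequentially. \<forall>\<sigma>\<in>assignments n.
        (\<forall>s\<le>T n. \<forall>c\<in>set_pmf (run P (planted k Q n \<sigma>) n s). \<forall>a. \<bar>mem c a\<bar> \<le> int n ^ b) \<and>
        (\<forall>c\<in>set_pmf (run P (planted k Q n \<sigma>) n (T n)). halted P c \<and> drawn c \<le> m n) \<and>
        measure_pmf.prob
          (bind_pmf (run P (planted k Q n \<sigma>) n (T n)) (\<lambda>c. complete_answer n (answer c)))
          {\<tau>. planted_solution k Q r t n \<sigma> \<tau>} \<ge> 1 - \<delta> n))"

section \<open>Statistical algorithms\<close>

text \<open>A statistical algorithm chooses its next query, and finally its output, at random depending on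
  the history of queries and answers. Oracles answer a query in view of the earlier history.\<close>

type_synonym ('q, 'a) history = "('q \<times> 'a) list"
type_synonym ('q, 'a) responder = "('q, 'a) history \<Rightarrow> 'q \<Rightarrow> 'a pmf"

primrec transcript ::
  "(('q, 'a) history \<Rightarrow> 'q pmf) \<Rightarrow> ('q, 'a) responder \<Rightarrow> nat \<Rightarrow> ('q, 'a) history pmf" where
  "transcript ask orc 0 = return_pmf []"
| "transcript ask orc (Suc q) =
     bind_pmf (transcript ask orc q) (\<lambda>h.
       bind_pmf (ask h) (\<lambda>x. map_pmf (\<lambda>a. h @ [(x, a)]) (orc h x)))"

text \<open>\<open>queries n\<close> are the admissible queries, \<open>oracles n D\<close> the oracles for the distribution \<open>D\<close>,
  and \<open>q n\<close> the number of calls.\<close>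

definition solved_by_statistical_algorithm ::
  "nat \<Rightarrow> int list pmf \<Rightarrow> nat \<Rightarrow> real \<Rightarrow> (nat \<Rightarrow> 'q set) \<Rightarrow>
   (nat \<Rightarrow> clause pmf \<Rightarrow> ('q, 'a) responder set) \<Rightarrow> (nat \<Rightarrow> nat) \<Rightarrow> bool" where
  "solved_by_statistical_algorithm k Q r t queries oracles q \<longleftrightarrow>
     (\<exists>(ask :: nat \<Rightarrow> ('q, 'a) history \<Rightarrow> 'q pmf) (guess :: nat \<Rightarrow> ('q, 'a) history \<Rightarrow> assignment pmf) \<delta>.
        \<delta> \<longlonglongrightarrow> (0::real) \<and>
        (\<forall>\<^sub>F n in sequentially. (\<forall>h. set_pmf (ask n h) \<subseteq> queries n) \<and>
           (\<forall>\<sigma>\<in>assignments n. \<forall>orc\<in>oracles n (planted k Q n \<sigma>).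
              measure_pmf.prob (bind_pmf (transcript (ask n) orc (q n)) (guess n))
                {\<tau>. planted_solution k Q r t n \<sigma> \<tau>} \<ge> 1 - \<delta> n)))"

definition mstat_queries :: "nat \<Rightarrow> nat \<Rightarrow> nat \<Rightarrow> (clause \<Rightarrow> nat) set" where
  "mstat_queries k L n = {h. h ` clauses k n \<subseteq> {..<L}}"

definition mstat_oracles :: "clause pmf \<Rightarrow> (clause \<Rightarrow> nat, nat) responder set" where
  "mstat_oracles D = {\<lambda>_ h. map_pmf h D}"

definition mvstat_queries :: "nat \<Rightarrow> nat \<Rightarrow> nat \<Rightarrow> ((clause \<Rightarrow> nat) \<times> nat set set) set" where
  "mvstat_queries k L n = mstat_queries k L n \<times> Pow (Pow {..<L})"

text \<open>Meaningful for \<open>s > 0\<close> only.\<close>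

definition mvstat_answer ::
  "nat \<Rightarrow> real \<Rightarrow> clause pmf \<Rightarrow> (clause \<Rightarrow> nat) \<Rightarrow> nat set set \<Rightarrow> real list \<Rightarrow> bool" where
  "mvstat_answer L s D h \<S> v \<longleftrightarrow> length v = L \<and>
     (\<forall>Z\<in>\<S>. let p = measure_pmf.prob D {C. h C \<in> Z}
             in \<bar>(\<Sum>l\<in>Z. v ! l) - p\<bar> \<le> max (1 / s) (sqrt (p * (1 - p) / s)))"

definition mvstat_oracles ::
  "nat \<Rightarrow> nat \<Rightarrow> real \<Rightarrow> nat \<Rightarrow> clause pmf \<Rightarrow>
   ((clause \<Rightarrow> nat) \<times> nat set set, real list) responder set" where
  "mvstat_oracles k L s n D =
     {orc. \<forall>hist. \<forall>(h, \<S>)\<in>mvstat_queries k L n. \<forall>v\<in>set_pmf (orc hist (h, \<S>)). mvstat_answer L s D h \<S> v}"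

definition solved_by_1_MSTAT ::
  "nat \<Rightarrow> int list pmf \<Rightarrow> nat \<Rightarrow> real \<Rightarrow> (nat \<Rightarrow> nat) \<Rightarrow> (nat \<Rightarrow> nat) \<Rightarrow> bool" where
  "solved_by_1_MSTAT k Q r t L q \<longleftrightarrow>
     solved_by_statistical_algorithm k Q r t (\<lambda>n. mstat_queries k (L n) n) (\<lambda>_. mstat_oracles) q"

definition solved_by_MVSTAT ::
  "nat \<Rightarrow> int list pmf \<Rightarrow> nat \<Rightarrow> real \<Rightarrow> (nat \<Rightarrow> nat) \<Rightarrow> (nat \<Rightarrow> real) \<Rightarrow> (nat \<Rightarrow> nat) \<Rightarrow> bool" where
  "solved_by_MVSTAT k Q r t L s q \<longleftrightarrow>
     solved_by_statistical_algorithm k Q r t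
       (\<lambda>n. mvstat_queries k (L n) n) (\<lambda>n. mvstat_oracles k (L n) (s n) n) q"

end

theory Submission
  imports Defs "HOL-Real_Asymp.Real_Asymp"
begin

text \<open>Let \<open>S\<close> be a set of \<open>r\<close> clause positions with nonzero Fourier coefficient. Given the variables of a clause
  at \<open>S\<close>, the product of its literal signs at \<open>S\<close> is a coin with constant bias towards the product of the planted
  values of these variables. Splitting \<open>S\<close> into parts of sizes \<open>\<lceil>r/2\<rceil>\<close> and \<open>\<lfloor>r/2\<rfloor>\<close> gives a noisy, sparsely sampled
  rank-one matrix indexed by tuples of variables, whose singular vectors are the two product vectors of the planted
  assignment. A power iteration with rounding to signs, using fresh clauses in every half round, starts from a
  single coordinate; the ratio of the support size to the squared correlation halves in every double round, so that
  after \<open>O(log n)\<close> rounds one vector has constant correlation. Majority votes against this vector are then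
  correct at every coordinate, and further votes read off single variables, with the global sign fixed by an
  odd Fourier coefficient if there is one.\<close>

text \<open>The obstacle is sparsity: a tuple expects a bounded number of votes per half round,
  often far less than one, so nothing concentrates at a single tuple before the last votes. A half
  round is therefore judged by two global numbers, the support and the correlation of the rounded
  vector, whose fluctuations Chebyshev and Efron-Stein control. Computing their means requires that
  all targets see the same vote probabilities; this is why the two kinds of tuples live on disjoint
  thirds of the variables. With \<open>m\<close> clauses a half round multiplies the potential by a
  constant times \<open>n ^ b / m\<close> or \<open>n ^ a / m\<close>. For odd \<open>r\<close> the
  second factor grows like a square root of \<open>n\<close>, and only the product,
  \<open>n ^ r / m ^ 2\<close>, can be made small; hence \<open>m\<close> of order
  \<open>n powr (r / 2)\<close> and a contraction over two half rounds. The machine and 1-MSTAT both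
  execute this vote clause by clause. MVSTAT needs no iteration: its answers hold for all sets of
  bins at once, and any sign vector explaining all of them already correlates with the planted
  one.\<close>

abbreviation prb :: "'a pmf => 'a set => real" where "prb p \<equiv> measure_pmf.prob p"
abbreviation ri :: "int => real" where "ri \<equiv> real_of_int"

section \<open>Expectations over finitely supported distributions\<close>

text \<open>A sum over the support instead of an integral, so that linearity, monotonicity and the
  exchange of two expectations come without integrability side conditions.\<close>

definition fexp :: "'a pmf => ('a => real) => real" where
 "fexp p f = (\<Sum>x\<in>set_pmf p. pmf p x * f x)"

lemma fexp_eq_expectation:
 "finite (set_pmf p) ==> fexp p f = measure_pmf.expectation p f"
 unfolding fexp_def by (subst integral_measure_pmf_real[where A="set_pmf p"]) (auto simp: mult.commute)

lemma fexp_const: "finite (set_pmf p) ==> fexp p (%_. c) = c"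
 by (simp add: fexp_eq_expectation)

lemma fexp_add: "fexp p (%x. f x + g x) = fexp p f + fexp p g"
 by (simp add: fexp_def distrib_left sum.distrib)

lemma fexp_diff: "fexp p (%x. f x - g x) = fexp p f - fexp p g"
 by (simp add: fexp_def right_diff_distrib sum_subtractf)

lemma fexp_cmult: "fexp p (%x. c * f x) = c * fexp p f"
 by (simp add: fexp_def sum_distrib_left algebra_simps)

lemma fexp_sum: "fexp p (%x. \<Sum>i\<in>I. f i x) = (\<Sum>i\<in>I. fexp p (f i))"
 by (simp add: fexp_def sum_distrib_left sum.swap[of _ I])

lemma fexp_mono: "(!!x. x \<in> set_pmf p ==> f x <= g x) ==> fexp p f <= fexp p g"
 unfolding fexp_def by (intro sum_mono mult_left_mono) auto

lemma fexp_cong: "(!!x. x \<in> set_pmf p ==> f x = g x) ==> fexp p f = fexp p g"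
 unfolding fexp_def by (intro sum.cong) auto

lemma fexp_nonneg: "(!!x. x \<in> set_pmf p ==> 0 <= f x) ==> 0 <= fexp p f"
 unfolding fexp_def by (intro sum_nonneg mult_nonneg_nonneg) auto

lemma fexp_swap: "fexp p (%x. fexp q (f x)) = fexp q (%y. fexp p (%x. f x y))"
 unfolding fexp_def by (simp add: sum_distrib_left) (subst sum.swap, simp add: algebra_simps)

lemma fexp_prob:
 "finite (set_pmf p) ==> prb p {x. P x} = fexp p (%x. if P x then 1 else 0)"
proof -
 assume fin: "finite (set_pmf p)"
 have "prb p {x. P x} = prb p ({x. P x} \<inter> set_pmf p)"
 by (simp add: measure_Int_set_pmf)
 also have "... = (\<Sum>x\<in>set_pmf p \<inter> {x. P x}. pmf p x)"
 using fin by (subst measure_measure_pmf_finite) (auto simp: Int_commute)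
 also have "... = fexp p (%x. if P x then 1 else 0)"
 using fin by (simp add: fexp_def if_distrib[of "times _"] sum.inter_restrict cong: if_cong)
 finally show ?thesis .
qed

lemma finite_set_replicate_pmf: "finite (set_pmf p) ==> finite (set_pmf (replicate_pmf m p))"
 by (induction m) auto

lemma fexp_replicate_Suc:
 assumes "finite (set_pmf p)"
 shows "fexp (replicate_pmf (Suc m) p) f = fexp p (%x. fexp (replicate_pmf m p) (%xs. f (x # xs)))"
proof -
 have [simp]: "replicate_pmf m p \<bind> (%xs. return_pmf (x # xs)) = map_pmf ((#) x) (replicate_pmf m p)" for x
 by (simp add: map_pmf_def)
 note fin = finite_set_replicate_pmf[OF assms]
 have "fexp (replicate_pmf (Suc m) p) f = measure_pmf.expectation (p \<bind> (%x. map_pmf ((#) x) (replicate_pmf m p))) f"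
 using fin[of "Suc m"] by (subst fexp_eq_expectation) simp_all
 also have "... = (\<Sum>a\<in>set_pmf p. pmf p a *\<^sub>R measure_pmf.expectation (map_pmf ((#) a) (replicate_pmf m p)) f)"
 by (rule pmf_expectation_bind) (use assms fin in auto)
 also have "... = fexp p (%x. fexp (replicate_pmf m p) (%xs. f (x # xs)))"
 by (simp add: fexp_def[of p] fexp_eq_expectation[OF fin])
 finally show ?thesis .
qed

section \<open>Variance and the second moment method\<close>

definition fvar :: "'a pmf => ('a => real) => real" where
 "fvar p f = fexp p (%x. (f x - fexp p f)\<^sup>2)"

lemma fexp_sq_dev:
 assumes "finite (set_pmf p)"
 shows "fexp p (%x. (f x - c)\<^sup>2) = fvar p f + (fexp p f - c)\<^sup>2"
proof -
 define m where "m = fexp p f"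
 have "fexp p (%x. (f x - c)\<^sup>2) = fexp p (%x. (f x - m)\<^sup>2 + (2 * (m - c) * (f x - m) + (m - c)\<^sup>2))"
 by (intro fexp_cong) (simp add: power2_eq_square algebra_simps)
 also have "... = fvar p f + (2 * (m - c) * (fexp p f - m) + (m - c)\<^sup>2)"
 by (simp only: fexp_add fexp_cmult fexp_diff fexp_const[OF assms] fvar_def m_def)
 finally show ?thesis by (simp add: m_def)
qed

lemma fexp_sq_le:
 assumes "finite (set_pmf p)"
 shows "(fexp p f)\<^sup>2 <= fexp p (%x. (f x)\<^sup>2)"
 using fexp_sq_dev[OF assms, of f 0] fexp_nonneg[of p "%x. (f x - fexp p f)\<^sup>2"]
 by (simp add: fvar_def)

lemma fvar_le_sq_dev:
 assumes "finite (set_pmf p)"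
 shows "fvar p f <= fexp p (%x. (f x - c)\<^sup>2)"
 using fexp_sq_dev[OF assms, of f c] by simp

lemma fvar_cong: "(!!x. x \<in> set_pmf p ==> f x = g x) ==> fvar p f = fvar p g"
 using fexp_cong[of p f g] by (auto simp: fvar_def intro!: fexp_cong)

text \<open>The Efron-Stein inequality.\<close>

lemma fvar_replicate_le:
 assumes fin: "finite (set_pmf p)"
 and one: "!!ys zs. set ys \<subseteq> set_pmf p ==> set zs \<subseteq> set_pmf p ==> fvar p (%x. f (ys @ x # zs)) <= c"
 shows "fvar (replicate_pmf m p) f <= real m * c"
 using one
proof (induction m arbitrary: f)
 case 0
 then show ?case by (simp add: fvar_def fexp_def)
next
 case (Suc m)
 define R where "R = replicate_pmf m p"
 have finR: "finite (set_pmf R)" unfolding R_def by (rule finite_set_replicate_pmf[OF fin])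
 have setR: "set xs \<subseteq> set_pmf p" if "xs \<in> set_pmf R" for xs
 using that by (auto simp: R_def set_replicate_pmf)
 define g where "g x = fexp R (%xs. f (x # xs))" for x
 define \<mu> where "\<mu> = fexp p g"
 have \<mu>: "fexp (replicate_pmf (Suc m) p) f = \<mu>"
 by (simp only: fexp_replicate_Suc[OF fin] \<mu>_def g_def[abs_def] R_def)
 have "fvar (replicate_pmf (Suc m) p) f = fexp p (%x. fexp R (%xs. (f (x # xs) - \<mu>)\<^sup>2))"
 unfolding fvar_def \<mu> unfolding fexp_replicate_Suc[OF fin] R_def ..
 \<comment> \<open>Law of total variance with respect to the first clause: the conditional variance
   goes to the induction hypothesis, the variance of the conditional mean to the Jensen step
   below.\<close>
 also have "... = fexp p (%x. fvar R (%xs. f (x # xs)) + (g x - \<mu>)\<^sup>2)"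
 by (simp add: fexp_sq_dev[OF finR] g_def)
 also have "... = fexp p (%x. fvar R (%xs. f (x # xs))) + fexp p (%x. (g x - \<mu>)\<^sup>2)"
 by (rule fexp_add)
 also have "fexp p (%x. fvar R (%xs. f (x # xs))) <= fexp p (%x. real m * c)"
 proof (rule fexp_mono)
 fix x assume x: "x \<in> set_pmf p"
 show "fvar R (%xs. f (x # xs)) <= real m * c"
 unfolding R_def
 proof (rule Suc.IH)
 fix ys zs assume "set ys \<subseteq> set_pmf p" "set zs \<subseteq> set_pmf p"
 then show "fvar p (%xa. f (x # ys @ xa # zs)) <= c"
 using Suc.prems[of "x # ys" zs] x by simp
 qed
 qed
 also have "fexp p (%x. real m * c) = real m * c" by (rule fexp_const[OF fin])
 \<comment> \<open>Jensen: \<open>g x - \<mu>\<close> is the mean, over the remaining clauses, of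
   \<open>f\<close> minus its average over the first clause, so its square is at most the mean of
   the square.\<close>
 also have "fexp p (%x. (g x - \<mu>)\<^sup>2) <= fexp p (%x. fexp R (%xs. (f (x # xs) - fexp p (%y. f (y # xs)))\<^sup>2))"
 proof (rule fexp_mono)
 fix x
 have "\<mu> = fexp R (%xs. fexp p (%y. f (y # xs)))"
 unfolding \<mu>_def g_def by (rule fexp_swap)
 then have "g x - \<mu> = fexp R (%xs. f (x # xs) - fexp p (%y. f (y # xs)))"
 by (simp only: g_def fexp_diff)
 then show "(g x - \<mu>)\<^sup>2 <= fexp R (%xs. (f (x # xs) - fexp p (%y. f (y # xs)))\<^sup>2)"
 using fexp_sq_le[OF finR] by simp
 qed
 also have "... = fexp R (%xs. fvar p (%x. f (x # xs)))"
 by (subst fexp_swap) (simp add: fvar_def)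
 also have "... <= fexp R (%xs. c)"
 proof (rule fexp_mono)
 fix xs assume "xs \<in> set_pmf R"
 then show "fvar p (%x. f (x # xs)) <= c" using Suc.prems[of "[]" xs] setR by simp
 qed
 also have "... = c" by (rule fexp_const[OF finR])
 finally show ?case by (simp add: algebra_simps)
qed

lemma fexp_chebyshev:
 assumes fin: "finite (set_pmf p)" and d: "0 < d"
 and P: "!!x. x \<in> set_pmf p ==> P x ==> d <= \<bar>f x - fexp p f\<bar>"
 shows "prb p {x. P x} <= fvar p f / d\<^sup>2"
proof -
 have "prb p {x. P x} = fexp p (%x. if P x then 1 else 0)"
 by (rule fexp_prob[OF fin])
 also have "... <= fexp p (%x. (1 / d\<^sup>2) * (f x - fexp p f)\<^sup>2)"
 proof (rule fexp_mono)
 fix x assume x: "x \<in> set_pmf p"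
 show "(if P x then 1 else 0) <= (1 / d\<^sup>2) * (f x - fexp p f)\<^sup>2"
 proof (cases "P x")
 case True
 then have "d <= \<bar>f x - fexp p f\<bar>" using P x by simp
 then have "d\<^sup>2 <= (f x - fexp p f)\<^sup>2" using d by (metis abs_of_pos abs_le_square_iff)
 then show ?thesis using d True by simp
 qed simp
 qed
 also have "... = fvar p f / d\<^sup>2" by (subst fexp_cmult) (simp add: fvar_def)
 finally show ?thesis .
qed

section \<open>Sums of independent votes in \<open>{-1, 0, 1}\<close>\<close>

text \<open>The expectation of \<open>G\<close> at a sum of \<open>m\<close> independent steps in 0,
  +1, -1 with weights \<open>q0\<close>, \<open>qp\<close>, \<open>qm\<close>. The weights need not
  add up to one: the tilting below leads to a symmetric walk of total mass below one.\<close>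

primrec tsum :: "real => real => real => nat => (int => real) => real" where
 "tsum q0 qp qm 0 G = G 0"
| "tsum q0 qp qm (Suc m) G = q0 * tsum q0 qp qm m G + qp * tsum q0 qp qm m (%s. G (s + 1))
 + qm * tsum q0 qp qm m (%s. G (s - 1))"

lemma tsum_add: "tsum q0 qp qm m (%s. G s + H s) = tsum q0 qp qm m G + tsum q0 qp qm m H"
 by (induction m arbitrary: G H) (simp_all add: algebra_simps)

lemma tsum_cmult: "tsum q0 qp qm m (%s. c * G s) = c * tsum q0 qp qm m G"
 by (induction m arbitrary: G) (simp_all add: algebra_simps)

lemma tsum_diff: "tsum q0 qp qm m (%s. G s - H s) = tsum q0 qp qm m G - tsum q0 qp qm m H"
 by (induction m arbitrary: G H) (simp_all add: right_diff_distrib)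

lemma tsum_mono:
 assumes "0 <= q0" "0 <= qp" "0 <= qm" "!!s. G s <= H s"
 shows "tsum q0 qp qm m G <= tsum q0 qp qm m H"
 using assms(4)
proof (induction m arbitrary: G H)
 case (Suc m)
 have "tsum q0 qp qm m G <= tsum q0 qp qm m H"
 "tsum q0 qp qm m (%s. G (s + 1)) <= tsum q0 qp qm m (%s. H (s + 1))"
 "tsum q0 qp qm m (%s. G (s - 1)) <= tsum q0 qp qm m (%s. H (s - 1))"
 by (rule Suc.IH, rule Suc.prems)+
 then show ?case using assms by (simp add: add_mono mult_left_mono)
qed simp

lemma tsum_const: "tsum q0 qp qm m (%_. 1) = (q0 + qp + qm) ^ m"
 by (induction m) (simp_all add: algebra_simps)

text \<open>Exponential change of measure: a path that ends at \<open>s\<close> has collected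
  exactly the factor \<open>eta powi s\<close>.\<close>

lemma tsum_tilt:
 assumes "eta > 0"
 shows "tsum q0 (a * eta) (b / eta) m G = tsum q0 a b m (%s. eta powi s * G s)"
proof (induction m arbitrary: G)
 case (Suc m)
 have 1: "(%s. eta powi (s + 1) * G (s + 1)) = (%s. eta * (eta powi s * G (s + 1)))"
 using assms by (auto simp: power_int_add)
 have 2: "(%s. eta powi (s - 1) * G (s - 1)) = (%s. (1 / eta) * (eta powi s * G (s - 1)))"
 using assms by (auto simp: power_int_diff)
 show ?case by (simp add: Suc.IH 1 2 tsum_cmult del: times_divide_eq_left mult.assoc)
qed simp

lemma tsum_uminus: "tsum q0 a b m (%s. G (- s)) = tsum q0 b a m G"
proof (induction m arbitrary: G)
 case (Suc m)
 have "tsum q0 a b m (%s. G (- (s + 1))) = tsum q0 b a m (%s. G (s - 1))"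
 using Suc.IH[of "%s. G (s - 1)"] by (simp add: algebra_simps)
 moreover have "tsum q0 a b m (%s. G (- (s - 1))) = tsum q0 b a m (%s. G (s + 1))"
 using Suc.IH[of "%s. G (s + 1)"] by (simp add: algebra_simps)
 ultimately show ?case using Suc.IH[of G] by simp
qed simp

text \<open>Stochastic domination: mass moved from step -1 to step +1 can only raise a monotone
  \<open>G\<close>. It lets a bias estimate that is valid for small bias serve for larger bias
  too.\<close>

lemma tsum_shift_mono:
 assumes "0 <= q0" "0 <= qp'" "0 <= qm" "qp' <= qp" "qp + qm = qp' + qm'" and G: "mono G"
 shows "tsum q0 qp' qm' m G <= tsum q0 qp qm m G"
 using G
proof (induction m arbitrary: G)
 case (Suc m)
 have qm: "qm <= qm'" "0 <= qp" using assms by linarith+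
 have m1: "mono (%s. G (s + 1))" "mono (%s. G (s - 1))"
 using Suc.prems by (auto simp: mono_def)
 define g where "g H = tsum q0 qp qm m H" for H
 have i: "tsum q0 qp' qm' m G <= g G" "tsum q0 qp' qm' m (%s. G (s + 1)) <= g (%s. G (s + 1))"
 "tsum q0 qp' qm' m (%s. G (s - 1)) <= g (%s. G (s - 1))"
 unfolding g_def by (rule Suc.IH, fact)+
 have d: "g (%s. G (s - 1)) <= g (%s. G (s + 1))"
 unfolding g_def by (rule tsum_mono) (use assms qm Suc.prems in \<open>auto simp: mono_def\<close>)
 have "tsum q0 qp' qm' (Suc m) G <= q0 * g G + qp' * g (%s. G (s + 1)) + qm' * g (%s. G (s - 1))"
 using i assms qm by (simp add: add_mono mult_left_mono)
 also have "... = q0 * g G + qp' * g (%s. G (s + 1)) + qm * g (%s. G (s - 1)) + (qp - qp') * g (%s. G (s - 1))"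
 proof -
 have "qm' = qm + (qp - qp')" using assms(5) by simp
 then show ?thesis by (simp only: distrib_right)
 qed
 also have "... <= q0 * g G + qp' * g (%s. G (s + 1)) + qm * g (%s. G (s - 1)) + (qp - qp') * g (%s. G (s + 1))"
 using d assms by (intro add_left_mono mult_left_mono) auto
 also have "... = tsum q0 qp qm (Suc m) G" by (simp add: g_def algebra_simps)
 finally show ?case .
qed simp

lemma tsum_odd: "(!!s. G (- s) = - G s) ==> tsum q0 a a m G = 0"
 using tsum_uminus[of q0 a a m G] tsum_cmult[of q0 a a m "-1" G] by simp

text \<open>One-step recursions for the even moments, the odd ones being zero by symmetry. The lower
  bound carries the surviving mass \<open>(q0 + 2 * a) ^ m\<close> because the weights may add up to
  less than one.\<close>

lemma tsum_square:
 assumes "0 <= q0" "0 <= a" "q0 + 2 * a <= 1"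
 shows "tsum q0 a a m (%s. (ri s)\<^sup>2) <= 2 * a * m"
 and "2 * a * m * (q0 + 2 * a) ^ m <= tsum q0 a a m (%s. (ri s)\<^sup>2)"
 and "tsum q0 a a m (%s. (ri s)^4) <= 2 * a * m + 3 * (2 * a * m)\<^sup>2"
proof -
 define z where "z = q0 + 2 * a"
 have z: "0 <= z" "z <= 1" using assms by (auto simp: z_def)
 define m2 where "m2 m = tsum q0 a a m (%s. (ri s)\<^sup>2)" for m
 define m4 where "m4 m = tsum q0 a a m (%s. (ri s)^4)" for m
 have one: "tsum q0 a a m (%_. c) = c * z ^ m" for m c
 using tsum_cmult[of q0 a a m c "%_. 1"] tsum_const[of q0 a a m] by (simp add: z_def algebra_simps)
 have o1: "tsum q0 a a m (%s. ri s) = 0" for m by (rule tsum_odd) simp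
 have o3: "tsum q0 a a m (%s. (ri s)^3) = 0" for m by (rule tsum_odd) simp
 have e1: "(%s. (ri (s + 1))\<^sup>2) = (%s. (ri s)\<^sup>2 + (2 * ri s + 1))"
 by (auto simp: power2_eq_square algebra_simps)
 have e2: "(%s. (ri (s - 1))\<^sup>2) = (%s. (ri s)\<^sup>2 + ((-2) * ri s + 1))"
 by (auto simp: power2_eq_square algebra_simps)
 have m2S: "m2 (Suc m) = z * m2 m + 2 * a * z ^ m" for m
 unfolding m2_def tsum.simps e1 e2
 by (simp only: tsum_add tsum_cmult o1 one) (simp add: z_def algebra_simps)
 have f1: "(%s. (ri (s + 1))^4) = (%s. (ri s)^4 + (4 * (ri s)^3 + (6 * (ri s)\<^sup>2 + (4 * ri s + 1))))"
 by (auto simp: power2_eq_square power4_eq_xxxx power3_eq_cube algebra_simps)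
 have f2: "(%s. (ri (s - 1))^4) = (%s. (ri s)^4 + ((-4) * (ri s)^3 + (6 * (ri s)\<^sup>2 + ((-4) * ri s + 1))))"
 by (auto simp: power2_eq_square power4_eq_xxxx power3_eq_cube algebra_simps)
 have m4S: "m4 (Suc m) = z * m4 m + 12 * a * m2 m + 2 * a * z ^ m" for m
 unfolding m4_def m2_def tsum.simps f1 f2
 by (simp only: tsum_add tsum_cmult o1 o3 one) (simp add: z_def algebra_simps)
 have nn: "0 <= m2 m" "0 <= m4 m" for m
 using tsum_mono[of q0 a a "%_. 0" "%s. (ri s)\<^sup>2" m]
 tsum_mono[of q0 a a "%_. 0" "%s. (ri s)^4" m] assms one[of m 0]
 by (auto simp: m2_def m4_def)
 have zp: "z ^ m <= 1" for m using z by (simp add: power_le_one)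
 have A: "m2 m <= 2 * a * m" for m
 proof (induction m)
 case (Suc m)
 have "z * m2 m <= m2 m" using nn z by (simp add: mult_left_le_one_le)
 moreover have "2 * a * z ^ m <= 2 * a" using zp assms by (simp add: mult_left_le)
 ultimately show ?case using Suc by (simp add: m2S algebra_simps)
 qed (simp add: m2_def)
 then show "tsum q0 a a m (%s. (ri s)\<^sup>2) <= 2 * a * m" by (simp add: m2_def)
 have B: "2 * a * m * z ^ m <= m2 m" for m
 proof (induction m)
 case (Suc m)
 have "z * (2 * a * m * z ^ m) <= z * m2 m" using Suc z by (intro mult_left_mono) auto
 moreover have "2 * a * (z * z ^ m) <= 2 * a * z ^ m"
 using assms z by (intro mult_left_mono) (auto simp: mult_left_le_one_le)
 ultimately show ?case by (simp add: m2S algebra_simps)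
 qed (simp add: m2_def)
 then show "2 * a * m * (q0 + 2 * a) ^ m <= tsum q0 a a m (%s. (ri s)\<^sup>2)"
 by (simp add: m2_def z_def)
 have C: "m4 m <= 2 * a * m + 3 * (2 * a * m)\<^sup>2" for m
 proof (induction m)
 case (Suc m)
 have "z * m4 m <= m4 m" using nn z by (simp add: mult_left_le_one_le)
 moreover have "2 * a * z ^ m <= 2 * a" using zp assms by (simp add: mult_left_le)
 moreover have "12 * a * m2 m <= 12 * a * (2 * a * m)" using A assms by (intro mult_left_mono) auto
 ultimately have "m4 (Suc m) <= 2 * a * m + 3 * (2 * a * m)\<^sup>2 + 12 * a * (2 * a * m) + 2 * a"
 using Suc by (simp add: m4S)
 also have "... <= 2 * a * Suc m + 3 * (2 * a * Suc m)\<^sup>2"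
 by (simp add: power2_eq_square algebra_simps)
 finally show ?case .
 qed (simp add: m4_def)
 then show "tsum q0 a a m (%s. (ri s)^4) <= 2 * a * m + 3 * (2 * a * m)\<^sup>2" by (simp add: m4_def)
qed

text \<open>An even quartic below the absolute value, so that second and fourth moments bound the
  first absolute moment from below. The scale \<open>t\<close> is free and is chosen later to
  balance the two moments.\<close>

lemma abs_ge_moments:
 fixes x t :: real assumes t: "t > 0"
 shows "(1 / t) * (x\<^sup>2 - x ^ 4 / (4 * t\<^sup>2)) <= \<bar>x\<bar>"
proof -
 define z where "z = \<bar>x\<bar> / t"
 have z: "z \<ge> 0" and x: "\<bar>x\<bar> = z * t" using t by (auto simp: z_def)
 have x2: "x\<^sup>2 = z\<^sup>2 * t\<^sup>2" by (metis power2_abs power_mult_distrib x)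
 have x4: "x ^ 4 = z ^ 4 * t ^ 4" by (metis power_mult_distrib x power_even_abs_numeral even_numeral)
 have "0 <= 4 - 4 * z + z ^ 3"
 proof -
 \<comment> \<open>For \<open>z = \<bar>x\<bar> / t\<close> the claim amounts to
   \<open>z ^ 3 - 4 * z + 4 >= 0\<close>. The identity is a certificate, with squares centred close
   to the minimum of the cubic at \<open>2 / sqrt 3\<close>.\<close>
 have "z ^ 3 - 4 * z + 4 = z * (z - 6/5)\<^sup>2 + (12/5) * (z - 17/15)\<^sup>2 + (4 - (12/5) * (17/15)\<^sup>2)"
 by (simp add: power2_eq_square power3_eq_cube algebra_simps)
 also have "... \<ge> 0" using z by (intro add_nonneg_nonneg mult_nonneg_nonneg) (auto simp: power2_eq_square)
 finally show ?thesis by simp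
 qed
 then have "0 <= z * (4 - 4 * z + z ^ 3)" using z by simp
 then have *: "z\<^sup>2 - z ^ 4 / 4 <= z" by (simp add: power2_eq_square power3_eq_cube power4_eq_xxxx algebra_simps)
 have "(1 / t) * (x\<^sup>2 - x ^ 4 / (4 * t\<^sup>2)) = t * (z\<^sup>2 - z ^ 4 / 4)"
 unfolding x2 x4 using t by (simp add: field_simps power2_eq_square power4_eq_xxxx)
 also have "... <= t * z" using * t by simp
 finally show ?thesis by (simp add: x mult.commute)
qed

text \<open>With \<open>eta = exp u\<close> this is \<open>sinh (j * u) >= j * sinh u\<close> for
  natural \<open>j\<close>, proved by induction on \<open>j\<close>; the factor \<open>sgn s\<close>
  covers negative exponents.\<close>

lemma power_int_minus_inverse_ge:
 fixes eta :: real assumes "eta \<ge> 1"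
 shows "\<bar>ri s\<bar> * (eta - 1 / eta) <= (eta powi s - eta powi (- s)) * ri (sgn s)"
proof -
 have nat: "real j * (eta - 1 / eta) <= eta ^ j - 1 / eta ^ j" for j
 proof (induction j)
 case (Suc j)
 define x where "x = eta ^ j"
 have x: "x \<ge> 1" using assms by (simp add: x_def)
 have "1 * 1 <= eta * x" using x assms by (intro mult_mono) auto
 then have "1 / (eta * x) <= 1" by simp
 then have "0 <= (eta - 1) * ((x - 1) * (1 - 1 / (eta * x)))"
 using x assms by (intro mult_nonneg_nonneg) auto
 also have "... = (eta * x - 1 / (eta * x)) - (x - 1 / x) - (eta - 1 / eta)"
 using x assms by (simp add: field_simps)
 finally show ?case using Suc by (simp add: x_def algebra_simps)
 qed simp
 show ?thesis
 proof (cases "s \<ge> 0")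
 case True
 then obtain j where "s = int j" using nonneg_eq_int by blast
 then show ?thesis using nat[of j] by (cases "j = 0") (auto simp: power_int_minus divide_inverse)
 next
 case False
 then obtain j where "- s = int j" by (auto intro: nonneg_eq_int[of "- s"])
 then have "s = - int j" "j > 0" using False by linarith+
 then show ?thesis using nat[of j] by (auto simp: power_int_minus divide_inverse)
 qed
qed

text \<open>Tilting by \<open>eta = sqrt (qp / qm)\<close> makes the steps symmetric, so the bias of the sign becomes
 a first absolute moment of a symmetric sum, which its second and fourth moments control.\<close>

lemma tsum_sgn_small_bias:
 assumes q: "0 <= q0" "0 < qm" "qm <= qp" "q0 + qp + qm = 1"
 and small: "real m * (qp - qm)\<^sup>2 <= (qp + qm) / 2"
 shows "real m * (qp - qm) / (4 * sqrt (1 + 3 * (m * (qp + qm)))) <= tsum q0 qp qm m (%s. ri (sgn s))"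
proof -
 define eta where "eta = sqrt (qp / qm)"
 define a where "a = sqrt (qp * qm)"
 have qp: "qp > 0" using q by linarith
 have eta: "eta \<ge> 1" using q by (simp add: eta_def)
 have a: "a > 0" using q qp by (simp add: a_def)
 have aeta: "a * eta = qp" "a / eta = qm"
 using q qp by (simp_all add: a_def eta_def real_sqrt_mult[symmetric] real_sqrt_divide[symmetric] )
 define z where "z = q0 + 2 * a"
 have sq: "(sqrt qp - sqrt qm)\<^sup>2 = qp + qm - 2 * a"
 using q qp by (simp add: power2_diff a_def real_sqrt_mult)
 have "2 * a <= qp + qm" using sq zero_le_power2[of "sqrt qp - sqrt qm"] by linarith
 then have z1: "z <= 1" using q by (simp add: z_def)
 have z0: "0 <= z" using q a by (simp add: z_def)
 \<comment> \<open>Each tilted step loses the mass \<open>1 - z\<close>, the squared difference of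
   the square roots. The assumption on \<open>m\<close> bounds the loss over all steps by one half,
   and Bernoulli's inequality then leaves \<open>z ^ m >= 1 / 2\<close>.\<close>
 have "(qp - qm)\<^sup>2 = (sqrt qp - sqrt qm)\<^sup>2 * (sqrt qp + sqrt qm)\<^sup>2"
 proof -
 have "qp - qm = (sqrt qp - sqrt qm) * (sqrt qp + sqrt qm)"
 using q qp by (simp add: algebra_simps)
 then show ?thesis by (metis power_mult_distrib)
 qed
 also have "... \<ge> (sqrt qp - sqrt qm)\<^sup>2 * (qp + qm)"
 using q qp by (intro mult_left_mono) (auto simp: power2_sum)
 finally have *: "(sqrt qp - sqrt qm)\<^sup>2 * (qp + qm) <= (qp - qm)\<^sup>2" .
 have "1 - z = (sqrt qp - sqrt qm)\<^sup>2" using q sq by (simp add: z_def)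
 with * have "(1 - z) * (qp + qm) <= (qp - qm)\<^sup>2" by simp
 then have "real m * ((1 - z) * (qp + qm)) <= (qp + qm) / 2"
 using small by (meson mult_left_mono of_nat_0_le_iff order_trans)
 then have "(real m * (1 - z)) * (qp + qm) <= (1 / 2) * (qp + qm)" by (simp add: mult.assoc)
 then have "real m * (1 - z) <= 1 / 2" by (rule mult_right_le_imp_le) (use q qp in simp)
 moreover have "1 + real m * (z - 1) <= (1 + (z - 1)) ^ m"
 by (rule Bernoulli_inequality) (use z0 in simp)
 ultimately have zm: "1 / 2 <= z ^ m" by (simp add: algebra_simps)
 define lam where "lam = 2 * a * m"
 have lam0: "lam \<ge> 0" using a by (simp add: lam_def)
 have lam: "lam <= m * (qp + qm)" using \<open>2 * a <= qp + qm\<close> by (auto simp: lam_def mult.commute[of _ "real m"] intro: mult_left_mono)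
 define t where "t = sqrt (1 + 3 * lam)"
 have t: "t > 0" "t\<^sup>2 = 1 + 3 * lam" using lam0 by (auto simp: t_def)
 define T where "T = tsum q0 a a m"
 have T: "lam * z ^ m <= T (%s. (ri s)\<^sup>2)" "T (%s. (ri s)^4) <= lam + 3 * lam\<^sup>2"
 unfolding T_def lam_def z_def by (rule tsum_square(2,3); use q a z1 in \<open>auto simp: z_def\<close>)+
 \<comment> \<open>By \<open>t\<^sup>2 = 1 + 3 * lam\<close> the fourth moment bound
   \<open>lam + 3 * lam\<^sup>2\<close> equals \<open>lam * t\<^sup>2\<close>; its share is
   \<open>lam / 4\<close>, against \<open>lam / 2\<close> from the second moment.\<close>
 have "lam / (4 * t) = (1 / t) * (lam * (1/2) - (lam + 3 * lam\<^sup>2) / (4 * t\<^sup>2))"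
 proof -
 have "lam + 3 * lam\<^sup>2 = lam * t\<^sup>2" unfolding t(2) by (simp add: power2_eq_square algebra_simps)
 then have "(lam + 3 * lam\<^sup>2) / (4 * t\<^sup>2) = lam / 4" using t(1) by simp
 then show ?thesis using t by (simp add: field_simps)
 qed
 also have "... <= (1 / t) * (T (%s. (ri s)\<^sup>2) - T (%s. (ri s)^4) / (4 * t\<^sup>2))"
 proof -
 have "lam * (1/2) <= lam * z ^ m" using zm lam0 by (rule mult_left_mono)
 moreover have "T (%s. (ri s)^4) / (4 * t\<^sup>2) <= (lam + 3 * lam\<^sup>2) / (4 * t\<^sup>2)"
 using T(2) by (intro divide_right_mono) auto
 ultimately show ?thesis using t T(1) by (intro mult_left_mono) auto
 qed
 also have "... = T (%s. (1 / t) * ((ri s)\<^sup>2 - (1 / (4 * t\<^sup>2)) * (ri s)^4))"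
 unfolding T_def by (simp only: tsum_cmult tsum_diff) simp
 also have "... <= T (%s. \<bar>ri s\<bar>)"
 unfolding T_def by (rule tsum_mono) (use q a abs_ge_moments[OF t(1)] in auto)
 finally have abs: "lam / (4 * t) <= T (%s. \<bar>ri s\<bar>)" .
 \<comment> \<open>Under the symmetric walk the sign comes with the density
   \<open>eta powi s\<close>. Pairing \<open>s\<close> with \<open>- s\<close> turns the density
   into a difference of powers that dominates a multiple of the absolute value.\<close>
 define H where "H s = eta powi s * ri (sgn s)" for s
 have s1: "tsum q0 qp qm m (%s. ri (sgn s)) = T H"
 using tsum_tilt[of eta q0 a a m] eta unfolding aeta T_def H_def by simp
 have s2: "T H = (1/2) * T (%s. H s + H (- s))"
 unfolding T_def by (simp only: tsum_add tsum_uminus) simp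
 have s3: "(%s. H s + H (- s)) = (%s. (eta powi s - eta powi (- s)) * ri (sgn s))"
 by (auto simp: H_def sgn_minus algebra_simps)
 have s4: "T (%s. (eta - 1 / eta) * \<bar>ri s\<bar>) <= T (%s. (eta powi s - eta powi (- s)) * ri (sgn s))"
 unfolding T_def using q a power_int_minus_inverse_ge[OF eta]
 by (intro tsum_mono) (auto simp: mult.commute)
 have s5: "T (%s. (eta - 1 / eta) * \<bar>ri s\<bar>) = (eta - 1 / eta) * T (%s. \<bar>ri s\<bar>)"
 unfolding T_def by (rule tsum_cmult)
 have "1 / eta <= eta" using eta by (simp add: divide_le_eq order_trans[of 1 eta "eta * eta"])
 then have s6: "(eta - 1 / eta) * (lam / (4 * t)) <= (eta - 1 / eta) * T (%s. \<bar>ri s\<bar>)"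
 using abs by (intro mult_left_mono) auto
 have s7: "(1/2) * ((eta - 1 / eta) * (lam / (4 * t))) = (a * eta - a / eta) * m / (4 * t)"
 by (simp add: lam_def field_simps)
 have "sqrt (1 + 3 * lam) <= sqrt (1 + 3 * (m * (qp + qm)))" using lam by simp
 then have s8: "m * (qp - qm) / (4 * sqrt (1 + 3 * (m * (qp + qm)))) <= m * (qp - qm) / (4 * t)"
 using t q qp unfolding t_def[symmetric]
 by (intro divide_left_mono mult_pos_pos mult_nonneg_nonneg) (auto intro!: add_pos_nonneg)
 have s9: "(a * eta - a / eta) * m / (4 * t) = m * (qp - qm) / (4 * t)" unfolding aeta by simp
 show ?thesis using s1 s2 s4 s5 s6 s7 s8 s9 unfolding s3 by linarith
qed

text \<open>\<open>lam\<close> is the expected number of votes, \<open>p\<close> the bias of one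
  vote. If \<open>p\<close> is small the preceding estimate applies directly. Otherwise the bias is
  first lowered to \<open>p0\<close>, of order \<open>1 / sqrt (1 + lam)\<close>, the largest scale
  at which that estimate applies; this yields the second argument of \<open>min\<close>. The
  constant 10 bounds \<open>4 * sqrt 3 * sqrt 2\<close>.\<close>

lemma tsum_sgn_bias:
 assumes q: "0 <= q0" "0 <= qm" "qm < qp" "q0 + qp + qm = 1" and m: "m > 0"
 and lam_def: "lam = real m * (qp + qm)" and p_def: "p = (qp - qm) / (qp + qm)"
 shows "lam * min (p / sqrt (1 + lam)) (1 / (1 + lam)) / 10 <= tsum q0 qp qm m (%s. ri (sgn s))"
proof -
 define q where "q = qp + qm"
 have q0: "q > 0" using q by (simp add: q_def)
 have lam: "lam > 0" using m q0 by (simp add: lam_def q_def)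
 define p0 where "p0 = 1 / sqrt (2 * (1 + lam))"
 have "sqrt 1 < sqrt (2 * (1 + lam))" using lam by (intro real_sqrt_less_mono) simp
 then have p0: "0 < p0" "p0 < 1" using lam by (auto simp: p0_def)
 define r where "r = min p p0"
 have p: "p > 0" using q by (simp add: p_def)
 have r: "0 < r" "r < 1" "r <= p" "r <= p0" using p p0 by (auto simp: r_def)
 define up um where "up = q * (1 + r) / 2" and "um = q * (1 - r) / 2"
 have u: "up + um = q" "up - um = q * r" "0 < um" "um <= up"
 using q0 r by (auto simp: up_def um_def field_simps)
 have "q * r <= q * p" using r q0 by simp
 also have "q * p = qp - qm" using q0 by (simp add: p_def q_def)
 finally have up: "up <= qp" using u(1,2) unfolding q_def by linarith
 have "r\<^sup>2 <= p0\<^sup>2" using r by (intro power_mono) auto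
 also have "p0\<^sup>2 = 1 / (2 * (1 + lam))" using lam by (simp add: p0_def power_divide)
 finally have "lam * r\<^sup>2 <= lam * (1 / (2 * (1 + lam)))" using lam by (intro mult_left_mono) auto
 also have "... <= 1 / 2" using lam by (simp add: field_simps)
 finally have lr: "lam * r\<^sup>2 <= 1 / 2" .
 have small: "real m * (up - um)\<^sup>2 <= (up + um) / 2"
 proof -
 have "real m * (up - um)\<^sup>2 = q * (lam * r\<^sup>2)" by (simp add: u lam_def q_def[symmetric] power_mult_distrib power2_eq_square)
 also have "... <= q * (1 / 2)" using lr q0 by (intro mult_left_mono) auto
 finally show ?thesis by (simp add: u)
 qed
 have "lam * min (p / sqrt (1 + lam)) (1 / (1 + lam)) / 10 <= lam * (r / (4 * sqrt (1 + 3 * lam)))"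
 proof -
 have s3: "sqrt (1 + 3 * lam) <= sqrt 3 * sqrt (1 + lam)"
 unfolding real_sqrt_mult[symmetric] using lam by (intro real_sqrt_le_mono) auto
 have sq3: "sqrt 3 <= 1.7321" "sqrt 2 <= 1.4143" by (rule real_le_lsqrt; simp add: power2_eq_square)+
 have pos: "sqrt (1 + lam) > 0" "sqrt (1 + 3 * lam) > 0" using lam by auto
 have "r / (4 * sqrt (1 + 3 * lam)) \<ge> r / (4 * (1.7321 * sqrt (1 + lam)))"
 proof -
 have "sqrt 3 * sqrt (1 + lam) <= 1.7321 * sqrt (1 + lam)" using sq3 pos by (intro mult_right_mono) auto
 then have "4 * sqrt (1 + 3 * lam) <= 4 * (1.7321 * sqrt (1 + lam))" using s3 by linarith
 then show ?thesis using r pos by (intro divide_left_mono mult_pos_pos) auto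
 qed
 moreover have "min (p / sqrt (1 + lam)) (1 / (1 + lam)) / 10 <= r / (4 * (1.7321 * sqrt (1 + lam)))"
 proof (cases "p <= p0")
 case True
 then have "r = p" by (simp add: r_def)
 have "min (p / sqrt (1 + lam)) (1 / (1 + lam)) / 10 <= p / sqrt (1 + lam) / 10" by (intro divide_right_mono) auto
 also have "... <= p / (4 * (1.7321 * sqrt (1 + lam)))" using p pos by (simp add: field_simps)
 finally show ?thesis by (simp add: \<open>r = p\<close>)
 next
 case False
 then have "r = p0" by (simp add: r_def)
 have ss: "sqrt (1 + lam) * sqrt (1 + lam) = 1 + lam" using lam by simp
 have "min (p / sqrt (1 + lam)) (1 / (1 + lam)) / 10 <= 1 / (1 + lam) / 10" by (intro divide_right_mono) auto
 also have "... <= 1 / (4 * 1.7321 * sqrt 2 * (1 + lam))"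
 proof -
 have "4 * 1.7321 * sqrt 2 * (1 + lam) <= 10 * (1 + lam)" using sq3 lam by (intro mult_right_mono) auto
 then show ?thesis using lam unfolding divide_divide_eq_left
 by (intro divide_left_mono mult_pos_pos) (auto simp: mult.commute)
 qed
 also have "... = p0 / (4 * (1.7321 * sqrt (1 + lam)))"
 unfolding p0_def real_sqrt_mult by (subst ss[symmetric]) simp
 finally show ?thesis by (simp add: \<open>r = p0\<close>)
 qed
 ultimately have "min (p / sqrt (1 + lam)) (1 / (1 + lam)) / 10 <= r / (4 * sqrt (1 + 3 * lam))" by linarith
 then have "lam * (min (p / sqrt (1 + lam)) (1 / (1 + lam)) / 10) <= lam * (r / (4 * sqrt (1 + 3 * lam)))"
 using lam by (intro mult_left_mono) auto
 then show ?thesis by simp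
 qed
 also have "... = real m * (up - um) / (4 * sqrt (1 + 3 * (m * (up + um))))"
 by (simp add: u lam_def q_def[symmetric])
 also have "... <= tsum q0 up um m (%s. ri (sgn s))"
 by (rule tsum_sgn_small_bias) (use q u small in \<open>auto simp: q_def\<close>)
 also have "... <= tsum q0 qp qm m (%s. ri (sgn s))"
 by (rule tsum_shift_mono) (use q u up in \<open>auto simp: q_def mono_def sgn_if\<close>)
 finally show ?thesis .
qed

text \<open>Chernoff's bound with the parameter \<open>1 / (1 + p)\<close> in place of the optimal
  \<open>sqrt (qm / qp)\<close>: it stays positive for \<open>qm = 0\<close>, and the generating
  function of one step collapses to \<open>1 - (qp - qm)\<^sup>2 / (2 * (qp + qm))\<close>.\<close>

lemma tsum_nonpos_le:
 assumes q: "0 <= q0" "0 <= qm" "qm < qp" "q0 + qp + qm = 1"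
 shows "tsum q0 qp qm m (%s. if s <= 0 then 1 else 0) <= exp (- (real m * (qp - qm)\<^sup>2 / (2 * (qp + qm))))"
proof -
 define p where "p = (qp - qm) / (qp + qm)"
 have qq: "qp + qm > 0" using q by linarith
 have p: "0 < p" "p <= 1" using q by (auto simp: p_def)
 define eta where "eta = 1 / (1 + p)"
 have eta: "0 < eta" "eta <= 1" using p by (auto simp: eta_def)
 have "tsum q0 qp qm m (%s. if s <= 0 then 1 else 0) <= tsum q0 qp qm m (%s. eta powi s * 1)"
 proof (rule tsum_mono)
 fix s :: int
 show "(if s <= 0 then 1 else 0) <= eta powi s * 1"
 proof (cases "s <= 0")
 case True
 then obtain j where "- s = int j" by (auto intro: nonneg_eq_int[of "- s"])
 then have "s = - int j" by linarith
 then show ?thesis using eta by (simp add: power_int_minus one_le_inverse power_le_one)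
 qed (use eta in simp)
 qed (use q in auto)
 also have "... = (q0 + qp * eta + qm / eta) ^ m"
 using tsum_tilt[OF eta(1), of q0 qp qm m "%_. 1"] by (simp add: tsum_const)
 also have "q0 + qp * eta + qm / eta = 1 - (qp - qm)\<^sup>2 / (2 * (qp + qm))"
 proof -
 have e: "qp = (qp + qm) * (1 + p) / 2" "qm = (qp + qm) * (1 - p) / 2"
 using qq by (auto simp: p_def field_simps)
 have "qp * eta = (qp + qm) / 2" using e(1) p by (simp add: eta_def field_simps)
 moreover have "qm / eta = (qp + qm) * (1 - p\<^sup>2) / 2"
 proof -
 have "qm / eta = qm * (1 + p)" by (simp add: eta_def)
 also have "... = (qp + qm) * (1 - p) / 2 * (1 + p)" by (subst (1) e(2)) (rule refl)
 finally show ?thesis by (simp add: power2_eq_square algebra_simps)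
 qed
 moreover have "(qp - qm)\<^sup>2 / (2 * (qp + qm)) = (qp + qm) * p\<^sup>2 / 2"
 using qq by (simp add: p_def power_divide power2_eq_square)
 moreover have "(qp + qm) * (1 - p\<^sup>2) / 2 = (qp + qm) / 2 - (qp + qm) * p\<^sup>2 / 2"
 by (simp add: right_diff_distrib diff_divide_distrib)
 ultimately show ?thesis using q(4) by (simp only:) (simp add: field_simps)
 qed
 also have "... ^ m <= exp (- ((qp - qm)\<^sup>2 / (2 * (qp + qm)))) ^ m"
 proof (rule power_mono)
 show "1 - (qp - qm)\<^sup>2 / (2 * (qp + qm)) <= exp (- ((qp - qm)\<^sup>2 / (2 * (qp + qm))))"
 using exp_ge_add_one_self[of "- ((qp - qm)\<^sup>2 / (2 * (qp + qm)))"] by simp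
 have "(qp - qm)\<^sup>2 <= (qp + qm)\<^sup>2" using q by (intro power_mono) auto
 also have "... <= 1 * (qp + qm)" unfolding power2_eq_square using q by (intro mult_right_mono) auto
 finally show "0 <= 1 - (qp - qm)\<^sup>2 / (2 * (qp + qm))" using qq by (simp add: field_simps)
 qed
 also have "... = exp (- (real m * (qp - qm)\<^sup>2 / (2 * (qp + qm))))"
 by (simp add: exp_of_nat_mult[symmetric])
 finally show ?thesis .
qed

section \<open>One round of voting\<close>

definition vsum :: "('c => 'j => int) => 'c list => 'j => int" where
 "vsum X cs j = (\<Sum>c\<leftarrow>cs. X c j)"

lemma fexp_tsum:
 assumes fin: "finite (set_pmf D)" and X: "!!c. c \<in> set_pmf D ==> X c \<in> {-1, 0, 1::int}"
 and qp: "qp = prb D {c. X c = 1}" and qm: "qm = prb D {c. X c = -1}"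
 shows "fexp (replicate_pmf m D) (%cs. G (\<Sum>c\<leftarrow>cs. X c)) = tsum (1 - qp - qm) qp qm m G"
proof (induction m arbitrary: G)
 case 0
 then show ?case by (simp add: fexp_def)
next
 case (Suc m)
 define I where "I i = fexp D (%c. if X c = i then 1 else 0)" for i
 have I: "qp = I 1" "qm = I (-1)" by (simp_all add: qp qm I_def fexp_prob[OF fin])
 have "fexp D (%c. (if X c = 1 then 1 else 0) + ((if X c = -1 then 1 else 0) + (if X c = 0 then 1 else 0))) = fexp D (%_. 1)"
 using X by (intro fexp_cong) fastforce
 then have I0: "I 0 = 1 - qp - qm" unfolding fexp_add I by (simp add: I_def fexp_const[OF fin])
 define t where "t x = tsum (1 - qp - qm) qp qm m (%s. G (s + x))" for x
 have "fexp (replicate_pmf (Suc m) D) (%cs. G (\<Sum>c\<leftarrow>cs. X c)) = fexp D (%c. t (X c))"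
 unfolding fexp_replicate_Suc[OF fin] t_def by (simp add: Suc.IH[symmetric] add.commute)
 also have "... = fexp D (%c. t 1 * (if X c = 1 then 1 else 0) + (t (-1) * (if X c = -1 then 1 else 0)
 + t 0 * (if X c = 0 then 1 else 0)))"
 using X by (intro fexp_cong) fastforce
 also have "... = t 1 * qp + (t (-1) * qm + t 0 * (1 - qp - qm))"
 unfolding fexp_add fexp_cmult I0[symmetric] unfolding I by (simp add: I_def)
 also have "... = tsum (1 - qp - qm) qp qm (Suc m) G" by (simp add: t_def algebra_simps)
 finally show ?case .
qed

lemma fexp_sum_list:
 assumes fin: "finite (set_pmf D)"
 shows "fexp (replicate_pmf m D) (%cs. \<Sum>c\<leftarrow>cs. f c) = real m * fexp D f"
proof (induction m)
 case 0
 then show ?case by (simp add: fexp_def)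
next
 case (Suc m)
 then show ?case
 unfolding fexp_replicate_Suc[OF fin]
 by (simp add: fexp_add fexp_const[OF finite_set_replicate_pmf[OF fin]] fexp_const[OF fin] algebra_simps)
qed

text \<open>An abstract half round. A clause votes for at most one bin, and all bins of
  \<open>J\<close> have the same probabilities \<open>qp\<close> of a right and \<open>qm\<close> of
  a wrong vote, so means of global statistics are \<open>card J\<close> times the value at one
  bin.\<close>

locale vote_round =
 fixes D :: "'c pmf" and X :: "'c => 'j => int" and J :: "'j set" and sga :: "'j => int"
 and qp qm :: real and m :: nat
 assumes fin: "finite (set_pmf D)" and J: "finite J" "J ~= {}"
 and tern: "!!c j. c \<in> set_pmf D ==> X c j \<in> {-1, 0, 1}"
 and uniq: "!!c i j. c \<in> set_pmf D ==> X c i ~= 0 ==> X c j ~= 0 ==> i = j"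
 and sga: "!!j. j \<in> J ==> sga j \<in> {-1, 1}"
 and qp: "!!j. j \<in> J ==> prb D {c. X c j = sga j} = qp"
 and qm: "!!j. j \<in> J ==> prb D {c. X c j = - sga j} = qm"
 and bias: "qm < qp" and m: "m > 0"
begin

text \<open>Per bin, \<open>lam\<close> is the expected number of votes, \<open>p\<close> the bias
  of one vote and \<open>gain\<close> the lower bound for the mean of the rounded vote found
  above.\<close>

definition "N = real (card J)"
definition "lam = real m * (qp + qm)"
definition "p = (qp - qm) / (qp + qm)"
definition "gain = lam * min (p / sqrt (1 + lam)) (1 / (1 + lam)) / 10"
definition "corr cs = (\<Sum>j\<in>J. sga j * sgn (vsum X cs j))"
definition "supp cs = card {j \<in> J. vsum X cs j ~= 0}"
definition "hit c = (\<Sum>j\<in>J. if X c j ~= 0 then 1 else (0::real))"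

abbreviation "R \<equiv> replicate_pmf m D"

lemmas finR = finite_set_replicate_pmf[OF fin, of m]

lemma N_pos: "N > 0" using J by (simp add: N_def card_gt_0_iff)

lemma q_nonneg: "0 <= qm" "0 <= qp"
 using J qm qp measure_nonneg by blast+

lemma q_sum: "qp + qm <= 1"
proof -
 obtain j where j: "j \<in> J" using J by auto
 have "qp + qm = prb D ({c. X c j = sga j} \<union> {c. X c j = - sga j})"
 using qp[OF j] qm[OF j] sga[OF j] by (subst measure_pmf.finite_measure_Union) auto
 then show ?thesis by simp
qed

lemma lam_pos: "lam > 0" using m bias q_nonneg by (simp add: lam_def)
lemma p_pos: "p > 0" and p_le: "p <= 1" using bias q_nonneg by (auto simp: p_def)
lemma gain_pos: "gain > 0" using lam_pos p_pos by (simp add: gain_def)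

lemma bin_tsum:
 assumes "j \<in> J"
 shows "fexp R (%cs. G (sga j * vsum X cs j)) = tsum (1 - qp - qm) qp qm m G"
proof -
 have e: "sga j * vsum X cs j = (\<Sum>c\<leftarrow>cs. sga j * X c j)" for cs
 by (simp add: vsum_def sum_list_const_mult)
 show ?thesis unfolding e
 proof (rule fexp_tsum[OF fin])
 show "qp = prb D {c. sga j * X c j = 1}"
 unfolding qp[OF assms, symmetric] using sga[OF assms] by (intro arg_cong[of _ _ "prb D"]) auto
 show "qm = prb D {c. sga j * X c j = -1}"
 unfolding qm[OF assms, symmetric] using sga[OF assms] by (intro arg_cong[of _ _ "prb D"]) auto
 show "sga j * X c j \<in> {- 1, 0, 1}" if "c \<in> set_pmf D" for c
 using sga[OF assms] tern[OF that, of j] by auto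
 qed
qed

lemma bin_wrong_sign:
 assumes "j \<in> J"
 shows "prb R {cs. sga j * vsum X cs j <= 0} <= exp (- (real m * (qp - qm)\<^sup>2 / (2 * (qp + qm))))"
proof -
 have "prb R {cs. sga j * vsum X cs j <= 0} = fexp R (%cs. (%s. if s <= 0 then 1 else 0) (sga j * vsum X cs j))"
 by (rule fexp_prob[OF finR])
 also have "... = tsum (1 - qp - qm) qp qm m (%s. if s <= 0 then 1 else 0)" by (rule bin_tsum[OF assms])
 also have "... <= exp (- (real m * (qp - qm)\<^sup>2 / (2 * (qp + qm))))"
 by (rule tsum_nonpos_le) (use q_nonneg q_sum bias in auto)
 finally show ?thesis .
qed

lemma corr_mean: "N * gain <= fexp R (%cs. ri (corr cs))"
proof -
 have "fexp R (%cs. ri (corr cs)) = (\<Sum>j\<in>J. fexp R (%cs. ri (sgn (sga j * vsum X cs j))))"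
 unfolding corr_def of_int_sum
 proof (subst fexp_sum, rule sum.cong[OF refl], rule fexp_cong)
 fix j cs assume "j \<in> J"
 then show "ri (sga j * sgn (vsum X cs j)) = ri (sgn (sga j * vsum X cs j))"
 using sga[of j] by (auto simp: sgn_mult)
 qed
 also have "... = (\<Sum>j\<in>J. tsum (1 - qp - qm) qp qm m (%s. ri (sgn s)))"
 by (intro sum.cong[OF refl] bin_tsum)
 also have "... = N * tsum (1 - qp - qm) qp qm m (%s. ri (sgn s))" by (simp add: N_def)
 also have "... \<ge> N * gain"
 unfolding gain_def by (intro mult_left_mono tsum_sgn_bias)
 (use q_nonneg q_sum bias m in \<open>auto simp: lam_def p_def N_def\<close>)
 finally show ?thesis .
qed

lemma hit_cases: "c \<in> set_pmf D ==> hit c = (if \<exists>j\<in>J. X c j ~= 0 then 1 else 0)"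
proof -
 assume c: "c \<in> set_pmf D"
 show ?thesis
 proof (cases "\<exists>j\<in>J. X c j ~= 0")
 case True
 then obtain j where j: "j \<in> J" "X c j ~= 0" by blast
 have "hit c = (\<Sum>i\<in>J. if i = j then 1 else 0)"
 unfolding hit_def using uniq[OF c] j by (intro sum.cong) auto
 then show ?thesis using True j J by simp
 qed (auto simp: hit_def)
qed

lemma hit_mean: "real m * fexp D hit = N * lam"
proof -
 have "fexp D hit = (\<Sum>j\<in>J. fexp D (%c. if X c j ~= 0 then 1 else 0))"
 unfolding hit_def by (rule fexp_sum)
 also have "... = (\<Sum>j\<in>J. qp + qm)"
 proof (rule sum.cong[OF refl])
 fix j assume j: "j \<in> J"
 have "fexp D (%c. if X c j ~= 0 then 1 else 0)
 = fexp D (%c. (if X c j = sga j then 1 else 0) + (if X c j = - sga j then 1 else 0))"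
 proof (rule fexp_cong)
 fix c assume "c \<in> set_pmf D"
 then show "(if X c j ~= 0 then 1 else 0) = (if X c j = sga j then 1 else 0) + (if X c j = - sga j then 1 else (0::real))"
 using tern[of c j] sga[OF j] by auto
 qed
 also have "... = qp + qm" by (simp add: fexp_add fexp_prob[OF fin, symmetric] qp[OF j] qm[OF j])
 finally show "fexp D (%c. if X c j ~= 0 then 1 else 0) = qp + qm" .
 qed
 finally show ?thesis by (simp add: N_def lam_def)
qed

text \<open>Efron-Stein, comparing with the vote from which one clause is removed. That clause
  changes at most one integer vote sum by at most one, hence at most one sign by at most one, and
  only if it hits \<open>J\<close>.\<close>

lemma corr_var: "fvar R (%cs. ri (corr cs)) <= N * lam"
proof -
 have "fvar R (%cs. ri (corr cs)) <= real m * fexp D hit"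
 proof (rule fvar_replicate_le[OF fin])
 fix ys zs
 have "fvar D (%x. ri (corr (ys @ x # zs)))
 <= fexp D (%x. (ri (corr (ys @ x # zs)) - ri (corr (ys @ zs)))\<^sup>2)"
 by (rule fvar_le_sq_dev[OF fin])
 also have "... <= fexp D hit"
 proof (rule fexp_mono)
 fix c assume c: "c \<in> set_pmf D"
 have v: "vsum X (ys @ c # zs) j = vsum X (ys @ zs) j + X c j" for j by (simp add: vsum_def)
 have "\<bar>ri (corr (ys @ c # zs)) - ri (corr (ys @ zs))\<bar>
 = \<bar>\<Sum>j\<in>J. ri (sga j * (sgn (vsum X (ys @ zs) j + X c j) - sgn (vsum X (ys @ zs) j)))\<bar>"
 by (simp add: corr_def v sum_subtractf[symmetric] right_diff_distrib)
 also have "... <= (\<Sum>j\<in>J. \<bar>ri (sga j * (sgn (vsum X (ys @ zs) j + X c j) - sgn (vsum X (ys @ zs) j)))\<bar>)"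
 by (rule sum_abs)
 also have "... <= hit c"
 unfolding hit_def
 proof (rule sum_mono)
 fix j assume j: "j \<in> J"
 show "\<bar>ri (sga j * (sgn (vsum X (ys @ zs) j + X c j) - sgn (vsum X (ys @ zs) j)))\<bar> <= (if X c j ~= 0 then 1 else 0)"
 using tern[OF c, of j] sga[OF j] by (auto simp: sgn_if)
 qed
 finally have "(ri (corr (ys @ c # zs)) - ri (corr (ys @ zs)))\<^sup>2 <= (hit c)\<^sup>2"
 using hit_cases[OF c] by (intro power2_le_iff_abs_le[THEN iffD2]) auto
 also have "... = hit c" using hit_cases[OF c] by simp
 finally show "(ri (corr (ys @ c # zs)) - ri (corr (ys @ zs)))\<^sup>2 <= hit c" .
 qed
 finally show "fvar D (%x. ri (corr (ys @ x # zs))) <= fexp D hit" .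
 qed
 then show ?thesis by (simp add: hit_mean)
qed

text \<open>Every bin of the support was hit at least once, so the support is at most the number of
  hits, a sum of independent indicators whose mean is \<open>N * lam\<close> and whose variance is
  at most that.\<close>

lemma supp_tail: "prb R {cs. real (supp cs) > 2 * N * lam} <= 1 / (N * lam)"
proof -
 define H where "H cs = (\<Sum>c\<leftarrow>cs. hit c)" for cs
 have EH: "fexp R H = N * lam" unfolding H_def by (simp add: fexp_sum_list[OF fin] hit_mean)
 have "fvar R H <= real m * fexp D hit"
 proof (rule fvar_replicate_le[OF fin])
 fix ys zs
 have "fvar D (%x. H (ys @ x # zs)) <= fexp D (%x. (H (ys @ x # zs) - H (ys @ zs))\<^sup>2)"
 by (rule fvar_le_sq_dev[OF fin])
 also have "... <= fexp D hit"
 by (rule fexp_mono) (simp add: H_def hit_cases)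
 finally show "fvar D (%x. H (ys @ x # zs)) <= fexp D hit" .
 qed
 then have VH: "fvar R H <= N * lam" by (simp add: hit_mean)
 have le: "real (supp cs) <= H cs" if "cs \<in> set_pmf R" for cs
 proof -
 have "real (supp cs) = (\<Sum>j\<in>J. if vsum X cs j ~= 0 then 1 else 0)"
 using J by (simp add: supp_def sum.If_cases Int_def)
 also have "... <= (\<Sum>j\<in>J. \<Sum>c\<leftarrow>cs. if X c j ~= 0 then 1 else 0)"
 proof (rule sum_mono)
 fix j
 have nn: "0 <= (\<Sum>c\<leftarrow>cs. if X c j ~= 0 then 1 else (0::real))" for cs by (induction cs) auto
 have "vsum X cs j = 0 \<or> 1 <= (\<Sum>c\<leftarrow>cs. if X c j ~= 0 then 1 else (0::real))" for cs
 using nn by (induction cs) (auto simp: vsum_def)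
 then show "(if vsum X cs j ~= 0 then 1 else 0) <= (\<Sum>c\<leftarrow>cs. if X c j ~= 0 then 1 else (0::real))"
 using nn[of cs] by auto
 qed
 also have "... = H cs" unfolding H_def hit_def by (induction cs) (simp_all add: sum.distrib)
 finally show ?thesis .
 qed
 have "prb R {cs. real (supp cs) > 2 * N * lam} <= fvar R H / (N * lam)\<^sup>2"
 proof (rule fexp_chebyshev[OF finR])
 show "0 < N * lam" using N_pos lam_pos by simp
 fix cs assume "cs \<in> set_pmf R" "real (supp cs) > 2 * N * lam"
 then show "N * lam <= \<bar>H cs - fexp R H\<bar>" using le[of cs] EH by auto
 qed
 also have "... <= N * lam / (N * lam)\<^sup>2" by (rule divide_right_mono[OF VH]) simp
 finally show ?thesis using N_pos lam_pos by (simp add: power2_eq_square)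
qed

lemma corr_tail: "prb R {cs. ri (corr cs) < N * gain / 2} <= 4 * lam / (N * gain\<^sup>2)"
proof -
 have "prb R {cs. ri (corr cs) < N * gain / 2}
 <= fvar R (%cs. ri (corr cs)) / (N * gain / 2)\<^sup>2"
 proof (rule fexp_chebyshev[OF finR])
 show "0 < N * gain / 2" using N_pos gain_pos by simp
 fix cs assume "ri (corr cs) < N * gain / 2"
 then show "N * gain / 2 <= \<bar>ri (corr cs) - fexp R (%cs. ri (corr cs))\<bar>"
 using corr_mean by linarith
 qed
 also have "... <= N * lam / (N * gain / 2)\<^sup>2" by (rule divide_right_mono[OF corr_var]) simp
 also have "... = 4 * lam / (N * gain\<^sup>2)" using N_pos gain_pos by (simp add: power2_eq_square field_simps)
 finally show ?thesis .
qed

text \<open>Up to constants, the ratio of support to squared correlation after the round: the first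
  term is the sampling noise, and \<open>1 / N\<close> is the ratio of a perfect vector with full
  support, below which no round can get.\<close>

definition "noise = (qp + qm) / (N * (real m * (qp - qm)\<^sup>2)) + 1 / N"

lemma noise_eq: "noise = 1 / (N * lam * p\<^sup>2) + 1 / N"
proof -
 have "lam * p\<^sup>2 = real m * (qp - qm)\<^sup>2 / (qp + qm)"
 by (simp add: lam_def p_def power_divide) (simp add: power2_eq_square)
 then show ?thesis by (simp add: noise_def mult.assoc)
qed

lemma inverse_gain_sq: "1 / gain\<^sup>2 <= 100 * ((1 + lam) / (lam\<^sup>2 * p\<^sup>2) + (1 + lam)\<^sup>2 / lam\<^sup>2)"
proof -
 define u v where "u = p / sqrt (1 + lam)" and "v = 1 / (1 + lam)"
 have uv: "u > 0" "v > 0" using p_pos lam_pos by (auto simp: u_def v_def)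
 have "1 / (min u v)\<^sup>2 <= 1 / u\<^sup>2 + 1 / v\<^sup>2" using uv by (auto simp: min_def)
 moreover have "1 / u\<^sup>2 = (1 + lam) / p\<^sup>2" using lam_pos by (simp add: u_def power_divide)
 moreover have "1 / v\<^sup>2 = (1 + lam)\<^sup>2" by (simp add: v_def power_divide)
 ultimately have m: "1 / (min u v)\<^sup>2 <= (1 + lam) / p\<^sup>2 + (1 + lam)\<^sup>2" by simp
 have "1 / gain\<^sup>2 = 100 / lam\<^sup>2 * (1 / (min u v)\<^sup>2)"
 by (simp add: gain_def u_def[symmetric] v_def[symmetric] power_divide power_mult_distrib)
 also have "... <= 100 / lam\<^sup>2 * ((1 + lam) / p\<^sup>2 + (1 + lam)\<^sup>2)" by (rule mult_left_mono[OF m]) simp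
 also have "... = 100 * ((1 + lam) / (lam\<^sup>2 * p\<^sup>2) + (1 + lam)\<^sup>2 / lam\<^sup>2)"
 by (simp add: distrib_left add_divide_distrib)
 finally show ?thesis .
qed

lemma noise_bounds:
 "1 / (N * lam) <= noise" "4 * lam / (N * gain\<^sup>2) <= 800 * ((1 + lam) * noise)"
 "lam / (1 + lam) / (N * gain\<^sup>2) <= 200 * noise"
proof -
 define x where "x = 1 / (N * lam * p\<^sup>2)"
 have x: "noise = x + 1 / N" by (simp add: noise_eq x_def)
 have p2: "p\<^sup>2 <= 1" "p\<^sup>2 > 0" using p_pos p_le by (auto simp: power_le_one)
 have Nl: "N * lam > 0" using N_pos lam_pos by simp
 have lx: "1 / (N * lam) <= x"
 unfolding x_def using p2 Nl N_pos lam_pos by (intro divide_left_mono mult_pos_pos) (auto simp: mult_left_le)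
 then show "1 / (N * lam) <= noise" using N_pos x by (simp add: add_increasing2)
 have key: "lam / (1 + lam) / (N * gain\<^sup>2) <= 100 * (2 * x + 1 / N)"
 proof -
 have "lam / (1 + lam) / (N * gain\<^sup>2) = lam / ((1 + lam) * N) * (1 / gain\<^sup>2)" by simp
 also have "... <= lam / ((1 + lam) * N) * (100 * ((1 + lam) / (lam\<^sup>2 * p\<^sup>2) + (1 + lam)\<^sup>2 / lam\<^sup>2))"
 using lam_pos N_pos by (intro mult_left_mono[OF inverse_gain_sq]) simp
 also have "... = 100 * (x + (1 + lam) / (N * lam))"
 proof -
 have "lam / ((1 + lam) * N) * ((1 + lam) / (lam\<^sup>2 * p\<^sup>2)) = x"
 using lam_pos p2 N_pos by (simp add: x_def power2_eq_square)
 moreover have "lam / ((1 + lam) * N) * ((1 + lam)\<^sup>2 / lam\<^sup>2) = (1 + lam) / (N * lam)"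
 using lam_pos N_pos by (simp add: power2_eq_square)
 ultimately show ?thesis by (simp only: mult.left_commute[of _ 100] distrib_left[of "lam / ((1 + lam) * N)"])
 qed
 also have "(1 + lam) / (N * lam) = 1 / (N * lam) + 1 / N" using lam_pos N_pos by (simp add: add_divide_distrib)
 also have "100 * (x + (1 / (N * lam) + 1 / N)) <= 100 * (2 * x + 1 / N)"
 using lx by (intro mult_left_mono) auto
 finally show ?thesis .
 qed
 have "1 / N \<ge> 0" using N_pos by simp
 then show k2: "lam / (1 + lam) / (N * gain\<^sup>2) <= 200 * noise"
 using N_pos by (intro order_trans[OF key]) (simp add: x divide_right_mono)
 define y where "y = lam / (1 + lam)"
 have "lam = (1 + lam) * y" using lam_pos by (simp add: y_def)
 then have "4 * lam / (N * gain\<^sup>2) = 4 * ((1 + lam) * y) / (N * gain\<^sup>2)" by simp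
 also have "... = 4 * (1 + lam) * (lam / (1 + lam) / (N * gain\<^sup>2))" unfolding y_def[symmetric] by simp
 also have "... <= 4 * (1 + lam) * (200 * noise)" using lam_pos by (intro mult_left_mono[OF k2]) simp
 also have "... = 800 * ((1 + lam) * noise)" by (simp only: mult.assoc mult.left_commute[of _ 200])
 finally show "4 * lam / (N * gain\<^sup>2) <= 800 * ((1 + lam) * noise)" .
qed

text \<open>The support is at most \<open>2 * N * lam\<close> and at most \<open>N\<close>, hence at
  most \<open>4 * N * lam / (1 + lam)\<close>. In 3200 = 16 * 200, the 200 compares
  \<open>lam / (1 + lam) / (N * gain\<^sup>2)\<close> with \<open>noise\<close>, and 16 is the 4 of
  the support bound times the 4 lost by using only half of the mean correlation.\<close>

lemma round_success:
 "prb R {cs. ~ (0 < corr cs & real (supp cs) <= 2 * N * lam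
 & real (supp cs) <= 3200 * noise * (ri (corr cs))\<^sup>2)} <= 1000 * (1 + lam) * noise"
proof -
 have inc: "0 < corr cs & real (supp cs) <= 3200 * noise * (ri (corr cs))\<^sup>2"
 if c: "~ ri (corr cs) < N * gain / 2" and s: "~ real (supp cs) > 2 * N * lam" for cs
 proof
 have Ng: "N * gain > 0" using N_pos gain_pos by simp
 show "0 < corr cs" using c Ng by linarith
 have sN: "real (supp cs) <= N" unfolding supp_def N_def using J by (auto intro: card_mono)
 have "real (supp cs) <= 4 * N * (lam / (1 + lam))"
 proof (cases "lam <= 1")
 case True
 have "2 * N * lam <= 4 * N * (lam / (1 + lam))" using True lam_pos N_pos by (simp add: field_simps)
 then show ?thesis using s by linarith
 next
 case False
 then have "N <= 4 * N * (lam / (1 + lam))" using lam_pos N_pos by (simp add: field_simps)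
 then show ?thesis using sN by linarith
 qed
 also have "... = 16 * (lam / (1 + lam) / (N * gain\<^sup>2)) * (N * gain / 2)\<^sup>2"
 proof -
 have "(N * gain / 2)\<^sup>2 = N * gain\<^sup>2 * (N / 4)" by (simp add: power2_eq_square)
 moreover have "N * gain\<^sup>2 ~= 0" using N_pos gain_pos by simp
 moreover have "4 * N * y = 16 * (y / G) * (G * (N / 4))" if "G ~= 0" for G y using that by simp
 ultimately show ?thesis by metis
 qed
 also have "... <= 16 * (200 * noise) * (N * gain / 2)\<^sup>2"
 using noise_bounds(3) by (intro mult_right_mono mult_left_mono) auto
 also have "... <= 16 * (200 * noise) * (ri (corr cs))\<^sup>2"
 using c Ng N_pos lam_pos by (intro mult_left_mono power_mono) (auto simp: noise_eq)
 finally show "real (supp cs) <= 3200 * noise * (ri (corr cs))\<^sup>2" by simp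
 qed
 have "prb R {cs. ~ (0 < corr cs & real (supp cs) <= 2 * N * lam
 & real (supp cs) <= 3200 * noise * (ri (corr cs))\<^sup>2)}
 <= prb R ({cs. ri (corr cs) < N * gain / 2} \<union> {cs. real (supp cs) > 2 * N * lam})"
 using inc by (intro measure_pmf.finite_measure_mono) auto
 also have "... <= 4 * lam / (N * gain\<^sup>2) + 1 / (N * lam)"
 by (rule order_trans[OF measure_Un_le add_mono[OF corr_tail supp_tail]]) auto
 also have "... <= 800 * ((1 + lam) * noise) + noise"
 by (rule add_mono[OF noise_bounds(2,1)])
 also have "... <= 1000 * (1 + lam) * noise"
 proof -
 have "0 <= noise" using N_pos lam_pos by (simp add: noise_eq)
 then show ?thesis using lam_pos by (simp add: algebra_simps add_increasing)
 qed
 finally show ?thesis .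
qed

end

section \<open>Planted clauses as independent variables and values\<close>

declare One_nat_def [simp del]

section \<open>Counting ordered tuples of distinct variables\<close>

definition tuples :: "nat => nat set => nat list set" where
 "tuples j V = {xs. length xs = j & distinct xs & set xs \<subseteq> V}"

lemma finite_tuples [simp]: "finite V ==> finite (tuples j V)"
 unfolding tuples_def by (rule finite_subset[OF _ finite_lists_length_eq[of V j]]) auto

lemma card_tuples_le: "finite V ==> card (tuples j V) <= card V ^ j"
 unfolding tuples_def card_lists_length_eq[symmetric]
 by (rule card_mono) (auto intro: finite_lists_length_eq)

lemma card_tuples_Suc:
 assumes "finite V"
 shows "card (tuples (Suc j) V) = (card V - j) * card (tuples j V)"
proof -
 have e: "tuples (Suc j) V = (%(xs, x). x # xs) ` (SIGMA xs:tuples j V. V - set xs)"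
 by (auto simp: tuples_def image_iff length_Suc_conv)
 have "card (tuples (Suc j) V) = card (SIGMA xs:tuples j V. V - set xs)"
 unfolding e by (rule card_image) (auto simp: inj_on_def)
 also have "... = (\<Sum>xs\<in>tuples j V. card (V - set xs))" using assms by simp
 also have "... = (\<Sum>xs\<in>tuples j V. card V - j)"
 by (rule sum.cong) (auto simp: tuples_def card_Diff_subset distinct_card)
 finally show ?thesis by (simp add: mult.commute)
qed

lemma tuples_0 [simp]: "tuples 0 V = {[]}" by (auto simp: tuples_def)

lemma card_tuples_ge: "finite V ==> (card V - j) ^ j <= card (tuples j V)"
proof (induction j)
 case (Suc j)
 have "(card V - Suc j) ^ Suc j <= (card V - j) * (card V - j) ^ j"
 by (simp add: mult_le_mono power_mono)
 also have "... <= card (tuples (Suc j) V)"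
 using Suc by (simp add: card_tuples_Suc)
 finally show ?case .
qed simp

lemma tuples_nonempty: "finite V ==> j <= card V ==> tuples j V ~= {}"
proof -
 assume V: "finite V" "j <= card V"
 then obtain W where W: "W \<subseteq> V" "card W = j" "finite W" by (meson obtain_subset_with_card_n)
 then obtain xs where "set xs = W" "distinct xs" using finite_distinct_list by blast
 then have "xs \<in> tuples j V" using W by (auto simp: tuples_def distinct_card[symmetric])
 then show ?thesis by blast
qed

section \<open>A clause as a pair of a variable tuple and a truth vector\<close>

definition lit_sign :: "literal => int" where
 "lit_sign l = (case l of Pos _ => 1 | Neg _ => - 1)"

lemma lit_sign_cases: "lit_sign l \<in> {-1, 1}" by (cases l) (auto simp: lit_sign_def)

lemma lit_val_eq: "lit_val sga l = lit_sign l * sga (lit_var l)"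
 by (cases l) (auto simp: lit_sign_def)

definition build_lit :: "assignment => nat => int => literal" where
 "build_lit sga v y = (if sga v = y then Pos v else Neg v)"

definition build :: "assignment => nat list \<times> int list => clause" where
 "build sga = (%(V, y). map2 (build_lit sga) V y)"

lemma assignmentsD: "sga \<in> assignments n ==> v \<in> {1..n} ==> sga v \<in> {-1, 1}"
 by (auto simp: assignments_def PiE_def Pi_def)

lemma cubeD: "y \<in> cube k ==> i < k ==> y ! i \<in> {-1, 1}"
 unfolding cube_def using nth_mem by blast

lemma build_props:
 assumes sga: "sga \<in> assignments n" and V: "V \<in> tuples k {1..n}" and y: "y \<in> cube k"
 shows "map lit_var (build sga (V, y)) = V" "clause_val sga (build sga (V, y)) = y"
proof -
 have l: "length V = k" "length y = k" using V y by (auto simp: tuples_def cube_def)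
 show "map lit_var (build sga (V, y)) = V"
 using l by (auto simp: build_def build_lit_def intro!: nth_equalityI)
 show "clause_val sga (build sga (V, y)) = y"
 proof (rule nth_equalityI)
 fix i assume "i < length (clause_val sga (build sga (V, y)))"
 then have i: "i < k" using l by (simp add: clause_val_def build_def)
 then have "V ! i \<in> {1..n}" "y ! i \<in> {-1, 1}"
 using l V cubeD[OF y] nth_mem[of i V] by (auto simp: tuples_def simp del: nth_mem)
 then show "clause_val sga (build sga (V, y)) ! i = y ! i"
 using assignmentsD[OF sga, of "V ! i"] i l by (auto simp: clause_val_def build_def build_lit_def)
 qed (use l in \<open>simp add: clause_val_def build_def\<close>)
qed

lemma build_in_clauses:
 assumes sga: "sga \<in> assignments n" and V: "V \<in> tuples k {1..n}" and y: "y \<in> cube k"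
 shows "build sga (V, y) \<in> clauses k n"
proof -
 let ?C = "build sga (V, y)"
 note e = build_props(1)[OF assms]
 have "length ?C = k" using e V by (metis (mono_tags, lifting) length_map mem_Collect_eq tuples_def)
 moreover have "lit_var ` set ?C = set V" by (metis e list.set_map)
 ultimately show ?thesis using V e by (simp add: clauses_def tuples_def)
qed

lemma clauses_build:
 assumes sga: "sga \<in> assignments n" and C: "C \<in> clauses k n"
 shows "map lit_var C \<in> tuples k {1..n}" "clause_val sga C \<in> cube k" "build sga (map lit_var C, clause_val sga C) = C"
proof -
 have l: "length C = k" and vs: "lit_var ` set C \<subseteq> {1..n}" using C by (auto simp: clauses_def)
 show "map lit_var C \<in> tuples k {1..n}" using C by (simp add: clauses_def tuples_def)
 have one: "lit_val sga x \<in> {-1, 1} & build_lit sga (lit_var x) (lit_val sga x) = x" if "x \<in> set C" for x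
 using assignmentsD[OF sga, of "lit_var x"] vs that by (cases x) (fastforce simp: build_lit_def)+
 then show "clause_val sga C \<in> cube k" using l by (auto simp: cube_def clause_val_def)
 show "build sga (map lit_var C, clause_val sga C) = C"
 using one by (auto simp: build_def clause_val_def map2_map_map intro!: map_idI)
qed

text \<open>Given \<open>sga\<close>, a clause is determined by its variables and its truth values,
  and its weight depends on the truth values only. So the normaliser is the number of variable
  tuples, and the variables are uniform and independent of the truth vector, which has law
  \<open>Q\<close>.\<close>

lemma planted_eq_build:
 assumes Q: "set_pmf Q \<subseteq> cube k" and kn: "k <= n" and sga: "sga \<in> assignments n"
 shows "planted k Q n sga = map_pmf (build sga) (pair_pmf (pmf_of_set (tuples k {1..n})) Q)" (is "_ = ?R")
proof -
 let ?U = "pmf_of_set (tuples k {1..n})"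
 have ne: "tuples k {1..n} ~= {}" by (rule tuples_nonempty) (use kn in auto)
 have sU: "set_pmf ?U = tuples k {1..n}" using ne by (simp add: set_pmf_of_set)
 have inj: "inj_on (build sga) (tuples k {1..n} \<times> cube k)"
 proof (rule inj_onI, clarify)
 fix V y V' y' assume *: "V \<in> tuples k {1..n}" "y \<in> cube k" "V' \<in> tuples k {1..n}" "y' \<in> cube k"
 "build sga (V, y) = build sga (V', y')"
 show "V = V' & y = y'"
 using build_props[OF sga *(1,2)] build_props[OF sga *(3,4)] *(5) by metis
 qed
 have R: "pmf ?R C = (if C \<in> clauses k n then pmf Q (clause_val sga C) / real (card (tuples k {1..n})) else 0)" for C
 proof (cases "C \<in> clauses k n")
 case True
 note cb = clauses_build[OF sga True]
 define x where "x = (map lit_var C, clause_val sga C)"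
 have x: "x \<in> tuples k {1..n} \<times> cube k" "build sga x = C" using cb by (auto simp: x_def)
 have "pmf ?R C = prb (pair_pmf ?U Q) (build sga -` {C})" by (rule pmf_map)
 also have "... = prb (pair_pmf ?U Q) (build sga -` {C} \<inter> set_pmf (pair_pmf ?U Q))"
 by (simp only: measure_Int_set_pmf)
 also have "... = prb (pair_pmf ?U Q) ({x} \<inter> set_pmf (pair_pmf ?U Q))"
 proof -
 have "build sga -` {C} \<inter> set_pmf (pair_pmf ?U Q) = {x} \<inter> set_pmf (pair_pmf ?U Q)"
 using inj x Q sU unfolding inj_on_def set_pair_pmf by blast
 then show ?thesis by simp
 qed
 also have "... = pmf (pair_pmf ?U Q) x" by (simp only: measure_Int_set_pmf pmf.rep_eq)
 also have "... = pmf Q (clause_val sga C) / real (card (tuples k {1..n}))"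
 using x ne by (simp add: x_def pmf_pair)
 finally show ?thesis using True by simp
 next
 case False
 have "C \<notin> set_pmf ?R"
 using False build_in_clauses[OF sga] Q sU by (auto simp: set_pair_pmf)
 then show ?thesis using False by (simp only: set_pmf_iff) simp
 qed
 define Z where "Z = (\<Sum>C'\<in>clauses k n. pmf Q (clause_val sga C'))"
 have "(\<Sum>C\<in>clauses k n. pmf ?R C) = 1"
 proof (rule sum_pmf_eq_1[OF finite_clauses])
 show "set_pmf ?R \<subseteq> clauses k n"
 unfolding set_map_pmf set_pair_pmf sU using build_in_clauses[OF sga] Q by blast
 qed
 moreover have "(\<Sum>C\<in>clauses k n. pmf ?R C) = Z / real (card (tuples k {1..n}))"
 unfolding Z_def sum_divide_distrib by (rule sum.cong) (simp_all add: R)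
 ultimately have "Z = real (card (tuples k {1..n}))" by (simp add: divide_eq_1_iff)
 then show ?thesis
 by (intro pmf_eqI) (simp add: R pmf_planted[OF assms] Z_def)
qed

lemma set_planted:
 assumes Q: "set_pmf Q \<subseteq> cube k" and kn: "k <= n" and sga: "sga \<in> assignments n"
 shows "set_pmf (planted k Q n sga) \<subseteq> clauses k n"
 using pmf_planted[OF assms] by (auto simp: set_pmf_iff split: if_splits)

lemma finite_set_planted:
 assumes "set_pmf Q \<subseteq> cube k" "k <= n" "sga \<in> assignments n"
 shows "finite (set_pmf (planted k Q n sga))"
 using set_planted[OF assms] finite_clauses finite_subset by blast

section \<open>Marginals of the planted distribution\<close>

lemma extend_tuple_bij:
 assumes V: "finite V" and w: "w \<in> tuples j V" and w': "w' \<in> tuples j V"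
 obtains f where "bij_betw f V V" "map f w = w'"
proof -
 have l: "length w = j" "length w' = j" "distinct w" "distinct w'" "set w \<subseteq> V" "set w' \<subseteq> V"
 using w w' by (auto simp: tuples_def)
 define g where "g x = the (map_of (zip w w') x)" for x
 have g: "map g w = w'"
 using l by (auto simp: g_def map_of_zip_nth intro!: nth_equalityI)
 have bg: "bij_betw g (set w) (set w')"
 proof -
 have "inj_on g (set w)" using g l by (metis distinct_map)
 moreover have "g ` set w = set w'" using g by (metis list.set_map)
 ultimately show ?thesis by (simp add: bij_betw_def)
 qed
 have "card (V - set w) = card (V - set w')"
 using l V by (simp add: card_Diff_subset distinct_card)
 then obtain h where bh: "bij_betw h (V - set w) (V - set w')"
 using V by (metis finite_Diff finite_same_card_bij)
 define f where "f x = (if x \<in> set w then g x else h x)" for x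
 have "bij_betw f (set w) (set w')" using bg by (rule bij_betw_cong[THEN iffD1, rotated]) (simp add: f_def)
 moreover have "bij_betw f (V - set w) (V - set w')" using bh by (rule bij_betw_cong[THEN iffD1, rotated]) (simp add: f_def)
 ultimately have "bij_betw f (set w \<union> (V - set w)) (set w' \<union> (V - set w'))"
 by (rule bij_betw_combine) auto
 then have "bij_betw f V V" using l by (simp add: Un_absorb1)
 moreover have "map f w = w'" using g by (auto simp: f_def)
 ultimately show ?thesis using that by blast
qed

text \<open>Permutations of \<open>V\<close> act transitively on tuples and carry the fibres of the
  projection to the positions \<open>ps\<close> into one another, so all fibres are equally
  large.\<close>

lemma card_tuples_restrict:
 assumes V: "finite V" and ps: "distinct ps" "set ps \<subseteq> {..<k}" and w: "w \<in> tuples (length ps) V"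
 shows "card {xs \<in> tuples k V. map ((!) xs) ps = w} * card (tuples (length ps) V) = card (tuples k V)"
proof -
 define r where "r = length ps"
 define F where "F w = {xs \<in> tuples k V. map ((!) xs) ps = w}" for w
 have le: "card (F u) <= card (F v)" if u: "u \<in> tuples r V" and v: "v \<in> tuples r V" for u v
 proof -
 obtain f where f: "bij_betw f V V" "map f u = v" using extend_tuple_bij[OF V u v] .
 have inj: "inj_on f V" and im: "f ` V = V" using f by (auto simp: bij_betw_def)
 show ?thesis
 proof (rule card_inj_on_le)
 show "inj_on (map f) (F u)"
 using inj by (intro inj_on_mapI inj_on_subset[OF inj]) (auto simp: F_def tuples_def)
 show "map f ` F u \<subseteq> F v"
 proof clarify
 fix xs assume xs: "xs \<in> F u"
 then have x: "length xs = k" "distinct xs" "set xs \<subseteq> V" "map ((!) xs) ps = u" by (auto simp: F_def tuples_def)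
 have "map ((!) (map f xs)) ps = map f (map ((!) xs) ps)" using x ps by (auto simp: subset_iff)
 then have "map ((!) (map f xs)) ps = v" using x f by simp
 moreover have "map f xs \<in> tuples k V"
 using x inj im by (auto simp: tuples_def distinct_map intro: inj_on_subset)
 ultimately show "map f xs \<in> F v" by (simp add: F_def)
 qed
 show "finite (F v)" using V by (simp add: F_def)
 qed
 qed
 have eq: "card (F u) = card (F w)" if "u \<in> tuples r V" for u
 using le that w by (metis r_def le_antisym)
 have mem: "map ((!) xs) ps \<in> tuples r V" if "xs \<in> tuples k V" for xs
 proof -
 have x: "length xs = k" "distinct xs" "set xs \<subseteq> V" using that by (auto simp: tuples_def)
 have "distinct (map ((!) xs) ps)"
 using x ps by (auto simp: distinct_map inj_on_def nth_eq_iff_index_eq subset_iff)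
 moreover have "set (map ((!) xs) ps) \<subseteq> V" using x ps by (auto simp: subset_iff)
 ultimately show ?thesis by (simp add: tuples_def r_def)
 qed
 have "tuples k V = (\<Union>u\<in>tuples r V. F u)" using mem by (auto simp: F_def)
 then have "card (tuples k V) = (\<Sum>u\<in>tuples r V. card (F u))"
 using V by (simp only:) (rule card_UN_disjoint; auto simp: F_def)
 also have "... = card (F w) * card (tuples r V)" by (simp add: eq)
 finally show ?thesis by (simp add: F_def r_def)
qed

definition cvars :: "nat list => clause => nat list" where
 "cvars ps C = map (%p. lit_var (C ! p)) ps"

definition csign :: "nat list => clause => int" where
 "csign ps C = (\<Prod>p\<leftarrow>ps. lit_sign (C ! p))"

definition aprod :: "assignment => nat list => int" where
 "aprod sga w = (\<Prod>v\<leftarrow>w. sga v)"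

lemma prod_list_sign: "(!!x. x \<in> set xs ==> f x \<in> {-1, 1::int}) ==> (\<Prod>x\<leftarrow>xs. f x) \<in> {-1, 1}"
proof (induction xs)
 case (Cons a xs)
 have "f a \<in> {-1, 1}" "(\<Prod>x\<leftarrow>xs. f x) \<in> {-1, 1}" using Cons by simp_all
 then show ?case by auto
qed simp

lemma aprod_sign: "sga \<in> assignments n ==> set w \<subseteq> {1..n} ==> aprod sga w \<in> {-1, 1}"
 unfolding aprod_def by (rule prod_list_sign) (use assignmentsD in blast)

text \<open>On the cube the indicator of the event is \<open>(1 + c * f y) / 2\<close> with the
  character \<open>f\<close> of \<open>set ps\<close>, so its probability is affine in the Fourier
  coefficient.\<close>

lemma cube_bias:
 assumes Q: "set_pmf Q \<subseteq> cube k" and ps: "distinct ps" "set ps \<subseteq> {..<k}" and c: "c \<in> {-1, 1::int}"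
 shows "prb Q {y. (\<Prod>p\<leftarrow>ps. y ! p) = c} = (1 + ri c * (2 ^ k * fourier k Q (set ps))) / 2"
proof -
 have fin: "finite (cube k)"
 unfolding cube_def by (rule finite_subset[OF _ finite_lists_length_eq[of "{-1,1}" k]]) auto
 define f where "f y = (\<Prod>p\<leftarrow>ps. y ! p)" for y :: "int list"
 have f: "f y \<in> {-1, 1}" if "y \<in> cube k" for y
 proof -
 have "y ! p \<in> {-1, 1}" if "p \<in> set ps" for p
 using cubeD[OF \<open>y \<in> cube k\<close>] that ps by auto
 then show ?thesis unfolding f_def by (rule prod_list_sign)
 qed
 have fp: "ri (f y) = (\<Prod>i\<in>set ps. ri (y ! i))" for y
 using ps(1) unfolding f_def by (induction ps) auto
 have one: "(\<Sum>y\<in>cube k. pmf Q y) = 1" by (rule sum_pmf_eq_1[OF fin Q])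
 have F: "2 ^ k * fourier k Q (set ps) = (\<Sum>y\<in>cube k. pmf Q y * ri (f y))"
 by (simp add: fourier_def fp)
 have "prb Q {y. f y = c} = prb Q ({y. f y = c} \<inter> set_pmf Q)"
 by (simp add: measure_Int_set_pmf)
 also have "... = prb Q ({y \<in> cube k. f y = c} \<inter> set_pmf Q)"
 using Q by (intro arg_cong[of _ _ "prb Q"]) auto
 also have "... = (\<Sum>y\<in>{y \<in> cube k. f y = c}. pmf Q y)"
 using fin by (simp add: measure_Int_set_pmf measure_measure_pmf_finite)
 also have "... = (\<Sum>y\<in>cube k. if f y = c then pmf Q y else 0)"
 using fin by (simp add: sum.inter_filter)
 also have "... = (\<Sum>y\<in>cube k. (pmf Q y + ri c * (pmf Q y * ri (f y))) / 2)"
 using f c by (intro sum.cong) fastforce+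
 also have "... = (1 + ri c * (2 ^ k * fourier k Q (set ps))) / 2"
 by (simp add: sum_divide_distrib[symmetric] sum.distrib one F sum_distrib_left[symmetric])
 finally show ?thesis by (simp add: f_def)
qed

text \<open>A literal's value is its sign times the planted value of its variable. Once the
  variables at \<open>ps\<close> are \<open>w\<close>, the event on the signs becomes one on the
  product of truth values at \<open>ps\<close>, which is independent of the variables; the bias
  towards the planted product is the rescaled Fourier coefficient.\<close>

theorem planted_marginal:
 assumes Q: "set_pmf Q \<subseteq> cube k" and kn: "k <= n" and sga: "sga \<in> assignments n"
 and ps: "distinct ps" "set ps \<subseteq> {..<k}" and w: "w \<in> tuples (length ps) {1..n}" and c: "c \<in> {-1, 1}"
 shows "prb (planted k Q n sga) {C. cvars ps C = w & csign ps C = c * aprod sga w}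
 = (1 + ri c * (2 ^ k * fourier k Q (set ps))) / 2 / real (card (tuples (length ps) {1..n}))"
proof -
 let ?U = "pmf_of_set (tuples k {1..n})"
 have ne: "tuples k {1..n} ~= {}" by (rule tuples_nonempty) (use kn in auto)
 have sU: "set_pmf ?U = tuples k {1..n}" using ne by (simp add: set_pmf_of_set)
 define A where "A = {xs. map ((!) xs) ps = w}"
 define B where "B = {y :: int list. (\<Prod>p\<leftarrow>ps. y ! p) = c}"
 have iff: "build sga (V, y) \<in> {C. cvars ps C = w & csign ps C = c * aprod sga w} \<longleftrightarrow> V \<in> A & y \<in> B"
 if V: "V \<in> tuples k {1..n}" and y: "y \<in> cube k" for V y
 proof -
 define C where "C = build sga (V, y)"
 have C: "map lit_var C = V" "clause_val sga C = y" using build_props[OF sga V y] by (auto simp: C_def)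
 have l: "length C = k" using C V by (metis (mono_tags, lifting) length_map mem_Collect_eq tuples_def)
 have cv: "cvars ps C = map ((!) V) ps" using ps l C by (auto simp: cvars_def)
 have cs: "(\<Prod>p\<leftarrow>qs. y ! p) = (\<Prod>p\<leftarrow>qs. lit_sign (C ! p)) * aprod sga (map ((!) V) qs)" if "set qs \<subseteq> {..<k}" for qs
 using that
 proof (induction qs)
 case (Cons p qs)
 have "y ! p = lit_sign (C ! p) * sga (V ! p)"
 using Cons.prems l C by (auto simp: clause_val_def lit_val_eq)
 then show ?case using Cons by (simp add: aprod_def)
 qed (simp add: aprod_def)
 have "aprod sga w \<in> {-1, 1}" by (rule aprod_sign[OF sga]) (use w in \<open>auto simp: tuples_def\<close>)
 then show ?thesis using cv cs[OF ps(2)] c unfolding C_def[symmetric] by (auto simp: A_def B_def csign_def)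
 qed
 have "prb (planted k Q n sga) {C. cvars ps C = w & csign ps C = c * aprod sga w}
 = prb (pair_pmf ?U Q) (build sga -` {C. cvars ps C = w & csign ps C = c * aprod sga w})"
 by (simp add: planted_eq_build[OF Q kn sga])
 also have "... = prb (pair_pmf ?U Q) (build sga -` {C. cvars ps C = w & csign ps C = c * aprod sga w} \<inter> set_pmf (pair_pmf ?U Q))"
 by (simp only: measure_Int_set_pmf)
 also have "build sga -` {C. cvars ps C = w & csign ps C = c * aprod sga w} \<inter> set_pmf (pair_pmf ?U Q) = (A \<times> B) \<inter> set_pmf (pair_pmf ?U Q)"
 using iff Q sU by (fastforce simp: set_pair_pmf)
 also have "prb (pair_pmf ?U Q) ... = prb (pair_pmf ?U Q) (A \<times> B)"
 by (simp only: measure_Int_set_pmf)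
 also have "... = prb ?U A * prb Q B"
 by (rule measure_pmf_prob_product) auto
 also have "prb ?U A = 1 / real (card (tuples (length ps) {1..n}))"
 proof -
 have "card (tuples k {1..n} \<inter> A) * card (tuples (length ps) {1..n}) = card (tuples k {1..n})"
 using card_tuples_restrict[OF _ ps w] by (simp add: A_def Int_def)
 then have e: "real (card (tuples k {1..n})) = real (card (tuples k {1..n} \<inter> A)) * real (card (tuples (length ps) {1..n}))"
 by (metis of_nat_mult)
 moreover have "card (tuples k {1..n}) ~= 0" using ne by (simp only: card_eq_0_iff finite_tuples finite_atLeastAtMost) simp
 ultimately have "card (tuples k {1..n} \<inter> A) ~= 0" by (metis mult_eq_0_iff of_nat_eq_0_iff)
 then show ?thesis
 unfolding measure_pmf_of_set[OF ne finite_tuples[OF finite_atLeastAtMost]] e by simp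
 qed
 also have "prb Q B = (1 + ri c * (2 ^ k * fourier k Q (set ps))) / 2"
 unfolding B_def by (rule cube_bias[OF Q ps c])
 finally show ?thesis by simp
qed

section \<open>Fourier inversion on the cube and the symmetry under negation\<close>

lemma fourier_inversion:
 assumes Q: "set_pmf Q \<subseteq> cube k" and z: "z \<in> cube k"
 shows "pmf Q z = (\<Sum>S\<in>Pow {..<k}. fourier k Q S * (\<Prod>i\<in>S. ri (z ! i)))"
proof -
 have fin: "finite (cube k)"
 unfolding cube_def by (rule finite_subset[OF _ finite_lists_length_eq[of "{-1,1}" k]]) auto
 have pw: "(\<Sum>S\<in>Pow A. \<Prod>i\<in>S. f i) = (\<Prod>i\<in>A. 1 + f i)" if "finite A" for A :: "nat set" and f :: "nat => real"
 using that
 proof (induction A)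
 case (insert a A)
 have "(\<Sum>S\<in>Pow (insert a A). \<Prod>i\<in>S. f i) = (\<Sum>S\<in>Pow A. \<Prod>i\<in>S. f i) + (\<Sum>S\<in>insert a ` Pow A. \<Prod>i\<in>S. f i)"
 unfolding Pow_insert using insert by (intro sum.union_disjoint) auto
 also have "(\<Sum>S\<in>insert a ` Pow A. \<Prod>i\<in>S. f i) = (\<Sum>S\<in>Pow A. f a * (\<Prod>i\<in>S. f i))"
 proof (subst sum.reindex)
 show "inj_on (insert a) (Pow A)" using insert by (auto simp: inj_on_def)
 show "sum ((%S. \<Prod>i\<in>S. f i) \<circ> insert a) (Pow A) = (\<Sum>S\<in>Pow A. f a * (\<Prod>i\<in>S. f i))"
 using insert by (intro sum.cong) (auto simp: finite_subset intro!: prod.insert)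
 qed
 finally show ?case using insert by (simp add: sum_distrib_left[symmetric] algebra_simps)
 qed simp
 \<comment> \<open>Orthogonality of characters: the sum over all sets factorises over positions, and
   a factor vanishes as soon as \<open>y\<close> and \<open>z\<close> differ there.\<close>
 have ker: "(\<Sum>S\<in>Pow {..<k}. (\<Prod>i\<in>S. ri (y ! i)) * (\<Prod>i\<in>S. ri (z ! i))) = (if y = z then 2 ^ k else 0)"
 if y: "y \<in> cube k" for y
 proof -
 have v: "y ! i \<in> {-1, 1}" "z ! i \<in> {-1, 1}" if "i < k" for i
 using cubeD[OF y that] cubeD[OF z that] by auto
 have "(\<Sum>S\<in>Pow {..<k}. (\<Prod>i\<in>S. ri (y ! i)) * (\<Prod>i\<in>S. ri (z ! i)))
 = (\<Prod>i<k. 1 + ri (y ! i) * ri (z ! i))"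
 by (simp add: prod.distrib[symmetric] pw)
 also have "... = (if y = z then 2 ^ k else 0)"
 proof (cases "y = z")
 case True
 have "(\<Prod>i<k. 1 + ri (y ! i) * ri (z ! i)) = (\<Prod>i<k. 2)"
 using v True by (intro prod.cong) fastforce+
 then show ?thesis using True by simp
 next
 case False
 then obtain i where i: "i < k" "y ! i ~= z ! i"
 using y z nth_equalityI[of y z] by (auto simp: cube_def)
 then have "1 + ri (y ! i) * ri (z ! i) = 0" using v[OF i(1)] by auto
 then show ?thesis using False i by (auto intro!: prod_zero)
 qed
 finally show ?thesis .
 qed
 have "(\<Sum>S\<in>Pow {..<k}. fourier k Q S * (\<Prod>i\<in>S. ri (z ! i)))
 = (\<Sum>S\<in>Pow {..<k}. \<Sum>y\<in>cube k. (1 / 2 ^ k) * pmf Q y * ((\<Prod>i\<in>S. ri (y ! i)) * (\<Prod>i\<in>S. ri (z ! i))))"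
 by (simp add: fourier_def sum_distrib_left sum_distrib_right algebra_simps)
 also have "... = (\<Sum>y\<in>cube k. (1 / 2 ^ k) * pmf Q y * (if y = z then 2 ^ k else 0))"
 by (subst sum.swap) (simp add: sum_distrib_left[symmetric] ker del: times_divide_eq_left)
 also have "... = pmf Q z" using fin z by (simp add: if_distrib[of "times _"] cong: if_cong)
 finally show ?thesis by simp
qed

text \<open>If all odd coefficients vanish, inversion shows that \<open>Q\<close> is invariant under
  negating all truth values, which is what negating the assignment does to every clause. This
  legitimises an output of the wrong global sign.\<close>

lemma planted_uminus:
 assumes Q: "set_pmf Q \<subseteq> cube k" and kn: "k <= n" and sga: "sga \<in> assignments n"
 and even: "!!S. S \<subseteq> {..<k} ==> odd (card S) ==> fourier k Q S = 0"
 shows "restrict (%i. - sga i) {1..n} \<in> assignments n"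
 "planted k Q n (restrict (%i. - sga i) {1..n}) = planted k Q n sga"
proof -
 let ?tau = "restrict (%i. - sga i) {1..n}"
 show tau: "?tau \<in> assignments n" using assignmentsD[OF sga] by (fastforce simp: assignments_def)
 have neg: "pmf Q (map uminus y) = pmf Q y" if y: "y \<in> cube k" for y
 proof -
 have y': "map uminus y \<in> cube k" using y by (auto simp: cube_def)
 have "fourier k Q S * (\<Prod>i\<in>S. ri (map uminus y ! i)) = fourier k Q S * (\<Prod>i\<in>S. ri (y ! i))"
 if S: "S \<subseteq> {..<k}" for S
 proof (cases "odd (card S)")
 case False
 have "(\<Prod>i\<in>S. ri (map uminus y ! i)) = (\<Prod>i\<in>S. (-1) * ri (y ! i))"
 using S y by (intro prod.cong) (auto simp: cube_def)
 then show ?thesis using False by (simp only: prod.distrib) simp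
 qed (use even S in simp)
 then show ?thesis unfolding fourier_inversion[OF Q y'] fourier_inversion[OF Q y] by (intro sum.cong) auto
 qed
 have val: "pmf Q (clause_val ?tau C) = pmf Q (clause_val sga C)" if C: "C \<in> clauses k n" for C
 proof -
 have "lit_val ?tau l = - lit_val sga l" if "l \<in> set C" for l
 using C that by (cases l) (fastforce simp: clauses_def)+
 then have "clause_val ?tau C = map uminus (clause_val sga C)" by (simp add: clause_val_def)
 then show ?thesis using neg[OF clauses_build(2)[OF sga C]] by simp
 qed
 show "planted k Q n ?tau = planted k Q n sga"
 by (rule pmf_eqI) (simp only: pmf_planted[OF Q kn tau] pmf_planted[OF Q kn sga] val cong: sum.cong if_cong)
qed

section \<open>Vote specifications\<close>

text \<open>A clause votes for the tuple of its variables at the positions \<open>tpos\<close>; the vote multiplies its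
 signs with the stored signs of the tuples listed in \<open>srcs\<close>, each given by clause positions and
 a fixed suffix. A bound \<open>(i, j, l)\<close> stands for \<open>i + j * (n div 3) + l * n\<close>.\<close>

type_synonym bound = "nat \<times> nat \<times> nat"

record vspec =
 tpos :: "nat list"
 srcs :: "(nat list \<times> nat list) list"
 trng :: "bound \<times> bound"
 srng :: "bound \<times> bound"
 vsg :: int

definition bnd :: "nat => bound => nat" where
 "bnd n b = (case b of (i, j, l) => i + j * (n div 3) + l * n)"

definition rng :: "nat => bound \<times> bound => nat set" where
 "rng n b = {bnd n (fst b)..bnd n (snd b)}"

definition spos :: "vspec => nat list" where "spos sp = concat (map fst (srcs sp))"
definition apos :: "vspec => nat list" where "apos sp = tpos sp @ spos sp"

text \<open>The second argument is cut into one block per source. Rounding to signs takes place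
  here, when an array is read; the arrays themselves hold plain vote sums.\<close>

fun gsrc :: "(nat list \<times> nat list) list => (nat list => int) => nat list => int" where
 "gsrc [] u w = 1"
| "gsrc ((q, s) # xs) u w = sgn (u (take (length q) w @ s)) * gsrc xs u (drop (length q) w)"

definition vrel :: "nat => vspec => clause => bool" where
 "vrel n sp C \<longleftrightarrow> set (cvars (tpos sp) C) \<subseteq> rng n (trng sp) & set (cvars (spos sp) C) \<subseteq> rng n (srng sp)"

definition vval :: "nat => vspec => (nat list => int) => clause => int" where
 "vval n sp u C = (if vrel n sp C
 then vsg sp * csign (apos sp) C * gsrc (srcs sp) u (cvars (spos sp) C) else 0)"

definition vx :: "nat => vspec => (nat list => int) => clause => nat list => int" where
 "vx n sp u C K = (if cvars (tpos sp) C = K then vval n sp u C else 0)"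

definition tkeys :: "nat => vspec => nat list set" where
 "tkeys n sp = tuples (length (tpos sp)) (rng n (trng sp))"

text \<open>A clause repeats no variable, so one that votes for \<open>K\<close> can only show
  source tuples disjoint from \<open>K\<close>.\<close>

definition skeys :: "nat => vspec => nat list => nat list set" where
 "skeys n sp K = {w \<in> tuples (length (spos sp)) (rng n (srng sp)). set w \<inter> set K = {}}"

definition ssup :: "nat => vspec => (nat list => int) => nat list => nat" where
 "ssup n sp u K = card {w \<in> skeys n sp K. gsrc (srcs sp) u w ~= 0}"

definition scor :: "nat => vspec => assignment => (nat list => int) => nat list => int" where
 "scor n sp sga u K = (\<Sum>w\<in>skeys n sp K. aprod sga w * gsrc (srcs sp) u w)"

definition vbias :: "nat => int list pmf => vspec => real" where
 "vbias k Q sp = 2 ^ k * \<bar>fourier k Q (set (apos sp))\<bar>"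

text \<open>\<open>vsg\<close> undoes the sign of the Fourier coefficient, so that votes lean
  towards the planted product multiplied by the sign of the source correlation.\<close>

definition wf_spec :: "nat => int list pmf => nat => vspec => bool" where
 "wf_spec k Q n sp \<longleftrightarrow> distinct (apos sp) & set (apos sp) \<subseteq> {..<k} & rng n (trng sp) \<subseteq> {1..n} &
 rng n (srng sp) \<subseteq> {1..n} & fourier k Q (set (apos sp)) ~= 0 &
 vsg sp = (if fourier k Q (set (apos sp)) > 0 then 1 else -1)"

lemma cvars_append: "cvars (xs @ ys) C = cvars xs C @ cvars ys C" by (simp add: cvars_def)
lemma length_cvars [simp]: "length (cvars ps C) = length ps" by (simp add: cvars_def)

lemma finite_rng [simp]: "finite (rng n b)" by (simp add: rng_def)

lemma cvars_tuples:
 assumes "C \<in> clauses k n" "distinct ps" "set ps \<subseteq> {..<k}"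
 shows "cvars ps C \<in> tuples (length ps) {1..n}"
proof -
 have c: "length C = k" "distinct (map lit_var C)" "lit_var ` set C \<subseteq> {1..n}" using assms by (auto simp: clauses_def)
 have "inj_on (%p. lit_var (C ! p)) (set ps)"
 proof (rule inj_onI)
 fix p q assume pq: "p \<in> set ps" "q \<in> set ps" "lit_var (C ! p) = lit_var (C ! q)"
 then have "p < length C" "q < length C" using assms c(1) by auto
 then show "p = q" using pq nth_eq_iff_index_eq[OF c(2), of p q] by simp
 qed
 moreover have "lit_var (C ! p) \<in> {1..n}" if "p \<in> set ps" for p
 using that assms c nth_mem[of p C] by blast
 ultimately show ?thesis using assms by (auto simp: tuples_def cvars_def distinct_map)
qed

lemma csign_sign: "csign ps C \<in> {-1, 1}"
 unfolding csign_def by (rule prod_list_sign) (rule lit_sign_cases)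

lemma gsrc_tern: "gsrc xs u w \<in> {-1, 0, 1}"
 by (induction xs u w rule: gsrc.induct) (auto simp: sgn_if)

lemma vval_tern: "wf_spec k Q n sp ==> vval n sp u C \<in> {-1, 0, 1}"
 using csign_sign[of "apos sp" C] gsrc_tern[of "srcs sp" u "cvars (spos sp) C"]
 by (auto simp: vval_def wf_spec_def split: if_splits)

lemma vx_tern: "wf_spec k Q n sp ==> vx n sp u C K \<in> {-1, 0, 1}"
 using vval_tern[of k Q n sp u C] by (auto simp: vx_def)

lemma vx_outside: "~ set K \<subseteq> rng n (trng sp) ==> vx n sp u C K = 0"
 by (auto simp: vx_def vval_def vrel_def)

locale planted_clauses =
 fixes k :: nat and Q :: "int list pmf" and n :: nat and sga :: assignment
 assumes Q: "set_pmf Q \<subseteq> cube k" and kn: "k <= n" and sga: "sga \<in> assignments n"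
begin

abbreviation "D \<equiv> planted k Q n sga"

lemmas finD = finite_set_planted[OF Q kn sga]

text \<open>The votes for \<open>K\<close> split according to the source tuple \<open>w\<close>.
  Each \<open>K @ w\<close> contributes the marginal of the preceding section: a base probability,
  summing up to the support, and a bias signed by the agreement of stored and planted value at
  \<open>w\<close>, summing up to the correlation.\<close>

lemma vote_prob:
 assumes wf: "wf_spec k Q n sp" and K: "K \<in> tkeys n sp" and c: "c \<in> {-1, 1}"
 shows "prb D {C. vx n sp u C K = c * aprod sga K}
 = (real (ssup n sp u K) + ri c * (vbias k Q sp * ri (scor n sp sga u K))) / 2
 / real (card (tuples (length (apos sp)) {1..n}))"
proof -
 define P where "P = real (card (tuples (length (apos sp)) {1..n}))"
 define g where "g w = gsrc (srcs sp) u w" for w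
 define W where "W = {w \<in> skeys n sp K. g w ~= 0}"
 have wf': "distinct (apos sp)" "set (apos sp) \<subseteq> {..<k}" "rng n (trng sp) \<subseteq> {1..n}" "rng n (srng sp) \<subseteq> {1..n}"
 and vs: "vsg sp \<in> {-1, 1}" and bias: "ri (vsg sp) * (2 ^ k * fourier k Q (set (apos sp))) = vbias k Q sp"
 using wf by (auto simp: wf_spec_def vbias_def)
 have finS: "finite (skeys n sp K)" by (simp add: skeys_def)
 have KS: "set K \<subseteq> rng n (trng sp)" "length K = length (tpos sp)" "distinct K"
 using K by (auto simp: tkeys_def tuples_def)
 have aK: "aprod sga K \<in> {-1, 1}" using KS wf' by (intro aprod_sign[OF sga]) auto
 have ap: "aprod sga (v @ w) = aprod sga v * aprod sga w" for v w by (simp add: aprod_def)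
 have gW: "g w \<in> {-1, 1}" if "w \<in> W" for w using that gsrc_tern[of "srcs sp" u w] by (auto simp: W_def g_def)
 have aW: "aprod sga w \<in> {-1, 1}" if "w \<in> skeys n sp K" for w
 using that wf' by (intro aprod_sign[OF sga]) (auto simp: skeys_def tuples_def)
 define E where "E w = {C. cvars (apos sp) C = K @ w &
 csign (apos sp) C = (c * vsg sp * g w * aprod sga w) * aprod sga (K @ w)}" for w
 have "prb D {C. vx n sp u C K = c * aprod sga K} = prb D (\<Union>w\<in>W. E w)"
 proof (rule measure_pmf.finite_measure_eq_AE)
 have "C \<in> {C. vx n sp u C K = c * aprod sga K} \<longleftrightarrow> C \<in> (\<Union>w\<in>W. E w)" if "C \<in> set_pmf D" for C
 proof -
 have C: "C \<in> clauses k n" using that set_planted[OF Q kn sga] by blast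
 define w where "w = cvars (spos sp) C"
 have tup: "cvars (apos sp) C \<in> tuples (length (apos sp)) {1..n}" by (rule cvars_tuples[OF C wf'(1,2)])
 have dw: "distinct (cvars (tpos sp) C @ w)" "length w = length (spos sp)"
 using tup by (auto simp: tuples_def apos_def cvars_append w_def)
 have app: "cvars (apos sp) C = K @ w' \<longleftrightarrow> cvars (tpos sp) C = K & w' = w" for w'
 using KS by (auto simp: apos_def cvars_append w_def)
 note cs = csign_sign[of "apos sp" C]
 show ?thesis
 proof (cases "cvars (tpos sp) C = K & set w \<subseteq> rng n (srng sp) & g w ~= 0")
 case True
 have wW: "w \<in> W" using True dw by (auto simp: W_def skeys_def tuples_def)
 have "vx n sp u C K = vsg sp * csign (apos sp) C * g w"
 using True KS by (simp add: vx_def vval_def vrel_def w_def g_def)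
 moreover have "C \<in> (\<Union>w\<in>W. E w) \<longleftrightarrow> csign (apos sp) C = (c * vsg sp * g w * aprod sga w) * (aprod sga K * aprod sga w)"
 using wW True app by (auto simp: E_def ap)
 moreover have "aprod sga w \<in> {-1, 1}" using aW wW by (auto simp: W_def)
 ultimately show ?thesis using vs gW[OF wW] cs aK c by auto
 next
 case False
 have "vx n sp u C K = 0"
 using False by (auto simp: vx_def vval_def vrel_def w_def g_def)
 moreover have "C \<notin> (\<Union>w\<in>W. E w)"
 using False app by (auto simp: E_def W_def skeys_def tuples_def)
 ultimately show ?thesis using c aK by auto
 qed
 qed
 then show "AE C in D. C \<in> {C. vx n sp u C K = c * aprod sga K} \<longleftrightarrow> C \<in> (\<Union>w\<in>W. E w)"
 by (simp add: AE_measure_pmf_iff)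
 qed auto
 also have "... = (\<Sum>w\<in>W. prb D (E w))"
 by (rule measure_pmf.finite_measure_finite_Union)
 (use finS in \<open>auto simp: W_def disjoint_family_on_def E_def\<close>)
 also have "... = (\<Sum>w\<in>W. (1 + ri c * (vbias k Q sp * ri (aprod sga w * g w))) / 2 / P)"
 proof (rule sum.cong[OF refl])
 fix w assume w: "w \<in> W"
 have KwT: "K @ w \<in> tuples (length (apos sp)) {1..n}"
 using w KS wf' by (auto simp: W_def skeys_def tuples_def apos_def)
 have cc: "c * vsg sp * g w * aprod sga w \<in> {-1, 1}"
 using c vs gW[OF w] aW[of w] w by (auto simp: W_def)
 show "prb D (E w) = (1 + ri c * (vbias k Q sp * ri (aprod sga w * g w))) / 2 / P"
 unfolding E_def planted_marginal[OF Q kn sga wf'(1,2) KwT cc] P_def bias[symmetric]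
 by (simp add: algebra_simps)
 qed
 also have "... = (real (card W) + ri c * (vbias k Q sp * ri (\<Sum>w\<in>W. aprod sga w * g w))) / 2 / P"
 by (simp add: sum_divide_distrib[symmetric] sum.distrib sum_distrib_left)
 also have "(\<Sum>w\<in>W. aprod sga w * g w) = scor n sp sga u K"
 unfolding scor_def g_def[symmetric] W_def using finS by (intro sum.mono_neutral_left) auto
 finally show ?thesis by (simp add: ssup_def W_def g_def P_def)
qed

text \<open>The target carries the factor \<open>sgn A\<close>: a source correlated negatively makes
  the round recover the negated vector. The global sign is left open until the last votes.\<close>

lemma vote_round_spec:
 assumes wf: "wf_spec k Q n sp" and J: "J \<subseteq> tkeys n sp" "J ~= {}" and m: "m > 0"
 and s: "!!K. K \<in> J ==> ssup n sp u K = s" and A: "!!K. K \<in> J ==> scor n sp sga u K = A" and A0: "A ~= 0"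
 shows "vote_round D (vx n sp u) J (%K. sgn A * aprod sga K)
 ((real s + vbias k Q sp * \<bar>ri A\<bar>) / 2 / real (card (tuples (length (apos sp)) {1..n})))
 ((real s - vbias k Q sp * \<bar>ri A\<bar>) / 2 / real (card (tuples (length (apos sp)) {1..n}))) m"
proof
 note pr = vote_prob[OF wf, of _ _ u]
 have sA: "sgn A \<in> {-1, 1}" using A0 by (auto simp: sgn_if)
 have wf': "rng n (trng sp) \<subseteq> {1..n}" "0 < vbias k Q sp" "set (apos sp) \<subseteq> {..<k}" "distinct (apos sp)"
 using wf by (auto simp: wf_spec_def vbias_def)
 show "finite (set_pmf D)" by (rule finD)
 show "finite J" using J by (auto simp: tkeys_def intro: finite_subset)
 show "J ~= {}" by (rule J)
 show "vx n sp u c j \<in> {- 1, 0, 1}" for c j by (rule vx_tern[OF wf])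
 show "i = j" if "vx n sp u c i ~= 0" "vx n sp u c j ~= 0" for c i j using that by (auto simp: vx_def split: if_splits)
 have aK: "aprod sga K \<in> {-1, 1}" if "K \<in> J" for K
 using that J wf' by (intro aprod_sign[OF sga]) (auto simp: tkeys_def tuples_def)
 show "sgn A * aprod sga j \<in> {- 1, 1}" if "j \<in> J" for j using aK[OF that] sA by auto
 have e: "ri (sgn A) * ri A = \<bar>ri A\<bar>" by (simp add: sgn_if)
 fix j assume j: "j \<in> J"
 then have jt: "j \<in> tkeys n sp" using J by auto
 show "prb D {c. vx n sp u c j = sgn A * aprod sga j}
 = (real s + vbias k Q sp * \<bar>ri A\<bar>) / 2 / real (card (tuples (length (apos sp)) {1..n}))"
 using pr[OF jt sA] s[OF j] A[OF j] e by (simp add: mult.left_commute)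
 have "- sgn A \<in> {-1, 1}" using sA by auto
 from pr[OF jt this]
 show "prb D {c. vx n sp u c j = - (sgn A * aprod sga j)}
 = (real s - vbias k Q sp * \<bar>ri A\<bar>) / 2 / real (card (tuples (length (apos sp)) {1..n}))"
 using s[OF j] A[OF j] e by (simp add: mult.left_commute)
next
 have "card (tuples (length (apos sp)) {1..n}) > 0"
 proof -
 have "length (apos sp) <= k"
 using wf card_mono[of "{..<k}" "set (apos sp)"] by (auto simp: wf_spec_def distinct_card)
 then have "tuples (length (apos sp)) {1..n} ~= {}" using kn by (intro tuples_nonempty) auto
 then show ?thesis by (simp add: card_gt_0_iff)
 qed
 moreover have "0 < vbias k Q sp" using wf by (auto simp: wf_spec_def vbias_def)
 ultimately show "(real s - vbias k Q sp * \<bar>ri A\<bar>) / 2 / real (card (tuples (length (apos sp)) {1..n}))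
 < (real s + vbias k Q sp * \<bar>ri A\<bar>) / 2 / real (card (tuples (length (apos sp)) {1..n}))"
 using A0 by (intro divide_strict_right_mono) auto
qed (rule m)

text \<open>Of the source only the ratio of support to squared correlation enters the noise, and it
  enters linearly; this is what turns rounds of voting into a recursion for that ratio.\<close>

lemma spec_step:
 assumes wf: "wf_spec k Q n sp" and ne: "tkeys n sp ~= {}" and m: "m > 0"
 and s: "!!K. K \<in> tkeys n sp ==> ssup n sp u K = s" and A: "!!K. K \<in> tkeys n sp ==> scor n sp sga u K = A" and A0: "A ~= 0"
 and rho: "real s <= rho * (ri A)\<^sup>2"
 and P: "P = real (card (tuples (length (apos sp)) {1..n}))" and N: "N = real (card (tkeys n sp))"
 and nz: "nz = rho * P / (N * (real m * (vbias k Q sp)\<^sup>2)) + 1 / N"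
 shows "prb (replicate_pmf m D) {cs. ~ (
 (\<Sum>K\<in>tkeys n sp. aprod sga K * sgn (vsum (vx n sp u) cs K)) ~= 0 &
 real (card {K \<in> tkeys n sp. vsum (vx n sp u) cs K ~= 0}) <= 2 * N * (real m * real s / P) &
 real (card {K \<in> tkeys n sp. vsum (vx n sp u) cs K ~= 0})
 <= 3200 * nz * (ri (\<Sum>K\<in>tkeys n sp. aprod sga K * sgn (vsum (vx n sp u) cs K)))\<^sup>2)}
 <= 1000 * (1 + real m * real s / P) * nz"
proof -
 define qp where "qp = (real s + vbias k Q sp * \<bar>ri A\<bar>) / 2 / P"
 define qm where "qm = (real s - vbias k Q sp * \<bar>ri A\<bar>) / 2 / P"
 interpret v: vote_round D "vx n sp u" "tkeys n sp" "%K. sgn A * aprod sga K" qp qm m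
 unfolding qp_def qm_def P by (rule vote_round_spec[OF wf _ ne m s A A0]) auto
 have P0: "P > 0"
 proof (rule ccontr)
 assume "~ P > 0"
 then have "P = 0" by (simp add: P)
 then show False using v.bias by (simp add: qp_def qm_def)
 qed
 have q: "qp + qm = real s / P" "qp - qm = vbias k Q sp * \<bar>ri A\<bar> / P"
 by (simp_all add: qp_def qm_def add_divide_distrib[symmetric] diff_divide_distrib[symmetric])
 have lam: "v.lam = real m * real s / P" unfolding v.lam_def q by simp
 have vb: "vbias k Q sp > 0" using wf by (auto simp: wf_spec_def vbias_def)
 have N0: "N > 0" using v.N_pos by (simp add: v.N_def N)
 have A2: "(ri A)\<^sup>2 > 0" using A0 by simp
 have "(qp + qm) / (v.N * (real m * (qp - qm)\<^sup>2)) = real s * P / (N * (real m * ((vbias k Q sp)\<^sup>2 * (ri A)\<^sup>2)))"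
 using P0 unfolding q v.N_def N[symmetric] by (simp add: power_divide power_mult_distrib) (simp add: power2_eq_square)
 also have "... <= (rho * (ri A)\<^sup>2) * P / (N * (real m * ((vbias k Q sp)\<^sup>2 * (ri A)\<^sup>2)))"
 using rho P0 N0 by (intro divide_right_mono mult_right_mono) auto
 also have "... = rho * P / (N * (real m * (vbias k Q sp)\<^sup>2))" using A2 by simp
 finally have nz': "v.noise <= nz" unfolding v.noise_def nz by (simp add: v.N_def N)
 have corr: "v.corr cs = sgn A * (\<Sum>K\<in>tkeys n sp. aprod sga K * sgn (vsum (vx n sp u) cs K))" for cs
 by (simp add: v.corr_def sum_distrib_left mult.assoc)
 have corr2: "(ri (v.corr cs))\<^sup>2 = (ri (\<Sum>K\<in>tkeys n sp. aprod sga K * sgn (vsum (vx n sp u) cs K)))\<^sup>2" for cs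
 unfolding corr using A0 by (auto simp: sgn_if power_mult_distrib)
 have "prb (replicate_pmf m D) {cs. ~ (
 (\<Sum>K\<in>tkeys n sp. aprod sga K * sgn (vsum (vx n sp u) cs K)) ~= 0 &
 real (card {K \<in> tkeys n sp. vsum (vx n sp u) cs K ~= 0}) <= 2 * N * (real m * real s / P) &
 real (card {K \<in> tkeys n sp. vsum (vx n sp u) cs K ~= 0})
 <= 3200 * nz * (ri (\<Sum>K\<in>tkeys n sp. aprod sga K * sgn (vsum (vx n sp u) cs K)))\<^sup>2)}
 <= prb (replicate_pmf m D) {cs. ~ (0 < v.corr cs & real (v.supp cs) <= 2 * v.N * v.lam
 & real (v.supp cs) <= 3200 * v.noise * (ri (v.corr cs))\<^sup>2)}"
 proof (intro measure_pmf.finite_measure_mono subsetI CollectI notI)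
 fix cs
 assume bad: "cs \<in> {cs. ~ (
 (\<Sum>K\<in>tkeys n sp. aprod sga K * sgn (vsum (vx n sp u) cs K)) ~= 0 &
 real (card {K \<in> tkeys n sp. vsum (vx n sp u) cs K ~= 0}) <= 2 * N * (real m * real s / P) &
 real (card {K \<in> tkeys n sp. vsum (vx n sp u) cs K ~= 0})
 <= 3200 * nz * (ri (\<Sum>K\<in>tkeys n sp. aprod sga K * sgn (vsum (vx n sp u) cs K)))\<^sup>2)}"
 assume good: "0 < v.corr cs & real (v.supp cs) <= 2 * v.N * v.lam
 & real (v.supp cs) <= 3200 * v.noise * (ri (v.corr cs))\<^sup>2"
 have "3200 * v.noise * (ri (v.corr cs))\<^sup>2 <= 3200 * nz * (ri (v.corr cs))\<^sup>2"
 using nz' by (intro mult_right_mono) auto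
 then have "real (v.supp cs) <= 3200 * nz * (ri (v.corr cs))\<^sup>2" using good by linarith
 moreover have "v.corr cs ~= 0" using good by simp
 ultimately show False using bad good unfolding corr2 by (auto simp: corr v.supp_def lam v.N_def N)
 qed auto
 also have "... <= 1000 * (1 + v.lam) * v.noise" by (rule v.round_success)
 also have "... <= 1000 * (1 + v.lam) * nz" using nz' v.lam_pos by (intro mult_left_mono) auto
 finally show ?thesis by (simp add: lam)
qed

text \<open>A round with the single bin \<open>K\<close>, so that \<open>ssup\<close> and
  \<open>scor\<close> may depend on \<open>K\<close>. The exponential bound is meant for a union
  bound over all targets.\<close>

lemma spec_exact:
 assumes wf: "wf_spec k Q n sp" and K: "K \<in> tkeys n sp" and m: "m > 0" and A0: "scor n sp sga u K ~= 0"
 and rho: "real (ssup n sp u K) <= rho * (ri (scor n sp sga u K))\<^sup>2"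
 and P: "P = real (card (tuples (length (apos sp)) {1..n}))"
 shows "prb (replicate_pmf m D) {cs. sgn (vsum (vx n sp u) cs K) ~= sgn (scor n sp sga u K) * aprod sga K}
 <= exp (- (real m * (vbias k Q sp)\<^sup>2 / (2 * (rho * P))))"
proof -
 define s where "s = ssup n sp u K"
 define A where "A = scor n sp sga u K"
 define qp where "qp = (real s + vbias k Q sp * \<bar>ri A\<bar>) / 2 / P"
 define qm where "qm = (real s - vbias k Q sp * \<bar>ri A\<bar>) / 2 / P"
 interpret v: vote_round D "vx n sp u" "{K}" "%K. sgn A * aprod sga K" qp qm m
 unfolding qp_def qm_def P by (rule vote_round_spec[OF wf _ _ m]) (use K A0 in \<open>auto simp: s_def A_def\<close>)
 have P0: "P > 0"
 proof (rule ccontr)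
 assume "~ P > 0"
 then have "P = 0" by (simp add: P)
 then show False using v.bias by (simp add: qp_def qm_def)
 qed
 have q: "qp + qm = real s / P" "qp - qm = vbias k Q sp * \<bar>ri A\<bar> / P"
 by (simp_all add: qp_def qm_def add_divide_distrib[symmetric] diff_divide_distrib[symmetric])
 have A2: "(ri A)\<^sup>2 > 0" using A0 by (simp add: A_def)
 have "qp + qm > 0" using v.bias v.q_nonneg by linarith
 then have s0: "real s > 0" unfolding q using P0 by (simp add: zero_less_divide_iff)
 have rho0: "rho > 0"
 proof (rule ccontr)
 assume "~ rho > 0"
 then have "rho * (ri A)\<^sup>2 <= 0" by (intro mult_nonpos_nonneg) auto
 then show False using rho s0 by (simp add: s_def A_def)
 qed
 have "real m * (vbias k Q sp)\<^sup>2 / (2 * (rho * P)) = real m * (vbias k Q sp)\<^sup>2 * (ri A)\<^sup>2 / (2 * (rho * (ri A)\<^sup>2) * P)"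
 using A2 by simp
 also have "... <= real m * (vbias k Q sp)\<^sup>2 * (ri A)\<^sup>2 / (2 * real s * P)"
 using rho s0 P0 rho0 A2 by (intro divide_left_mono mult_right_mono mult_pos_pos) (auto simp: s_def A_def)
 also have "... = real m * (qp - qm)\<^sup>2 / (2 * (qp + qm))"
 unfolding q using P0 s0 by (simp add: power_divide power_mult_distrib) (simp add: power2_eq_square mult_ac)
 finally have ex: "exp (- (real m * (qp - qm)\<^sup>2 / (2 * (qp + qm)))) <= exp (- (real m * (vbias k Q sp)\<^sup>2 / (2 * (rho * P))))"
 by simp
 have sg: "sgn A * aprod sga K \<in> {-1, 1}" using v.sga by simp
 have "prb (replicate_pmf m D) {cs. sgn (vsum (vx n sp u) cs K) ~= sgn A * aprod sga K}
 <= prb (replicate_pmf m D) {cs. sgn A * aprod sga K * vsum (vx n sp u) cs K <= 0}"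
 using sg by (intro measure_pmf.finite_measure_mono) (auto simp: sgn_if split: if_splits)
 also have "... <= exp (- (real m * (qp - qm)\<^sup>2 / (2 * (qp + qm))))"
 using v.bin_wrong_sign[of K] by simp
 finally show ?thesis unfolding A_def[symmetric] by (rule order_trans[OF _ ex])
qed

end

section \<open>The voting algorithm\<close>

type_synonym arrays = "nat => nat list => int"
type_synonym phase = "vspec \<times> nat \<times> nat \<times> nat"

text \<open>Votes are added to the destination instead of replacing it; thus several phases can fill
  one array, and a phase can be executed clause by clause.\<close>

definition vphase :: "nat => vspec => nat => nat => clause list => arrays => arrays" where
 "vphase n sp src dst cs arr = arr(dst := (%K. arr dst K + vsum (vx n sp (arr src)) cs K))"

primrec vrun :: "clause pmf => nat => phase list => arrays => arrays pmf" where
 "vrun D n [] arr = return_pmf arr"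
| "vrun D n (p # phs) arr = (case p of (sp, src, dst, m) =>
 bind_pmf (replicate_pmf m D) (%cs. vrun D n phs (vphase n sp src dst cs arr)))"

lemma prob_bind_le:
 assumes 1: "prb p {x. ~ I x} <= e1"
 and 2: "!!x. I x ==> prb (f x) B <= e2" and e2: "0 <= e2"
 shows "prb (bind_pmf p f) B <= e1 + e2"
proof -
 have "emeasure (bind_pmf p f) B = (\<integral>\<^sup>+x. emeasure (f x) B \<partial>p)" by simp
 also have "... <= (\<integral>\<^sup>+x. indicator {x. ~ I x} x + ennreal e2 \<partial>p)"
 proof (rule nn_integral_mono)
 fix x
 show "emeasure (f x) B <= indicator {x. ~ I x} x + ennreal e2"
 proof (cases "I x")
 case True
 then show ?thesis using 2[OF True] by (simp add: measure_pmf.emeasure_eq_measure ennreal_leI)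
 next
 case False
 have "emeasure (f x) B <= 1" by (rule measure_pmf.emeasure_le_1)
 also have "1 <= 1 + ennreal e2" by simp
 finally show ?thesis using False by simp
 qed
 qed
 also have "... = emeasure p {x. ~ I x} + ennreal e2"
 by (subst nn_integral_add) auto
 also have "... = ennreal (prb p {x. ~ I x} + e2)"
 using e2 by (simp add: measure_pmf.emeasure_eq_measure)
 also have "... <= ennreal (e1 + e2)" using 1 by (intro ennreal_leI) simp
 finally have "ennreal (prb (bind_pmf p f) B) <= ennreal (e1 + e2)"
 by (simp only: measure_pmf.emeasure_eq_measure)
 moreover have "0 <= e1 + e2" using 1 e2 measure_nonneg[of "measure_pmf p" "{x. ~ I x}"] by linarith
 ultimately show ?thesis using ennreal_le_iff by blast
qed

text \<open>The form in which fresh clauses are exploited: once the invariant \<open>I\<close> holds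
  after a phase, the remaining phases are analysed for an arbitrary fixed state of the
  arrays.\<close>

lemma vrun_fail_Cons:
 assumes "prb (replicate_pmf m D) {cs. ~ I (vphase n sp src dst cs arr)} <= e1"
 and "!!arr'. I arr' ==> prb (vrun D n phs arr') {x. ~ G x} <= e2" and "0 <= e2"
 shows "prb (vrun D n ((sp, src, dst, m) # phs) arr) {x. ~ G x} <= e1 + e2"
 using prob_bind_le[of "replicate_pmf m D" "%cs. I (vphase n sp src dst cs arr)" e1
 "%cs. vrun D n phs (vphase n sp src dst cs arr)" "{x. ~ G x}" e2] assms by simp

definition tcor :: "assignment => nat list set => (nat list => int) => int" where
 "tcor sga T u = (\<Sum>w\<in>T. aprod sga w * sgn (u w))"

definition tsup :: "nat list set => (nat list => int) => nat" where
 "tsup T u = card {w \<in> T. u w ~= 0}"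

text \<open>The potential that a round of voting contracts is (support size) / (correlation squared).\<close>

definition good :: "assignment => nat list set => (nat list => int) => real => bool" where
 "good sga T u rho \<longleftrightarrow> tcor sga T u ~= 0 & real (tsup T u) <= rho * (ri (tcor sga T u))\<^sup>2"

lemma good_mono: "good sga T u rho ==> rho <= rho' ==> good sga T u rho'"
 unfolding good_def by (meson mult_right_mono order_trans zero_le_power2)

definition spec_sign :: "nat => int list pmf => nat set => int" where
 "spec_sign k Q S = (if fourier k Q S > 0 then 1 else - 1)"

text \<open>\<open>RB\<close>, \<open>RA\<close>, \<open>RC\<close> are the first, second and last
  third of the variables. As \<open>RA\<close> and \<open>RB\<close> are disjoint, support and
  correlation seen from a target do not depend on the target. \<open>RB' b\<close> starts at
  \<open>b\<close> to stay clear of the fixed suffix \<open>[1..<b]\<close>.\<close>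

definition "RA = ((1, 1, 0), (0, 2, 0) :: bound)"
definition "RB = ((1, 0, 0), (0, 1, 0) :: bound)"
definition "RC = ((1, 2, 0), (0, 0, 1) :: bound)"
definition "RB' b = ((b, 0, 0), (0, 1, 0) :: bound)"
definition "RU = ((1, 0, 0), (0, 0, 1) :: bound)"

lemma rng_simps:
 "rng n RA = {1 + n div 3..2 * (n div 3)}" "rng n RB = {1..n div 3}" "rng n RC = {1 + 2 * (n div 3)..n}"
 "rng n (RB' b) = {b..n div 3}" "rng n RU = {1..n}"
 by (auto simp: rng_def bnd_def RA_def RB_def RC_def RB'_def RU_def)

definition two_spec :: "nat => int list pmf => nat list => nat list => bound \<times> bound => bound \<times> bound => vspec" where
 "two_spec k Q ps1 ps2 R1 R2 = \<lparr>tpos = ps1, srcs = [(ps2, [])], trng = R1, srng = R2, vsg = spec_sign k Q (set ps1 \<union> set ps2)\<rparr>"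

text \<open>Every position of \<open>tl ps\<close> reads one variable \<open>v\<close> through the
  key \<open>v # sfx\<close>: with empty suffix from an array of single variables, with the suffix
  \<open>[1..<b]\<close> from an array of \<open>b\<close>-tuples.\<close>

definition one_spec :: "nat => int list pmf => nat list => nat list => bound \<times> bound => bound \<times> bound => vspec" where
 "one_spec k Q ps sfx R1 R2 = \<lparr>tpos = [hd ps], srcs = map (%p. ([p], sfx)) (tl ps), trng = R1, srng = R2, vsg = spec_sign k Q (set ps)\<rparr>"

lemma two_spec_pos: "apos (two_spec k Q ps1 ps2 R1 R2) = ps1 @ ps2" "spos (two_spec k Q ps1 ps2 R1 R2) = ps2"
 by (simp_all add: apos_def spos_def two_spec_def)

lemma concat_singletons: "concat (map (%p. [p]) xs) = xs" by (induction xs) auto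

lemma one_spec_pos: "spos (one_spec k Q ps sfx R1 R2) = tl ps" "ps ~= [] ==> apos (one_spec k Q ps sfx R1 R2) = ps"
 by (simp_all add: apos_def spos_def one_spec_def comp_def concat_singletons)

lemma two_spec_src:
 assumes "K \<in> tkeys n (two_spec k Q ps1 ps2 R1 R2)" "rng n R1 \<inter> rng n R2 = {}"
 shows "skeys n (two_spec k Q ps1 ps2 R1 R2) K = tuples (length ps2) (rng n R2)"
 and "ssup n (two_spec k Q ps1 ps2 R1 R2) u K = tsup (tuples (length ps2) (rng n R2)) u"
 and "scor n (two_spec k Q ps1 ps2 R1 R2) sga u K = tcor sga (tuples (length ps2) (rng n R2)) u"
proof -
 let ?sp = "two_spec k Q ps1 ps2 R1 R2"
 show sk: "skeys n ?sp K = tuples (length ps2) (rng n R2)"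
 using assms unfolding skeys_def two_spec_pos
 by (fastforce simp: two_spec_def tuples_def tkeys_def)
 have g: "gsrc (srcs ?sp) u w = sgn (u w)" if "w \<in> tuples (length ps2) (rng n R2)" for w
 using that by (simp add: two_spec_def tuples_def)
 have "{w \<in> skeys n ?sp K. gsrc (srcs ?sp) u w ~= 0} = {w \<in> tuples (length ps2) (rng n R2). u w ~= 0}"
 unfolding sk using g by (auto simp: sgn_0_0)
 then show "ssup n ?sp u K = tsup (tuples (length ps2) (rng n R2)) u"
 by (simp only: ssup_def tsup_def)
 show "scor n ?sp sga u K = tcor sga (tuples (length ps2) (rng n R2)) u"
 unfolding scor_def tcor_def sk using g by (intro sum.cong) auto
qed

lemma gsrc_singletons:
 "length w = length qs ==> gsrc (map (%p. ([p], sfx)) qs) u w = (\<Prod>v\<leftarrow>w. sgn (u (v # sfx)))"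
proof (induction qs arbitrary: w)
 case (Cons q qs)
 then show ?case by (cases w) auto
qed simp

text \<open>If all single variables are known up to one common sign, every source tuple is known up
  to the same power of it, so support and absolute correlation coincide.\<close>

lemma one_spec_src:
 assumes u: "!!v. v \<in> rng n R2 ==> sgn (u (v # sfx)) = \<epsilon> * sga v" and \<epsilon>: "\<epsilon> \<in> {-1, 1}"
 and sga: "sga \<in> assignments n" and R2: "rng n R2 \<subseteq> {1..n}" and ne: "skeys n (one_spec k Q ps sfx R1 R2) K ~= {}"
 defines "s \<equiv> card (skeys n (one_spec k Q ps sfx R1 R2) K)"
 shows "ssup n (one_spec k Q ps sfx R1 R2) u K = s"
 and "scor n (one_spec k Q ps sfx R1 R2) sga u K = \<epsilon> ^ length (tl ps) * int s"
 and "s > 0"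
proof -
 let ?sp = "one_spec k Q ps sfx R1 R2"
 have fin: "finite (skeys n ?sp K)" by (simp add: skeys_def)
 show "s > 0" using ne fin by (simp add: s_def card_gt_0_iff)
 have g: "gsrc (srcs ?sp) u w = \<epsilon> ^ length (tl ps) * aprod sga w & aprod sga w \<in> {-1, 1}" if "w \<in> skeys n ?sp K" for w
 proof
 have w: "length w = length (tl ps)" "set w \<subseteq> rng n R2"
 using that by (auto simp: skeys_def one_spec_pos tuples_def) (auto simp: one_spec_def)
 then show "aprod sga w \<in> {-1, 1}" using R2 by (intro aprod_sign[OF sga]) auto
 have "(\<Prod>v\<leftarrow>w. sgn (u (v # sfx))) = \<epsilon> ^ length w * aprod sga w"
 using w(2) u by (induction w) (auto simp: aprod_def algebra_simps)
 then show "gsrc (srcs ?sp) u w = \<epsilon> ^ length (tl ps) * aprod sga w"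
 using gsrc_singletons[OF w(1), of sfx u] w(1) by (simp add: one_spec_def)
 qed
 have e: "\<epsilon> ^ j \<in> {-1, 1}" for j using \<epsilon> by (induction j) auto
 show "ssup n ?sp u K = s"
 unfolding ssup_def s_def using g e[of "length (tl ps)"] by (intro arg_cong[of _ _ card]) fastforce
 have "scor n ?sp sga u K = (\<Sum>w\<in>skeys n ?sp K. \<epsilon> ^ length (tl ps))"
 unfolding scor_def
 proof (rule sum.cong[OF refl])
 fix w assume "w \<in> skeys n ?sp K"
 from g[OF this] show "aprod sga w * gsrc (srcs ?sp) u w = \<epsilon> ^ length (tl ps)" by auto
 qed
 then show "scor n ?sp sga u K = \<epsilon> ^ length (tl ps) * int s" by (simp add: s_def)
qed

text \<open>A clause touches one key. This bound on the support holds with certainty and keeps the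
  expected number of votes of the following half round bounded.\<close>

lemma card_votes_le: "finite T ==> card {K \<in> T. vsum (vx n sp u) cs K ~= 0} <= length cs"
proof -
 assume "finite T"
 have "{K \<in> T. vsum (vx n sp u) cs K ~= 0} \<subseteq> set (map (cvars (tpos sp)) cs)"
 proof
 fix K assume K: "K \<in> {K \<in> T. vsum (vx n sp u) cs K ~= 0}"
 have "vsum (vx n sp u) cs K = 0" if "\<forall>c\<in>set cs. vx n sp u c K = 0"
 using that unfolding vsum_def by (induction cs) auto
 then have "\<exists>c\<in>set cs. vx n sp u c K ~= 0" using K by blast
 then show "K \<in> set (map (cvars (tpos sp)) cs)" by (auto simp: vx_def split: if_splits)
 qed
 then have "card {K \<in> T. vsum (vx n sp u) cs K ~= 0} <= card (set (map (cvars (tpos sp)) cs))"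
 by (intro card_mono) auto
 also have "... <= length cs" using card_length[of "map (cvars (tpos sp)) cs"] by simp
 finally show ?thesis .
qed

text \<open>Rounded-up square root and binary logarithm, as least numbers, which a counting loop of
  the machine can find.\<close>

definition sq :: "nat => nat" where "sq n = (LEAST w. 1 <= w & n <= w * w)"
definition lg :: "nat => nat" where "lg n = (LEAST l. 1 <= l & n <= 2 ^ l)"

lemma sq_ge: "1 <= sq n" "n <= sq n * sq n"
proof -
 have "\<exists>w. 1 <= w & n <= w * w" by (rule exI[of _ "Suc n"]) auto
 then have "1 <= sq n & n <= sq n * sq n" unfolding sq_def by (rule LeastI_ex)
 then show "1 <= sq n" "n <= sq n * sq n" by auto
qed

lemma sq_least: "1 <= w ==> w < sq n ==> w * w < n"
 using not_less_Least[of w "%w. 1 <= w & n <= w * w"] by (auto simp: sq_def)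

lemma sq_le: "1 <= n ==> sq n * sq n <= 4 * n"
proof (cases "sq n <= 1")
 case False
 assume "1 <= n"
 define w where "w = sq n - 1"
 have w: "1 <= w" "w < sq n" "sq n = Suc w" using False by (auto simp: w_def)
 then have "w * w < n" using sq_least by simp
 moreover have "Suc w * Suc w <= 4 * (w * w)" using w(1) by (cases w) auto
 ultimately show ?thesis using w(3) by simp
qed (use sq_ge(1)[of n] in \<open>auto simp: le_Suc_eq\<close>)

lemma lg_ge: "1 <= lg n" "n <= 2 ^ lg n"
proof -
 have "n <= 2 ^ Suc n" using less_exp[of n] unfolding power_Suc by linarith
 then have "\<exists>l. 1 <= l & n <= 2 ^ l" by (intro exI[of _ "Suc n"]) simp
 then have "1 <= lg n & n <= 2 ^ lg n" unfolding lg_def by (rule LeastI_ex)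
 then show "1 <= lg n" "n <= 2 ^ lg n" by auto
qed

lemma lg_least: "1 <= l ==> l < lg n ==> 2 ^ l < n"
 using not_less_Least[of l "%l. 1 <= l & n <= 2 ^ l"] by (auto simp: lg_def)

lemma lg_bounds: "2 <= n ==> ln (real n) <= real (lg n)" "2 <= n ==> real (lg n) <= 3 * ln (real n)"
proof -
 assume n: "2 <= n"
 have ln2: "ln (2::real) <= 1" "1 / 2 <= ln (2::real)"
 using ln_2_less_1 ln2_ge_two_thirds by auto
 have "real n <= real (2 ^ lg n)" using lg_ge(2)[of n] by (simp only: of_nat_le_iff)
 then have "ln (real n) <= ln (2 ^ lg n)" using n by (subst ln_le_cancel_iff) auto
 also have "... = real (lg n) * ln 2" by (simp add: ln_realpow)
 also have "... <= real (lg n)" using ln2 by (simp add: mult_left_le)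
 finally show "ln (real n) <= real (lg n)" .
 show "real (lg n) <= 3 * ln (real n)"
 proof (cases "lg n = 1")
 case True
 have "ln 2 <= ln (real n)" using n by simp
 then show ?thesis using True ln2 by simp
 next
 case False
 define l where "l = lg n - 1"
 have l: "1 <= l" "l < lg n" "lg n = Suc l" using False lg_ge(1)[of n] by (auto simp: l_def)
 then have "2 ^ l < n" using lg_least by simp
 then have "real (2 ^ l) < real n" by (simp only: of_nat_less_iff)
 then have "ln (2 ^ l) <= ln (real n)" by (subst ln_le_cancel_iff) auto
 then have 1: "real l * ln 2 <= ln (real n)" by (simp add: ln_realpow)
 have "real (lg n) <= 2 * real l" using l by simp
 also have "... = 3 * (real l * (2 / 3))" by simp
 also have "... <= 3 * (real l * ln 2)" using ln2_ge_two_thirds by (intro mult_left_mono) auto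
 also have "... <= 3 * ln (real n)" using 1 by simp
 finally show ?thesis .
 qed
qed

section \<open>Analysis of the voting algorithm\<close>

context planted_clauses
begin

lemma two_step:
 fixes ps1 ps2 R1 R2
 defines "sp \<equiv> two_spec k Q ps1 ps2 R1 R2" and "T1 \<equiv> tuples (length ps1) (rng n R1)"
 and "T2 \<equiv> tuples (length ps2) (rng n R2)"
 assumes wf: "wf_spec k Q n sp" and disj: "rng n R1 \<inter> rng n R2 = {}" and ne: "T1 ~= {}" and m: "m > 0"
 and u: "good sga T2 u rho"
 and P: "P = real (card (tuples (length ps1 + length ps2) {1..n}))"
 and nz: "rho * P / (real (card T1) * (real m * (vbias k Q sp)\<^sup>2)) + 1 / real (card T1) <= nz"
 shows "prb (replicate_pmf m D) {cs. ~ (good sga T1 (vsum (vx n sp u) cs) (3200 * nz) &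
 real (tsup T1 (vsum (vx n sp u) cs)) <= 2 * real (card T1) * (real m * real (tsup T2 u) / P))}
 <= 1000 * (1 + real m * real (tsup T2 u) / P) * nz"
proof -
 define nz0 where "nz0 = rho * P / (real (card T1) * (real m * (vbias k Q sp)\<^sup>2)) + 1 / real (card T1)"
 have tk: "tkeys n sp = T1" by (simp add: sp_def tkeys_def two_spec_def T1_def)
 have src: "ssup n sp u K = tsup T2 u" "scor n sp sga u K = tcor sga T2 u" if "K \<in> tkeys n sp" for K
 using two_spec_src[of K n k Q ps1 ps2 R1 R2] that disj by (auto simp: sp_def T2_def)
 have le: "length (apos sp) = length ps1 + length ps2" by (simp add: sp_def two_spec_pos)
 have "prb (replicate_pmf m D) {cs. ~ (good sga T1 (vsum (vx n sp u) cs) (3200 * nz) &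
 real (tsup T1 (vsum (vx n sp u) cs)) <= 2 * real (card T1) * (real m * real (tsup T2 u) / P))}
 <= prb (replicate_pmf m D) {cs. ~ (good sga T1 (vsum (vx n sp u) cs) (3200 * nz0) &
 real (tsup T1 (vsum (vx n sp u) cs)) <= 2 * real (card T1) * (real m * real (tsup T2 u) / P))}"
 using nz by (intro measure_pmf.finite_measure_mono) (auto simp: nz0_def[symmetric] intro: good_mono)
 also have "... <= 1000 * (1 + real m * real (tsup T2 u) / P) * nz0"
 proof -
 have E: "good sga T1 v (3200 * nz0) & real (tsup T1 v) <= y \<longleftrightarrow>
 (\<Sum>K\<in>T1. aprod sga K * sgn (v K)) ~= 0 & real (card {K \<in> T1. v K ~= 0}) <= y &
 real (card {K \<in> T1. v K ~= 0}) <= 3200 * nz0 * (ri (\<Sum>K\<in>T1. aprod sga K * sgn (v K)))\<^sup>2" for v y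
 by (auto simp: good_def tsup_def tcor_def)
 have "tcor sga T2 u ~= 0" "real (tsup T2 u) <= rho * (ri (tcor sga T2 u))\<^sup>2" using u by (auto simp: good_def)
 note st = spec_step[OF wf _ m src this, unfolded tk le, OF ne _ _ P refl nz0_def]
 show ?thesis unfolding E by (rule st)
 qed
 also have "... <= 1000 * (1 + real m * real (tsup T2 u) / P) * nz"
 using nz by (intro mult_left_mono) (auto simp: nz0_def P)
 finally show ?thesis .
qed

lemma union_exact:
 assumes "finite T" "!!w. w \<in> T ==> prb R {cs. f cs w ~= g w} <= e"
 shows "prb R {cs. ~ (\<forall>w\<in>T. f cs w = g w)} <= real (card T) * e"
proof -
 have "prb R {cs. ~ (\<forall>w\<in>T. f cs w = g w)} = prb R (\<Union>w\<in>T. {cs. f cs w ~= g w})"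
 by (intro arg_cong[of _ _ "prb R"]) auto
 also have "... <= (\<Sum>w\<in>T. prb R {cs. f cs w ~= g w})"
 by (rule measure_UNION_le) (use assms in auto)
 also have "... <= (\<Sum>w\<in>T. e)" by (rule sum_mono) (rule assms)
 finally show ?thesis by simp
qed

lemma two_exact:
 fixes ps1 ps2 R1 R2
 defines "sp \<equiv> two_spec k Q ps1 ps2 R1 R2" and "T1 \<equiv> tuples (length ps1) (rng n R1)"
 and "T2 \<equiv> tuples (length ps2) (rng n R2)"
 assumes wf: "wf_spec k Q n sp" and disj: "rng n R1 \<inter> rng n R2 = {}" and m: "m > 0"
 and u: "good sga T2 u rho" and P: "P = real (card (tuples (length ps1 + length ps2) {1..n}))"
 and ex: "exp (- (real m * (vbias k Q sp)\<^sup>2 / (2 * (rho * P)))) <= e"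
 shows "prb (replicate_pmf m D)
 {cs. ~ (\<forall>w\<in>T1. sgn (vsum (vx n sp u) cs w) = sgn (tcor sga T2 u) * aprod sga w)} <= real (card T1) * e"
proof (rule union_exact)
 show "finite T1" by (simp add: T1_def)
 fix w assume w: "w \<in> T1"
 have tk: "w \<in> tkeys n sp" using w by (simp add: sp_def tkeys_def two_spec_def T1_def)
 have src: "ssup n sp u w = tsup T2 u" "scor n sp sga u w = tcor sga T2 u"
 using two_spec_src[of w n k Q ps1 ps2 R1 R2] tk disj by (auto simp: sp_def T2_def)
 have le: "length (apos sp) = length ps1 + length ps2" by (simp add: sp_def two_spec_pos)
 have "prb (replicate_pmf m D) {cs. sgn (vsum (vx n sp u) cs w) ~= sgn (tcor sga T2 u) * aprod sga w}
 <= exp (- (real m * (vbias k Q sp)\<^sup>2 / (2 * (rho * P))))"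
 using spec_exact[OF wf tk m, of u rho P] u by (simp add: src good_def le P)
 then show "prb (replicate_pmf m D) {cs. sgn (vsum (vx n sp u) cs w) ~= sgn (tcor sga T2 u) * aprod sga w} <= e"
 using ex by linarith
qed

text \<open>With all sources right up to a common sign, the ratio of support to squared correlation
  is one over the number of source tuples. That number depends on \<open>v\<close>, which source
  tuples must avoid, hence the common lower bound \<open>s\<close>.\<close>

lemma one_exact:
 fixes ps sfx R1 R2
 defines "sp \<equiv> one_spec k Q ps sfx R1 R2"
 assumes wf: "wf_spec k Q n sp" and ps: "ps ~= []" and m: "m > 0"
 and u: "!!v. v \<in> rng n R2 ==> sgn (u (v # sfx)) = \<epsilon> * sga v" and \<epsilon>: "\<epsilon> \<in> {-1, 1}"
 and s: "!!v. v \<in> rng n R1 ==> 0 < s & s <= real (card (skeys n sp [v]))"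
 and P: "P = real (card (tuples (length ps) {1..n}))"
 and ex: "exp (- (real m * (vbias k Q sp)\<^sup>2 * s / (2 * P))) <= e"
 shows "prb (replicate_pmf m D)
 {cs. ~ (\<forall>v\<in>rng n R1. sgn (vsum (vx n sp u) cs [v]) = \<epsilon> ^ (length ps - 1) * sga v)} <= real n * e"
proof -
 have wf': "rng n R1 \<subseteq> {1..n}" "rng n R2 \<subseteq> {1..n}" using wf by (auto simp: wf_spec_def sp_def one_spec_def)
 have e0: "0 <= e" using ex by (meson exp_ge_zero order_trans)
 have eps: "\<epsilon> ^ j \<in> {-1, 1}" for j using \<epsilon> by (induction j) auto
 have "prb (replicate_pmf m D)
 {cs. ~ (\<forall>v\<in>rng n R1. sgn (vsum (vx n sp u) cs [v]) = \<epsilon> ^ (length ps - 1) * sga v)} <= real (card (rng n R1)) * e"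
 proof (rule union_exact)
 fix v assume v: "v \<in> rng n R1"
 have K: "[v] \<in> tkeys n sp" using v by (simp add: tkeys_def sp_def one_spec_def tuples_def)
 define t where "t = real (card (skeys n sp [v]))"
 have t: "0 < s" "s <= t" using s[OF v] by (auto simp: t_def)
 have ne: "skeys n sp [v] ~= {}" using t by (auto simp: t_def)
 note src = one_spec_src[OF u \<epsilon> sga wf'(2) ne[unfolded sp_def], folded sp_def]
 have sup: "real (ssup n sp u [v]) = t" using src(1) by (simp add: t_def)
 have cor: "scor n sp sga u [v] = \<epsilon> ^ (length ps - 1) * int (card (skeys n sp [v]))" using src(2) by simp
 have sg: "sgn (scor n sp sga u [v]) = \<epsilon> ^ (length ps - 1)"
 proof -
 define e1 where "e1 = \<epsilon> ^ (length ps - 1)"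
 have "e1 \<in> {-1, 1}" unfolding e1_def by (rule eps)
 then show ?thesis unfolding cor e1_def[symmetric] using src(3) by (auto simp: sgn_mult)
 qed
 have c2: "(ri (scor n sp sga u [v]))\<^sup>2 = t\<^sup>2"
 proof -
 define e1 where "e1 = \<epsilon> ^ (length ps - 1)"
 have "e1 \<in> {-1, 1}" unfolding e1_def by (rule eps)
 then show ?thesis unfolding cor e1_def[symmetric] by (auto simp: t_def power_mult_distrib)
 qed
 have P0: "0 <= P" by (simp add: P)
 have "prb (replicate_pmf m D) {cs. sgn (vsum (vx n sp u) cs [v]) ~= sgn (scor n sp sga u [v]) * aprod sga [v]}
 <= exp (- (real m * (vbias k Q sp)\<^sup>2 / (2 * ((1 / t) * P))))"
 proof (rule spec_exact[OF wf K m])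
 show "scor n sp sga u [v] ~= 0" using sg eps[of "length ps - 1"] by (metis insert_iff sgn_0 singletonD zero_neq_neg_one zero_neq_one)
 show "real (ssup n sp u [v]) <= 1 / t * (ri (scor n sp sga u [v]))\<^sup>2"
 unfolding sup c2 using t by (simp add: power2_eq_square)
 show "P = real (card (tuples (length (apos sp)) {1..n}))" unfolding sp_def one_spec_pos(2)[OF ps] by (rule P)
 qed
 also have "... = exp (- (real m * (vbias k Q sp)\<^sup>2 * t / (2 * P)))" by simp
 also have "... <= exp (- (real m * (vbias k Q sp)\<^sup>2 * s / (2 * P)))"
 using t P0 by (simp add: divide_right_mono mult_left_mono)
 finally show "prb (replicate_pmf m D) {cs. sgn (vsum (vx n sp u) cs [v]) ~= \<epsilon> ^ (length ps - 1) * sga v} <= e"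
 using ex by (simp add: sg aprod_def)
 qed simp
 also have "... <= real n * e"
 using e0 card_mono[OF _ wf'(1)] by (intro mult_right_mono) auto
 finally show ?thesis .
qed

end

text \<open>\<open>ps\<close> enumerates the set that drives the power iteration. \<open>ps'\<close>
  enumerates a second set with nonzero coefficient, used for the last votes; by
  \<open>even_case\<close> its size is odd whenever some odd coefficient is nonzero, and then it
  fixes the global sign.\<close>

locale sampler =
 fixes k :: nat and Q :: "int list pmf" and r :: nat and ps ps' :: "nat list" and K1 K2 :: nat
 assumes Q: "set_pmf Q \<subseteq> cube k" and r: "1 <= r"
 and ps: "distinct ps" "set ps \<subseteq> {..<k}" "length ps = r" "fourier k Q (set ps) ~= 0"
 and ps': "distinct ps'" "set ps' \<subseteq> {..<k}" "ps' ~= []" "fourier k Q (set ps') ~= 0"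
 and even_case: "!!S. even (length ps') ==> S \<subseteq> {..<k} ==> odd (card S) ==> fourier k Q S = 0"
 and K: "1 <= K1" "1 <= K2"
begin

section \<open>Parameters, votes and phases of the sampler\<close>

definition "a = (r + 1) div 2"
definition "b = r div 2"

lemma ab: "a + b = r" "b <= a" "1 <= a" "2 <= r ==> 1 <= b" using r by (auto simp: a_def b_def)

definition "T1 = two_spec k Q (take a ps) (drop a ps) RA RB"
definition "T2 = two_spec k Q (drop a ps) (take a ps) RB RA"
text \<open>\<open>FS\<close> extracts single variables: the entry of \<open>b\<close>-tuples at
  \<open>v # [1..<b]\<close> is the value of \<open>v\<close> times a sign that does not depend on
  \<open>v\<close>. \<open>GS\<close> votes once more from single variables; if \<open>ps'\<close>
  has odd length it sees an even power of the unknown global sign, which cancels.\<close>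

definition "FS X = one_spec k Q ps [1..<b] X (RB' b)"
definition "GS X = one_spec k Q ps' [] X RU"

text \<open>Of order \<open>K1 * n powr (r / 2)\<close>, with \<open>sq n\<close> for the half
  power. \<open>Mb\<close> adds a logarithm for the phase that starts from a single coordinate and
  for the phases that must be right everywhere. \<open>R n\<close> rounds give
  \<open>2 ^ R n >= n ^ r\<close>, enough to halve the potential down to its floor.\<close>

definition "M n = K1 * n ^ b * (if odd r then sq n else 1)"
definition "Mb n = K2 * M n * lg n"
definition "R n = r * lg n"

text \<open>Each half round writes to the next array number, which is still zero, so vote sums of
  different rounds never mix.\<close>

primrec rounds :: "nat => nat => nat => phase list" where
 "rounds n q 0 = []"
| "rounds n q (Suc t) = (T1, q, q + 1, M n) # (T2, q + 1, q + 2, M n) # rounds n (q + 2) t"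

text \<open>Arrays of single variables are filled in three phases, one per third. An oracle query
  has only \<open>n ^ a\<close> possible values, and for \<open>r = 2\<close> these could not encode
  both signs of all \<open>n\<close> variables at once.\<close>

definition final_phases :: "nat => nat => phase list" where
 "final_phases n q = [(T1, q, q + 1, M n), (T2, q + 1, q + 2, Mb n),
 (FS RA, q + 2, q + 3, Mb n), (FS RB, q + 2, q + 3, Mb n), (FS RC, q + 2, q + 3, Mb n),
 (GS RA, q + 3, q + 4, Mb n), (GS RB, q + 3, q + 4, Mb n), (GS RC, q + 3, q + 4, Mb n)]"

definition phases :: "nat => phase list" where
 "phases n = (T1, 0, 1, Mb n) # (if r = 1 then []
 else (T2, 1, 2, M n) # rounds n 2 (R n) @ final_phases n (2 + 2 * R n))"

definition "outp n = (if r = 1 then 1 else 6 + 2 * R n)"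

text \<open>The start vector has support one and guesses the sign +1 there; a wrong guess only flips
  the global sign. For \<open>r = 1\<close> the key is the empty tuple, whose product is
  one.\<close>

definition arr0 :: arrays where
 "arr0 = (%p K. if p = 0 & K = [1..<b + 1] then 1 else 0)"

definition "d = 2 ^ k * \<bar>fourier k Q (set ps)\<bar>"
definition "d' = 2 ^ k * \<bar>fourier k Q (set ps')\<bar>"

lemma d_pos: "d > 0" "d' > 0" using ps ps' by (auto simp: d_def d'_def)

lemma lengths: "length (take a ps) = a" "length (drop a ps) = b" using ps ab by auto

lemma set_td: "set (take a ps) \<union> set (drop a ps) = set ps" "set (drop a ps) \<union> set (take a ps) = set ps"
 by (metis append_take_drop_id set_append, metis append_take_drop_id set_append sup_commute)

lemma distinct_td: "distinct (take a ps @ drop a ps)" "distinct (drop a ps @ take a ps)"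
proof -
 show 1: "distinct (take a ps @ drop a ps)" using ps by simp
 show "distinct (drop a ps @ take a ps)" using 1 unfolding distinct_append by blast
qed

lemma rng_T: "3 <= n ==> rng n RA \<subseteq> {1..n}" "rng n RB \<subseteq> {1..n}" "rng n RC \<subseteq> {1..n}" "rng n RU \<subseteq> {1..n}"
 "1 <= b ==> rng n (RB' b) \<subseteq> {1..n}" "rng n RA \<inter> rng n RB = {}" "rng n RB \<inter> rng n RA = {}"
 by (auto simp: rng_simps)

lemma wf_T1: "3 <= n ==> wf_spec k Q n T1" and wf_T2: "3 <= n ==> wf_spec k Q n T2"
 using ps rng_T distinct_td set_td
 unfolding wf_spec_def T1_def T2_def two_spec_pos by (auto simp: two_spec_def spec_sign_def)

lemma wf_FS: "1 <= b ==> rng n X \<subseteq> {1..n} ==> wf_spec k Q n (FS X)"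
 using ps r rng_T unfolding wf_spec_def FS_def by (subst one_spec_pos, force)+ (auto simp: one_spec_def spec_sign_def)

lemma wf_GS: "rng n X \<subseteq> {1..n} ==> wf_spec k Q n (GS X)"
 using ps' rng_T unfolding wf_spec_def GS_def by (subst one_spec_pos, force)+ (auto simp: one_spec_def spec_sign_def)

lemma vbias_specs: "vbias k Q T1 = d" "vbias k Q T2 = d" "vbias k Q (FS X) = d" "vbias k Q (GS X) = d'"
proof -
 have "ps ~= []" using ps r by auto
 then show "vbias k Q T1 = d" "vbias k Q T2 = d" "vbias k Q (FS X) = d" "vbias k Q (GS X) = d'"
 using set_td ps' by (simp_all add: vbias_def d_def d'_def T1_def T2_def FS_def GS_def two_spec_pos one_spec_pos)
qed

text \<open>\<open>c\<close> converts powers of \<open>n\<close> into numbers of tuples over a third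
  of the variables. \<open>C0 / n ^ b\<close> is the additive loss of a double round,
  \<open>Lam\<close> bounds the expected votes at a target, \<open>C1\<close> governs the failure of
  a double round, \<open>C2\<close> and \<open>C3\<close> the noise of the two halves of the first
  one. \<open>C4 / n ^ b\<close> is the potential after all rounds and \<open>C5\<close> the
  resulting noise before the exact votes.\<close>

definition "c = (4::real) ^ r"
definition "C0 = 3200 * c * (3200 * c / d\<^sup>2 + 1)"
definition "Lam = 4 * c * (real K1)\<^sup>2"
definition "C1 = 1000 * (1 + Lam) * (c / d\<^sup>2 + c + 1 + C0)"
definition "C2 = c * (1 / d\<^sup>2 + 1)"
definition "C3 = c * (3200 * c * (1 / d ^ 4 + 1 / d\<^sup>2) + 1)"
definition "C4 = 1 + 2 * C0"
definition "C5 = 3200 * c * (C4 / d\<^sup>2 + 1)"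

text \<open>\<open>K1\<close> makes a double round halve the potential, \<open>K2\<close> makes the exact phases succeed.\<close>

definition "K1_large \<longleftrightarrow> 2 * (3200 * c)\<^sup>2 / d ^ 4 <= (real K1)\<^sup>2"
definition "K2_large \<longleftrightarrow> 2 * C5 * (real r + 1) / d\<^sup>2 <= K2 & 4 * c / d\<^sup>2 <= K2 & 4 * 4 ^ length ps' / d'\<^sup>2 <= K2"

definition "AT n = tuples a (rng n RA)"
definition "BT n = tuples b (rng n RB)"

definition "Z n = 1 / real (lg n) + 1 / real n ^ b"

text \<open>The two inequalities with \<open>Mb n\<close> say that a target expects at most one vote
  in either half of the first double round; the last condition makes the potential after it at most
  one. The factor 24 leaves room to count tuples that avoid a few variables.\<close>

definition large :: "nat => bool" where
 "large n \<longleftrightarrow> 3 <= n & k <= n & 24 * (r + length ps' + 2) <= n & c * real (Mb n) <= real n ^ r &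
 2 * c\<^sup>2 * real n ^ a * real (M n) * real (Mb n) <= real n ^ (2 * r) & 3200 * C3 * Z n <= 1"

definition "errb n = 2000 * (C2 + C3) * Z n + C1 * (6400 * C3 * Z n + real (R n) * (2 * C0 + 1) / real n ^ b)
 + 1000 * (1 + Lam) * c * (C4 / d\<^sup>2 + 1) / real n ^ b + 7 / real n"

lemma c_ge: "c \<ge> 1" by (simp add: c_def)

lemma const_nonneg: "C0 \<ge> 0" "Lam \<ge> 0" "C1 \<ge> 0" "C2 \<ge> 0" "C3 \<ge> 0" "C4 \<ge> 1" "C5 > 0" "Z n \<ge> 0"
proof -
 show C0: "C0 \<ge> 0" unfolding C0_def using c_ge d_pos by (intro mult_nonneg_nonneg add_nonneg_nonneg) auto
 show L: "Lam \<ge> 0" unfolding Lam_def using c_ge by simp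
 show "C1 \<ge> 0" unfolding C1_def using c_ge d_pos C0 L by (intro mult_nonneg_nonneg add_nonneg_nonneg) auto
 show "C2 \<ge> 0" unfolding C2_def using c_ge d_pos by (intro mult_nonneg_nonneg add_nonneg_nonneg) auto
 show "C3 \<ge> 0" unfolding C3_def using c_ge d_pos by (intro mult_nonneg_nonneg add_nonneg_nonneg) auto
 show C4: "C4 \<ge> 1" unfolding C4_def using C0 by simp
 show "C5 > 0" unfolding C5_def using c_ge d_pos C4 by (intro mult_pos_pos add_nonneg_pos) auto
 show "Z n \<ge> 0" by (simp add: Z_def)
qed

lemma card_tuples_quarter:
 assumes "finite V" "real n / 4 <= real (card V) - real j"
 shows "real n ^ j <= 4 ^ j * real (card (tuples j V))"
proof -
 have "(real n / 4) ^ j <= (real (card V) - real j) ^ j" using assms by (intro power_mono) auto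
 also have "real (card V) - real j = real (card V - j)" using assms by (subst of_nat_diff) (auto intro: ccontr)
 also have "real (card V - j) ^ j = real ((card V - j) ^ j)" by simp
 also have "... <= real (card (tuples j V))" using card_tuples_ge[OF assms(1), of j] by (simp only: of_nat_le_iff)
 finally show ?thesis by (simp add: power_divide field_simps)
qed

end

lemma noise_le:
 fixes rho P N m d c x y :: real
 assumes "0 <= rho" "0 <= P" "P <= x * y" "0 < x" "x <= c * N" "0 < m" "0 < d" "0 < c"
 shows "rho * P / (N * (m * d\<^sup>2)) + 1 / N <= c * (rho * y / (m * d\<^sup>2) + 1 / x)"
proof -
 have "0 < c * N" using assms by linarith
 then have N: "0 < N" using assms by (simp add: zero_less_mult_iff)
 have 1: "1 / N <= c / x" using assms N by (simp add: field_simps)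
 have md: "0 < m * d\<^sup>2" using assms by simp
 have "P / N <= (x * y) * (1 / N)" using assms N by (simp add: divide_right_mono)
 also have "... <= (x * y) * (c / x)" using 1 assms by (intro mult_left_mono) (auto intro: order_trans)
 also have "... = c * y" using assms by simp
 finally have "rho * (P / N) / (m * d\<^sup>2) <= rho * (c * y) / (m * d\<^sup>2)"
 using assms md by (intro divide_right_mono mult_left_mono) auto
 then show ?thesis using 1 by (simp add: algebra_simps)
qed

locale sampler_at = sampler k Q r ps ps' K1 K2 + planted_clauses k Q n sga
 for k Q r ps ps' K1 K2 n sga +
 assumes n: "large n" and r2: "2 <= r" and K1: K1_large and K2: K2_large
begin

section \<open>Size estimates at a fixed large \<open>n\<close>\<close>

definition "N1 = real (card (AT n))"
definition "N2 = real (card (BT n))"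
definition "P = real (card (tuples r {1..n}))"
definition "na = real n ^ a"
definition "nb = real n ^ b"
definition "m = real (M n)"
definition "l = real (lg n)"

lemma n_ge: "3 <= n" "k <= n" "24 * (r + length ps' + 2) <= n" "c * real (Mb n) <= real n ^ r"
 "2 * c\<^sup>2 * na * m * real (Mb n) <= real n ^ (2 * r)" "3200 * C3 * Z n <= 1"
 using n by (auto simp: large_def na_def m_def)

lemma nab: "na * nb = real n ^ r" "nb * na = real n ^ r" "1 <= nb" "nb <= na" "0 < na" "0 < nb" "real n <= nb"
proof -
 show "na * nb = real n ^ r" "nb * na = real n ^ r"
 by (simp_all add: na_def nb_def power_add[symmetric] ab(1) add.commute[of b])
 have n1: "1 <= real n" using n_ge(1) by simp
 show "1 <= nb" "nb <= na" "0 < na" "0 < nb" using n1 ab(2) n_ge(1) by (auto simp: na_def nb_def intro: power_increasing)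
 have "real n ^ 1 <= real n ^ b" using n1 ab(4)[OF r2] by (intro power_increasing) auto
 then show "real n <= nb" by (simp add: nb_def)
qed

lemma third: "real n / 3 - 1 <= real (n div 3)"
 by linarith

lemma N1_ge: "na <= c * N1" and N2_ge: "nb <= c * N2" and P_ge: "real n ^ r <= c * P"
proof -
 have big: "24 * (real r + real (length ps') + 2) <= real n" using n_ge(3)
 by (metis (no_types, opaque_lifting) of_nat_add of_nat_le_iff of_nat_mult of_nat_numeral)
 have abr: "real a <= real r" "real b <= real r" using ab(1) by auto
 have cd: "card (rng n RA) = n div 3" "card (rng n RB) = n div 3" by (auto simp: rng_simps)
 have 4: "(4::real) ^ a <= c" "(4::real) ^ b <= c" unfolding c_def using ab(1) by (auto intro!: power_increasing)
 have "na <= 4 ^ a * N1"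
 unfolding na_def N1_def AT_def by (rule card_tuples_quarter) (use big abr third cd in auto)
 also have "... <= c * N1" using 4 by (intro mult_right_mono) (auto simp: N1_def)
 finally show "na <= c * N1" .
 have "nb <= 4 ^ b * N2"
 unfolding nb_def N2_def BT_def by (rule card_tuples_quarter) (use big abr third cd in auto)
 also have "... <= c * N2" using 4 by (intro mult_right_mono) (auto simp: N2_def)
 finally show "nb <= c * N2" .
 show "real n ^ r <= c * P"
 unfolding c_def P_def by (rule card_tuples_quarter) (use big in auto)
qed

lemma P_le: "P <= real n ^ r" and N1_le: "N1 <= na" and N2_le: "N2 <= nb"
proof -
 have "card (tuples j V) <= n ^ j" if "finite V" "card V <= n" for j V
 using card_tuples_le[OF that(1), of j] power_mono[OF that(2), of j] by simp
 note h = this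
 have "real (card (tuples j V)) <= real n ^ j" if "finite V" "card V <= n" for j V
 using h[OF that, of j] by (metis of_nat_le_iff of_nat_power)
 then show "P <= real n ^ r" "N1 <= na" "N2 <= nb"
 unfolding P_def N1_def N2_def na_def nb_def AT_def BT_def by (auto simp: rng_simps)
qed

lemma pos: "P > 0" "N1 > 0" "N2 > 0" "m > 0" "M n > 0" "Mb n > 0" "l \<ge> 1" "lg n > 0"
proof -
 have "0 < real n ^ r" using n_ge by simp
 then show "P > 0" using P_ge c_ge by (smt (verit) mult_nonneg_nonpos)
 show "N1 > 0" using N1_ge c_ge nab by (smt (verit) mult_nonneg_nonpos)
 show "N2 > 0" using N2_ge c_ge nab by (smt (verit) mult_nonneg_nonpos)
 show "M n > 0" using K n_ge sq_ge(1)[of n] by (simp add: M_def)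
 then show "m > 0" by (simp add: m_def)
 show "lg n > 0" "l \<ge> 1" using lg_ge(1)[of n] by (auto simp: l_def)
 then show "Mb n > 0" using \<open>M n > 0\<close> K by (simp add: Mb_def)
qed

lemma m_sq: "(real K1)\<^sup>2 * real n ^ r <= m\<^sup>2" "m\<^sup>2 <= 4 * (real K1)\<^sup>2 * real n ^ r"
proof -
 define w where "w = (if odd r then sq n else 1)"
 have w: "n ^ (r - 2 * b) <= w * w" "w * w <= 4 * n ^ (r - 2 * b)"
 using sq_ge(2)[of n] sq_le[of n] n_ge(1) by (auto simp: w_def b_def odd_two_times_div_two_nat elim!: oddE)
 have rb: "2 * b + (r - 2 * b) = r" by (simp add: b_def)
 have m2: "m\<^sup>2 = (real K1)\<^sup>2 * (real n ^ (2 * b) * real (w * w))"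
 proof -
 have "real n ^ (2 * b) = real n ^ b * real n ^ b" unfolding mult_2 by (rule power_add)
 then show ?thesis by (simp only: m_def M_def w_def[symmetric] of_nat_mult of_nat_power power2_eq_square mult_ac)
 qed
 have nr: "real n ^ r = real n ^ (2 * b) * real (n ^ (r - 2 * b))"
 unfolding of_nat_power power_add[symmetric] rb ..
 have "real (n ^ (r - 2 * b)) <= real (w * w)" using w(1) by (simp only: of_nat_le_iff)
 then show "(real K1)\<^sup>2 * real n ^ r <= m\<^sup>2" unfolding m2 nr by (intro mult_left_mono) auto
 have "real (w * w) <= real (4 * n ^ (r - 2 * b))" using w(2) by (simp only: of_nat_le_iff)
 then have "real (w * w) <= 4 * real (n ^ (r - 2 * b))" by simp
 then have "m\<^sup>2 <= (real K1)\<^sup>2 * (real n ^ (2 * b) * (4 * real (n ^ (r - 2 * b))))"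
 unfolding m2 by (intro mult_left_mono) auto
 then show "m\<^sup>2 <= 4 * (real K1)\<^sup>2 * real n ^ r" unfolding nr by (simp add: algebra_simps)
qed

lemma m_ge: "nb <= m" "real n <= m" "real n ^ r <= m\<^sup>2"
proof -
 have "nb * 1 <= nb * (real K1 * real (if odd r then sq n else 1))"
 proof (rule mult_left_mono)
 have "1 * 1 <= real K1 * real (if odd r then sq n else 1)"
 using K sq_ge(1)[of n] by (intro mult_mono) auto
 then show "1 <= real K1 * real (if odd r then sq n else 1)" by simp
 qed (use nab in simp)
 then show "nb <= m" by (simp add: m_def M_def nb_def mult_ac)
 then show "real n <= m" using nab(7) by simp
 have "1 * real n ^ r <= (real K1)\<^sup>2 * real n ^ r" using K by (intro mult_right_mono) auto
 then show "real n ^ r <= m\<^sup>2" using m_sq(1) by simp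
qed

lemma Mb_eq: "real (Mb n) = real K2 * m * l" by (simp add: Mb_def m_def l_def)
lemma Mb_ge: "m * l <= real (Mb n)"
proof -
 have "1 * (m * l) <= real K2 * (m * l)" using K pos by (intro mult_right_mono) auto
 then show ?thesis by (simp add: Mb_eq)
qed

lemma m_lam: "m * m / P <= Lam" "m * nb / P <= Lam"
proof -
 have "m * m <= 4 * (real K1)\<^sup>2 * real n ^ r" using m_sq(2) by (simp add: power2_eq_square)
 also have "... <= 4 * (real K1)\<^sup>2 * (c * P)" using P_ge by (intro mult_left_mono) auto
 finally show 1: "m * m / P <= Lam" using pos by (simp add: Lam_def field_simps)
 have "m * nb / P <= m * m / P" using m_ge(1) pos by (intro divide_right_mono mult_left_mono) auto
 then show "m * nb / P <= Lam" using 1 by simp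
qed

lemma wf: "wf_spec k Q n T1" "wf_spec k Q n T2" by (rule wf_T1[OF n_ge(1)], rule wf_T2[OF n_ge(1)])

lemma T_ne: "AT n ~= {}" "BT n ~= {}" using pos by (auto simp: N1_def N2_def)

lemma step1:
 assumes "good sga (BT n) u rho" "0 <= rho" "0 < j" "c * (rho * nb / (real j * d\<^sup>2) + 1 / na) <= nz"
 shows "prb (replicate_pmf j D) {cs. ~ (good sga (AT n) (vsum (vx n T1 u) cs) (3200 * nz) &
 real (tsup (AT n) (vsum (vx n T1 u) cs)) <= 2 * N1 * (real j * real (tsup (BT n) u) / P))}
 <= 1000 * (1 + real j * real (tsup (BT n) u) / P) * nz"
proof -
 have "rho * P / (N1 * (real j * d\<^sup>2)) + 1 / N1 <= nz"
 using noise_le[of rho P na nb c N1 "real j" d] assms nab pos P_le N1_ge d_pos c_ge by simp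
 moreover note two_step[of "take a ps" "drop a ps" RA RB j u rho P nz,
 unfolded lengths, folded T1_def AT_def BT_def, unfolded vbias_specs]
 ultimately show ?thesis using assms(1,3) rng_T wf T_ne by (simp add: P_def ab N1_def)
qed

lemma step2:
 assumes "good sga (AT n) u rho" "0 <= rho" "0 < j" "c * (rho * na / (real j * d\<^sup>2) + 1 / nb) <= nz"
 shows "prb (replicate_pmf j D) {cs. ~ (good sga (BT n) (vsum (vx n T2 u) cs) (3200 * nz))}
 <= 1000 * (1 + real j * real (tsup (AT n) u) / P) * nz"
proof -
 have "rho * P / (N2 * (real j * d\<^sup>2)) + 1 / N2 <= nz"
 using noise_le[of rho P nb na c N2 "real j" d] assms nab pos P_le N2_ge d_pos c_ge by simp
 then have 1: "prb (replicate_pmf j D) {cs. ~ (good sga (BT n) (vsum (vx n T2 u) cs) (3200 * nz) &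
 real (tsup (BT n) (vsum (vx n T2 u) cs)) <= 2 * N2 * (real j * real (tsup (AT n) u) / P))}
 <= 1000 * (1 + real j * real (tsup (AT n) u) / P) * nz"
 using two_step[of "drop a ps" "take a ps" RB RA j u rho P nz,
 unfolded lengths, folded T2_def AT_def BT_def, unfolded vbias_specs] assms(1,3) rng_T wf T_ne
 by (simp add: P_def ab N2_def add.commute[of b])
 show ?thesis by (rule order_trans[OF measure_pmf.finite_measure_mono 1]) auto
qed

lemma noise_square:
 "0 < y ==> 0 < m * d\<^sup>2 ==> c * (rho * x / (m * d\<^sup>2) + 1 / y) * y / (m * d\<^sup>2) = c * (rho * (x * y) / (m\<^sup>2 * d ^ 4) + 1 / (m * d\<^sup>2))"
proof -
 assume y: "0 < y" and X: "0 < m * d\<^sup>2"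
 have "m\<^sup>2 * d ^ 4 = (m * d\<^sup>2) * (m * d\<^sup>2)" by (simp add: power2_eq_square power4_eq_xxxx)
 moreover have "c * (rho * x / X + 1 / y) * y / X = c * (rho * (x * y) / (X * X) + 1 / X)" if "0 < X" for X
 using y that by (simp add: field_simps)
 ultimately show ?thesis using X by simp
qed

section \<open>Contraction of the potential over the rounds\<close>

definition "fresh q arr \<longleftrightarrow> (\<forall>p>q. arr p = (%_. 0))" for arr :: arrays

lemma vphase_fresh: "fresh q arr ==> vphase n sp q (q + 1) cs arr = arr(q + 1 := vsum (vx n sp (arr q)) cs)"
 by (simp add: vphase_def fresh_def)

lemma fresh_upd: "fresh q arr ==> fresh (q + 1) (arr(q + 1 := x))" by (auto simp: fresh_def)

lemma fail_mono_len:
 assumes "!!cs. cs \<in> set_pmf (replicate_pmf j D) ==> A cs ==> B cs"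
 shows "prb (replicate_pmf j D) {cs. ~ B cs} <= prb (replicate_pmf j D) {cs. ~ A cs}"
proof -
 have "prb (replicate_pmf j D) {cs. ~ B cs} = prb (replicate_pmf j D) ({cs. ~ B cs} \<inter> set_pmf (replicate_pmf j D))"
 by (simp only: measure_Int_set_pmf)
 also have "... <= prb (replicate_pmf j D) {cs. ~ A cs}"
 using assms by (intro measure_pmf.finite_measure_mono) auto
 finally show ?thesis .
qed

text \<open>Up to constants the halves multiply the potential by \<open>nb / m\<close> and
  \<open>na / m\<close>; the product is \<open>n ^ r / m\<^sup>2\<close>, at most
  \<open>1 / K1\<^sup>2\<close>, and \<open>K1_large\<close> makes the total factor one half. The
  support between the halves is at most \<open>M n\<close>, one key per clause, so a target of the
  second half expects at most \<open>m * m / P <= Lam\<close> votes.\<close>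

lemma double_round:
 assumes I: "good sga (BT n) (arr q) rho" "fresh q arr" "0 <= rho"
 and rest: "!!arr'. good sga (BT n) (arr' (q + 2)) (rho / 2 + C0 / nb) ==> fresh (q + 2) arr' ==>
 prb (vrun D n phs arr') {x. ~ G x} <= e" and e: "0 <= e"
 shows "prb (vrun D n ((T1, q, q + 1, M n) # (T2, q + 1, q + 2, M n) # phs) arr) {x. ~ G x}
 <= C1 * (rho + 1 / nb) + e"
proof -
 define nz1 where "nz1 = c * (rho * nb / (m * d\<^sup>2) + 1 / na)"
 define nz2 where "nz2 = c * (3200 * nz1 * na / (m * d\<^sup>2) + 1 / nb)"
 have md: "m * d\<^sup>2 > 0" using pos d_pos by simp
 have nz0: "0 <= nz1" "0 <= nz2"
 unfolding nz2_def nz1_def using I md nab c_ge by (auto intro!: mult_nonneg_nonneg add_nonneg_nonneg divide_nonneg_nonneg)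
 have b1: "nz1 <= c / d\<^sup>2 * rho + c / nb"
 proof -
 have "rho * nb / (m * d\<^sup>2) <= rho * m / (m * d\<^sup>2)"
 using m_ge I md by (intro divide_right_mono mult_left_mono) auto
 also have "... = rho / d\<^sup>2" using pos by simp
 finally have "rho * nb / (m * d\<^sup>2) <= rho / d\<^sup>2" .
 moreover have "1 / na <= 1 / nb" using nab by (intro frac_le) auto
 ultimately have "rho * nb / (m * d\<^sup>2) + 1 / na <= rho / d\<^sup>2 + 1 / nb" by (rule add_mono)
 then have "c * (rho * nb / (m * d\<^sup>2) + 1 / na) <= c * (rho / d\<^sup>2 + 1 / nb)" using c_ge by (intro mult_left_mono) auto
 then show ?thesis by (simp add: nz1_def algebra_simps)
 qed
 have b2: "3200 * nz2 <= rho / 2 + C0 / nb"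
 proof -
 have "nz1 * na / (m * d\<^sup>2) = c * (rho * (nb * na) / (m\<^sup>2 * d ^ 4) + 1 / (m * d\<^sup>2))"
 unfolding nz1_def by (rule noise_square[OF nab(5) md])
 also have "... <= c * (rho / ((real K1)\<^sup>2 * d ^ 4) + 1 / (nb * d\<^sup>2))"
 proof -
 have K0: "0 < (real K1)\<^sup>2" using K by simp
 have "rho * (nb * na) / (m\<^sup>2 * d ^ 4) <= rho * (m\<^sup>2 / (real K1)\<^sup>2) / (m\<^sup>2 * d ^ 4)"
 using m_sq(1) I K0 unfolding nab(2)
 by (intro divide_right_mono mult_left_mono) (auto simp: field_simps)
 also have "... = rho / ((real K1)\<^sup>2 * d ^ 4)" using pos by simp
 finally have 1: "rho * (nb * na) / (m\<^sup>2 * d ^ 4) <= rho / ((real K1)\<^sup>2 * d ^ 4)" .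
 have "1 / (m * d\<^sup>2) <= 1 / (nb * d\<^sup>2)" using m_ge nab d_pos pos by (intro divide_left_mono mult_right_mono) auto
 then show ?thesis using 1 c_ge by (intro mult_left_mono add_mono) auto
 qed
 finally have x: "nz1 * na / (m * d\<^sup>2) <= c * (rho / ((real K1)\<^sup>2 * d ^ 4) + 1 / (nb * d\<^sup>2))" .
 have "3200 * nz2 = 3200 * c * (3200 * (nz1 * na / (m * d\<^sup>2)) + 1 / nb)" by (simp add: nz2_def)
 also have "... <= 3200 * c * (3200 * (c * (rho / ((real K1)\<^sup>2 * d ^ 4) + 1 / (nb * d\<^sup>2))) + 1 / nb)"
 using x c_ge by (intro mult_left_mono add_right_mono) auto
 also have "... = rho * ((3200 * c)\<^sup>2 / d ^ 4 / (real K1)\<^sup>2) + C0 / nb"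
 using nab d_pos by (simp add: C0_def field_simps power2_eq_square)
 also have "(3200 * c)\<^sup>2 / d ^ 4 / (real K1)\<^sup>2 <= 1 / 2"
 proof (subst pos_divide_le_eq)
 show "0 < (real K1)\<^sup>2" using K by simp
 show "(3200 * c)\<^sup>2 / d ^ 4 <= 1 / 2 * (real K1)\<^sup>2" using K1 by (simp add: K1_large_def)
 qed
 finally show ?thesis using I by (simp add: mult_left_mono)
 qed
 have c0: "0 <= C0 / nb" using const_nonneg nab by simp
 define I1 where "I1 arr' \<longleftrightarrow> good sga (AT n) (arr' (q + 1)) (3200 * nz1) & tsup (AT n) (arr' (q + 1)) <= M n & fresh (q + 1) arr'" for arr'
 have tB: "real (tsup (BT n) u) <= nb" for u
 using N2_le card_mono[of "BT n" "{w \<in> BT n. u w ~= 0}"] by (auto simp: tsup_def N2_def BT_def)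
 have f1: "prb (replicate_pmf (M n) D) {cs. ~ I1 (vphase n T1 q (q + 1) cs arr)} <= 1000 * (1 + Lam) * nz1"
 proof -
 have "prb (replicate_pmf (M n) D) {cs. ~ I1 (vphase n T1 q (q + 1) cs arr)}
 <= prb (replicate_pmf (M n) D) {cs. ~ (good sga (AT n) (vsum (vx n T1 (arr q)) cs) (3200 * nz1) &
 real (tsup (AT n) (vsum (vx n T1 (arr q)) cs)) <= 2 * N1 * (real (M n) * real (tsup (BT n) (arr q)) / P))}"
 proof (rule fail_mono_len)
 fix cs assume cs: "cs \<in> set_pmf (replicate_pmf (M n) D)"
 have "tsup (AT n) (vsum (vx n T1 (arr q)) cs) <= M n"
 using card_votes_le[of "AT n" n T1 "arr q" cs] cs by (simp add: tsup_def AT_def set_replicate_pmf)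
 then show "I1 (vphase n T1 q (q + 1) cs arr)" if "good sga (AT n) (vsum (vx n T1 (arr q)) cs) (3200 * nz1) &
 real (tsup (AT n) (vsum (vx n T1 (arr q)) cs)) <= 2 * N1 * (real (M n) * real (tsup (BT n) (arr q)) / P)"
 using that I(2) unfolding I1_def vphase_fresh[OF I(2)] by (auto intro: fresh_upd)
 qed
 also have "... <= 1000 * (1 + real (M n) * real (tsup (BT n) (arr q)) / P) * nz1"
 by (rule step1[OF I(1,3) pos(5)]) (simp add: nz1_def m_def)
 also have "... <= 1000 * (1 + Lam) * nz1"
 proof -
 have "real (M n) * real (tsup (BT n) (arr q)) / P <= m * nb / P"
 using tB pos by (intro divide_right_mono) (auto simp: m_def mult_left_mono)
 then show ?thesis using m_lam nz0 by (intro mult_right_mono) auto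
 qed
 finally show ?thesis .
 qed
 have f2: "prb (vrun D n ((T2, q + 1, q + 2, M n) # phs) arr1) {x. ~ G x} <= 1000 * (1 + Lam) * nz2 + e"
 if "I1 arr1" for arr1
 proof (rule vrun_fail_Cons[OF _ _ e])
 let ?I = "%arr'. good sga (BT n) (arr' (q + 2)) (rho / 2 + C0 / nb) & fresh (q + 2) arr'"
 have fr: "fresh (q + 1) arr1" and g1: "good sga (AT n) (arr1 (q + 1)) (3200 * nz1)" "tsup (AT n) (arr1 (q + 1)) <= M n"
 using that by (auto simp: I1_def)
 have "prb (replicate_pmf (M n) D) {cs. ~ ?I (vphase n T2 (q + 1) (q + 2) cs arr1)}
 <= prb (replicate_pmf (M n) D) {cs. ~ good sga (BT n) (vsum (vx n T2 (arr1 (q + 1))) cs) (3200 * nz2)}"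
 proof (rule fail_mono_len)
 fix cs assume "good sga (BT n) (vsum (vx n T2 (arr1 (q + 1))) cs) (3200 * nz2)"
 then show "?I (vphase n T2 (q + 1) (q + 2) cs arr1)"
 using vphase_fresh[OF fr, of T2 cs, unfolded add.assoc one_add_one] fresh_upd[OF fr, unfolded add.assoc one_add_one]
 good_mono[OF _ b2] by simp
 qed
 also have "... <= 1000 * (1 + real (M n) * real (tsup (AT n) (arr1 (q + 1))) / P) * nz2"
 by (rule step2[OF g1(1) _ pos(5)]) (use nz0 in \<open>auto simp: nz2_def m_def\<close>)
 also have "... <= 1000 * (1 + Lam) * nz2"
 proof -
 have "real (M n) * real (tsup (AT n) (arr1 (q + 1))) / P <= m * m / P"
 using g1(2) pos by (intro divide_right_mono) (auto simp: m_def mult_left_mono)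
 then show ?thesis using m_lam nz0 by (intro mult_right_mono) auto
 qed
 finally show "prb (replicate_pmf (M n) D) {cs. ~ ?I (vphase n T2 (q + 1) (q + 2) cs arr1)} <= 1000 * (1 + Lam) * nz2" .
 show "prb (vrun D n phs arr') {x. ~ G x} <= e" if "?I arr'" for arr' using rest that by blast
 qed
 have "prb (vrun D n ((T1, q, q + 1, M n) # (T2, q + 1, q + 2, M n) # phs) arr) {x. ~ G x}
 <= 1000 * (1 + Lam) * nz1 + (1000 * (1 + Lam) * nz2 + e)"
 by (rule vrun_fail_Cons[OF f1 f2]) (use nz0 e const_nonneg in \<open>auto intro!: add_nonneg_nonneg\<close>)
 also have "... = 1000 * (1 + Lam) * (nz1 + nz2) + e" by (simp add: algebra_simps)
 also have "... <= 1000 * (1 + Lam) * ((c / d\<^sup>2 + c + 1 + C0) * (rho + 1 / nb)) + e"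
 proof -
 have cd: "0 <= c / d\<^sup>2" using c_ge by simp
 have "nz1 + nz2 <= (c / d\<^sup>2 * rho + c / nb) + (rho + C0 / nb)"
 using b1 b2 nz0 I c0 by linarith
 also have "... <= (c / d\<^sup>2 + c + 1 + C0) * (rho + 1 / nb)"
 proof -
 have "0 <= c / d\<^sup>2 * (1 / nb) + c * rho + 1 / nb + C0 * rho"
 using cd c_ge nab I const_nonneg by (intro add_nonneg_nonneg mult_nonneg_nonneg) auto
 moreover have "(X + c + 1 + C0) * (rho + y) = (X * rho + c * y) + (rho + C0 * y) + (X * y + c * rho + y + C0 * rho)" for X y
 by (simp add: algebra_simps)
 from this[of "c / d\<^sup>2" "1 / nb"]
 have "(c / d\<^sup>2 + c + 1 + C0) * (rho + 1 / nb) = (c / d\<^sup>2 * rho + c / nb) + (rho + C0 / nb) + (c / d\<^sup>2 * (1 / nb) + c * rho + 1 / nb + C0 * rho)"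
 by simp
 ultimately show ?thesis by linarith
 qed
 finally show ?thesis using const_nonneg by (intro add_right_mono mult_left_mono) auto
 qed
 also have "... = C1 * (rho + 1 / nb) + e" by (simp add: C1_def)
 finally show ?thesis .
qed

text \<open>\<open>2 * C0 / nb\<close> is the fixed point of
  \<open>y \<mapsto> y / 2 + C0 / nb\<close>. Measured from it the potential halves exactly, so the
  failure bounds form a geometric series, summing to \<open>2 * x\<close>, plus a constant share of
  order \<open>1 / nb\<close> per round.\<close>

lemma many_rounds:
 assumes "good sga (BT n) (arr q) (x + 2 * C0 / nb)" "fresh q arr" "0 <= x"
 and "!!arr'. good sga (BT n) (arr' (q + 2 * t)) (x / 2 ^ t + 2 * C0 / nb) ==> fresh (q + 2 * t) arr' ==>
 prb (vrun D n phs arr') {x. ~ G x} <= e" and e: "0 <= e"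
 shows "prb (vrun D n (rounds n q t @ phs) arr) {x. ~ G x} <= C1 * (2 * x + real t * (2 * C0 + 1) / nb) + e"
 using assms(1-4)
proof (induction t arbitrary: q arr x)
 case 0
 have "0 <= C1 * (2 * x)" using const_nonneg 0 by simp
 then show ?case using 0 by (simp add: add_increasing)
next
 case (Suc t)
 have c0: "0 <= C0 / nb" using const_nonneg nab by simp
 have e': "0 <= C1 * (2 * (x / 2) + real t * (2 * C0 + 1) / nb) + e"
 using const_nonneg nab e Suc.prems by (intro add_nonneg_nonneg mult_nonneg_nonneg divide_nonneg_nonneg) auto
 have "prb (vrun D n ((T1, q, q + 1, M n) # (T2, q + 1, q + 2, M n) # (rounds n (q + 2) t @ phs)) arr) {x. ~ G x}
 <= C1 * ((x + 2 * C0 / nb) + 1 / nb) + (C1 * (2 * (x / 2) + real t * (2 * C0 + 1) / nb) + e)"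
 proof (rule double_round[OF Suc.prems(1,2) _ _ e'])
 show "0 <= x + 2 * C0 / nb" using Suc.prems c0 by simp
 fix arr' assume g: "good sga (BT n) (arr' (q + 2)) ((x + 2 * C0 / nb) / 2 + C0 / nb)" and f: "fresh (q + 2) arr'"
 have eq: "(x + 2 * C0 / nb) / 2 + C0 / nb = x / 2 + 2 * C0 / nb" by (simp add: add_divide_distrib)
 show "prb (vrun D n (rounds n (q + 2) t @ phs) arr') {x. ~ G x}
 <= C1 * (2 * (x / 2) + real t * (2 * C0 + 1) / nb) + e"
 by (rule Suc.IH) (use g f Suc.prems eq in \<open>auto simp: algebra_simps\<close>)
 qed
 also have "... = C1 * (2 * x + real (Suc t) * (2 * C0 + 1) / nb) + e"
 by (simp add: algebra_simps add_divide_distrib)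
 finally show ?case by simp
qed

lemma start: "good sga (BT n) (arr0 0) 1" "tsup (BT n) (arr0 0) = 1" "fresh 0 arr0"
proof -
 have "b <= r" using ab(1) by simp
 then have "b * 3 <= 24 * (r + length ps' + 2)" by simp
 then have "b * 3 <= n" using n_ge(3) by (rule order_trans)
 then have "b <= n div 3" by (simp add: less_eq_div_iff_mult_less_eq)
 then have J: "[1..<b + 1] \<in> BT n" by (auto simp: BT_def tuples_def rng_simps)
 have a1: "aprod sga [1..<b + 1] \<in> {-1, 1}"
 using J rng_T(2)[of n] by (intro aprod_sign[OF sga]) (auto simp: BT_def tuples_def)
 have "tcor sga (BT n) (arr0 0) = (\<Sum>w\<in>BT n. if w = [1..<b + 1] then aprod sga w else 0)"
 unfolding tcor_def arr0_def by (intro sum.cong) auto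
 also have "... = aprod sga [1..<b + 1]" using J by (simp add: BT_def)
 finally have t: "tcor sga (BT n) (arr0 0) = aprod sga [1..<b + 1]" .
 have "{w \<in> BT n. arr0 0 w ~= 0} = {[1..<b + 1]}" using J by (auto simp: arr0_def)
 then show s: "tsup (BT n) (arr0 0) = 1" by (simp add: tsup_def)
 show "good sga (BT n) (arr0 0) 1" unfolding good_def s t using a1 by auto
 show "fresh 0 arr0" by (auto simp: fresh_def arr0_def)
qed

text \<open>The potential starts at one, where the failure bound of an ordinary double round says
  nothing. The additional logarithm of clauses in the first phase brings potential and failure
  probability down to the order of \<open>Z n\<close>.\<close>

lemma first_round:
 assumes rest: "!!arr'. good sga (BT n) (arr' 2) (3200 * (C3 * Z n)) ==> fresh 2 arr' ==>
 prb (vrun D n phs arr') {x. ~ G x} <= e" and e: "0 <= e"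
 shows "prb (vrun D n ((T1, 0, 1, Mb n) # (T2, 1, 2, M n) # phs) arr0) {x. ~ G x} <= 2000 * (C2 + C3) * Z n + e"
proof -
 define j where "j = real (Mb n)"
 have j: "j > 0" "m * l <= j" using pos Mb_ge by (auto simp: j_def)
 have l0: "l > 0" using pos by linarith
 define nz1 where "nz1 = c * (1 * nb / (j * d\<^sup>2) + 1 / na)"
 have d2: "d\<^sup>2 > 0" "d ^ 4 > 0" using d_pos by auto
 have jP: "j <= P"
 proof -
 have "c * j <= c * P" using n_ge(4) P_ge by (simp add: j_def)
 then show ?thesis using c_ge by simp
 qed
 have Zn: "Z n = 1 / l + 1 / nb" by (simp add: Z_def l_def nb_def)
 have nz10: "0 <= nz1" unfolding nz1_def using j d2 nab c_ge by (intro mult_nonneg_nonneg add_nonneg_nonneg) auto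
 have nbj: "nb / j <= 1 / l"
 proof -
 have "nb * l <= m * l" using m_ge l0 by (intro mult_right_mono) auto
 then have "nb * l <= j" using j(2) by linarith
 then show ?thesis using j(1) l0 by (simp add: field_simps)
 qed
 have b1: "nz1 <= C2 * Z n"
 proof -
 have "nb / (j * d\<^sup>2) <= (1 / l) * (1 / d\<^sup>2)" using divide_right_mono[OF nbj, of "d\<^sup>2"] d2 by simp
 moreover have "1 / na <= 1 / nb" using nab by (intro frac_le) auto
 ultimately have "1 * nb / (j * d\<^sup>2) + 1 / na <= (1 / l) * (1 / d\<^sup>2) + 1 / nb" by simp
 also have "... <= (1 / d\<^sup>2 + 1) * (1 / l + 1 / nb)"
 proof -
 have "(1 / d\<^sup>2 + 1) * (1 / l + 1 / nb) = (1 / l) * (1 / d\<^sup>2) + 1 / nb + (1 / l + 1 / d\<^sup>2 * (1 / nb))"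
 by (simp only: distrib_left distrib_right) simp
 moreover have "0 <= 1 / l + 1 / d\<^sup>2 * (1 / nb)" using d2 l0 nab by (intro add_nonneg_nonneg mult_nonneg_nonneg) auto
 ultimately show ?thesis by linarith
 qed
 finally show ?thesis unfolding nz1_def C2_def Zn using c_ge by (simp add: mult.assoc mult_left_mono)
 qed
 have b2: "c * (3200 * nz1 * na / (real (M n) * d\<^sup>2) + 1 / nb) <= C3 * Z n"
 proof -
 have md: "m * d\<^sup>2 > 0" using pos d2 by simp
 have "nz1 * na / (m * d\<^sup>2) = c * (nb * na / (j * m * d ^ 4) + 1 / (m * d\<^sup>2))"
 proof -
 have "j * m * d ^ 4 = (j * d\<^sup>2) * (m * d\<^sup>2)" by (simp add: power2_eq_square power4_eq_xxxx)
 moreover have "c * (1 * nb / X + 1 / na) * na / Y = c * (nb * na / (X * Y) + 1 / Y)" if "0 < X" "0 < Y" for X Y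
 using that nab by (simp add: field_simps)
 ultimately show ?thesis using md j d2 unfolding nz1_def by simp
 qed
 also have "... <= c * (1 / (l * d ^ 4) + 1 / (nb * d\<^sup>2))"
 proof -
 have "(nb * na) * l <= m\<^sup>2 * l" unfolding nab(2) using m_ge(3) l0 by (intro mult_right_mono) auto
 also have "... <= j * m" using j pos by (simp add: power2_eq_square mult_ac)
 finally have "nb * na / (j * m) <= 1 / l" using j pos l0 by (simp add: field_simps)
 then have "nb * na / (j * m) / d ^ 4 <= 1 / l / d ^ 4" using d2 by (intro divide_right_mono) auto
 then have "nb * na / (j * m * d ^ 4) <= 1 / (l * d ^ 4)" by simp
 moreover have "1 / (m * d\<^sup>2) <= 1 / (nb * d\<^sup>2)" using m_ge nab d2 by (intro frac_le) auto
 ultimately show ?thesis using c_ge by (intro mult_left_mono add_mono) auto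
 qed
 finally have x: "nz1 * na / (m * d\<^sup>2) <= c * (1 / (l * d ^ 4) + 1 / (nb * d\<^sup>2))" .
 have "1 / (l * d ^ 4) + 1 / (nb * d\<^sup>2) <= (1 / d ^ 4 + 1 / d\<^sup>2) * Z n"
 proof -
 have "(1 / d ^ 4 + 1 / d\<^sup>2) * Z n = 1 / (l * d ^ 4) + 1 / (nb * d\<^sup>2) + (1 / d\<^sup>2 * (1 / l) + 1 / d ^ 4 * (1 / nb))"
 unfolding Zn by (simp only: distrib_left distrib_right) (simp add: mult.commute)
 moreover have "0 <= 1 / d\<^sup>2 * (1 / l) + 1 / d ^ 4 * (1 / nb)" using d2 l0 nab by (intro add_nonneg_nonneg mult_nonneg_nonneg) auto
 ultimately show ?thesis by linarith
 qed
 then have "c * (1 / (l * d ^ 4) + 1 / (nb * d\<^sup>2)) <= c * ((1 / d ^ 4 + 1 / d\<^sup>2) * Z n)" using c_ge by (intro mult_left_mono) auto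
 with x have y: "3200 * (nz1 * na / (m * d\<^sup>2)) <= 3200 * (c * ((1 / d ^ 4 + 1 / d\<^sup>2) * Z n))" by linarith
 have "1 / nb <= Z n" using l0 by (simp add: Zn)
 with y have "3200 * (nz1 * na / (m * d\<^sup>2)) + 1 / nb <= (3200 * c * (1 / d ^ 4 + 1 / d\<^sup>2) + 1) * Z n"
 by (simp add: algebra_simps)
 then have "c * (3200 * (nz1 * na / (m * d\<^sup>2)) + 1 / nb) <= c * ((3200 * c * (1 / d ^ 4 + 1 / d\<^sup>2) + 1) * Z n)"
 using c_ge by (intro mult_left_mono) auto
 then show ?thesis by (simp add: C3_def m_def mult.assoc)
 qed
 define I1 where "I1 arr' \<longleftrightarrow> good sga (AT n) (arr' 1) (3200 * nz1) & real (tsup (AT n) (arr' 1)) <= 2 * N1 * (j / P) & fresh 1 arr'" for arr'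
 have f1: "prb (replicate_pmf (Mb n) D) {cs. ~ I1 (vphase n T1 0 1 cs arr0)} <= 2000 * nz1"
 proof -
 have "prb (replicate_pmf (Mb n) D) {cs. ~ I1 (vphase n T1 0 1 cs arr0)}
 <= prb (replicate_pmf (Mb n) D) {cs. ~ (good sga (AT n) (vsum (vx n T1 (arr0 0)) cs) (3200 * nz1) &
 real (tsup (AT n) (vsum (vx n T1 (arr0 0)) cs)) <= 2 * N1 * (real (Mb n) * real (tsup (BT n) (arr0 0)) / P))}"
 proof (rule fail_mono_len)
 fix cs assume "good sga (AT n) (vsum (vx n T1 (arr0 0)) cs) (3200 * nz1) &
 real (tsup (AT n) (vsum (vx n T1 (arr0 0)) cs)) <= 2 * N1 * (real (Mb n) * real (tsup (BT n) (arr0 0)) / P)"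
 then show "I1 (vphase n T1 0 1 cs arr0)"
 using vphase_fresh[OF start(3), of T1 cs] fresh_upd[OF start(3)] by (simp add: I1_def start(2) j_def)
 qed
 also have "... <= 1000 * (1 + real (Mb n) * real (tsup (BT n) (arr0 0)) / P) * nz1"
 by (rule step1[OF start(1) _ pos(6)]) (simp_all add: nz1_def j_def)
 also have "... <= 1000 * (1 + 1) * nz1"
 proof -
 have "real (Mb n) * real (tsup (BT n) (arr0 0)) / P <= 1" using jP pos(1) by (simp add: start(2) j_def)
 then show ?thesis using nz10 by (intro mult_right_mono) auto
 qed
 finally show ?thesis by simp
 qed
 have f2: "prb (vrun D n ((T2, 1, 2, M n) # phs) arr1) {x. ~ G x} <= 2000 * (C3 * Z n) + e"
 if "I1 arr1" for arr1
 proof (rule vrun_fail_Cons[OF _ _ e])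
 let ?I = "%arr'. good sga (BT n) (arr' 2) (3200 * (C3 * Z n)) & fresh 2 arr'"
 have fr: "fresh 1 arr1" and g1: "good sga (AT n) (arr1 1) (3200 * nz1)" "real (tsup (AT n) (arr1 1)) <= 2 * N1 * (j / P)"
 using that by (auto simp: I1_def)
 have "prb (replicate_pmf (M n) D) {cs. ~ ?I (vphase n T2 1 2 cs arr1)}
 <= prb (replicate_pmf (M n) D) {cs. ~ good sga (BT n) (vsum (vx n T2 (arr1 1)) cs) (3200 * (C3 * Z n))}"
 proof (rule fail_mono_len)
 fix cs assume "good sga (BT n) (vsum (vx n T2 (arr1 1)) cs) (3200 * (C3 * Z n))"
 then show "?I (vphase n T2 1 2 cs arr1)"
 using vphase_fresh[OF fr, of T2 cs] fresh_upd[OF fr] by (simp add: numeral_2_eq_2 One_nat_def)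
 qed
 also have "... <= 1000 * (1 + real (M n) * real (tsup (AT n) (arr1 1)) / P) * (C3 * Z n)"
 by (rule step2[OF g1(1) _ pos(5) b2]) (use nz10 in simp)
 also have "... <= 1000 * (1 + 1) * (C3 * Z n)"
 proof -
 have "m * real (tsup (AT n) (arr1 1)) <= m * (2 * N1 * (j / P))" using g1 pos by (intro mult_left_mono) auto
 also have "... = 2 * N1 * m * j / P" by simp
 also have "... <= P"
 proof -
 have "c\<^sup>2 * (2 * N1 * m * j) <= c\<^sup>2 * (2 * na * m * j)"
 using N1_le pos j by (intro mult_left_mono mult_right_mono) auto
 also have "... <= real n ^ (2 * r)" using n_ge(5) by (simp add: j_def mult_ac)
 also have "... = (real n ^ r)\<^sup>2" by (simp add: power_mult[symmetric] mult.commute)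
 also have "... <= (c * P)\<^sup>2" using P_ge by (intro power_mono) auto
 finally have "c\<^sup>2 * (2 * N1 * m * j) <= c\<^sup>2 * P\<^sup>2" by (simp add: power_mult_distrib)
 then have "2 * N1 * m * j <= P\<^sup>2" using c_ge by simp
 then show ?thesis using pos by (simp add: power2_eq_square field_simps)
 qed
 finally have "real (M n) * real (tsup (AT n) (arr1 1)) / P <= 1" using pos by (simp add: m_def)
 then show ?thesis using const_nonneg by (intro mult_right_mono) auto
 qed
 finally show "prb (replicate_pmf (M n) D) {cs. ~ ?I (vphase n T2 1 2 cs arr1)} <= 2000 * (C3 * Z n)" by simp
 show "prb (vrun D n phs arr') {x. ~ G x} <= e" if "?I arr'" for arr' using rest that by blast
 qed
 have "prb (vrun D n ((T1, 0, 1, Mb n) # (T2, 1, 2, M n) # phs) arr0) {x. ~ G x}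
 <= 2000 * nz1 + (2000 * (C3 * Z n) + e)"
 by (rule vrun_fail_Cons[OF f1 f2]) (use e const_nonneg in \<open>auto intro!: add_nonneg_nonneg\<close>)
 also have "... <= 2000 * (C2 + C3) * Z n + e" using b1 by (simp add: algebra_simps)
 finally show ?thesis .
qed

section \<open>Exact votes, single variables and the global sign\<close>

lemma l_ge_ln: "ln (real n) <= l" using lg_bounds(1)[of n] n_ge(1) by (simp add: l_def)

lemma exp_le_inverse: "real i * l <= x ==> exp (- x) <= 1 / real n ^ i"
proof -
 assume "real i * l <= x"
 then have "real i * ln (real n) <= x" using l_ge_ln by (meson mult_left_mono of_nat_0_le_iff order_trans)
 then have "exp (- x) <= exp (- (real i * ln (real n)))" by simp
 also have "... = 1 / real n ^ i" using n_ge(1) by (simp add: exp_minus exp_of_nat_mult inverse_eq_divide)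
 finally show ?thesis .
qed

text \<open>Outside \<open>V\<close> the vote sums must still be zero, because the phases for the
  other ranges will add to the same array.\<close>

definition "solved_on V u e \<longleftrightarrow> (\<forall>v\<in>V. sgn (u [v]) = e * sga v) & (\<forall>v\<in>{1..n} - V. u [v] = 0)" for V u and e :: int

text \<open>The size of \<open>K2\<close> makes the exponent at least \<open>2 * lg n\<close>, so a
  single variable fails with probability at most \<open>1 / n\<^sup>2\<close> and some variable of
  the range with probability at most \<open>1 / n\<close>.\<close>

lemma one_phase:
 fixes qs sfx X R2 q
 defines "sp \<equiv> one_spec k Q qs sfx X R2"
 assumes wf: "wf_spec k Q n sp" and qs: "qs ~= []"
 and src: "!!v. v \<in> rng n R2 ==> sgn (arr q (v # sfx)) = \<epsilon> * sga v" and \<epsilon>: "\<epsilon> \<in> {-1, 1}"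
 and card: "!!v. real n ^ (length qs - 1) <= C * real (card (skeys n sp [v]))" and C: "C > 0"
 and K2': "4 * C / (vbias k Q sp)\<^sup>2 <= real K2"
 and dn: "solved_on V (arr (q + 1)) (\<epsilon> ^ (length qs - 1))" "V \<inter> rng n X = {}" "fresh (q + 1) arr"
 shows "prb (replicate_pmf (Mb n) D) {cs. ~ (
 (\<forall>p. p ~= q + 1 --> vphase n sp q (q + 1) cs arr p = arr p) & fresh (q + 1) (vphase n sp q (q + 1) cs arr) &
 solved_on (V \<union> rng n X) (vphase n sp q (q + 1) cs arr (q + 1)) (\<epsilon> ^ (length qs - 1)))} <= 1 / real n"
proof -
 define u where "u = arr q"
 define P' where "P' = real (card (tuples (length qs) {1..n}))"
 define s where "s = real n ^ (length qs - 1) / C"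
 have vb: "vbias k Q sp > 0" using wf by (auto simp: wf_spec_def vbias_def)
 have n0: "real n > 0" using n_ge by simp
 have sX: "rng n X \<subseteq> {1..n}" using wf by (auto simp: wf_spec_def sp_def one_spec_def)
 have P'le: "P' <= real n ^ length qs"
 unfolding P'_def using card_tuples_le[of "{1..n}" "length qs"] by (simp flip: of_nat_power)
 have P'0: "P' > 0"
 proof -
 have "length qs <= k" using wf qs card_mono[of "{..<k}" "set qs"]
 by (auto simp: wf_spec_def sp_def one_spec_pos distinct_card)
 then have "tuples (length qs) {1..n} ~= {}" using kn by (intro tuples_nonempty) auto
 then show ?thesis by (simp add: P'_def card_gt_0_iff)
 qed
 have nq: "real n ^ length qs = real n * real n ^ (length qs - 1)" using qs by (cases qs) auto
 have "real 2 * l <= real (Mb n) * (vbias k Q sp)\<^sup>2 * s / (2 * P')"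
 proof -
 have "2 * l <= real K2 * (vbias k Q sp)\<^sup>2 / (2 * C) * l"
 using K2' vb C pos by (intro mult_right_mono) (auto simp: field_simps)
 also have "... = (real K2 * real n * l) * (vbias k Q sp)\<^sup>2 * s / (2 * real n ^ length qs)"
 using n0 by (simp add: s_def nq mult_ac)
 also have "... <= (real K2 * m * l) * (vbias k Q sp)\<^sup>2 * s / (2 * real n ^ length qs)"
 using m_ge(2) n0 C pos by (intro divide_right_mono mult_right_mono mult_left_mono) (auto simp: s_def)
 also have "... <= (real K2 * m * l) * (vbias k Q sp)\<^sup>2 * s / (2 * P')"
 using P'le P'0 n0 C pos by (intro divide_left_mono mult_nonneg_nonneg mult_pos_pos) (auto simp: s_def)
 finally show ?thesis by (simp add: Mb_eq)
 qed
 then have ex: "exp (- (real (Mb n) * (vbias k Q sp)\<^sup>2 * s / (2 * P'))) <= 1 / real n ^ 2" by (rule exp_le_inverse)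
 have sc: "0 < s & s <= real (card (skeys n sp [v]))" for v
 using card[of v] C n0 by (simp add: s_def field_simps)
 have "prb (replicate_pmf (Mb n) D)
 {cs. ~ (\<forall>v\<in>rng n X. sgn (vsum (vx n sp u) cs [v]) = \<epsilon> ^ (length qs - 1) * sga v)} <= real n * (1 / real n ^ 2)"
 unfolding sp_def by (rule one_exact[OF wf[unfolded sp_def] qs pos(6) _ \<epsilon> _ P'_def])
 (use src sc ex in \<open>auto simp: u_def sp_def\<close>)
 also have "... = 1 / real n" using n0 by (simp add: power2_eq_square)
 finally have 1: "prb (replicate_pmf (Mb n) D)
 {cs. ~ (\<forall>v\<in>rng n X. sgn (vsum (vx n sp u) cs [v]) = \<epsilon> ^ (length qs - 1) * sga v)} <= 1 / real n" .
 show ?thesis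
 proof (rule order_trans[OF fail_mono_len 1])
 fix cs assume ok: "\<forall>v\<in>rng n X. sgn (vsum (vx n sp u) cs [v]) = \<epsilon> ^ (length qs - 1) * sga v"
 have z: "vsum (vx n sp u) cs [v] = 0" if "v \<notin> rng n X" for v
 using that vx_outside[of "[v]" n sp u] unfolding vsum_def by (simp add: sp_def one_spec_def)
 have z': "arr (q + 1) [v] = 0" if "v \<in> rng n X" for v
 using that dn(1,2) sX unfolding solved_on_def by blast
 have "solved_on (V \<union> rng n X) (vphase n sp q (q + 1) cs arr (q + 1)) (\<epsilon> ^ (length qs - 1))"
 using dn(1,2) ok z z' unfolding solved_on_def vphase_def u_def[symmetric]
 by (auto simp: disjoint_iff)
 moreover have "fresh (q + 1) (vphase n sp q (q + 1) cs arr)" using dn(3) by (simp add: fresh_def vphase_def)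
 ultimately show "(\<forall>p. p ~= q + 1 --> vphase n sp q (q + 1) cs arr p = arr p) & fresh (q + 1) (vphase n sp q (q + 1) cs arr) &
 solved_on (V \<union> rng n X) (vphase n sp q (q + 1) cs arr (q + 1)) (\<epsilon> ^ (length qs - 1))"
 by (simp add: vphase_def)
 qed
qed

lemma three_phases:
 fixes qs sfx R2 q
 defines "sp \<equiv> %X. one_spec k Q qs sfx X R2"
 assumes wf: "!!X. rng n X \<subseteq> {1..n} ==> wf_spec k Q n (sp X)" and qs: "qs ~= []"
 and src: "!!v. v \<in> rng n R2 ==> sgn (arr q (v # sfx)) = \<epsilon> * sga v" and \<epsilon>: "\<epsilon> \<in> {-1, 1}"
 and card: "!!v X. real n ^ (length qs - 1) <= C * real (card (skeys n (sp X) [v]))" and C: "C > 0"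
 and K2': "!!X. 4 * C / (vbias k Q (sp X))\<^sup>2 <= real K2" and fr: "fresh q arr"
 and rest: "!!arr'. (\<forall>v\<in>{1..n}. sgn (arr' (q + 1) [v]) = \<epsilon> ^ (length qs - 1) * sga v) ==> fresh (q + 1) arr' ==>
 prb (vrun D n phs arr') {x. ~ G x} <= e" and e: "0 <= e"
 shows "prb (vrun D n ((sp RA, q, q + 1, Mb n) # (sp RB, q, q + 1, Mb n) # (sp RC, q, q + 1, Mb n) # phs) arr) {x. ~ G x}
 <= 3 / real n + e"
proof -
 define St where "St V arr' \<longleftrightarrow> arr' q = arr q & fresh (q + 1) arr' & solved_on V (arr' (q + 1)) (\<epsilon> ^ (length qs - 1))" for V and arr' :: arrays
 have step: "prb (vrun D n ((sp X, q, q + 1, Mb n) # phs') arr1) {x. ~ G x} <= 1 / real n + e'"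
 if "St V arr1" "V \<inter> rng n X = {}" "rng n X \<subseteq> {1..n}" "0 <= e'"
 and nxt: "!!arr2. St (V \<union> rng n X) arr2 ==> prb (vrun D n phs' arr2) {x. ~ G x} <= e'" for V X arr1 phs' e'
 proof (rule vrun_fail_Cons[of _ _ "St (V \<union> rng n X)"])
 have "prb (replicate_pmf (Mb n) D) {cs. ~ St (V \<union> rng n X) (vphase n (sp X) q (q + 1) cs arr1)}
 <= prb (replicate_pmf (Mb n) D) {cs. ~ (
 (\<forall>p. p ~= q + 1 --> vphase n (sp X) q (q + 1) cs arr1 p = arr1 p) & fresh (q + 1) (vphase n (sp X) q (q + 1) cs arr1) &
 solved_on (V \<union> rng n X) (vphase n (sp X) q (q + 1) cs arr1 (q + 1)) (\<epsilon> ^ (length qs - 1)))}"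
 by (rule fail_mono_len) (use that(1) in \<open>auto simp: St_def\<close>)
 also have "... <= 1 / real n"
 unfolding sp_def by (rule one_phase[OF wf[OF that(3), unfolded sp_def] qs _ \<epsilon> card[unfolded sp_def] C K2'[unfolded sp_def]])
 (use that(1,2) src in \<open>auto simp: St_def\<close>)
 finally show "prb (replicate_pmf (Mb n) D) {cs. ~ St (V \<union> rng n X) (vphase n (sp X) q (q + 1) cs arr1)} <= 1 / real n" .
 qed (use that in auto)
 have n0: "0 <= 1 / real n" by simp
 have cover: "rng n RA \<union> rng n RB \<union> rng n RC = {1..n}" and dj: "rng n RA \<inter> rng n RB = {}" "(rng n RA \<union> rng n RB) \<inter> rng n RC = {}"
 using n_ge(1) by (auto simp: rng_simps)
 have St0: "St {} arr" using fr by (auto simp: St_def fresh_def solved_on_def)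
 have r3: "prb (vrun D n phs arr2) {x. ~ G x} <= e" if "St (rng n RA \<union> rng n RB \<union> rng n RC) arr2" for arr2
 using that unfolding cover by (intro rest) (auto simp: St_def solved_on_def)
 have r2: "prb (vrun D n ((sp RC, q, q + 1, Mb n) # phs) arr2) {x. ~ G x} <= 1 / real n + e"
 if "St (rng n RA \<union> rng n RB) arr2" for arr2
 by (rule step[OF that dj(2) rng_T(3) e r3])
 have r1: "prb (vrun D n ((sp RB, q, q + 1, Mb n) # (sp RC, q, q + 1, Mb n) # phs) arr2) {x. ~ G x} <= 1 / real n + (1 / real n + e)"
 if "St ({} \<union> rng n RA) arr2" for arr2
 by (rule step[of "rng n RA"]) (use that dj rng_T e r2 in auto)
 have "prb (vrun D n ((sp RA, q, q + 1, Mb n) # (sp RB, q, q + 1, Mb n) # (sp RC, q, q + 1, Mb n) # phs) arr) {x. ~ G x}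
 <= 1 / real n + (1 / real n + (1 / real n + e))"
 by (rule step[OF St0 _ rng_T(1)[OF n_ge(1)] _ r1]) (use e in auto)
 then show ?thesis by simp
qed

definition "planted_found u \<longleftrightarrow> (\<exists>e\<in>{-1, 1}. (\<forall>v\<in>{1..n}. sgn (u [v]) = e * sga v) & (odd (length ps') --> e = 1))"

lemma final_fail:
 assumes I: "good sga (BT n) (arr q) (C4 / nb)" "fresh q arr"
 shows "prb (vrun D n (final_phases n q) arr) {x. ~ planted_found (x (q + 4))}
 <= 1000 * (1 + Lam) * c * (C4 / d\<^sup>2 + 1) / nb + 7 / real n"
proof -
 let ?G = "%x :: arrays. planted_found (x (q + 4))"
 have psne: "ps ~= []" using ps r by auto
 have b1: "1 <= b" using ab(4)[OF r2] .
 have big: "24 * (real r + real (length ps') + 2) <= real n" using n_ge(3)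
 by (metis (no_types, opaque_lifting) of_nat_add of_nat_le_iff of_nat_mult of_nat_numeral)
 have epow: "(e::int) ^ j \<in> {-1, 1}" if "e \<in> {-1, 1}" for e j using that by (induction j) auto
 have G4: "prb (vrun D n [] arr') {x. ~ ?G x} <= 0"
 if "\<forall>v\<in>{1..n}. sgn (arr' (q + 3 + 1) [v]) = e ^ (length ps' - 1) * sga v" "e \<in> {-1, 1}" for arr' e
 proof -
 \<comment> \<open>For odd length the exponent is even, which erases the unknown sign.\<close>
 have "odd (length ps') --> e ^ (length ps' - 1) = 1" using that(2) ps'(3) by auto
 then have "?G arr'" unfolding planted_found_def using that epow[OF that(2)] by (intro bexI[of _ "e ^ (length ps' - 1)"]) (auto simp: add.assoc)
 then show ?thesis by simp
 qed
 have G3: "prb (vrun D n ((GS RA, q + 3, q + 3 + 1, Mb n) # (GS RB, q + 3, q + 3 + 1, Mb n) # (GS RC, q + 3, q + 3 + 1, Mb n) # []) arr') {x. ~ ?G x} <= 3 / real n + 0"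
 if u: "\<forall>v\<in>{1..n}. sgn (arr' (q + 3) [v]) = e * sga v" and e: "e \<in> {-1, 1}" and fr: "fresh (q + 3) arr'" for arr' e
 unfolding GS_def
 proof (rule three_phases[OF _ ps'(3) _ e _ _ _ fr])
 show "wf_spec k Q n (one_spec k Q ps' [] X RU)" if "rng n X \<subseteq> {1..n}" for X
 using wf_GS[OF that] by (simp add: GS_def)
 show "sgn (arr' (q + 3) [v]) = e * sga v" if "v \<in> rng n RU" for v using u that by (simp add: rng_simps)
 show "real n ^ (length ps' - 1) <= 4 ^ length ps' * real (card (skeys n (one_spec k Q ps' [] X RU) [v]))" for v X
 proof -
 have sub: "tuples (length ps' - 1) ({1..n} - {v}) \<subseteq> skeys n (one_spec k Q ps' [] X RU) [v]"
 by (auto simp: skeys_def one_spec_pos tuples_def) (auto simp: one_spec_def rng_simps)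
 have cd: "real n - 1 <= real (card ({1..n} - {v}))" by (cases "v \<in> {1..n}") auto
 have "real n ^ (length ps' - 1) <= 4 ^ (length ps' - 1) * real (card (tuples (length ps' - 1) ({1..n} - {v})))"
 by (rule card_tuples_quarter) (use cd big in auto)
 moreover have "card (tuples (length ps' - 1) ({1..n} - {v})) <= card (skeys n (one_spec k Q ps' [] X RU) [v])"
 by (rule card_mono[OF _ sub]) (simp add: skeys_def)
 then have "4 ^ (length ps' - 1) * real (card (tuples (length ps' - 1) ({1..n} - {v})))
 <= 4 ^ length ps' * real (card (skeys n (one_spec k Q ps' [] X RU) [v]))"
 by (intro mult_mono power_increasing) auto
 ultimately show ?thesis by linarith
 qed
 show "4 * 4 ^ length ps' / (vbias k Q (one_spec k Q ps' [] X RU))\<^sup>2 <= real K2" for X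
 using K2 vbias_specs(4)[of X] by (simp add: K2_large_def GS_def)
 qed (use G4 e in \<open>auto simp: add.assoc\<close>)
 have G2: "prb (vrun D n ((FS RA, q + 2, q + 2 + 1, Mb n) # (FS RB, q + 2, q + 2 + 1, Mb n) # (FS RC, q + 2, q + 2 + 1, Mb n) #
 (GS RA, q + 3, q + 3 + 1, Mb n) # (GS RB, q + 3, q + 3 + 1, Mb n) # (GS RC, q + 3, q + 3 + 1, Mb n) # []) arr') {x. ~ ?G x} <= 3 / real n + (3 / real n + 0)"
 if u: "\<forall>w\<in>BT n. sgn (arr' (q + 2) w) = e0 * aprod sga w" and e0: "e0 \<in> {-1, 1}" and fr: "fresh (q + 2) arr'" for arr' e0
 unfolding FS_def
 proof (rule three_phases[OF _ psne _ _ _ _ _ fr])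
 \<comment> \<open>The fixed suffix contributes a sign that is the same for all \<open>v\<close>; it
   is absorbed into the unknown global sign.\<close>
 define e where "e = e0 * aprod sga [1..<b]"
 have "b <= r" using ab(1) by simp
 then have "b <= 24 * (r + length ps' + 2)" by simp
 then have "b <= n" using n_ge(3) by (rule order_trans)
 then have "aprod sga [1..<b] \<in> {-1, 1}" by (intro aprod_sign[OF sga]) auto
 then show e: "e \<in> {-1, 1}" using e0 by (auto simp: e_def)
 show "wf_spec k Q n (one_spec k Q ps [1..<b] X (RB' b))" if "rng n X \<subseteq> {1..n}" for X
 using wf_FS[OF b1 that] by (simp add: FS_def)
 show "sgn (arr' (q + 2) (v # [1..<b])) = e * sga v" if v: "v \<in> rng n (RB' b)" for v
 proof -
 have "v # [1..<b] \<in> BT n" using v b1 by (auto simp: BT_def tuples_def rng_simps)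
 then show ?thesis using u by (simp add: e_def aprod_def mult_ac)
 qed
 show "real n ^ (length ps - 1) <= c * real (card (skeys n (one_spec k Q ps [1..<b] X (RB' b)) [v]))" for v X
 proof -
 have sub: "tuples (length ps - 1) ({b..n div 3} - {v}) \<subseteq> skeys n (one_spec k Q ps [1..<b] X (RB' b)) [v]"
 by (auto simp: skeys_def one_spec_pos tuples_def) (auto simp: one_spec_def rng_simps)
 have cd: "real (n div 3) - real b <= real (card ({b..n div 3} - {v}))" by (cases "v \<in> {b..n div 3}") auto
 have "real n ^ (length ps - 1) <= 4 ^ (length ps - 1) * real (card (tuples (length ps - 1) ({b..n div 3} - {v})))"
 proof (rule card_tuples_quarter)
 have "real b <= real r" "real (length ps - 1) <= real r" using ab(1) ps(3) by auto
 moreover have "x / 4 <= y - z" if "b' <= r'" "z <= r'" "q' - b' <= y" "24 * r' + 24 * w + 48 <= x" "x / 3 - 1 <= q'" "0 <= w"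
 for b' r' z q' y x w :: real using that by linarith
 ultimately show "real n / 4 <= real (card ({b..n div 3} - {v})) - real (length ps - 1)"
 using cd big third of_nat_0_le_iff by (simp add: distrib_left)
 qed simp
 moreover have "card (tuples (length ps - 1) ({b..n div 3} - {v})) <= card (skeys n (one_spec k Q ps [1..<b] X (RB' b)) [v])"
 by (rule card_mono[OF _ sub]) (simp add: skeys_def)
 then have "4 ^ (length ps - 1) * real (card (tuples (length ps - 1) ({b..n div 3} - {v})))
 <= c * real (card (skeys n (one_spec k Q ps [1..<b] X (RB' b)) [v]))"
 proof (intro mult_mono)
 show "4 ^ (length ps - 1) <= c" unfolding c_def using ps(3) by (intro power_increasing) auto
 qed (use c_ge in auto)
 ultimately show ?thesis by linarith
 qed
 show "c > 0" using c_ge by simp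
 show "4 * c / (vbias k Q (one_spec k Q ps [1..<b] X (RB' b)))\<^sup>2 <= real K2" for X
 using K2 vbias_specs(3)[of X] by (simp add: K2_large_def FS_def)
 fix arr2 assume 2: "\<forall>v\<in>{1..n}. sgn (arr2 (q + 2 + 1) [v]) = e ^ (length ps - 1) * sga v" "fresh (q + 2 + 1) arr2"
 have q3: "q + 2 + 1 = q + 3" by simp
 show "prb (vrun D n ((GS RA, q + 3, q + 3 + 1, Mb n) # (GS RB, q + 3, q + 3 + 1, Mb n) # (GS RC, q + 3, q + 3 + 1, Mb n) # []) arr2) {x. ~ ?G x} <= 3 / real n + 0"
 by (rule G3[OF 2(1)[unfolded q3] epow[OF e] 2(2)[unfolded q3]])
 qed simp
 define nz1 where "nz1 = c * (C4 / nb * nb / (m * d\<^sup>2) + 1 / na)"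
 have d2: "d\<^sup>2 > 0" using d_pos by simp
 have C4p: "C4 > 0" using const_nonneg(6) by linarith
 have nz10: "0 < nz1" unfolding nz1_def using d2 nab c_ge pos C4p by (intro mult_pos_pos add_pos_pos) auto
 have nz1_le: "nz1 <= c * (C4 / d\<^sup>2 + 1) / nb"
 proof -
 have "C4 / nb * nb / (m * d\<^sup>2) = C4 / d\<^sup>2 * (1 / m)" using nab by simp
 also have "... <= C4 / d\<^sup>2 * (1 / nb)" using C4p d2 m_ge nab by (intro mult_left_mono frac_le) auto
 finally have "C4 / nb * nb / (m * d\<^sup>2) + 1 / na <= C4 / d\<^sup>2 * (1 / nb) + 1 / nb"
 using nab by (intro add_mono) (auto intro: frac_le)
 then have "c * (C4 / nb * nb / (m * d\<^sup>2) + 1 / na) <= c * (C4 / d\<^sup>2 * (1 / nb) + 1 / nb)" using c_ge by (intro mult_left_mono) auto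
 then show ?thesis by (simp add: nz1_def add_divide_distrib distrib_left)
 qed
 have tB: "real (tsup (BT n) u) <= nb" for u
 using N2_le card_mono[of "BT n" "{w \<in> BT n. u w ~= 0}"] by (auto simp: tsup_def N2_def BT_def)
 define I1 where "I1 arr' \<longleftrightarrow> good sga (AT n) (arr' (q + 1)) (3200 * nz1) & fresh (q + 1) arr'" for arr'
 have f1: "prb (replicate_pmf (M n) D) {cs. ~ I1 (vphase n T1 q (q + 1) cs arr)} <= 1000 * (1 + Lam) * nz1"
 proof -
 have "prb (replicate_pmf (M n) D) {cs. ~ I1 (vphase n T1 q (q + 1) cs arr)}
 <= prb (replicate_pmf (M n) D) {cs. ~ (good sga (AT n) (vsum (vx n T1 (arr q)) cs) (3200 * nz1) &
 real (tsup (AT n) (vsum (vx n T1 (arr q)) cs)) <= 2 * N1 * (real (M n) * real (tsup (BT n) (arr q)) / P))}"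
 by (rule fail_mono_len) (use I(2) in \<open>auto simp: I1_def vphase_fresh intro: fresh_upd\<close>)
 also have "... <= 1000 * (1 + real (M n) * real (tsup (BT n) (arr q)) / P) * nz1"
 by (rule step1[OF I(1) _ pos(5)]) (use C4p nab in \<open>auto simp: nz1_def m_def\<close>)
 also have "... <= 1000 * (1 + Lam) * nz1"
 proof -
 have "real (M n) * real (tsup (BT n) (arr q)) / P <= m * nb / P"
 using tB pos by (intro divide_right_mono) (auto simp: m_def mult_left_mono)
 then show ?thesis using m_lam nz10 by (intro mult_right_mono) auto
 qed
 finally show ?thesis .
 qed
 have f2: "prb (vrun D n ((T2, q + 1, q + 2, Mb n) # phs) arr1) {x. ~ ?G x} <= 1 / real n + (3 / real n + (3 / real n + 0))"
 if "I1 arr1" and phs: "phs = (FS RA, q + 2, q + 2 + 1, Mb n) # (FS RB, q + 2, q + 2 + 1, Mb n) # (FS RC, q + 2, q + 2 + 1, Mb n) #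
 (GS RA, q + 3, q + 3 + 1, Mb n) # (GS RB, q + 3, q + 3 + 1, Mb n) # (GS RC, q + 3, q + 3 + 1, Mb n) # []" for arr1 phs
 proof (rule vrun_fail_Cons)
 let ?e = "sgn (tcor sga (AT n) (arr1 (q + 1)))"
 let ?I = "%arr'. (\<forall>w\<in>BT n. sgn (arr' (q + 2) w) = ?e * aprod sga w) & fresh (q + 2) arr'"
 have fr: "fresh (q + 1) arr1" and g1: "good sga (AT n) (arr1 (q + 1)) (3200 * nz1)"
 using that by (auto simp: I1_def)
 have e: "?e \<in> {-1, 1}" using g1 by (auto simp: good_def sgn_if)
 \<comment> \<open>\<open>K2_large\<close> yields an exponent of \<open>(r + 1) * lg n\<close>; a
   union bound over at most \<open>n ^ r\<close> tuples then leaves failure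
   \<open>1 / n\<close>.\<close>
 have "real (r + 1) * l <= real (Mb n) * d\<^sup>2 / (2 * (3200 * nz1 * P))"
 proof -
 have "3200 * nz1 * P = 3200 * c * (C4 / d\<^sup>2 * (P / m) + P / na)" using nab by (simp add: nz1_def field_simps)
 also have "... <= 3200 * c * (C4 / d\<^sup>2 * m + m)"
 proof -
 have "P <= m * m" using P_le m_ge(3) by (simp add: power2_eq_square)
 then have "P / m <= m" using pos by (simp add: field_simps)
 moreover have "P / na <= nb" using P_le by (simp only: pos_divide_le_eq[OF nab(5)] nab(2))
 then have "P / na <= m" using m_ge(1) by linarith
 ultimately show ?thesis using c_ge C4p d2 by (intro mult_left_mono add_mono) auto
 qed
 also have "... = C5 * m" by (simp add: C5_def algebra_simps)
 finally have le: "3200 * nz1 * P <= C5 * m" .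
 have K2'': "2 * C5 * (real r + 1) / d\<^sup>2 <= real K2" using K2 by (simp add: K2_large_def)
 have "real (r + 1) * l <= real K2 * d\<^sup>2 / (2 * C5) * l"
 using K2'' const_nonneg(7) d2 pos by (intro mult_right_mono) (auto simp: field_simps)
 also have "... = real (Mb n) * d\<^sup>2 / (2 * (C5 * m))" using pos by (simp add: Mb_eq)
 also have "... <= real (Mb n) * d\<^sup>2 / (2 * (3200 * nz1 * P))"
 proof (rule divide_left_mono)
 show "2 * (3200 * nz1 * P) <= 2 * (C5 * m)" using le by linarith
 show "0 < 2 * (C5 * m) * (2 * (3200 * nz1 * P))" using const_nonneg(7) pos nz10 by (intro mult_pos_pos) auto
 qed simp
 finally show ?thesis .
 qed
 then have ex: "exp (- (real (Mb n) * d\<^sup>2 / (2 * (3200 * nz1 * P)))) <= 1 / real n ^ (r + 1)" by (rule exp_le_inverse)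
 note te = two_exact[of "drop a ps" "take a ps" RB RA "Mb n" "arr1 (q + 1)" "3200 * nz1" P "1 / real n ^ (r + 1)",
 unfolded lengths, folded T2_def AT_def BT_def, unfolded vbias_specs]
 have "prb (replicate_pmf (Mb n) D) {cs. ~ ?I (vphase n T2 (q + 1) (q + 2) cs arr1)}
 <= prb (replicate_pmf (Mb n) D) {cs. ~ (\<forall>w\<in>BT n. sgn (vsum (vx n T2 (arr1 (q + 1))) cs w) = ?e * aprod sga w)}"
 by (rule fail_mono_len) (use vphase_fresh[OF fr, of T2, unfolded add.assoc one_add_one]
 fresh_upd[OF fr, unfolded add.assoc one_add_one] in simp)
 also have "... <= real (card (BT n)) * (1 / real n ^ (r + 1))"
 by (rule te) (use wf rng_T pos g1 ex in \<open>auto simp: P_def ab add.commute[of b]\<close>)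
 also have "... <= real n ^ r * (1 / real n ^ (r + 1))"
 proof -
 have "real n ^ b <= real n ^ r" using ab(1) n_ge(1) by (intro power_increasing) auto
 then have "real (card (BT n)) <= real n ^ r" using N2_le unfolding N2_def nb_def by linarith
 then show ?thesis by (rule mult_right_mono) simp
 qed
 also have "... = 1 / real n" using n_ge(1) by (simp add: power_add)
 finally show "prb (replicate_pmf (Mb n) D) {cs. ~ ?I (vphase n T2 (q + 1) (q + 2) cs arr1)} <= 1 / real n" .
 show "prb (vrun D n phs arr') {x. ~ ?G x} <= 3 / real n + (3 / real n + 0)" if "?I arr'" for arr'
 unfolding phs by (rule G2) (use that e in auto)
 qed simp
 have "prb (vrun D n (final_phases n q) arr) {x. ~ ?G x} <= 1000 * (1 + Lam) * nz1 + (1 / real n + (3 / real n + (3 / real n + 0)))"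
 unfolding final_phases_def
 by (rule vrun_fail_Cons[OF f1]) (use f2 in \<open>auto simp: numeral_eq_Suc One_nat_def\<close>)
 also have "... <= 1000 * (1 + Lam) * (c * (C4 / d\<^sup>2 + 1) / nb) + 7 / real n"
 using nz1_le const_nonneg by (intro add_mono mult_left_mono) auto
 finally show ?thesis by (simp add: mult.assoc)
qed

theorem sampler_success:
 "prb (vrun D n (phases n) arr0) {x. ~ planted_found (x (outp n))} <= errb n"
proof -
 let ?G = "%x :: arrays. planted_found (x (outp n))"
 define x where "x = 3200 * (C3 * Z n)"
 have x: "0 <= x" "x <= 1" using n_ge(6) const_nonneg by (auto simp: x_def)
 have c0: "0 <= C0 / nb" using const_nonneg nab by simp
 define e2 where "e2 = 1000 * (1 + Lam) * c * (C4 / d\<^sup>2 + 1) / nb + 7 / real n"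
 have e2: "0 <= e2" unfolding e2_def using const_nonneg c_ge nab
 by (intro add_nonneg_nonneg divide_nonneg_nonneg mult_nonneg_nonneg) auto
 have o: "outp n = 2 + 2 * R n + 4" using r2 by (simp add: outp_def)
 \<comment> \<open>After \<open>R n\<close> halvings the initial excess, at most one, has fallen
   below \<open>1 / nb\<close>, the order of the floor.\<close>
 have pw: "nb <= 2 ^ R n"
 proof -
 have "nb <= real n ^ r" unfolding nb_def using ab(1) n_ge(1) by (intro power_increasing) auto
 also have "... <= (2 ^ lg n) ^ r"
 proof -
 have "real n <= real (2 ^ lg n)" using lg_ge(2)[of n] by (simp only: of_nat_le_iff)
 then show ?thesis by (intro power_mono) auto
 qed
 finally show ?thesis by (simp add: R_def power_mult[symmetric] mult.commute)
 qed
 have fin: "prb (vrun D n (final_phases n (2 + 2 * R n)) arr') {x. ~ ?G x} <= e2"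
 if "good sga (BT n) (arr' (2 + 2 * R n)) (x / 2 ^ R n + 2 * C0 / nb)" "fresh (2 + 2 * R n) arr'" for arr'
 proof -
 have "x / 2 ^ R n <= 1 / nb" using x pw nab by (intro frac_le) auto
 then have "x / 2 ^ R n + 2 * C0 / nb <= C4 / nb" by (simp add: C4_def add_divide_distrib)
 then show ?thesis unfolding o e2_def using final_fail[OF good_mono[OF that(1)] that(2)] by blast
 qed
 have rd: "prb (vrun D n (rounds n 2 (R n) @ final_phases n (2 + 2 * R n)) arr') {x. ~ ?G x}
 <= C1 * (2 * x + real (R n) * (2 * C0 + 1) / nb) + e2"
 if g: "good sga (BT n) (arr' 2) (3200 * (C3 * Z n))" and f: "fresh 2 arr'" for arr'
 by (rule many_rounds[OF good_mono[OF g] f x(1) fin e2]) (use c0 in \<open>auto simp: x_def\<close>)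
 have "0 <= C1 * (2 * x + real (R n) * (2 * C0 + 1) / nb) + e2"
 using const_nonneg e2 x nab by (intro add_nonneg_nonneg mult_nonneg_nonneg divide_nonneg_nonneg) auto
 from first_round[OF rd this]
 have "prb (vrun D n (phases n) arr0) {x. ~ ?G x}
 <= 2000 * (C2 + C3) * Z n + (C1 * (2 * x + real (R n) * (2 * C0 + 1) / nb) + e2)"
 using r2 by (simp add: phases_def)
 also have "... = errb n" by (simp add: errb_def e2_def x_def nb_def)
 finally show ?thesis .
qed

end

section \<open>From votes to assignments\<close>

lemma fexp_map: "finite (set_pmf p) ==> fexp (map_pmf g p) f = fexp p (%x. f (g x))"
 by (simp add: fexp_eq_expectation)

lemma fexp_pair:
 assumes "finite (set_pmf p)" "finite (set_pmf q)"
 shows "fexp (pair_pmf p q) f = fexp p (%x. fexp q (%y. f (x, y)))"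
proof -
 have "fexp (pair_pmf p q) f = (\<Sum>(x, y)\<in>set_pmf p \<times> set_pmf q. pmf p x * (pmf q y * f (x, y)))"
 unfolding fexp_def set_pair_pmf by (rule sum.cong) (auto simp: pmf_pair)
 also have "... = (\<Sum>x\<in>set_pmf p. \<Sum>y\<in>set_pmf q. pmf p x * (pmf q y * f (x, y)))"
 by (rule sum.cartesian_product[symmetric])
 finally show ?thesis by (simp add: fexp_def sum_distrib_left)
qed

text \<open>Variances of independent centred terms add. Finiteness and mean zero are part of the
  claim because the induction step for the second moment uses both.\<close>

lemma Pi_pmf_centered_sum:
 assumes "finite A" and fin: "!!i. i \<in> A ==> finite (set_pmf (p i))"
 and mean: "!!i. i \<in> A ==> fexp (p i) (g i) = 0" and var: "!!i. i \<in> A ==> fexp (p i) (%y. (g i y)\<^sup>2) <= 1"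
 shows "finite (set_pmf (Pi_pmf A dflt p)) & fexp (Pi_pmf A dflt p) (%f. \<Sum>i\<in>A. g i (f i)) = 0
 & fexp (Pi_pmf A dflt p) (%f. (\<Sum>i\<in>A. g i (f i))\<^sup>2) <= real (card A)"
 using assms
proof (induction A rule: finite_induct)
 case empty
 then show ?case by (simp add: fexp_def)
next
 case (insert x A)
 define q where "q = Pi_pmf A dflt p"
 define S where "S f = (\<Sum>i\<in>A. g i (f i))" for f
 have IH: "finite (set_pmf q)" "fexp q S = 0" "fexp q (%f. (S f)\<^sup>2) <= real (card A)"
 using insert.IH insert.prems by (auto simp: q_def S_def[abs_def])
 have fx: "finite (set_pmf (p x))" using insert.prems by simp
 have P: "Pi_pmf (insert x A) dflt p = map_pmf (%(y, f). f(x := y)) (pair_pmf (p x) q)"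
 unfolding q_def by (rule Pi_pmf_insert) (use insert in auto)
 have fp: "finite (set_pmf (pair_pmf (p x) q))" using fx IH by simp
 have sm: "(\<Sum>i\<in>insert x A. g i ((f(x := y)) i)) = g x y + S f" for f y
 proof -
 have "(\<Sum>i\<in>A. g i ((f(x := y)) i)) = S f" unfolding S_def using insert.hyps by (intro sum.cong) auto
 then show ?thesis using insert.hyps by simp
 qed
 have E: "fexp (Pi_pmf (insert x A) dflt p) (%f. G (\<Sum>i\<in>insert x A. g i (f i))) = fexp (p x) (%y. fexp q (%f. G (g x y + S f)))" for G
 unfolding P by (simp only: fexp_map[OF fp] case_prod_beta fexp_pair[OF fx IH(1)] fst_conv snd_conv sm)
 have "finite (set_pmf (Pi_pmf (insert x A) dflt p))" unfolding P using fp by simp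
 moreover have "fexp (Pi_pmf (insert x A) dflt p) (%f. \<Sum>i\<in>insert x A. g i (f i)) = 0"
 using E[of "%z. z"] insert.prems(2)[of x] by (simp add: fexp_add fexp_const[OF IH(1)] IH(2))
 moreover have "fexp (Pi_pmf (insert x A) dflt p) (%f. (\<Sum>i\<in>insert x A. g i (f i))\<^sup>2) <= real (card (insert x A))"
 proof -
 have e: "(%f. (g x y + S f)\<^sup>2) = (%f. (g x y)\<^sup>2 + (2 * g x y * S f + (S f)\<^sup>2))" for y
 by (auto simp: power2_eq_square algebra_simps)
 have "fexp (Pi_pmf (insert x A) dflt p) (%f. (\<Sum>i\<in>insert x A. g i (f i))\<^sup>2)
 = fexp (p x) (%y. (g x y)\<^sup>2 + fexp q (%f. (S f)\<^sup>2))"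
 using E[of "%z. z\<^sup>2"] unfolding e by (simp add: fexp_add fexp_cmult fexp_const[OF IH(1)] IH(2))
 also have "... <= 1 + real (card A)"
 using insert.prems(3)[of x] IH(3) by (simp add: fexp_add fexp_const[OF fx])
 finally show ?thesis using insert.hyps by simp
 qed
 ultimately show ?case by simp
qed

text \<open>Twice the number of agreements minus \<open>n\<close> is the correlation with
  \<open>sga\<close>. The uniform values of undecided variables leave its mean unchanged and give it
  variance at most \<open>n\<close>, so Chebyshev applies.\<close>

lemma complete_answer_tail:
 assumes sga: "sga \<in> assignments n" and o: "!!v. v \<in> {1..n} ==> out v \<in> {-1, 0, 1}"
 and big: "2 * t * sqrt (real n) < ri (\<Sum>v\<in>{1..n}. sga v * out v)"
 shows "prb (complete_answer n out)
 {tau. ~ (tau \<in> assignments n & real n / 2 + t * sqrt (real n) <= real (card {i \<in> {1..n}. tau i = sga i}))}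
 <= real n / (ri (\<Sum>v\<in>{1..n}. sga v * out v) - 2 * t * sqrt (real n))\<^sup>2"
proof -
 define p where "p i = (if out i = 0 then pmf_of_set {-1, 1} else return_pmf (out i))" for i
 define g where "g i y = ri (sga i * y) - ri (sga i * out i)" for i y
 define A where "A = ri (\<Sum>v\<in>{1..n}. sga v * out v)"
 have u: "set_pmf (pmf_of_set {-1, 1::int}) = {-1, 1}" by (rule set_pmf_of_set) auto
 have sg: "sga i \<in> {-1, 1}" if "i \<in> {1..n}" for i using assignmentsD[OF sga that] .
 have pm: "pmf (pmf_of_set {-1, 1::int}) y = 1 / 2" if "y \<in> {-1, 1}" for y
 using that by (subst pmf_of_set) auto
 have ex: "fexp (pmf_of_set {-1, 1::int}) f = (f (-1) + f 1) / 2" for f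
 unfolding fexp_def u by (simp add: pm)
 have er: "fexp (return_pmf z) f = f z" for z :: int and f by (simp add: fexp_def)
 have c: "finite (set_pmf (Pi_pmf {1..n} undefined p)) & fexp (Pi_pmf {1..n} undefined p) (%f. \<Sum>i\<in>{1..n}. g i (f i)) = 0
 & fexp (Pi_pmf {1..n} undefined p) (%f. (\<Sum>i\<in>{1..n}. g i (f i))\<^sup>2) <= real (card {1..n})"
 proof (rule Pi_pmf_centered_sum)
 fix i assume i: "i \<in> {1..n}"
 show "finite (set_pmf (p i))" by (simp add: p_def u)
 show "fexp (p i) (g i) = 0" by (auto simp: p_def g_def ex er)
 show "fexp (p i) (%y. (g i y)\<^sup>2) <= 1" using sg[OF i] by (auto simp: p_def g_def ex er)
 qed simp
 define S where "S f = (\<Sum>i\<in>{1..n}. g i (f i))" for f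
 note fin = c[THEN conjunct1]
 have var: "fvar (Pi_pmf {1..n} undefined p) S <= real n"
 using c by (simp add: fvar_def S_def[abs_def])
 have sup: "f \<in> assignments n" if "f \<in> set_pmf (Pi_pmf {1..n} undefined p)" for f
 proof -
 have "f \<in> PiE_dflt {1..n} undefined (set_pmf \<circ> p)" using that by (simp add: set_Pi_pmf)
 then have f: "!!i. i \<in> {1..n} ==> f i \<in> set_pmf (p i)" "!!i. i \<notin> {1..n} ==> f i = undefined"
 by (auto simp: PiE_dflt_def)
 have "f i \<in> {-1, 1}" if "i \<in> {1..n}" for i using f(1)[OF that] o[OF that] u by (auto simp: p_def split: if_splits)
 then show ?thesis using f(2) by (auto simp: assignments_def PiE_def extensional_def)
 qed
 have agree: "S f = 2 * real (card {i \<in> {1..n}. f i = sga i}) - real n - A" if "f \<in> assignments n" for f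
 proof -
 have "ri (sga i * f i) = 2 * (if f i = sga i then 1 else 0) - 1" if i: "i \<in> {1..n}" for i
 using sg[OF i] assignmentsD[OF \<open>f \<in> assignments n\<close> i] by auto
 then have "(\<Sum>i\<in>{1..n}. ri (sga i * f i)) = (\<Sum>i\<in>{1..n}. 2 * (if f i = sga i then 1 else 0) - 1)"
 by (intro sum.cong) auto
 also have "... = 2 * (\<Sum>i\<in>{1..n}. if f i = sga i then 1 else 0) - real n"
 by (simp add: sum_subtractf sum_distrib_left)
 also have "(\<Sum>i\<in>{1..n}. if f i = sga i then 1 else 0) = real (card {i \<in> {1..n}. f i = sga i})"
 by (simp add: sum.If_cases Int_def)
 finally show ?thesis unfolding S_def g_def A_def by (simp add: sum_subtractf)
 qed
 have "prb (Pi_pmf {1..n} undefined p)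
 {tau. ~ (tau \<in> assignments n & real n / 2 + t * sqrt (real n) <= real (card {i \<in> {1..n}. tau i = sga i}))}
 <= fvar (Pi_pmf {1..n} undefined p) S / (A - 2 * t * sqrt (real n))\<^sup>2"
 proof (rule fexp_chebyshev[OF fin])
 show "0 < A - 2 * t * sqrt (real n)" using big by (simp add: A_def)
 fix f assume f: "f \<in> set_pmf (Pi_pmf {1..n} undefined p)"
 and bad: "~ (f \<in> assignments n & real n / 2 + t * sqrt (real n) <= real (card {i \<in> {1..n}. f i = sga i}))"
 have E0: "fexp (Pi_pmf {1..n} undefined p) S = 0" using c by (simp add: S_def[abs_def])
 have "S f < 2 * t * sqrt (real n) - A" using bad sup[OF f] agree[OF sup[OF f]] by auto
 then show "A - 2 * t * sqrt (real n) <= \<bar>S f - fexp (Pi_pmf {1..n} undefined p) S\<bar>" unfolding E0 by linarith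
 qed
 also have "... <= real n / (A - 2 * t * sqrt (real n))\<^sup>2" by (rule divide_right_mono[OF var]) simp
 finally show ?thesis unfolding complete_answer_def p_def A_def .
qed

section \<open>Success probability of the sampler for all \<open>r\<close>\<close>

context sampler
begin

definition votes_answer :: "nat => arrays => assignment pmf" where
 "votes_answer n arr = complete_answer n (%v. sgn (arr (outp n) [v]))"

lemma M_sq_le: "1 <= n ==> (real (M n))\<^sup>2 <= 4 * (real K1)\<^sup>2 * real n ^ r"
proof -
 assume n: "1 <= n"
 define w where "w = (if odd r then sq n else 1)"
 have w: "w * w <= 4 * n ^ (r - 2 * b)"
 using sq_le[of n] n by (auto simp: w_def b_def odd_two_times_div_two_nat elim!: oddE)
 have rb: "2 * b + (r - 2 * b) = r" by (simp add: b_def)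
 have m2: "(real (M n))\<^sup>2 = (real K1)\<^sup>2 * (real n ^ (2 * b) * real (w * w))"
 proof -
 have "real n ^ (2 * b) = real n ^ b * real n ^ b" unfolding mult_2 by (rule power_add)
 then show ?thesis by (simp only: M_def w_def[symmetric] of_nat_mult of_nat_power power2_eq_square mult_ac)
 qed
 have nr: "real n ^ r = real n ^ (2 * b) * real (n ^ (r - 2 * b))"
 unfolding of_nat_power power_add[symmetric] rb ..
 have "real (w * w) <= real (4 * n ^ (r - 2 * b))" using w by (simp only: of_nat_le_iff)
 then have "real (w * w) <= 4 * real (n ^ (r - 2 * b))" by simp
 then have "(real (M n))\<^sup>2 <= (real K1)\<^sup>2 * (real n ^ (2 * b) * (4 * real (n ^ (r - 2 * b))))"
 unfolding m2 by (intro mult_left_mono) auto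
 then show ?thesis unfolding nr by (simp add: algebra_simps)
qed

lemma M_le: "1 <= n ==> real (M n) <= 2 * real K1 * real n powr (real r / 2)"
proof -
 assume n: "1 <= n"
 have "real n ^ r = (real n powr (real r / 2))\<^sup>2"
 using n by (simp add: powr_realpow[symmetric] powr_powr[symmetric] power2_eq_square powr_add[symmetric])
 then have "(real (M n))\<^sup>2 <= (2 * real K1 * real n powr (real r / 2))\<^sup>2"
 using M_sq_le[OF n] by (simp add: power_mult_distrib)
 then show ?thesis by (rule power2_le_imp_le) simp
qed

lemma Mb_le: "2 <= n ==> real (Mb n) <= 6 * real K1 * real K2 * (real n powr (real r / 2) * ln (real n))"
proof -
 assume n: "2 <= n"
 have "real (Mb n) = real K2 * (real (M n) * real (lg n))" by (simp add: Mb_def)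
 also have "... <= real K2 * ((2 * real K1 * real n powr (real r / 2)) * (3 * ln (real n)))"
 using M_le[of n] lg_bounds(2)[OF n] n by (intro mult_left_mono mult_mono) auto
 finally show ?thesis by (simp add: mult_ac)
qed

lemma Z_tendsto: "2 <= r ==> Z \<longlonglongrightarrow> 0"
proof -
 assume r2: "2 <= r"
 have "\<forall>\<^sub>F n in sequentially. norm (Z n) <= 1 / ln (real n) + 1 / real n"
 using eventually_ge_at_top[of 2]
 proof eventually_elim
 case (elim n)
 have "real n ^ 1 <= real n ^ b" using elim ab(4)[OF r2] by (intro power_increasing) auto
 then have "1 / real n ^ b <= 1 / real n" using elim by (intro frac_le) auto
 moreover have "1 / real (lg n) <= 1 / ln (real n)" using lg_bounds(1)[OF elim] elim by (intro frac_le) auto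
 ultimately show ?case by (simp add: Z_def)
 qed
 moreover have "(%n. 1 / ln (real n) + 1 / real n) \<longlonglongrightarrow> 0" by real_asymp
 ultimately show ?thesis by (rule Lim_null_comparison)
qed

lemma errb_tendsto: "2 <= r ==> errb \<longlonglongrightarrow> 0"
proof -
 assume r2: "2 <= r"
 note Z = Z_tendsto[OF r2]
 have pw: "1 / real n ^ b <= 1 / real n" if "2 <= n" for n
 proof -
 have "real n ^ 1 <= real n ^ b" using that ab(4)[OF r2] by (intro power_increasing) auto
 then show ?thesis using that by (intro frac_le) auto
 qed
 have i: "(%n. 1 / real n ^ b) \<longlonglongrightarrow> 0"
 proof (rule Lim_null_comparison)
 show "\<forall>\<^sub>F n in sequentially. norm (1 / real n ^ b) <= 1 / real n"
 using eventually_ge_at_top[of 2] by eventually_elim (use pw in simp)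
 show "(%n. 1 / real n) \<longlonglongrightarrow> 0" by real_asymp
 qed
 have R: "(%n. real (R n) * (1 / real n ^ b)) \<longlonglongrightarrow> 0"
 proof (rule Lim_null_comparison)
 show "\<forall>\<^sub>F n in sequentially. norm (real (R n) * (1 / real n ^ b)) <= 3 * real r * ln (real n) * (1 / real n)"
 using eventually_ge_at_top[of 2]
 proof eventually_elim
 case (elim n)
 have "real (R n) <= 3 * real r * ln (real n)"
 unfolding R_def of_nat_mult using mult_left_mono[OF lg_bounds(2)[OF elim], of "real r"] by simp
 then have "real (R n) * (1 / real n ^ b) <= 3 * real r * ln (real n) * (1 / real n)"
 using pw[OF elim] elim by (intro mult_mono) auto
 then show ?case by simp
 qed
 show "(%n. 3 * real r * ln (real n) * (1 / real n)) \<longlonglongrightarrow> 0" by real_asymp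
 qed
 have "(%n. 2000 * (C2 + C3) * Z n + C1 * (6400 * C3 * Z n + (2 * C0 + 1) * (real (R n) * (1 / real n ^ b)))
 + 1000 * (1 + Lam) * c * (C4 / d\<^sup>2 + 1) * (1 / real n ^ b) + 7 * (1 / real n))
 \<longlonglongrightarrow> 2000 * (C2 + C3) * 0 + C1 * (6400 * C3 * 0 + (2 * C0 + 1) * 0) + 1000 * (1 + Lam) * c * (C4 / d\<^sup>2 + 1) * 0 + 7 * 0"
 by (intro tendsto_intros Z i R)
 then show ?thesis unfolding errb_def[abs_def] by (simp add: mult_ac)
qed

lemma eventually_large: "2 <= r ==> eventually large sequentially"
proof -
 assume r2: "2 <= r"
 have b1: "1 <= b" using ab(4)[OF r2] .
 define u where "u = c * (6 * real K1 * real K2)"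
 have "(%n. u * (ln (real n) / real n)) \<longlonglongrightarrow> 0" by real_asymp
 then have 1: "\<forall>\<^sub>F n in sequentially. u * (ln (real n) / real n) < 1" by (rule order_tendstoD) simp
 define v where "v = 2 * c\<^sup>2 * (4 * (real K1)\<^sup>2) * real K2 * 3"
 have "(%n. v * (ln (real n) / real n)) \<longlonglongrightarrow> 0" by real_asymp
 then have 2: "\<forall>\<^sub>F n in sequentially. v * (ln (real n) / real n) < 1" by (rule order_tendstoD) simp
 have "(%n. 3200 * C3 * Z n) \<longlonglongrightarrow> 3200 * C3 * 0" by (intro tendsto_intros Z_tendsto[OF r2])
 then have 3: "\<forall>\<^sub>F n in sequentially. 3200 * C3 * Z n < 1" by (rule order_tendstoD) simp
 show ?thesis
 using 1 2 3 eventually_ge_at_top[of "max (max 3 k) (24 * (r + length ps' + 2))"]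
 proof eventually_elim
 case (elim n)
 have n: "2 <= n" "real n > 0" using elim(4) by auto
 have x1: "c * real (Mb n) <= real n ^ r"
 proof -
 have "real n powr (real r / 2) <= real n powr (real r - 1)" using r2 n by (intro powr_mono) auto
 also have "... = real n ^ r / real n" using n by (simp add: powr_diff powr_realpow)
 finally have p: "real n powr (real r / 2) <= real n ^ r / real n" .
 have "c * real (Mb n) <= c * (6 * real K1 * real K2 * (real n powr (real r / 2) * ln (real n)))"
 using Mb_le[OF n(1)] c_ge by (intro mult_left_mono) auto
 also have "... <= c * (6 * real K1 * real K2 * (real n ^ r / real n * ln (real n)))"
 using p c_ge n by (intro mult_left_mono mult_right_mono) auto
 also have "... = real n ^ r * (u * (ln (real n) / real n))" by (simp add: u_def)
 also have "... <= real n ^ r * 1" using elim(1) by (intro mult_left_mono) auto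
 finally show ?thesis by simp
 qed
 have x2: "2 * c\<^sup>2 * real n ^ a * real (M n) * real (Mb n) <= real n ^ (2 * r)"
 proof -
 have "2 * c\<^sup>2 * real n ^ a * real (M n) * real (Mb n) = 2 * c\<^sup>2 * real n ^ a * (real K2 * ((real (M n))\<^sup>2 * real (lg n)))"
 by (simp add: Mb_def power2_eq_square)
 also have "... <= 2 * c\<^sup>2 * real n ^ a * (real K2 * ((4 * (real K1)\<^sup>2 * real n ^ r) * (3 * ln (real n))))"
 using M_sq_le[of n] lg_bounds(2)[OF n(1)] n by (intro mult_left_mono mult_mono) auto
 also have "... = real n ^ (a + r) * (v * ln (real n))" by (simp add: v_def power_add)
 also have "... <= real n ^ (a + r) * real n"
 using elim(2) n by (intro mult_left_mono) (auto simp: divide_less_eq)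
 also have "... = real n ^ (a + r + 1)" by (simp add: power_add)
 also have "... <= real n ^ (2 * r)" using ab(1) b1 n by (intro power_increasing) auto
 finally show ?thesis .
 qed
 show ?case unfolding large_def using elim x1 x2 by auto
 qed
qed

lemma votes_solve_ge2:
 assumes r2: "2 <= r" and n: "large n" and Kl: K1_large K2_large and sga: "sga \<in> assignments n"
 shows "prb (bind_pmf (vrun (planted k Q n sga) n (phases n) arr0) (votes_answer n))
 {tau. ~ planted_solution k Q r t n sga tau} <= errb n + 0"
proof (rule prob_bind_le)
 interpret sampler_at k Q r ps ps' K1 K2 n sga
 by unfold_locales (use n r2 Kl sga Q in \<open>auto simp: large_def\<close>)
 show "prb (vrun (planted k Q n sga) n (phases n) arr0) {x. ~ planted_found (x (outp n))} <= errb n"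
 by (rule sampler_success)
 fix arr :: arrays assume "planted_found (arr (outp n))"
 then obtain e where e: "e \<in> {-1, 1}" "!!v. v \<in> {1..n} ==> sgn (arr (outp n) [v]) = e * sga v" "odd (length ps') ==> e = 1"
 unfolding planted_found_def by blast
 define tau where "tau = (%i. if i \<in> {1..n} then e * sga i else undefined)"
 have "votes_answer n arr = Pi_pmf {1..n} undefined (%i. return_pmf (e * sga i))"
 unfolding votes_answer_def complete_answer_def
 proof (rule Pi_pmf_cong)
 fix i assume i: "i \<in> {1..n}"
 show "(if sgn (arr (outp n) [i]) = 0 then pmf_of_set {- 1, 1} else return_pmf (sgn (arr (outp n) [i]))) = return_pmf (e * sga i)"
 unfolding e(2)[OF i] using assignmentsD[OF sga i] e(1) by auto
 qed auto
 then have va: "votes_answer n arr = return_pmf tau" by (simp add: Pi_pmf_return_pmf tau_def)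
 have "planted_solution k Q r t n sga tau"
 proof (cases "e = 1")
 case True
 have "tau = sga" using True sga by (auto simp: tau_def assignments_def PiE_def extensional_def)
 then show ?thesis using sga r2 by (simp add: planted_solution_def)
 next
 case False
 \<comment> \<open>A wrong sign survives only if \<open>ps'\<close> has even length; then all odd
   coefficients vanish and the negated assignment counts as a solution.\<close>
 then have e1: "e = -1" "even (length ps')" using e by auto
 have "tau = restrict (%i. - sga i) {1..n}" using e1 by (auto simp: tau_def)
 then show ?thesis using planted_uminus[OF Q kn sga even_case[OF e1(2)]] r2 by (simp add: planted_solution_def)
 qed
 then show "prb (votes_answer n arr) {tau. ~ planted_solution k Q r t n sga tau} <= 0" by (simp add: va)
qed simp

definition "err1 t n = 6400 / (real (Mb n) * d\<^sup>2) + real n / (real (Mb n) * d / 160 - 2 * t * sqrt (real n))\<^sup>2" for t :: real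

text \<open>The source is the empty tuple with stored sign +1, so one phase of about
  \<open>sqrt n * ln n\<close> clauses yields a correlation of that order, which outgrows
  \<open>t * sqrt n\<close>. In 160 = 2 * 4 * 20, the 2 is for half of the mean correlation, the 4
  for \<open>N >= n / 4\<close> and the 20 for \<open>gain >= lam * d / 20\<close>.\<close>

lemma votes_solve_1:
 assumes r1: "r = 1" and n: "24 <= n" "k <= n" and Mb1: "real (Mb n) <= real n"
 and big: "2 * t * sqrt (real n) < real (Mb n) * d / 160" and sga: "sga \<in> assignments n"
 shows "prb (bind_pmf (vrun (planted k Q n sga) n (phases n) arr0) (votes_answer n))
 {tau. ~ planted_solution k Q r t n sga tau} <= err1 t n"
proof -
 interpret planted_clauses k Q n sga by unfold_locales (use n sga Q in auto)
 have ab1: "a = 1" "b = 0" unfolding a_def b_def using r1 by auto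
 have Mb0: "Mb n > 0" using K n sq_ge(1)[of n] lg_ge(1)[of n] by (simp add: Mb_def M_def)
 have wf: "wf_spec k Q n T1" using n by (intro wf_T1) simp
 define J where "J = tkeys n T1"
 have J: "J = (%v. [v]) ` rng n RA"
 proof -
 have "tuples 1 V = (%v. [v]) ` V" for V
 by (auto simp: tuples_def One_nat_def length_Suc_conv)
 then show ?thesis using lengths by (simp add: J_def tkeys_def T1_def two_spec_def ab1)
 qed
 have cJ: "card J = n div 3"
 unfolding J by (subst card_image) (auto simp: rng_simps inj_on_def)
 have src: "ssup n T1 (arr0 0) K = 1" "scor n T1 sga (arr0 0) K = 1" if "K \<in> tkeys n T1" for K
 proof -
 have t0: "tuples (length (drop a ps)) (rng n RB) = {[]}" using lengths by (simp add: ab1)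
 have u0: "arr0 0 [] = 1" by (simp add: arr0_def ab1)
 have dj: "rng n RA \<inter> rng n RB = {}" by (rule rng_T)
 have "{w. w = [] & arr0 0 w ~= 0} = {[]}" using u0 by auto
 then show "ssup n T1 (arr0 0) K = 1"
 using two_spec_src(2)[OF that[unfolded T1_def] dj, of "arr0 0"] u0
 unfolding T1_def t0 by (simp add: tsup_def)
 show "scor n T1 sga (arr0 0) K = 1"
 using two_spec_src(3)[OF that[unfolded T1_def] dj, of sga "arr0 0"] u0
 unfolding T1_def t0 by (simp add: tcor_def aprod_def)
 qed
 have J0: "J ~= {}" using cJ n by auto
 define P where "P = real (card (tuples (length (apos T1)) {1..n}))"
 have P: "P = real n"
 proof -
 have "length (apos T1) = Suc 0" using lengths by (simp add: T1_def two_spec_pos ab1 One_nat_def)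
 then show ?thesis using card_tuples_Suc[of "{1..n}" 0] by (simp add: P_def)
 qed
 define qp qm where "qp = (1 + d) / 2 / P" and "qm = (1 - d) / 2 / P"
 interpret v: vote_round D "vx n T1 (arr0 0)" J "%K. aprod sga K" qp qm "Mb n"
 using vote_round_spec[OF wf _ J0 Mb0, of "arr0 0" 1 1] src J0
 by (simp add: J_def vbias_specs qp_def qm_def P_def)
 have q: "qp + qm = 1 / P" "qp - qm = d / P"
 by (simp_all add: qp_def qm_def add_divide_distrib[symmetric] diff_divide_distrib[symmetric])
 have P0: "P > 0" using P n by simp
 have lam: "v.lam = real (Mb n) / P" unfolding v.lam_def q by simp
 have p: "v.p = d" unfolding v.p_def q using P0 by simp
 have l1: "v.lam <= 1" using Mb1 P P0 by (simp add: lam)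
 have d1: "d <= 1" using v.p_le p by simp
 have gain: "v.lam * d / 20 <= v.gain"
 proof -
 have "sqrt (1 + v.lam) <= sqrt 4" using l1 by (intro real_sqrt_le_mono) simp
 then have s2: "sqrt (1 + v.lam) <= 2" by simp
 have "d / 2 <= d / sqrt (1 + v.lam)" using s2 d_pos v.lam_pos by (intro divide_left_mono) auto
 moreover have "d / 2 <= 1 / (1 + v.lam)" using d1 l1 v.lam_pos d_pos by (intro frac_le) auto
 ultimately have "v.lam * (d / 2) <= v.lam * min (d / sqrt (1 + v.lam)) (1 / (1 + v.lam))"
 using v.lam_pos by (intro mult_left_mono) auto
 then show ?thesis unfolding v.gain_def p by (simp add: mult.commute[of d])
 qed
 have N: "real n / 4 <= v.N"
 proof -
 have "real n / 3 - 1 <= real (n div 3)" by linarith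
 then show ?thesis using n(1) unfolding v.N_def cJ by linarith
 qed
 have Nl: "real (Mb n) / 4 <= v.N * v.lam"
 proof -
 have "real (Mb n) / 4 = real n / 4 * v.lam" using P P0 by (simp add: lam)
 also have "... <= v.N * v.lam" using N v.lam_pos by (intro mult_right_mono) auto
 finally show ?thesis .
 qed
 have low: "real (Mb n) * d / 160 <= v.N * v.gain / 2"
 proof -
 have "real (Mb n) / 4 * (d / 40) <= v.N * v.lam * (d / 40)" using Nl d_pos by (intro mult_right_mono) auto
 also have "... = v.N * (v.lam * d / 20) / 2" by simp
 also have "... <= v.N * v.gain / 2" using gain v.N_pos by (intro divide_right_mono mult_left_mono) auto
 finally show ?thesis by simp
 qed
 have tail: "4 * v.lam / (v.N * v.gain\<^sup>2) <= 6400 / (real (Mb n) * d\<^sup>2)"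
 proof -
 have l0: "v.lam * d / 20 > 0" using v.lam_pos d_pos by simp
 have "(v.lam * d / 20)\<^sup>2 <= v.gain\<^sup>2" using gain l0 by (intro power_mono) auto
 then have "4 * v.lam / (v.N * v.gain\<^sup>2) <= 4 * v.lam / (v.N * (v.lam * d / 20)\<^sup>2)"
 using v.N_pos v.lam_pos l0 v.gain_pos by (intro divide_left_mono mult_left_mono mult_pos_pos) auto
 also have "... = 1600 / (v.N * v.lam * d\<^sup>2)" using v.lam_pos by (simp add: power2_eq_square)
 also have "... <= 1600 / (real (Mb n) / 4 * d\<^sup>2)"
 using Nl Mb0 d_pos v.N_pos v.lam_pos by (intro divide_left_mono mult_right_mono mult_pos_pos) auto
 finally show ?thesis by simp
 qed
 have ph: "phases n = [(T1, 0, 1, Mb n)]" unfolding phases_def using r1 by simp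
 have op: "outp n = 1" unfolding outp_def using r1 by simp
 define I where "I arr \<longleftrightarrow> real (Mb n) * d / 160 <= ri (\<Sum>v\<in>{1..n}. sga v * sgn (arr 1 [v]))" for arr :: arrays
 have "prb (vrun D n (phases n) arr0) {x. ~ I x}
 = prb (replicate_pmf (Mb n) D) {cs. ~ I (vphase n T1 0 1 cs arr0)}"
 unfolding ph by (simp add: map_pmf_def[symmetric] vimage_def)
 also have "... <= prb (replicate_pmf (Mb n) D) {cs. ri (v.corr cs) < v.N * v.gain / 2}"
 proof (intro measure_pmf.finite_measure_mono subsetI CollectI)
 fix cs assume "cs \<in> {cs. ~ I (vphase n T1 0 1 cs arr0)}"
 moreover have "(\<Sum>v\<in>{1..n}. sga v * sgn (vphase n T1 0 1 cs arr0 1 [v])) = v.corr cs"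
 proof -
 have e: "vphase n T1 0 1 cs arr0 1 [v] = vsum (vx n T1 (arr0 0)) cs [v]" for v
 by (simp add: vphase_def arr0_def)
 have z: "vsum (vx n T1 (arr0 0)) cs [v] = 0" if "v \<notin> rng n RA" for v
 using that vx_outside[of "[v]" n T1 "arr0 0"] unfolding vsum_def by (simp add: T1_def two_spec_def)
 have "v.corr cs = (\<Sum>v\<in>rng n RA. sga v * sgn (vsum (vx n T1 (arr0 0)) cs [v]))"
 unfolding v.corr_def unfolding J by (subst sum.reindex) (auto simp: inj_on_def aprod_def)
 also have "... = (\<Sum>v\<in>{1..n}. sga v * sgn (vsum (vx n T1 (arr0 0)) cs [v]))"
 by (rule sum.mono_neutral_left) (use rng_T(1)[of n] n z in auto)
 finally show ?thesis by (simp add: e)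
 qed
 ultimately have "~ real (Mb n) * d / 160 <= ri (v.corr cs)" by (simp only: I_def mem_Collect_eq) simp
 then show "ri (v.corr cs) < v.N * v.gain / 2" using low by linarith
 qed auto
 also have "... <= 6400 / (real (Mb n) * d\<^sup>2)" using v.corr_tail tail by linarith
 finally have f1: "prb (vrun D n (phases n) arr0) {x. ~ I x} <= 6400 / (real (Mb n) * d\<^sup>2)" .
 have "prb (bind_pmf (vrun D n (phases n) arr0) (votes_answer n)) {tau. ~ planted_solution k Q r t n sga tau}
 <= 6400 / (real (Mb n) * d\<^sup>2) + real n / (real (Mb n) * d / 160 - 2 * t * sqrt (real n))\<^sup>2"
 proof (rule prob_bind_le[OF f1])
 fix arr assume arr: "I arr"
 define A where "A = ri (\<Sum>v\<in>{1..n}. sga v * sgn (arr 1 [v]))"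
 have A: "real (Mb n) * d / 160 <= A" using arr by (simp add: I_def A_def)
 have "prb (votes_answer n arr) {tau. ~ planted_solution k Q r t n sga tau} <= real n / (A - 2 * t * sqrt (real n))\<^sup>2"
 proof -
 have ps_iff: "planted_solution k Q r t n sga tau \<longleftrightarrow> tau \<in> assignments n &
 real n / 2 + t * sqrt (real n) <= real (card {i \<in> {1..n}. tau i = sga i})" for tau
 unfolding planted_solution_def using r1 by simp
 show ?thesis unfolding ps_iff votes_answer_def op A_def
 proof (rule complete_answer_tail[OF sga])
 show "sgn (arr 1 [v]) \<in> {-1, 0, 1}" for v by (simp add: sgn_if)
 show "2 * t * sqrt (real n) < ri (\<Sum>v\<in>{1..n}. sga v * sgn (arr 1 [v]))"
 using big A unfolding A_def by (rule less_le_trans)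
 qed
 qed
 also have "... <= real n / (real (Mb n) * d / 160 - 2 * t * sqrt (real n))\<^sup>2"
 using A big by (intro divide_left_mono power_mono mult_pos_pos) (auto intro!: zero_less_power)
 finally show "prb (votes_answer n arr) {tau. ~ planted_solution k Q r t n sga tau}
 <= real n / (real (Mb n) * d / 160 - 2 * t * sqrt (real n))\<^sup>2" .
 qed simp
 then show ?thesis by (simp add: err1_def)
qed

lemma Mb_ge_sqrt: "r = 1 ==> 2 <= n ==> sqrt (real n) * ln (real n) <= real (Mb n)"
proof -
 assume r1: "r = 1" and n: "2 <= n"
 have "real n <= real (sq n * sq n)" using sq_ge(2)[of n] by (simp only: of_nat_le_iff)
 then have "real n <= (real (sq n))\<^sup>2" by (simp add: power2_eq_square)
 then have "sqrt (real n) <= real (sq n)" by (intro real_le_lsqrt) auto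
 then have "sqrt (real n) * ln (real n) <= real (sq n) * real (lg n)"
 using lg_bounds(1)[OF n] n by (intro mult_mono) auto
 also have "... = 1 * 1 * (real (sq n) * real (lg n))" by simp
 also have "... <= real K2 * real K1 * (real (sq n) * real (lg n))" using K by (intro mult_right_mono mult_mono) auto
 also have "... = real (Mb n)" unfolding Mb_def M_def b_def using r1 by simp
 finally show ?thesis .
qed

theorem votes_solve:
 assumes Kl: K1_large K2_large
 obtains err :: "nat => real" where "err \<longlonglongrightarrow> 0"
 "\<forall>\<^sub>F n in sequentially. \<forall>sga\<in>assignments n. prb (bind_pmf (vrun (planted k Q n sga) n (phases n) arr0) (votes_answer n))
 {tau. planted_solution k Q r t n sga tau} \<ge> 1 - err n"
proof -
 have compl: "prb p {tau. S tau} = 1 - prb p {tau. ~ S tau}" for p and S :: "assignment => bool"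
 proof -
 have "{tau. S tau} = UNIV - {tau. ~ S tau}" by auto
 then show ?thesis using measure_pmf.prob_compl[of "{tau. ~ S tau}" p] by simp
 qed
 show ?thesis
 proof (cases "r = 1")
 case False
 then have r2: "2 <= r" using r by linarith
 show ?thesis
 proof (rule that[OF errb_tendsto[OF r2]])
 show "\<forall>\<^sub>F n in sequentially. \<forall>sga\<in>assignments n. prb (bind_pmf (vrun (planted k Q n sga) n (phases n) arr0) (votes_answer n))
 {tau. planted_solution k Q r t n sga tau} \<ge> 1 - errb n"
 using eventually_large[OF r2]
 proof eventually_elim
 case (elim n)
 show ?case
 proof
 fix sga assume "sga \<in> assignments n"
 from votes_solve_ge2[OF r2 elim Kl this, of t] show "prb (bind_pmf (vrun (planted k Q n sga) n (phases n) arr0) (votes_answer n))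
 {tau. planted_solution k Q r t n sga tau} \<ge> 1 - errb n"
 unfolding compl[of _ "planted_solution k Q r t n sga"] by simp
 qed
 qed
 qed
 next
 case True
 define e where "e = d / 160"
 have e: "e > 0" using d_pos by (simp add: e_def)
 have lim: "(%n. 6400 / (sqrt (real n) * ln (real n) * d\<^sup>2) + real n / (sqrt (real n) * ln (real n) * e - 2 * t * sqrt (real n))\<^sup>2) \<longlonglongrightarrow> 0"
 using e d_pos by real_asymp
 show ?thesis
 proof (rule that[OF lim])
 have "filterlim (%n. sqrt (real n) * ln (real n) * e - 2 * t * sqrt (real n)) at_top sequentially" using e by real_asymp
 then have ev1: "\<forall>\<^sub>F n in sequentially. 1 <= sqrt (real n) * ln (real n) * e - 2 * t * sqrt (real n)"
 by (simp add: filterlim_at_top)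
 have "(%n. 6 * real K1 * real K2 * (real n powr (1 / 2) * ln (real n)) / real n) \<longlonglongrightarrow> 0" by real_asymp
 then have ev2: "\<forall>\<^sub>F n in sequentially. 6 * real K1 * real K2 * (real n powr (1 / 2) * ln (real n)) / real n < 1"
 by (rule order_tendstoD) simp
 show "\<forall>\<^sub>F n in sequentially. \<forall>sga\<in>assignments n. prb (bind_pmf (vrun (planted k Q n sga) n (phases n) arr0) (votes_answer n))
 {tau. planted_solution k Q r t n sga tau} \<ge> 1 - (6400 / (sqrt (real n) * ln (real n) * d\<^sup>2) + real n / (sqrt (real n) * ln (real n) * e - 2 * t * sqrt (real n))\<^sup>2)"
 using ev1 ev2 eventually_ge_at_top[of "max 24 k"]
 proof eventually_elim
 case (elim n)
 have n: "24 <= n" "k <= n" "2 <= n" "real n > 0" using elim(3) by auto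
 have M1: "sqrt (real n) * ln (real n) <= real (Mb n)" by (rule Mb_ge_sqrt[OF True n(3)])
 have M0: "0 < sqrt (real n) * ln (real n)" using n by simp
 have M2: "real (Mb n) <= real n"
 using Mb_le[OF n(3)] elim(2) n True by (simp add: divide_less_eq)
 have M3: "sqrt (real n) * ln (real n) * e <= real (Mb n) * e" using M1 e by (intro mult_right_mono) auto
 have big: "2 * t * sqrt (real n) < real (Mb n) * d / 160" using elim(1) M3 by (simp add: e_def)
 have "err1 t n <= 6400 / (sqrt (real n) * ln (real n) * d\<^sup>2) + real n / (sqrt (real n) * ln (real n) * e - 2 * t * sqrt (real n))\<^sup>2"
 unfolding err1_def
 proof (intro add_mono)
 show "6400 / (real (Mb n) * d\<^sup>2) <= 6400 / (sqrt (real n) * ln (real n) * d\<^sup>2)"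
 using M1 M0 d_pos n by (intro frac_le mult_right_mono mult_pos_pos) auto
 have "sqrt (real n) * ln (real n) * e - 2 * t * sqrt (real n) <= real (Mb n) * d / 160 - 2 * t * sqrt (real n)"
 using M3 by (simp add: e_def)
 then show "real n / (real (Mb n) * d / 160 - 2 * t * sqrt (real n))\<^sup>2
 <= real n / (sqrt (real n) * ln (real n) * e - 2 * t * sqrt (real n))\<^sup>2"
 using elim(1) by (intro frac_le power_mono zero_less_power) (linarith | simp)+
 qed
 note e1 = this
 show ?case
 proof
 fix sga assume "sga \<in> assignments n"
 from votes_solve_1[OF True n(1,2) M2 big this] show "prb (bind_pmf (vrun (planted k Q n sga) n (phases n) arr0) (votes_answer n))
 {tau. planted_solution k Q r t n sga tau} \<ge> 1 - (6400 / (sqrt (real n) * ln (real n) * d\<^sup>2) + real n / (sqrt (real n) * ln (real n) * e - 2 * t * sqrt (real n))\<^sup>2)"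
 unfolding compl[of _ "planted_solution k Q r t n sga"] using e1 by linarith
 qed
 qed
 qed
 qed
qed

end

section \<open>Processing one clause at a time\<close>

type_synonym task = "vspec \<times> nat \<times> nat"

definition vstep :: "nat => task => clause => arrays => arrays" where
 "vstep n x C arr = (case x of (sp, src, dst) => arr(dst := (%K. arr dst K + vx n sp (arr src) C K)))"

definition valg :: "nat => task list => clause list => arrays => arrays" where
 "valg n xs cs arr = fold (%(x, C). vstep n x C) (zip xs cs) arr"

definition tasks :: "phase list => task list" where
 "tasks phs = concat (map (%(sp, src, dst, m). replicate m (sp, src, dst)) phs)"

text \<open>When source and destination differ, the source stays fixed during the phase, so handling
  clauses one at a time has the effect of handling them as a batch.\<close>

definition proper :: "phase list => bool" where
 "proper phs \<longleftrightarrow> (\<forall>(sp, src, dst, m)\<in>set phs. src ~= dst)"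

lemma valg_replicate:
 assumes "src ~= dst" "length cs = m"
 shows "valg n (replicate m (sp, src, dst)) cs arr = vphase n sp src dst cs arr"
 using assms(2)
proof (induction cs arbitrary: m arr)
 case Nil
 then show ?case by (simp add: valg_def vphase_def vsum_def)
next
 case (Cons c cs)
 then obtain m' where m: "m = Suc m'" "length cs = m'" by auto
 have "valg n (replicate m (sp, src, dst)) (c # cs) arr = valg n (replicate m' (sp, src, dst)) cs (vstep n (sp, src, dst) c arr)"
 by (simp add: valg_def m)
 also have "... = vphase n sp src dst cs (vstep n (sp, src, dst) c arr)" by (rule Cons.IH[OF m(2)])
 also have "... = vphase n sp src dst (c # cs) arr"
 using assms(1) by (auto simp: vphase_def vstep_def vsum_def fun_eq_iff)
 finally show ?case .
qed

lemma valg_append: "length xs = length cs ==> valg n (xs @ ys) (cs @ ds) arr = valg n ys ds (valg n xs cs arr)"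
 by (simp add: valg_def)

lemma vrun_eq_valg:
 "proper phs ==> vrun D n phs arr = map_pmf (%cs. valg n (tasks phs) cs arr) (replicate_pmf (length (tasks phs)) D)"
proof (induction phs arbitrary: arr)
 case Nil
 then show ?case by (simp add: tasks_def valg_def)
next
 case (Cons p phs)
 obtain sp src dst m where p: "p = (sp, src, dst, m)" by (cases p)
 have sd: "src ~= dst" and pr: "proper phs" using Cons.prems by (auto simp: proper_def p)
 have tk: "tasks (p # phs) = replicate m (sp, src, dst) @ tasks phs" by (simp add: tasks_def p)
 have "map_pmf (%cs. valg n (tasks (p # phs)) cs arr) (replicate_pmf (length (tasks (p # phs))) D)
 = bind_pmf (replicate_pmf m D) (%cs. map_pmf (%ds. valg n (tasks (p # phs)) (cs @ ds) arr) (replicate_pmf (length (tasks phs)) D))"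
 by (simp add: tk replicate_pmf_distrib map_bind_pmf map_pmf_def[symmetric] pmf.map_comp comp_def)
 also have "... = bind_pmf (replicate_pmf m D) (%cs. vrun D n phs (vphase n sp src dst cs arr))"
 proof (rule bind_pmf_cong[OF refl])
 fix cs assume "cs \<in> set_pmf (replicate_pmf m D)"
 then have l: "length cs = m" by (simp add: set_replicate_pmf)
 show "map_pmf (%ds. valg n (tasks (p # phs)) (cs @ ds) arr) (replicate_pmf (length (tasks phs)) D)
 = vrun D n phs (vphase n sp src dst cs arr)"
 unfolding Cons.IH[OF pr] tk using l by (simp add: valg_append valg_replicate[OF sd])
 qed
 finally show ?case by (simp add: p)
qed

section \<open>Simulation by 1-MSTAT\<close>

text \<open>0 stands for no vote; a vote for the target with index \<open>j\<close> is
  \<open>2 * j + 1\<close> if negative and \<open>2 * j + 2\<close> if positive. Thus the single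
  answer of 1-MSTAT carries all that a clause contributes.\<close>

definition vcode :: "nat => task => arrays => clause => nat" where
 "vcode n x arr C = (case x of (sp, src, dst) => let v = vval n sp (arr src) C in
 if v = 0 \<or> C \<notin> clauses (length C) n \<or> cvars (tpos sp) C \<notin> tkeys n sp then 0
 else 1 + 2 * to_nat_on (tkeys n sp) (cvars (tpos sp) C) + (if v > 0 then 1 else 0))"

definition vdecode :: "nat => task => nat => arrays => arrays" where
 "vdecode n x i arr = (case x of (sp, src, dst) => arr(dst := (%K. arr dst K +
 (if i = 0 \<or> from_nat_into (tkeys n sp) ((i - 1) div 2) ~= K then 0 else if even i then 1 else -1))))"

lemma vcode_less: "2 * card (tkeys n sp) + 1 <= L ==> vcode n (sp, src, dst) arr C < L"
proof -
 assume L: "2 * card (tkeys n sp) + 1 <= L"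
 have fin: "finite (tkeys n sp)" by (simp add: tkeys_def)
 have "to_nat_on (tkeys n sp) K < card (tkeys n sp)" if "K \<in> tkeys n sp" for K
 using bij_betwE[OF to_nat_on_finite[OF fin]] that by auto
 then show ?thesis using L by (auto simp: vcode_def Let_def) fastforce+
qed

lemma vdecode_vcode:
 assumes wf: "wf_spec k Q n sp" and C: "C \<in> clauses k n"
 shows "vdecode n (sp, src, dst) (vcode n (sp, src, dst) arr C) arr = vstep n (sp, src, dst) C arr"
proof -
 have fin: "finite (tkeys n sp)" by (simp add: tkeys_def)
 have Cl: "C \<in> clauses (length C) n" using C by (simp add: clauses_def)
 define v where "v = vval n sp (arr src) C"
 have v: "v \<in> {-1, 0, 1}" unfolding v_def by (rule vval_tern[OF wf])
 have wf': "distinct (tpos sp)" "set (tpos sp) \<subseteq> {..<k}" using wf by (auto simp: wf_spec_def apos_def)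
 show ?thesis
 proof (cases "v = 0")
 case True
 then show ?thesis by (auto simp: vdecode_def vcode_def vstep_def vx_def v_def[symmetric] Let_def fun_eq_iff)
 next
 case False
 then have "vrel n sp C" by (auto simp: v_def vval_def split: if_splits)
 then have K: "cvars (tpos sp) C \<in> tkeys n sp"
 using cvars_tuples[OF C wf'] by (auto simp: vrel_def tkeys_def tuples_def)
 have fn: "from_nat_into (tkeys n sp) (to_nat_on (tkeys n sp) (cvars (tpos sp) C)) = cvars (tpos sp) C"
 using K fin by (simp add: countable_finite)
 define j where "j = to_nat_on (tkeys n sp) (cvars (tpos sp) C)"
 have cd: "vcode n (sp, src, dst) arr C = 1 + 2 * j + (if v > 0 then 1 else 0)"
 using False K Cl by (simp add: vcode_def v_def[symmetric] j_def)
 have d2: "(1 + 2 * j + (if v > 0 then 1 else 0) - 1) div 2 = j" by auto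
 show ?thesis
 unfolding vdecode_def vstep_def cd d2 prod.case using fn[folded j_def] v False
 by (auto simp: vx_def v_def[symmetric] fun_eq_iff d2)
 qed
qed

context sampler
begin

definition mstate :: "nat => ('q \<times> nat) list => arrays" where
 "mstate n h = fold (%(x, i). vdecode n x i) (zip (tasks (phases n)) (map snd h)) arr0"

definition mask :: "nat => (clause => nat, nat) history => (clause => nat) pmf" where
 "mask n h = return_pmf (if length h < length (tasks (phases n)) then vcode n (tasks (phases n) ! length h) (mstate n h) else (%_. 0))"

lemma proper_phases: "proper (phases n)"
proof -
 have "proper (rounds n q t)" for q t
 by (induction t arbitrary: q) (auto simp: proper_def)
 then show ?thesis by (auto simp: proper_def phases_def final_phases_def)
qed

lemma phases_spec:
 assumes "(sp, src, dst, m) \<in> set (phases n)"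
 shows "sp = T1 \<or> (2 <= r & (sp = T2 \<or> (\<exists>X\<in>{RA, RB, RC}. sp = FS X \<or> sp = GS X)))"
proof -
 have "sp \<in> {T1, T2}" if "(sp, src, dst, m) \<in> set (rounds n q t)" for q t
 using that by (induction t arbitrary: q) auto
 then show ?thesis using assms r by (auto simp: phases_def final_phases_def split: if_splits)
qed

lemma tasks_spec: "(sp, src, dst) \<in> set (tasks phs) ==> \<exists>m. (sp, src, dst, m) \<in> set phs"
 by (auto simp: tasks_def)

lemma wf_tasks:
 assumes "3 <= n" "(sp, src, dst) \<in> set (tasks (phases n))"
 shows "wf_spec k Q n sp"
proof -
 obtain m where "(sp, src, dst, m) \<in> set (phases n)" using tasks_spec[OF assms(2)] by blast
 from phases_spec[OF this] show ?thesis
 using wf_T1[OF assms(1)] wf_T2[OF assms(1)] wf_FS wf_GS rng_T(1)[OF assms(1)] rng_T(2,3) ab(4) by blast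
qed

text \<open>Both signs of every target and the value for no vote must fit into \<open>n ^ a\<close>
  codes. Restricting targets to a third of the variables pays for this:
  \<open>2 * x + 1 <= 3 * x\<close> for tuples, and \<open>2 * (n div 3 + 2) + 1 <= n\<close> for
  single variables.\<close>

lemma card_tkeys:
 assumes n: "24 <= n" "(sp, src, dst) \<in> set (tasks (phases n))"
 shows "2 * card (tkeys n sp) + 1 <= n ^ a"
proof -
 obtain m where m: "(sp, src, dst, m) \<in> set (phases n)" using tasks_spec[OF n(2)] by blast
 have pw: "2 * (n div 3) ^ j + 1 <= n ^ a" if "1 <= j" "j <= a" for j
 proof -
 have "2 * (n div 3) ^ j + 1 <= 2 * (n div 3) ^ j + (n div 3) ^ j" using n by simp
 also have "... = 3 * (n div 3) ^ j" by simp
 also have "... <= 3 ^ j * (n div 3) ^ j"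
 using power_increasing[OF that(1), of "3::nat"] by (intro mult_right_mono) auto
 also have "... = (3 * (n div 3)) ^ j" by (simp add: power_mult_distrib)
 also have "... <= n ^ j" by (intro power_mono) auto
 also have "... <= n ^ a" using that n by (intro power_increasing) auto
 finally show ?thesis .
 qed
 have ct: "card (tkeys n sp) <= card (rng n (trng sp)) ^ length (tpos sp)"
 unfolding tkeys_def by (rule card_tuples_le) simp
 have n1: "n ^ 1 <= n ^ a" using ab(3) n by (intro power_increasing) auto
 have one: "2 * card (tkeys n sp) + 1 <= n ^ a" if "length (tpos sp) = 1" "trng sp \<in> {RA, RB, RC}"
 proof -
 have "card (rng n (trng sp)) <= n div 3 + 2" using that(2) by (auto simp: rng_simps)
 then have "card (tkeys n sp) <= n div 3 + 2" using ct that(1) by simp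
 moreover have "2 * (n div 3 + 2) + 1 <= n" using n(1) by presburger
 ultimately show ?thesis using n1 by simp
 qed
 have two: "card (rng n RA) = n div 3" "card (rng n RB) = n div 3" by (auto simp: rng_simps)
 from phases_spec[OF m] show ?thesis
 proof (elim disjE conjE bexE)
 assume sp: "sp = T1"
 have "card (tkeys n sp) <= (n div 3) ^ a" using ct lengths two unfolding sp by (simp add: T1_def two_spec_def)
 then show ?thesis using pw[OF ab(3) order_refl] by linarith
 next
 assume sp: "sp = T2" and r2: "2 <= r"
 have "card (tkeys n sp) <= (n div 3) ^ b" using ct lengths two unfolding sp by (simp add: T2_def two_spec_def)
 then show ?thesis using pw[OF ab(4)[OF r2] ab(2)] by linarith
 next
 fix X assume "X \<in> {RA, RB, RC}" "sp = FS X"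
 then show ?thesis by (intro one) (simp_all add: FS_def one_spec_def)
 next
 fix X assume "X \<in> {RA, RB, RC}" "sp = GS X"
 then show ?thesis by (intro one) (simp_all add: GS_def one_spec_def)
 qed
qed

lemma mask_queries: "24 <= n ==> set_pmf (mask n h) \<subseteq> mstat_queries k (n ^ a) n"
proof -
 assume n: "24 <= n"
 have "0 < n ^ a" using n by simp
 moreover have "vcode n (tasks (phases n) ! length h) (mstate n h) C < n ^ a" if "length h < length (tasks (phases n))" for C
 proof -
 obtain sp src dst where x: "tasks (phases n) ! length h = (sp, src, dst)" by (cases "tasks (phases n) ! length h")
 then have "(sp, src, dst) \<in> set (tasks (phases n))" using that by (metis nth_mem)
 then show ?thesis unfolding x by (intro vcode_less card_tkeys[OF n])
 qed
 ultimately show ?thesis by (auto simp: mask_def mstat_queries_def)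
qed

lemma transcript_length: "h \<in> set_pmf (transcript ask orc q) ==> length h = q"
 by (induction q arbitrary: h) auto

text \<open>Queries are adaptive, but the state is a function of the answers received. By induction
  it has the law of the clause-by-clause algorithm after as many clauses, so the success probability
  carries over unchanged.\<close>

lemma mstate_transcript:
 assumes n: "3 <= n" "k <= n" and sga: "sga \<in> assignments n" and q: "q <= length (tasks (phases n))"
 defines "D \<equiv> planted k Q n sga"
 shows "map_pmf (mstate n) (transcript (mask n) (%_ h. map_pmf h D) q)
 = map_pmf (%cs. valg n (take q (tasks (phases n))) cs arr0) (replicate_pmf q D)"
 using q
proof (induction q)
 case 0
 then show ?case by (simp add: mstate_def valg_def)
next
 case (Suc q)
 define xs where "xs = tasks (phases n)"
 have q: "q < length xs" using Suc.prems by (simp add: xs_def)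
 obtain sp src dst where x: "xs ! q = (sp, src, dst)" by (cases "xs ! q")
 have wf: "wf_spec k Q n sp" using wf_tasks[OF n(1)] q x by (metis nth_mem xs_def)
 let ?T = "transcript (mask n) (%_ h. map_pmf h D) q"
 have st: "mstate n (h @ [(y, i)]) = vdecode n (xs ! q) i (mstate n h)" if "length h = q" for h y i
 proof -
 have "zip xs (map snd h @ [i]) = zip xs (map snd h) @ [(xs ! q, i)]"
 proof -
 have "zip (take q xs) (map snd h) = zip xs (map snd h)" using take_zip[of q xs "map snd h"] that q by simp
 then show ?thesis using that q by (subst (1) id_take_nth_drop[OF q]) (simp add: zip_append1)
 qed
 then show ?thesis by (simp add: mstate_def xs_def[symmetric])
 qed
 have "map_pmf (mstate n) (transcript (mask n) (%_ h. map_pmf h D) (Suc q))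
 = bind_pmf ?T (%h. map_pmf (%C. vstep n (xs ! q) C (mstate n h)) D)"
 unfolding transcript.simps map_bind_pmf
 proof (rule bind_pmf_cong[OF refl])
 fix h assume "h \<in> set_pmf ?T"
 then have l: "length h = q" by (rule transcript_length)
 show "mask n h \<bind> (%x. map_pmf (mstate n) (map_pmf (%a. h @ [(x, a)]) (map_pmf x D))) = map_pmf (%C. vstep n (xs ! q) C (mstate n h)) D"
 unfolding mask_def bind_return_pmf pmf.map_comp
 proof (rule map_pmf_cong[OF refl])
 fix C assume "C \<in> set_pmf D"
 then have "C \<in> clauses k n" using set_planted[OF Q n(2) sga] by (auto simp: D_def)
 then show "(mstate n \<circ> ((%a. h @ [(if length h < length (tasks (phases n)) then vcode n (tasks (phases n) ! length h) (mstate n h) else (%_. 0), a)]) \<circ>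
 (if length h < length (tasks (phases n)) then vcode n (tasks (phases n) ! length h) (mstate n h) else (%_. 0)))) C
 = vstep n (xs ! q) C (mstate n h)"
 using q l vdecode_vcode[OF wf, of C src dst "mstate n h"] by (simp add: st xs_def[symmetric] x)
 qed
 qed
 also have "... = bind_pmf (map_pmf (mstate n) ?T) (%arr. map_pmf (%C. vstep n (xs ! q) C arr) D)"
 by (simp add: bind_map_pmf)
 also have "... = bind_pmf (replicate_pmf q D) (%cs. map_pmf (%C. vstep n (xs ! q) C (valg n (take q xs) cs arr0)) D)"
 using Suc by (simp add: bind_map_pmf xs_def)
 also have "... = bind_pmf (replicate_pmf q D) (%cs. map_pmf (%C. valg n (take (Suc q) xs) (cs @ [C]) arr0) D)"
 proof (rule bind_pmf_cong[OF refl])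
 fix cs assume "cs \<in> set_pmf (replicate_pmf q D)"
 then have l: "length cs = q" by (simp add: set_replicate_pmf)
 show "map_pmf (%C. vstep n (xs ! q) C (valg n (take q xs) cs arr0)) D = map_pmf (%C. valg n (take (Suc q) xs) (cs @ [C]) arr0) D"
 unfolding take_Suc_conv_app_nth[OF q] using l q by (simp add: valg_append) (simp add: valg_def)
 qed
 also have "... = map_pmf (%cs. valg n (take (Suc q) xs) cs arr0) (replicate_pmf (q + 1) D)"
 unfolding replicate_pmf_distrib replicate_pmf_1 map_pmf_def by (simp add: bind_assoc_pmf bind_return_pmf)
 finally show ?case by (simp only: xs_def Suc_eq_plus1)
qed

theorem votes_by_mstat:
 assumes Kl: K1_large K2_large
 shows "solved_by_1_MSTAT k Q r t (%n. n ^ a) (%n. length (tasks (phases n)))"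
proof -
 obtain err where err: "err \<longlonglongrightarrow> 0"
 "\<forall>\<^sub>F n in sequentially. \<forall>sga\<in>assignments n. prb (bind_pmf (vrun (planted k Q n sga) n (phases n) arr0) (votes_answer n))
 {tau. planted_solution k Q r t n sga tau} \<ge> 1 - err n"
 by (rule votes_solve[OF Kl, of t])
 show ?thesis
 unfolding solved_by_1_MSTAT_def solved_by_statistical_algorithm_def
 proof (intro exI conjI)
 show "err \<longlonglongrightarrow> 0" by (rule err)
 show "\<forall>\<^sub>F n in sequentially. (\<forall>h. set_pmf (mask n h) \<subseteq> mstat_queries k (n ^ a) n) &
 (\<forall>sga\<in>assignments n. \<forall>orc\<in>mstat_oracles (planted k Q n sga).
 1 - err n <= prb (bind_pmf (transcript (mask n) orc (length (tasks (phases n)))) (%h. votes_answer n (mstate n h)))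
 {tau. planted_solution k Q r t n sga tau})"
 using err(2) eventually_ge_at_top[of "max 24 k"]
 proof eventually_elim
 case (elim n)
 have n: "24 <= n" "3 <= n" "k <= n" using elim(2) by auto
 have "bind_pmf (transcript (mask n) (%_ h. map_pmf h (planted k Q n sga)) (length (tasks (phases n)))) (%h. votes_answer n (mstate n h))
 = bind_pmf (vrun (planted k Q n sga) n (phases n) arr0) (votes_answer n)" if "sga \<in> assignments n" for sga
 proof -
 have "bind_pmf (transcript (mask n) (%_ h. map_pmf h (planted k Q n sga)) (length (tasks (phases n)))) (%h. votes_answer n (mstate n h))
 = bind_pmf (map_pmf (mstate n) (transcript (mask n) (%_ h. map_pmf h (planted k Q n sga)) (length (tasks (phases n))))) (votes_answer n)"
 by (simp add: bind_map_pmf)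
 also have "... = bind_pmf (vrun (planted k Q n sga) n (phases n) arr0) (votes_answer n)"
 unfolding mstate_transcript[OF n(2,3) that order_refl] vrun_eq_valg[OF proper_phases] by simp
 finally show ?thesis .
 qed
 then show ?case using elim(1) mask_queries[OF n(1)] by (auto simp: mstat_oracles_def)
 qed
 qed
qed

end

section \<open>Simulation by MVSTAT\<close>

text \<open>The \<open>vcode\<close> of a positive vote for \<open>K\<close>. Only positive votes
  are evaluated: their probability alone already reveals the bias.\<close>

definition kcode :: "nat => vspec => nat list => nat" where
 "kcode n sp K = 2 * to_nat_on (tkeys n sp) K + 2"

lemma kcode_inj: "inj_on (kcode n sp) (tkeys n sp)"
 by (auto simp: inj_on_def kcode_def tkeys_def countable_finite)

lemma kcode_less: "K \<in> tkeys n sp ==> 2 * card (tkeys n sp) + 1 <= L ==> kcode n sp K < L"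
proof -
 assume K: "K \<in> tkeys n sp" and L: "2 * card (tkeys n sp) + 1 <= L"
 have fin: "finite (tkeys n sp)" by (simp add: tkeys_def)
 have "to_nat_on (tkeys n sp) K < card (tkeys n sp)"
 using bij_betwE[OF to_nat_on_finite[OF fin]] K by auto
 then show ?thesis using L by (simp add: kcode_def)
qed

text \<open>The tolerance of the oracle with \<open>p * (1 - p)\<close> relaxed to an upper bound
  \<open>x\<close> of \<open>p\<close>.\<close>

definition mvtol :: "real => real => real" where
 "mvtol s x = max (1 / s) (sqrt (x / s))"

context planted_clauses
begin

lemma prob_kcode:
 assumes wf: "wf_spec k Q n sp" and T: "T \<subseteq> tkeys n sp"
 shows "prb D {C. vcode n (sp, i, j) arr C \<in> kcode n sp ` T}
 = (\<Sum>K\<in>T. prb D {C. vx n sp (arr i) C K = 1})"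
proof -
 have fin: "finite (tkeys n sp)" by (simp add: tkeys_def)
 have wf': "distinct (tpos sp)" "set (tpos sp) \<subseteq> {..<k}" using wf by (auto simp: wf_spec_def apos_def)
 have "prb D {C. vcode n (sp, i, j) arr C \<in> kcode n sp ` T} = prb D (\<Union>K\<in>T. {C. vx n sp (arr i) C K = 1})"
 proof (rule measure_pmf.finite_measure_eq_AE)
 have "C \<in> {C. vcode n (sp, i, j) arr C \<in> kcode n sp ` T} \<longleftrightarrow> C \<in> (\<Union>K\<in>T. {C. vx n sp (arr i) C K = 1})" if "C \<in> set_pmf D" for C
 proof -
 have C: "C \<in> clauses k n" using that set_planted[OF Q kn sga] by blast
 then have Cl: "C \<in> clauses (length C) n" by (simp add: clauses_def)
 define v where "v = vval n sp (arr i) C"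
 have v: "v \<in> {-1, 0, 1}" unfolding v_def by (rule vval_tern[OF wf])
 define K where "K = cvars (tpos sp) C"
 have vxK: "vx n sp (arr i) C K' = (if K = K' then v else 0)" for K' by (simp add: vx_def K_def v_def)
 have KT: "K \<in> tkeys n sp" if "v ~= 0"
 proof -
 have "vrel n sp C" using that by (auto simp: v_def vval_def split: if_splits)
 then show ?thesis using cvars_tuples[OF C wf'] by (auto simp: vrel_def tkeys_def tuples_def K_def)
 qed
 have vc: "vcode n (sp, i, j) arr C = (if v = 0 then 0 else if v = 1 then kcode n sp K else 2 * to_nat_on (tkeys n sp) K + 1)"
 using v KT Cl by (auto simp: vcode_def v_def[symmetric] K_def[symmetric] kcode_def Let_def)
 have odd: "2 * x + 1 \<notin> kcode n sp ` T" for x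
 proof
 assume "2 * x + 1 \<in> kcode n sp ` T"
 then obtain K' where "2 * x + 1 = 2 * to_nat_on (tkeys n sp) K' + 2" by (auto simp: kcode_def)
 then show False by presburger
 qed
 have z: "0 \<notin> kcode n sp ` T" by (auto simp: kcode_def)
 show ?thesis
 proof (cases "v = 1")
 case True
 then show ?thesis using vc vxK KT T inj_on_image_mem_iff[OF kcode_inj, of K n sp T] by auto
 next
 case False
 then show ?thesis using vc vxK odd z by auto
 qed
 qed
 then show "AE C in D. C \<in> {C. vcode n (sp, i, j) arr C \<in> kcode n sp ` T} \<longleftrightarrow> C \<in> (\<Union>K\<in>T. {C. vx n sp (arr i) C K = 1})"
 by (simp add: AE_measure_pmf_iff)
 qed auto
 also have "... = (\<Sum>K\<in>T. prb D {C. vx n sp (arr i) C K = 1})"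
 by (rule measure_pmf.finite_measure_finite_Union)
 (use fin T finite_subset in \<open>auto simp: disjoint_family_on_def vx_def split: if_splits\<close>)
 finally show ?thesis .
qed

lemma prob_plus:
 assumes wf: "wf_spec k Q n sp" and K: "K \<in> tkeys n sp"
 shows "prb D {C. vx n sp u C K = 1}
 = (real (ssup n sp u K) + ri (aprod sga K) * (vbias k Q sp * ri (scor n sp sga u K))) / 2
 / real (card (tuples (length (apos sp)) {1..n}))"
proof -
 have "aprod sga K \<in> {-1, 1}"
 using wf K by (intro aprod_sign[OF sga]) (auto simp: wf_spec_def tkeys_def tuples_def)
 then have "aprod sga K \<in> {-1, 1}" "aprod sga K * aprod sga K = 1" by auto
 then show ?thesis using vote_prob[OF wf K, of "aprod sga K" u] by simp
qed

lemma answer_sum: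
 assumes wf: "wf_spec k Q n sp" and T: "T \<subseteq> tkeys n sp" and L: "2 * card (tkeys n sp) + 1 <= L" and s: "s > 0"
 and ans: "mvstat_answer L s D (vcode n (sp, i, j) arr) (Pow {..<L}) v"
 and x: "(\<Sum>K\<in>T. prb D {C. vx n sp (arr i) C K = 1}) <= x"
 shows "\<bar>(\<Sum>K\<in>T. v ! kcode n sp K) - (\<Sum>K\<in>T. prb D {C. vx n sp (arr i) C K = 1})\<bar> <= mvtol s x"
proof -
 define p where "p = (\<Sum>K\<in>T. prb D {C. vx n sp (arr i) C K = 1})"
 have p: "prb D {C. vcode n (sp, i, j) arr C \<in> kcode n sp ` T} = p"
 unfolding p_def by (rule prob_kcode[OF wf T])
 have Z: "kcode n sp ` T \<in> Pow {..<L}" using T kcode_less[OF _ L] by auto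
 have p0: "0 <= p" unfolding p[symmetric] by simp
 have "\<bar>(\<Sum>l\<in>kcode n sp ` T. v ! l) - p\<bar> <= max (1 / s) (sqrt (p * (1 - p) / s))"
 using ans Z unfolding mvstat_answer_def Let_def p[symmetric] by blast
 also have "(\<Sum>l\<in>kcode n sp ` T. v ! l) = (\<Sum>K\<in>T. v ! kcode n sp K)"
 by (subst sum.reindex) (auto intro: inj_on_subset[OF kcode_inj T])
 also have "max (1 / s) (sqrt (p * (1 - p) / s)) <= mvtol s x"
 proof -
 have "p * (1 - p) <= p" using p0 by (simp add: mult_left_le)
 then have "p * (1 - p) / s <= x / s" using x s by (intro divide_right_mono) (auto simp: p_def)
 then show ?thesis unfolding mvtol_def by (intro max.mono real_sqrt_le_mono) auto
 qed
 finally show ?thesis by (simp add: p_def)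
qed

text \<open>Both instances of \<open>cube_bias\<close>, for the two signs, are probabilities and
  hence nonnegative.\<close>

lemma bias_le_1:
 assumes "wf_spec k Q n sp"
 shows "vbias k Q sp <= 1"
proof -
 have ps: "distinct (apos sp)" "set (apos sp) \<subseteq> {..<k}" using assms by (auto simp: wf_spec_def)
 define F where "F = 2 ^ k * fourier k Q (set (apos sp))"
 have "0 <= (1 + ri c * F) / 2" if "c \<in> {-1, 1}" for c
 unfolding F_def cube_bias[OF Q ps that, symmetric] by (rule measure_nonneg)
 from this[of 1] this[of "-1"] have "\<bar>F\<bar> <= 1" by simp
 then have "\<bar>2 ^ k * fourier k Q (set (apos sp))\<bar> <= 1" by (simp only: F_def)
 then show ?thesis by (simp add: vbias_def abs_mult)
qed

text \<open>The probability of a positive vote lies above or below \<open>ssup / 2 / P\<close> by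
  \<open>vbias * \<bar>scor\<bar> / 2 / P\<close>, depending on the sought sign. The threshold is
  computable from the stored source alone, so a tolerance below this deviation reveals the
  sign.\<close>

lemma answer_exact:
 assumes wf: "wf_spec k Q n sp" and K: "K \<in> tkeys n sp" and L: "2 * card (tkeys n sp) + 1 <= L" and s: "s > 0"
 and ans: "mvstat_answer L s D (vcode n (sp, i, j) arr) (Pow {..<L}) v"
 and P: "P = real (card (tuples (length (apos sp)) {1..n}))"
 and tol: "mvtol s (real (ssup n sp (arr i) K) / P) < vbias k Q sp * \<bar>ri (scor n sp sga (arr i) K)\<bar> / 2 / P"
 shows "sgn (v ! kcode n sp K - real (ssup n sp (arr i) K) / 2 / P) = ri (sgn (scor n sp sga (arr i) K) * aprod sga K)"
proof -
 define S where "S = real (ssup n sp (arr i) K)"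
 define A where "A = scor n sp sga (arr i) K"
 define w where "w = ri (aprod sga K)"
 have aK: "aprod sga K \<in> {-1, 1}"
 using wf K by (intro aprod_sign[OF sga]) (auto simp: wf_spec_def tkeys_def tuples_def)
 have pr: "prb D {C. vx n sp (arr i) C K = 1} = (S + w * (vbias k Q sp * ri A)) / 2 / P"
 using prob_plus[OF wf K, of "arr i"] by (simp add: S_def A_def w_def P)
 have AS: "\<bar>ri A\<bar> <= S"
 proof -
 have "\<bar>A\<bar> <= (\<Sum>w\<in>skeys n sp K. \<bar>aprod sga w * gsrc (srcs sp) (arr i) w\<bar>)" unfolding A_def scor_def by (rule sum_abs)
 also have "... <= (\<Sum>w\<in>skeys n sp K. if gsrc (srcs sp) (arr i) w ~= 0 then 1 else 0)"
 proof (rule sum_mono)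
 fix w assume "w \<in> skeys n sp K"
 then have "aprod sga w \<in> {-1, 1}" using wf by (intro aprod_sign[OF sga]) (auto simp: skeys_def tuples_def wf_spec_def)
 then show "\<bar>aprod sga w * gsrc (srcs sp) (arr i) w\<bar> <= (if gsrc (srcs sp) (arr i) w ~= 0 then 1 else 0)"
 using gsrc_tern[of "srcs sp" "arr i" w] by (auto simp: abs_mult)
 qed
 also have "... = int (ssup n sp (arr i) K)"
 by (simp add: ssup_def sum.If_cases skeys_def Int_def conj_ac)
 finally have "ri \<bar>A\<bar> <= ri (int (ssup n sp (arr i) K))" by (simp only: of_int_le_iff)
 then show ?thesis by (simp add: S_def)
 qed
 have P0: "0 <= P" by (simp add: P)
 have "w * (vbias k Q sp * ri A) <= 1 * (1 * S)"
 proof -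
 have "w * (vbias k Q sp * ri A) <= \<bar>w * (vbias k Q sp * ri A)\<bar>" by simp
 also have "... = vbias k Q sp * \<bar>ri A\<bar>" using aK by (auto simp: w_def abs_mult vbias_def)
 also have "... <= 1 * S" using AS bias_le_1[OF wf] by (intro mult_mono) (auto simp: vbias_def)
 finally show ?thesis by simp
 qed
 then have "(S + w * (vbias k Q sp * ri A)) / 2 <= S" by simp
 then have "(S + w * (vbias k Q sp * ri A)) / 2 / P <= S / P" using P0 by (rule divide_right_mono)
 then have "\<bar>(\<Sum>K\<in>{K}. v ! kcode n sp K) - (\<Sum>K\<in>{K}. prb D {C. vx n sp (arr i) C K = 1})\<bar> <= mvtol s (S / P)"
 by (intro answer_sum[OF wf _ L s ans]) (use K pr in auto)
 then have close: "\<bar>v ! kcode n sp K - (S + w * (vbias k Q sp * ri A)) / 2 / P\<bar> <= mvtol s (S / P)" by (simp add: pr)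
 define y where "y = vbias k Q sp * \<bar>ri A\<bar> / 2 / P"
 have y: "mvtol s (S / P) < y" using tol by (simp add: y_def S_def A_def)
 have split: "(S + w * (vbias k Q sp * ri A)) / 2 / P = S / 2 / P + ri (sgn A * aprod sga K) * y"
 by (auto simp: y_def w_def sgn_if add_divide_distrib)
 have "0 <= mvtol s (S / P)" using s by (simp add: mvtol_def le_max_iff_disj)
 then have "y > 0" using y by linarith
 then have "A ~= 0" by (auto simp: y_def)
 then have sg: "sgn A * aprod sga K \<in> {-1, 1}" using aK by (auto simp: sgn_if)
 have "\<bar>(v ! kcode n sp K - S / 2 / P) - ri (sgn A * aprod sga K) * y\<bar> < y" using close y unfolding split by linarith
 then show ?thesis using sg unfolding S_def[symmetric] A_def[symmetric] by (auto simp: sgn_if)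
qed

end

section \<open>The MVSTAT algorithm: eight queries, or one for \<open>r = 1\<close>\<close>

context sampler
begin

definition mvtasks :: "task list" where
 "mvtasks = [(T1, 0, 1), (T2, 1, 2), (FS RA, 2, 3), (FS RB, 2, 3), (FS RC, 2, 3), (GS RA, 3, 4), (GS RB, 3, 4), (GS RC, 3, 4)]"

definition "Pn n sp = real (card (tuples (length (apos sp)) {1..n}))"

text \<open>In the query that starts from a single coordinate, one entry is far below the tolerance
  and only sums over many entries are reliable. A sign vector is therefore judged by all subset sums
  together, and any vector that passes is accepted.\<close>

definition consistent :: "nat => real => real list => (nat list => int) => bool" where
 "consistent n tol v y \<longleftrightarrow> (\<forall>K. y K \<in> {-1, 1}) & (\<forall>T\<subseteq>AT n.
 \<bar>(\<Sum>K\<in>T. v ! kcode n T1 K) - (\<Sum>K\<in>T. (1 + d * ri (y K)) / 2 / Pn n T1)\<bar> <= tol)"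

definition tol1 :: "nat => real => real" where
 "tol1 n s = mvtol s (real (card (AT n)) / Pn n T1)"

definition mvupd :: "nat => real => task => real list => arrays => arrays" where
 "mvupd n s x v arr = (case x of (sp, i, j) => arr(j := (if i = 0 then (SOME y. consistent n (tol1 n s) v y)
 else (%K. if K \<in> tkeys n sp then (if v ! kcode n sp K > real (ssup n sp (arr i) K) / 2 / Pn n sp then 1
 else if v ! kcode n sp K < real (ssup n sp (arr i) K) / 2 / Pn n sp then - 1 else 0) else arr j K))))"

definition mvstate :: "nat => real => ('q \<times> real list) list => arrays" where
 "mvstate n s h = fold (%(x, v). mvupd n s x v) (zip mvtasks (map snd h)) arr0"

definition mvask :: "nat => real => ((clause => nat) \<times> nat set set, real list) history => ((clause => nat) \<times> nat set set) pmf" where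
 "mvask n s h = return_pmf (if length h < 8 & (r = 1 --> length h = 0) then vcode n (mvtasks ! length h) (mvstate n s h) else (%_. 0), Pow {..<n ^ a})"

definition "mvcalls = (if r = 1 then 1 else (8::nat))"

definition mvguess :: "nat => real => ('q \<times> real list) list => assignment pmf" where
 "mvguess n s h = complete_answer n (%v. if r = 1 then if v \<in> rng n RA then mvstate n s h 1 [v] else 0 else mvstate n s h 4 [v])"

lemma mvtask_in:
 assumes "24 <= n" "j < mvcalls"
 shows "fst (mvtasks ! j) \<in> insert T1 (if r = 1 then {} else {T2, FS RA, FS RB, FS RC, GS RA, GS RB, GS RC})"
proof (cases "r = 1")
 case True
 then have "j = 0" using assms(2) unfolding mvcalls_def by simp
 then show ?thesis by (simp add: mvtasks_def)
next
 case False
 then have "j < 8" using assms(2) unfolding mvcalls_def by simp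
 then have "j \<in> {0, 1, 2, 3, 4, 5, 6, 7}" by auto
 then show ?thesis using False by (auto simp: mvtasks_def One_nat_def numeral_eq_Suc)
qed

lemma mv_specs:
 assumes "24 <= n" "sp \<in> insert T1 (if r = 1 then {} else {T2, FS RA, FS RB, FS RC, GS RA, GS RB, GS RC})"
 shows "wf_spec k Q n sp" "2 * card (tkeys n sp) + 1 <= n ^ a"
proof -
 have "\<exists>src dst. (sp, src, dst) \<in> set (tasks (phases n))"
 proof -
 have "M n > 0" using K assms(1) sq_ge(1)[of n] by (simp add: M_def)
 moreover then have "Mb n > 0" using K lg_ge(1)[of n] by (simp add: Mb_def)
 moreover have "\<exists>src dst m. m > 0 & (sp, src, dst, m) \<in> set (phases n)"
 using assms(2) calculation by (auto simp: phases_def final_phases_def split: if_splits)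
 ultimately show ?thesis by (fastforce simp: tasks_def)
 qed
 then obtain src dst where t: "(sp, src, dst) \<in> set (tasks (phases n))" by blast
 show "wf_spec k Q n sp" by (rule wf_tasks[OF _ t]) (use assms(1) in simp)
 show "2 * card (tkeys n sp) + 1 <= n ^ a" by (rule card_tkeys[OF assms(1) t])
qed

lemma mvask_queries: "24 <= n ==> set_pmf (mvask n s h) \<subseteq> mvstat_queries k (n ^ a) n"
proof -
 assume n: "24 <= n"
 have "0 < n ^ a" using n by simp
 moreover have "vcode n (mvtasks ! length h) (mvstate n s h) C < n ^ a" if "length h < mvcalls" for C
 proof -
 obtain sp src dst where x: "mvtasks ! length h = (sp, src, dst)" by (cases "mvtasks ! length h")
 show ?thesis unfolding x using mvtask_in[OF n that] mv_specs(2)[OF n, of sp] by (intro vcode_less) (simp add: x)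
 qed
 moreover have "length h < 8 & (r = 1 --> length h = 0) \<longleftrightarrow> length h < mvcalls" by (auto simp: mvcalls_def)
 ultimately show ?thesis by (auto simp: mvask_def mvstat_queries_def mstat_queries_def)
qed

lemma mvstate_snoc:
 assumes "length h < 8"
 shows "mvstate n s (h @ [(y, v)]) = mvupd n s (mvtasks ! length h) v (mvstate n s h)"
proof -
 have l: "length h < length mvtasks" using assms by (simp add: mvtasks_def)
 have "zip (take (length h) mvtasks) (map snd h) = zip mvtasks (map snd h)" using take_zip[of "length h" mvtasks "map snd h"] l by simp
 then have "zip mvtasks (map snd h @ [v]) = zip mvtasks (map snd h) @ [(mvtasks ! length h, v)]"
 using l by (subst (1) id_take_nth_drop[OF l]) (simp add: zip_append1)
 then show ?thesis by (simp add: mvstate_def)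
qed

lemma mv_induct:
 assumes n: "24 <= n" and orc: "orc \<in> mvstat_oracles k (n ^ a) s n D" and q: "q <= mvcalls"
 and I0: "I 0 arr0"
 and step: "!!j sp i i' arr v. j < mvcalls ==> mvtasks ! j = (sp, i, i') ==> I j arr ==>
 mvstat_answer (n ^ a) s D (vcode n (sp, i, i') arr) (Pow {..<n ^ a}) v ==> I (Suc j) (mvupd n s (sp, i, i') v arr)"
 shows "h \<in> set_pmf (transcript (mvask n s) orc q) ==> I q (mvstate n s h)"
 using q
proof (induction q arbitrary: h)
 case 0
 then show ?case using I0 by (simp add: mvstate_def)
next
 case (Suc q)
 from Suc.prems(1) obtain h' x v where h: "h' \<in> set_pmf (transcript (mvask n s) orc q)" "x \<in> set_pmf (mvask n s h')"
 "v \<in> set_pmf (orc h' x)" "h = h' @ [(x, v)]" by auto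
 have l: "length h' = q" by (rule transcript_length[OF h(1)])
 have q8: "q < 8" "r = 1 --> q = 0" "q < mvcalls" using Suc.prems(2) by (auto simp: mvcalls_def split: if_splits)
 obtain sp i i' where t: "mvtasks ! q = (sp, i, i')" by (cases "mvtasks ! q")
 have x: "x = (vcode n (sp, i, i') (mvstate n s h'), Pow {..<n ^ a})" using h(2) q8 by (simp add: mvask_def l t)
 have "x \<in> mvstat_queries k (n ^ a) n" using mvask_queries[OF n, of s h'] h(2) by blast
 then have "mvstat_answer (n ^ a) s D (vcode n (sp, i, i') (mvstate n s h')) (Pow {..<n ^ a}) v"
 using orc h(3) unfolding mvstat_oracles_def x by blast
 then have "I (Suc q) (mvupd n s (sp, i, i') v (mvstate n s h'))"
 using Suc.IH[OF h(1)] q8 t by (intro step) auto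
 then show ?case unfolding h(4) mvstate_snoc[of h', unfolded l, OF q8(1)] t .
qed

text \<open>256 is the square of 16: it makes the tolerance at most a sixteenth of bias times vote
  probability. The conditions with \<open>n\<close> serve the queries for single variables, where a
  target is voted for with probability of order \<open>1 / n\<close>.\<close>

definition mv_large :: "nat => real => bool" where
 "mv_large n s \<longleftrightarrow> k <= n & 24 * (r + length ps' + 2) <= n & 0 < s & 256 * c * real n ^ b / d\<^sup>2 <= s &
 (2 <= r --> 256 * c * real n / d\<^sup>2 <= s & 256 * 4 ^ length ps' * real n / d'\<^sup>2 <= s)"

end

lemma mvtol_le:
 assumes "0 < x" "0 < s" "0 < d" "d <= 1" "256 <= s * x * d\<^sup>2"
 shows "mvtol s x <= d * x / 16"
proof -
 have "d\<^sup>2 <= d" using assms by (simp add: power2_eq_square mult_left_le)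
 then have "s * x * d\<^sup>2 <= s * x * d" using assms by (intro mult_left_mono) auto
 then have "16 <= s * x * d" using assms by linarith
 then have 1: "1 / s <= d * x / 16" using assms by (simp add: field_simps)
 have "x * 256 <= x * (s * x * d\<^sup>2)" using assms by (intro mult_left_mono) auto
 then have "x / s <= (d * x / 16)\<^sup>2" using assms by (simp add: field_simps power2_eq_square)
 then have "sqrt (x / s) <= d * x / 16" using assms by (intro real_le_lsqrt) auto
 then show ?thesis using 1 by (simp add: mvtol_def)
qed

locale mv_at = sampler k Q r ps ps' K1 K2 + planted_clauses k Q n sga
 for k Q r ps ps' K1 K2 n sga + fixes s :: real
 assumes mv: "mv_large n s"
begin

section \<open>Correctness of the MVSTAT algorithm\<close>

lemma n_mv: "24 * (r + length ps' + 2) <= n" "24 <= n" "3 <= n" "real n > 0" "s > 0"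
 using mv by (auto simp: mv_large_def)

lemma N1_mv: "real n ^ a <= c * real (card (AT n))"
proof -
 have "24 * real r + 48 <= real n" using n_mv(1) by (auto simp: distrib_left)
 moreover have "real a <= real r" using ab(1) by auto
 moreover have "real n / 3 - 1 <= real (n div 3)" by linarith
 moreover have "card (rng n RA) = n div 3" by (auto simp: rng_simps)
 ultimately have "real n ^ a <= 4 ^ a * real (card (AT n))"
 unfolding AT_def by (intro card_tuples_quarter) auto
 also have "... <= c * real (card (AT n))" unfolding c_def using ab(1) by (intro mult_right_mono power_increasing) auto
 finally show ?thesis .
qed

lemma Pn_bounds: "wf_spec k Q n sp ==> 0 < Pn n sp" "Pn n sp <= real n ^ length (apos sp)"
proof -
 show "Pn n sp <= real n ^ length (apos sp)"
 unfolding Pn_def using card_tuples_le[of "{1..n}" "length (apos sp)"] by (simp flip: of_nat_power)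
 assume wf: "wf_spec k Q n sp"
 have "length (apos sp) <= k"
 using wf card_mono[of "{..<k}" "set (apos sp)"] by (auto simp: wf_spec_def distinct_card)
 then have "tuples (length (apos sp)) {1..n} ~= {}" using kn by (intro tuples_nonempty) auto
 then show "0 < Pn n sp" by (simp add: Pn_def card_gt_0_iff)
qed

lemma wf12: "wf_spec k Q n T1" "wf_spec k Q n T2" using wf_T1 wf_T2 n_mv by auto

lemma len12: "length (apos T1) = r" "length (apos T2) = r"
 using ps(3) by (auto simp: T1_def T2_def two_spec_pos)

lemma P12: "Pn n T1 = Pn n T2" by (simp add: Pn_def len12)

lemma d_le: "d <= 1" "d' <= 1"
 using bias_le_1[OF wf12(1)] bias_le_1[OF wf_GS[of n RU]] rng_T(4)[of n] vbias_specs by auto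

lemma AT_pos: "0 < real (card (AT n))"
proof -
 have "0 < real n ^ a" using n_mv by simp
 then show ?thesis using N1_mv c_ge by (smt (verit) mult_nonneg_nonpos)
qed

lemma tol1_le: "tol1 n s <= d * (real (card (AT n)) / Pn n T1) / 16"
 unfolding tol1_def
proof (rule mvtol_le)
 let ?x = "real (card (AT n)) / Pn n T1"
 show "0 < ?x" using AT_pos Pn_bounds(1)[OF wf12(1)] by simp
 have "real n ^ a / c <= real (card (AT n))" using N1_mv c_ge by (simp add: field_simps)
 then have "(real n ^ a / c) / real n ^ r <= ?x"
 using Pn_bounds(1)[OF wf12(1)] AT_pos Pn_bounds(2)[of T1] unfolding len12(1) by (intro frac_le) simp_all
 moreover have "(real n ^ a / c) / real n ^ r = 1 / (c * real n ^ b)"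
 proof -
 have "real n ^ r = real n ^ a * real n ^ b" using power_add[of "real n" a b] unfolding ab(1) .
 then show ?thesis using n_mv by simp
 qed
 ultimately have x: "1 / (c * real n ^ b) <= ?x" by simp
 have "256 = 256 * c * real n ^ b / d\<^sup>2 * (1 / (c * real n ^ b)) * d\<^sup>2" using c_ge n_mv d_pos by simp
 also have "... <= s * ?x * d\<^sup>2"
 proof (intro mult_right_mono mult_mono)
 show "256 * c * real n ^ b / d\<^sup>2 <= s" using mv by (simp add: mv_large_def)
 qed (use x c_ge n_mv d_pos in simp_all)
 finally show "256 <= s * ?x * d\<^sup>2" .
qed (use n_mv d_pos d_le in simp_all)

lemma start_mv: "tsup (BT n) (arr0 0) = 1" "tcor sga (BT n) (arr0 0) = aprod sga [1..<b + 1]" "aprod sga [1..<b + 1] \<in> {-1, 1}"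
proof -
 have "b <= r" using ab(1) by simp
 then have "b * 3 <= 24 * (r + length ps' + 2)" by simp
 then have "b * 3 <= n" using n_mv(1) by (rule order_trans)
 then have "b <= n div 3" by (simp add: less_eq_div_iff_mult_less_eq)
 then have J: "[1..<b + 1] \<in> BT n" by (auto simp: BT_def tuples_def rng_simps)
 show "aprod sga [1..<b + 1] \<in> {-1, 1}"
 using J rng_T(2)[of n] by (intro aprod_sign[OF sga]) (auto simp: BT_def tuples_def)
 have "tcor sga (BT n) (arr0 0) = (\<Sum>w\<in>BT n. if w = [1..<b + 1] then aprod sga w else 0)"
 unfolding tcor_def arr0_def by (intro sum.cong) auto
 also have "... = aprod sga [1..<b + 1]" using J by (simp add: BT_def)
 finally show "tcor sga (BT n) (arr0 0) = aprod sga [1..<b + 1]" .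
 have "{w \<in> BT n. arr0 0 w ~= 0} = {[1..<b + 1]}" using J by (auto simp: arr0_def)
 then show "tsup (BT n) (arr0 0) = 1" by (simp add: tsup_def)
qed

definition "e0 = aprod sga [1..<b + 1]"

lemma tkeys12: "tkeys n T1 = AT n" "tkeys n T2 = BT n"
 using lengths by (auto simp: tkeys_def T1_def T2_def two_spec_def AT_def BT_def)

lemma aprod_AT: "K \<in> AT n ==> aprod sga K \<in> {-1, 1}"
 using rng_T(1)[OF n_mv(3)] by (intro aprod_sign[OF sga]) (auto simp: AT_def tuples_def)

text \<open>The planted vector, up to the sign \<open>e0\<close>, is itself consistent, so the
  accepted vector has the same subset sums up to twice the tolerance. Applied to the two sets of
  disagreement, this bounds each by an eighth of \<open>AT n\<close>, which leaves at least half of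
  the full correlation.\<close>

lemma mv_first:
 assumes ans: "mvstat_answer (n ^ a) s D (vcode n (T1, 0, 1) arr0) (Pow {..<n ^ a}) v"
 defines "y \<equiv> mvupd n s (T1, 0, 1) v arr0 1"
 shows "(\<forall>K. y K \<in> {-1, 1}) & real (card (AT n)) / 2 <= ri (e0 * tcor sga (AT n) y)"
proof -
 define P where "P = Pn n T1"
 have P0: "P > 0" using Pn_bounds(1)[OF wf12(1)] by (simp add: P_def)
 have finA: "finite (AT n)" by (simp add: AT_def)
 \<comment> \<open>\<open>consistent\<close> asks for signs at all keys, also where
   \<open>aprod\<close> need not be one; the value 1 outside \<open>AT n\<close> is
   arbitrary.\<close>
 define y0 where "y0 K = (if K \<in> AT n then e0 * aprod sga K else 1)" for K
 have y0: "y0 K \<in> {-1, 1}" for K using start_mv(3) aprod_AT[of K] by (auto simp: y0_def e0_def)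
 have dj: "rng n RA \<inter> rng n RB = {}" by (rule rng_T)
 have pr: "prb D {C. vx n T1 (arr0 0) C K = 1} = (1 + d * ri (y0 K)) / 2 / P" if "K \<in> AT n" for K
 proof -
 have K: "K \<in> tkeys n T1" using that by (simp add: tkeys12)
 have "ssup n T1 (arr0 0) K = 1" "scor n T1 sga (arr0 0) K = e0"
 using two_spec_src(2,3)[of K n k Q "take a ps" "drop a ps" RA RB] K dj start_mv(1,2) lengths
 by (simp_all add: T1_def BT_def e0_def)
 then show ?thesis using prob_plus[OF wf12(1) K, of "arr0 0"] that
 by (simp add: vbias_specs P_def Pn_def y0_def mult_ac)
 qed
 have L: "2 * card (tkeys n T1) + 1 <= n ^ a" by (rule mv_specs(2)[OF n_mv(2)]) simp
 have con0: "consistent n (tol1 n s) v y0"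
 unfolding consistent_def
 proof (intro conjI allI impI)
 show "y0 K \<in> {-1, 1}" for K by (rule y0)
 fix T assume T: "T \<subseteq> AT n"
 have e: "(\<Sum>K\<in>T. prb D {C. vx n T1 (arr0 0) C K = 1}) = (\<Sum>K\<in>T. (1 + d * ri (y0 K)) / 2 / P)"
 using T pr by (intro sum.cong) auto
 have "(\<Sum>K\<in>T. prb D {C. vx n T1 (arr0 0) C K = 1}) <= (\<Sum>K\<in>T. 1 / P)"
 unfolding e
 proof (rule sum_mono)
 fix K
 have "(1 + d * ri (y0 K)) / 2 <= 1" using y0[of K] d_le(1) d_pos by auto
 then show "(1 + d * ri (y0 K)) / 2 / P <= 1 / P" using P0 by (intro divide_right_mono) auto
 qed
 also have "... <= real (card (AT n)) / P" using P0 card_mono[OF finA T] by (simp add: divide_right_mono)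
 finally have x: "(\<Sum>K\<in>T. prb D {C. vx n T1 (arr0 0) C K = 1}) <= real (card (AT n)) / P" .
 show "\<bar>(\<Sum>K\<in>T. v ! kcode n T1 K) - (\<Sum>K\<in>T. (1 + d * ri (y0 K)) / 2 / Pn n T1)\<bar> <= tol1 n s"
 using answer_sum[OF wf12(1) _ L n_mv(5) ans x] T unfolding e tkeys12 by (simp add: tol1_def P_def)
 qed
 have yeq: "y = (SOME y. consistent n (tol1 n s) v y)" by (simp add: y_def mvupd_def)
 have con: "consistent n (tol1 n s) v y" unfolding yeq by (rule someI[of _ y0]) (rule con0)
 have ypm: "y K \<in> {-1, 1}" for K using con by (auto simp: consistent_def)
 have close: "\<bar>\<Sum>K\<in>T. d * (ri (y K) - ri (y0 K)) / 2 / P\<bar> <= 2 * tol1 n s" if T: "T \<subseteq> AT n" for T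
 proof -
 have "(\<Sum>K\<in>T. d * (ri (y K) - ri (y0 K)) / 2 / P)
 = (\<Sum>K\<in>T. (1 + d * ri (y K)) / 2 / P) - (\<Sum>K\<in>T. (1 + d * ri (y0 K)) / 2 / P)"
 unfolding sum_subtractf[symmetric] by (intro sum.cong) (auto simp: diff_divide_distrib[symmetric] algebra_simps)
 moreover have "\<bar>(\<Sum>K\<in>T. v ! kcode n T1 K) - (\<Sum>K\<in>T. (1 + d * ri (y K)) / 2 / P)\<bar> <= tol1 n s"
 "\<bar>(\<Sum>K\<in>T. v ! kcode n T1 K) - (\<Sum>K\<in>T. (1 + d * ri (y0 K)) / 2 / P)\<bar> <= tol1 n s"
 using con con0 T by (auto simp: consistent_def P_def)
 ultimately show ?thesis by linarith
 qed
 define U where "U e = {K \<in> AT n. y K = e & y0 K = - e}" for e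
 have U: "real (card (U e)) <= real (card (AT n)) / 8" if e: "e \<in> {-1, 1}" for e
 proof -
 have "(\<Sum>K\<in>U e. d * (ri (y K) - ri (y0 K)) / 2 / P) = (\<Sum>K\<in>U e. ri e * (d / P))"
 by (intro sum.cong) (auto simp: U_def)
 moreover have "... = real (card (U e)) * (ri e * (d / P))" by simp
 moreover have "U e \<subseteq> AT n" by (auto simp: U_def)
 ultimately have "\<bar>real (card (U e)) * (ri e * (d / P))\<bar> <= 2 * tol1 n s"
 using close[of "U e"] by metis
 then have "real (card (U e)) * (d / P) <= 2 * tol1 n s" using e d_pos P0 by (auto simp: abs_mult)
 also have "... <= real (card (AT n)) / 8 * (d / P)" using tol1_le by (simp add: P_def mult.commute)
 finally show ?thesis using d_pos P0 by (intro mult_right_le_imp_le[of "real (card (U e))" "d / P"]) auto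
 qed
 have "ri (e0 * tcor sga (AT n) y) = (\<Sum>K\<in>AT n. ri (y0 K * y K))"
 proof -
 have sy: "sgn (y K) = y K" for K using ypm[of K] by auto
 have "e0 * tcor sga (AT n) y = (\<Sum>K\<in>AT n. y0 K * y K)"
 unfolding tcor_def sum_distrib_left by (intro sum.cong) (auto simp: y0_def sy)
 then show ?thesis by simp
 qed
 also have "... = (\<Sum>K\<in>AT n. 1 - 2 * ((if K \<in> U 1 then 1 else 0) + (if K \<in> U (-1) then 1 else 0)))"
 proof (rule sum.cong)
 fix K assume "K \<in> AT n"
 then show "ri (y0 K * y K) = 1 - 2 * ((if K \<in> U 1 then 1 else 0) + (if K \<in> U (-1) then 1 else 0))"
 using ypm[of K] y0[of K] by (auto simp: U_def)
 qed simp
 also have "... = real (card (AT n)) - 2 * (real (card (U 1)) + real (card (U (-1))))"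
 proof -
 have c: "(\<Sum>K\<in>AT n. if K \<in> U e then 1 else 0) = real (card (U e))" for e
 proof -
 have "AT n \<inter> U e = U e" by (auto simp: U_def)
 then show ?thesis using finA by (simp add: sum.If_cases)
 qed
 show ?thesis by (simp add: sum_subtractf sum.distrib c flip: sum_distrib_left)
 qed
 finally have "real (card (AT n)) / 2 <= ri (e0 * tcor sga (AT n) y)" using U[of 1] U[of "-1"] by simp
 then show ?thesis using ypm by blast
qed

lemma sgn_threshold: "sgn (x - t) = ri e ==> sgn (if x > t then 1 else if x < t then - 1 else (0::int)) = e" for x t :: real
 by (auto simp: sgn_if split: if_splits)

text \<open>The source now has full support and at least half of the full correlation, so at each
  target the deviation is at least \<open>d * card (AT n) / 4 / P\<close>, against a tolerance of a
  quarter of this.\<close>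

lemma mv_second:
 assumes y: "\<forall>K. arr 1 K \<in> {-1, 1}" "real (card (AT n)) / 2 <= ri (e0 * tcor sga (AT n) (arr 1))"
 and ans: "mvstat_answer (n ^ a) s D (vcode n (T2, 1, 2) arr) (Pow {..<n ^ a}) v" and r2: "2 <= r"
 shows "\<exists>e\<in>{-1, 1}. \<forall>w\<in>BT n. sgn (mvupd n s (T2, 1, 2) v arr 2 w) = e * aprod sga w"
proof -
 define A where "A = tcor sga (AT n) (arr 1)"
 have e0: "e0 \<in> {-1, 1}" using start_mv(3) by (simp add: e0_def)
 have A: "real (card (AT n)) / 2 <= \<bar>ri A\<bar>" using y(2) e0 by (auto simp: A_def)
 have A0: "A ~= 0" using A AT_pos by auto
 have dj: "rng n RB \<inter> rng n RA = {}" by (rule rng_T)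
 have sup: "tsup (AT n) (arr 1) = card (AT n)"
 proof -
 have "arr 1 w ~= 0" for w using spec[OF y(1), of w] by auto
 then show ?thesis by (simp add: tsup_def)
 qed
 have L: "2 * card (tkeys n T2) + 1 <= n ^ a" by (rule mv_specs(2)[OF n_mv(2)]) (use r2 in auto)
 have P0: "Pn n T2 > 0" using Pn_bounds(1)[OF wf12(2)] .
 have "sgn (mvupd n s (T2, 1, 2) v arr 2 w) = sgn A * aprod sga w" if w: "w \<in> BT n" for w
 proof -
 have K: "w \<in> tkeys n T2" using w by (simp add: tkeys12)
 have src: "ssup n T2 (arr 1) w = card (AT n)" "scor n T2 sga (arr 1) w = A"
 using two_spec_src(2,3)[of w n k Q "drop a ps" "take a ps" RB RA] K dj lengths sup
 by (simp_all add: T2_def AT_def A_def)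
 have "mvtol s (real (card (AT n)) / Pn n T2) <= d * (real (card (AT n)) / Pn n T2) / 16"
 using tol1_le by (simp add: tol1_def P12)
 also have "... < d * (real (card (AT n)) / 2) / 2 / Pn n T2" using d_pos AT_pos P0 by (simp add: field_simps)
 also have "... <= d * \<bar>ri A\<bar> / 2 / Pn n T2" using A d_pos P0 by (intro divide_right_mono mult_left_mono) auto
 finally have tol: "mvtol s (real (ssup n T2 (arr 1) w) / Pn n T2) < vbias k Q T2 * \<bar>ri (scor n T2 sga (arr 1) w)\<bar> / 2 / Pn n T2"
 by (simp add: src vbias_specs)
 have "sgn (v ! kcode n T2 w - real (ssup n T2 (arr 1) w) / 2 / Pn n T2) = ri (sgn A * aprod sga w)"
 using answer_exact[OF wf12(2) K L n_mv(5) ans _ tol] by (simp add: Pn_def src)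
 from sgn_threshold[OF this] show ?thesis using K by (simp add: mvupd_def)
 qed
 moreover have "sgn A \<in> {-1, 1}" using A0 by (auto simp: sgn_if)
 ultimately show ?thesis by blast
qed

lemma mv_single:
 fixes qs sfx X R2 i
 defines "sp \<equiv> one_spec k Q qs sfx X R2"
 assumes wf: "wf_spec k Q n sp" and qs: "qs ~= []" and L: "2 * card (tkeys n sp) + 1 <= n ^ a" and i: "i ~= 0"
 and src: "!!v. v \<in> rng n R2 ==> sgn (arr i (v # sfx)) = \<epsilon> * sga v" and \<epsilon>: "\<epsilon> \<in> {-1, 1}"
 and card: "!!v. real n ^ (length qs - 1) <= C * real (card (skeys n sp [v]))" and C: "C > 0"
 and s: "256 * C * real n / (vbias k Q sp)\<^sup>2 <= s"
 and ans: "mvstat_answer (n ^ a) s D (vcode n (sp, i, i') arr) (Pow {..<n ^ a}) v"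
 and x: "x \<in> rng n X"
 shows "sgn (mvupd n s (sp, i, i') v arr i' [x]) = \<epsilon> ^ (length qs - 1) * sga x"
proof -
 have K: "[x] \<in> tkeys n sp" using x by (simp add: tkeys_def sp_def one_spec_def tuples_def)
 define S where "S = card (skeys n sp [x])"
 have S0: "0 < C * real S" using card[of x] n_mv by (auto simp: S_def intro: less_le_trans[of 0 "real n ^ (length qs - 1)"])
 then have S: "S > 0" using C by (simp add: zero_less_mult_iff)
 then have ne: "skeys n sp [x] ~= {}" by (auto simp: S_def)
 have R2: "rng n R2 \<subseteq> {1..n}" using wf by (auto simp: wf_spec_def sp_def one_spec_def)
 have eps: "\<epsilon> ^ j \<in> {-1, 1}" for j using \<epsilon> by (induction j) auto
 note os = one_spec_src[OF src \<epsilon> sga R2 ne[unfolded sp_def], folded sp_def]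
 define e1 where "e1 = \<epsilon> ^ (length qs - 1)"
 have e1: "e1 \<in> {-1, 1}" unfolding e1_def by (rule eps)
 have sup: "ssup n sp (arr i) [x] = S" using os(1) by (simp add: S_def)
 have cor: "scor n sp sga (arr i) [x] = e1 * int S" using os(2) by (simp add: S_def e1_def)
 have sg: "sgn (scor n sp sga (arr i) [x]) = e1" unfolding cor using e1 S by (auto simp: sgn_mult)
 have ab_cor: "\<bar>ri (scor n sp sga (arr i) [x])\<bar> = real S" unfolding cor using e1 by auto
 have vb: "0 < vbias k Q sp" using wf by (auto simp: wf_spec_def vbias_def)
 have P0: "Pn n sp > 0" using Pn_bounds(1)[OF wf] .
 have len: "length (apos sp) = length qs" using qs by (simp add: sp_def one_spec_pos)
 have x0: "1 / (C * real n) <= real S / Pn n sp"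
 proof -
 have "real n ^ (length qs - 1) / C <= real S" using card[of x] C by (simp add: S_def field_simps)
 then have "(real n ^ (length qs - 1) / C) / real n ^ length qs <= real S / Pn n sp"
 using P0 Pn_bounds(2)[of sp] by (intro frac_le) (auto simp: len)
 moreover have "real n ^ length qs = real n * real n ^ (length qs - 1)" using qs by (cases qs) auto
 ultimately show ?thesis using n_mv by (simp add: field_simps)
 qed
 have "mvtol s (real S / Pn n sp) <= vbias k Q sp * (real S / Pn n sp) / 16"
 proof (rule mvtol_le)
 have "256 = 256 * C * real n / (vbias k Q sp)\<^sup>2 * (1 / (C * real n)) * (vbias k Q sp)\<^sup>2" using C n_mv vb by simp
 also have "... <= s * (real S / Pn n sp) * (vbias k Q sp)\<^sup>2"
 using s x0 C n_mv vb by (intro mult_right_mono mult_mono) auto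
 finally show "256 <= s * (real S / Pn n sp) * (vbias k Q sp)\<^sup>2" .
 qed (use S P0 n_mv vb bias_le_1[OF wf] in auto)
 also have "... < vbias k Q sp * real S / 2 / Pn n sp" using vb S P0 by (simp add: field_simps)
 finally have tol: "mvtol s (real (ssup n sp (arr i) [x]) / Pn n sp) < vbias k Q sp * \<bar>ri (scor n sp sga (arr i) [x])\<bar> / 2 / Pn n sp"
 unfolding sup ab_cor .
 have "sgn (v ! kcode n sp [x] - real (ssup n sp (arr i) [x]) / 2 / Pn n sp) = ri (e1 * sga x)"
 using answer_exact[OF wf K L n_mv(5) ans _ tol] sg by (simp add: Pn_def aprod_def)
 from sgn_threshold[OF this] show ?thesis using K i by (simp add: mvupd_def e1_def)
qed

lemma card_skeys_FS:
 assumes b1: "1 <= b"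
 shows "real n ^ (length ps - 1) <= c * real (card (skeys n (FS X) [v]))"
proof -
 have sub: "tuples (length ps - 1) ({b..n div 3} - {v}) \<subseteq> skeys n (FS X) [v]"
 by (auto simp: FS_def skeys_def one_spec_pos tuples_def) (auto simp: one_spec_def rng_simps)
 have cd: "real (n div 3) - real b <= real (card ({b..n div 3} - {v}))" by (cases "v \<in> {b..n div 3}") auto
 have big: "24 * real r + 24 * real (length ps') + 48 <= real n" using n_mv(1) by (auto simp: distrib_left)
 have "real n ^ (length ps - 1) <= 4 ^ (length ps - 1) * real (card (tuples (length ps - 1) ({b..n div 3} - {v})))"
 proof (rule card_tuples_quarter)
 have "real b <= real r" "real (length ps - 1) <= real r" using ab(1) ps(3) by auto
 moreover have "real n / 3 - 1 <= real (n div 3)" by linarith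
 moreover have "x / 4 <= y - z" if "b' <= r'" "z <= r'" "q' - b' <= y" "24 * r' + 24 * w + 48 <= x" "x / 3 - 1 <= q'" "0 <= w"
 for b' r' z q' y x w :: real using that by linarith
 ultimately show "real n / 4 <= real (card ({b..n div 3} - {v})) - real (length ps - 1)"
 using cd big of_nat_0_le_iff by blast
 qed simp
 moreover have "card (tuples (length ps - 1) ({b..n div 3} - {v})) <= card (skeys n (FS X) [v])"
 by (rule card_mono[OF _ sub]) (simp add: skeys_def)
 then have "4 ^ (length ps - 1) * real (card (tuples (length ps - 1) ({b..n div 3} - {v}))) <= c * real (card (skeys n (FS X) [v]))"
 proof (intro mult_mono)
 show "4 ^ (length ps - 1) <= c" unfolding c_def using ps(3) by (intro power_increasing) auto
 qed (use c_ge in auto)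
 ultimately show ?thesis by linarith
qed

lemma card_skeys_GS: "real n ^ (length ps' - 1) <= 4 ^ length ps' * real (card (skeys n (GS X) [v]))"
proof -
 have sub: "tuples (length ps' - 1) ({1..n} - {v}) \<subseteq> skeys n (GS X) [v]"
 by (auto simp: GS_def skeys_def one_spec_pos tuples_def) (auto simp: one_spec_def rng_simps)
 have cd: "real n - 1 <= real (card ({1..n} - {v}))" by (cases "v \<in> {1..n}") auto
 have big: "24 * real r + 24 * real (length ps') + 48 <= real n" using n_mv(1) by (auto simp: distrib_left)
 have "real n ^ (length ps' - 1) <= 4 ^ (length ps' - 1) * real (card (tuples (length ps' - 1) ({1..n} - {v})))"
 by (rule card_tuples_quarter) (use cd big in auto)
 moreover have "card (tuples (length ps' - 1) ({1..n} - {v})) <= card (skeys n (GS X) [v])"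
 by (rule card_mono[OF _ sub]) (simp add: skeys_def)
 then have "4 ^ (length ps' - 1) * real (card (tuples (length ps' - 1) ({1..n} - {v}))) <= 4 ^ length ps' * real (card (skeys n (GS X) [v]))"
 by (intro mult_mono power_increasing) auto
 ultimately show ?thesis by linarith
qed

definition "JF V arr \<longleftrightarrow> (\<exists>e\<in>{-1, 1}. (\<forall>v\<in>rng n (RB' b). sgn (arr 2 (v # [1..<b])) = e * sga v) &
 (\<forall>v\<in>V. sgn (arr 3 [v]) = e ^ (r - 1) * sga v))" for V and arr :: arrays
definition "JG V arr \<longleftrightarrow> (\<exists>e\<in>{-1, 1}. (\<forall>v\<in>{1..n}. sgn (arr 3 [v]) = e * sga v) &
 (\<forall>v\<in>V. sgn (arr 4 [v]) = e ^ (length ps' - 1) * sga v))" for V and arr :: arrays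

lemma mv_stepF:
 assumes I: "JF V arr" and r2: "2 <= r" and X: "X \<in> {RA, RB, RC}" and V: "V \<inter> rng n X = {}"
 and ans: "mvstat_answer (n ^ a) s D (vcode n (FS X, 2, 3) arr) (Pow {..<n ^ a}) v"
 shows "JF (V \<union> rng n X) (mvupd n s (FS X, 2, 3) v arr)"
proof -
 obtain e where e: "e \<in> {-1, 1}" "!!v. v \<in> rng n (RB' b) ==> sgn (arr 2 (v # [1..<b])) = e * sga v"
 "!!v. v \<in> V ==> sgn (arr 3 [v]) = e ^ (r - 1) * sga v" using I unfolding JF_def by blast
 have b1: "1 <= b" using ab(4)[OF r2] .
 have sp: "wf_spec k Q n (FS X)" "2 * card (tkeys n (FS X)) + 1 <= n ^ a"
 using mv_specs[OF n_mv(2), of "FS X"] X r2 by auto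
 have psne: "ps ~= []" using ps r by auto
 have new: "sgn (mvupd n s (FS X, 2, 3) v arr 3 [x]) = e ^ (r - 1) * sga x" if "x \<in> rng n X" for x
 using mv_single[OF sp(1)[unfolded FS_def] psne sp(2)[unfolded FS_def] _ e(2,1) card_skeys_FS[OF b1, of X, unfolded FS_def] _ _ ans[unfolded FS_def] that]
 mv r2 vbias_specs(3)[of X] c_ge by (simp add: FS_def mv_large_def ps(3))
 have old: "mvupd n s (FS X, 2, 3) v arr 3 [x] = arr 3 [x]" if "x \<in> V" for x
 using that V by (auto simp: mvupd_def tkeys_def FS_def one_spec_def tuples_def)
 have "mvupd n s (FS X, 2, 3) v arr 2 = arr 2" by (simp add: mvupd_def)
 then show ?thesis unfolding JF_def using e new old by (intro bexI[of _ e]) auto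
qed

lemma mv_stepG:
 assumes I: "JG V arr" and r2: "2 <= r" and X: "X \<in> {RA, RB, RC}" and V: "V \<inter> rng n X = {}"
 and ans: "mvstat_answer (n ^ a) s D (vcode n (GS X, 3, 4) arr) (Pow {..<n ^ a}) v"
 shows "JG (V \<union> rng n X) (mvupd n s (GS X, 3, 4) v arr)"
proof -
 obtain e where e: "e \<in> {-1, 1}" "!!v. v \<in> {1..n} ==> sgn (arr 3 [v]) = e * sga v"
 "!!v. v \<in> V ==> sgn (arr 4 [v]) = e ^ (length ps' - 1) * sga v" using I unfolding JG_def by blast
 have sp: "wf_spec k Q n (GS X)" "2 * card (tkeys n (GS X)) + 1 <= n ^ a"
 using mv_specs[OF n_mv(2), of "GS X"] X r2 by auto
 have src: "!!v. v \<in> rng n RU ==> sgn (arr 3 (v # [])) = e * sga v" using e(2) by (simp add: rng_simps)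
 have new: "sgn (mvupd n s (GS X, 3, 4) v arr 4 [x]) = e ^ (length ps' - 1) * sga x" if "x \<in> rng n X" for x
 using mv_single[OF sp(1)[unfolded GS_def] ps'(3) sp(2)[unfolded GS_def] _ src e(1) card_skeys_GS[of X, unfolded GS_def] _ _ ans[unfolded GS_def] that]
 mv r2 vbias_specs(4)[of X] by (simp add: GS_def mv_large_def)
 have old: "mvupd n s (GS X, 3, 4) v arr 4 [x] = arr 4 [x]" if "x \<in> V" for x
 using that V by (auto simp: mvupd_def tkeys_def GS_def one_spec_def tuples_def)
 have "mvupd n s (GS X, 3, 4) v arr 3 = arr 3" by (simp add: mvupd_def)
 then show ?thesis unfolding JG_def using e new old by (intro bexI[of _ e]) auto
qed

lemma JF_JG: "JF {1..n} arr ==> JG {} arr"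
proof -
 assume "JF {1..n} arr"
 then obtain e where e: "e \<in> {-1, 1}" "\<forall>v\<in>{1..n}. sgn (arr 3 [v]) = e ^ (r - 1) * sga v" unfolding JF_def by blast
 have "e ^ j \<in> {-1, 1}" for j using e(1) by (induction j) auto
 then have "e ^ (r - 1) \<in> {-1, 1}" .
 then show ?thesis unfolding JG_def using e(2) by blast
qed

definition "MI j arr = (if j = 0 then arr = arr0 else if j = 1 then (\<forall>K. arr 1 K \<in> {-1, 1}) & real (card (AT n)) / 2 <= ri (e0 * tcor sga (AT n) (arr 1))
 else if j = 2 then JF {} arr else if j = 3 then JF (rng n RA) arr else if j = 4 then JF (rng n RA \<union> rng n RB) arr
 else if j = 5 then JG {} arr else if j = 6 then JG (rng n RA) arr else if j = 7 then JG (rng n RA \<union> rng n RB) arr else JG {1..n} arr)"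
 for j :: nat and arr :: arrays

lemma MI_transcript:
 assumes orc: "orc \<in> mvstat_oracles k (n ^ a) s n D" and h: "h \<in> set_pmf (transcript (mvask n s) orc mvcalls)"
 shows "MI mvcalls (mvstate n s h)"
proof (rule mv_induct[OF n_mv(2) orc order_refl, where I=MI, OF _ _ h])
 show "MI 0 arr0" by (simp add: MI_def)
 fix j sp i i' arr v
 assume j: "j < mvcalls" "mvtasks ! j = (sp, i, i')" and I: "MI j arr"
 and ans: "mvstat_answer (n ^ a) s D (vcode n (sp, i, i') arr) (Pow {..<n ^ a}) v"
 have cover: "rng n RA \<union> rng n RB \<union> rng n RC = {1..n}" and dj: "rng n RA \<inter> rng n RB = {}" "(rng n RA \<union> rng n RB) \<inter> rng n RC = {}"
 using n_mv(3) by (auto simp: rng_simps)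
 have j8: "j < 8" "0 < j ==> 2 <= r" using j(1) r by (auto simp: mvcalls_def split: if_splits)
 then consider "j = 0" | "j = 1" | "j = 2" | "j = 3" | "j = 4" | "j = 5" | "j = 6" | "j = 7" by linarith
 then show "MI (Suc j) (mvupd n s (sp, i, i') v arr)"
 proof cases
 case 1
 then have t: "sp = T1" "i = 0" "i' = 1" using j(2) by (auto simp: mvtasks_def)
 show ?thesis using I ans mv_first[of v] 1 unfolding t by (simp add: MI_def One_nat_def[symmetric])
 next
 case 2
 then have t: "sp = T2" "i = 1" "i' = 2" using j(2) by (auto simp: mvtasks_def One_nat_def)
 obtain e where e: "e \<in> {-1, 1}" "\<forall>w\<in>BT n. sgn (mvupd n s (T2, 1, 2) v arr 2 w) = e * aprod sga w"
 proof -
 have "\<exists>e\<in>{-1, 1}. \<forall>w\<in>BT n. sgn (mvupd n s (T2, 1, 2) v arr 2 w) = e * aprod sga w"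
 by (rule mv_second) (use I ans j8 2 in \<open>simp_all add: MI_def t\<close>)
 then show thesis using that by blast
 qed
 define e1 where "e1 = e * aprod sga [1..<b]"
 have "b <= r" using ab(1) by simp
 then have "b <= 24 * (r + length ps' + 2)" by simp
 then have bn: "b <= n" using n_mv(1) by (rule order_trans)
 have "aprod sga [1..<b] \<in> {-1, 1}" using bn by (intro aprod_sign[OF sga]) auto
 then have e1: "e1 \<in> {-1, 1}" using e(1) by (auto simp: e1_def)
 have "sgn (mvupd n s (T2, 1, 2) v arr 2 (x # [1..<b])) = e1 * sga x" if x: "x \<in> rng n (RB' b)" for x
 proof -
 have "x # [1..<b] \<in> BT n" using x ab(4) j8 2 by (auto simp: BT_def tuples_def rng_simps)
 then show ?thesis using e(2) by (simp add: e1_def aprod_def mult_ac)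
 qed
 then have "JF {} (mvupd n s (T2, 1, 2) v arr)" unfolding JF_def using e1 by blast
 then show ?thesis using 2 unfolding t by (simp add: MI_def)
 next
 case 3
 then have t: "sp = FS RA" "i = 2" "i' = 3" using j(2) by (auto simp: mvtasks_def numeral_eq_Suc)
 show ?thesis using mv_stepF[of "{}" arr RA v] I ans j8 3 unfolding t by (simp add: MI_def)
 next
 case 4
 then have t: "sp = FS RB" "i = 2" "i' = 3" using j(2) by (auto simp: mvtasks_def numeral_eq_Suc)
 show ?thesis using mv_stepF[of "rng n RA" arr RB v] I ans j8 4 dj unfolding t by (simp add: MI_def)
 next
 case 5
 then have t: "sp = FS RC" "i = 2" "i' = 3" using j(2) by (auto simp: mvtasks_def numeral_eq_Suc)
 show ?thesis using mv_stepF[of "rng n RA \<union> rng n RB" arr RC v] I ans j8 5 dj JF_JG unfolding t cover by (simp add: MI_def)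
 next
 case 6
 then have t: "sp = GS RA" "i = 3" "i' = 4" using j(2) by (auto simp: mvtasks_def numeral_eq_Suc)
 show ?thesis using mv_stepG[of "{}" arr RA v] I ans j8 6 unfolding t by (simp add: MI_def)
 next
 case 7
 then have t: "sp = GS RB" "i = 3" "i' = 4" using j(2) by (auto simp: mvtasks_def numeral_eq_Suc)
 show ?thesis using mv_stepG[of "rng n RA" arr RB v] I ans j8 7 dj unfolding t by (simp add: MI_def)
 next
 case 8
 then have t: "sp = GS RC" "i = 3" "i' = 4" using j(2) by (auto simp: mvtasks_def numeral_eq_Suc)
 show ?thesis using mv_stepG[of "rng n RA \<union> rng n RB" arr RC v] I ans j8 8 dj unfolding t cover by (simp add: MI_def)
 qed
qed

text \<open>The oracle stays within its tolerance with certainty, so for \<open>r >= 2\<close> no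
  transcript fails.\<close>

lemma mv_ge2:
 assumes orc: "orc \<in> mvstat_oracles k (n ^ a) s n D" and h: "h \<in> set_pmf (transcript (mvask n s) orc mvcalls)" and r2: "2 <= r"
 shows "prb (mvguess n s h) {tau. ~ planted_solution k Q r t n sga tau} <= 0"
proof -
 define arr where "arr = mvstate n s h"
 have "mvcalls = 8" unfolding mvcalls_def using r2 by auto
 then have "JG {1..n} arr" using MI_transcript[OF orc h] by (simp add: MI_def arr_def)
 then obtain e' where e': "e' \<in> {-1, 1}" "\<forall>v\<in>{1..n}. sgn (arr 4 [v]) = e' ^ (length ps' - 1) * sga v"
 unfolding JG_def by blast
 define e where "e = e' ^ (length ps' - 1)"
 have "e' ^ j \<in> {-1, 1}" for j using e'(1) by (induction j) auto
 then have e: "e \<in> {-1, 1}" unfolding e_def .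
 have odd: "e = 1" if "odd (length ps')"
 proof -
 have "even (length ps' - 1)" using that by simp
 then show ?thesis using e'(1) by (auto simp: e_def)
 qed
 \<comment> \<open>\<open>mvguess\<close> outputs the entries themselves without rounding, so they
   have to be signs already.\<close>
 have tern: "arr 4 [v] \<in> {-1, 0, 1}" for v
 proof -
 have "mvupd n s x v' arr' 4 [v] \<in> {-1, 0, 1}" if "arr' 4 [v] \<in> {-1, 0, 1}" "x \<in> set mvtasks" for x v' arr'
 proof -
 obtain sp i j where x: "x = (sp, i, j)" by (cases x)
 have ij: "i ~= 0 \<or> j ~= 4" using that(2) unfolding x mvtasks_def by auto
 have three: "(if A then if B then 1 else if C then - 1 else 0 else y) \<in> {-1, 0, 1}" if "y \<in> {-1, 0, 1}" for A B C and y :: int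
 using that by simp
 show ?thesis
 proof (cases "j = 4")
 case True
 then have i: "i = 0 \<longleftrightarrow> False" using ij by simp
 show ?thesis unfolding x mvupd_def True prod.case fun_upd_same i if_False using that(1) by (rule three)
 next
 case False
 then show ?thesis using that(1) unfolding x mvupd_def by simp
 qed
 qed
 then have "fold (%(x, v). mvupd n s x v) xs arr' 4 [v] \<in> {-1, 0, 1}"
 if "arr' 4 [v] \<in> {-1, 0, 1}" "fst ` set xs \<subseteq> set mvtasks" for xs arr'
 using that
 proof (induction xs arbitrary: arr')
 case (Cons p xs)
 then show ?case by (cases p) simp
 qed simp
 moreover have "arr0 4 [v] \<in> {-1, 0, 1}" by (simp add: arr0_def)
 moreover have "fst ` set (zip mvtasks (map snd h)) \<subseteq> set mvtasks" by (auto dest: set_zip_leftD)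
 ultimately show ?thesis unfolding arr_def mvstate_def by blast
 qed
 define tau where "tau = (%i. if i \<in> {1..n} then e * sga i else undefined)"
 have "mvguess n s h = Pi_pmf {1..n} undefined (%i. return_pmf (e * sga i))"
 unfolding mvguess_def complete_answer_def arr_def[symmetric]
 proof (rule Pi_pmf_cong)
 fix i assume i: "i \<in> {1..n}"
 have "sgn (arr 4 [i]) = e * sga i" using bspec[OF e'(2) i] by (simp only: e_def)
 moreover have "sgn (arr 4 [i]) = arr 4 [i]" using tern[of i] by auto
 ultimately have "arr 4 [i] = e * sga i" by (rule trans[OF sym, rotated])
 then show "(if (if r = 1 then if i \<in> rng n RA then arr 1 [i] else 0 else arr 4 [i]) = 0 then pmf_of_set {- 1, 1}
 else return_pmf (if r = 1 then if i \<in> rng n RA then arr 1 [i] else 0 else arr 4 [i])) = return_pmf (e * sga i)"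
 using assignmentsD[OF sga i] e r2 by auto
 qed auto
 then have va: "mvguess n s h = return_pmf tau" by (simp add: Pi_pmf_return_pmf tau_def)
 have "planted_solution k Q r t n sga tau"
 proof (cases "e = 1")
 case True
 have "tau = sga" using True sga by (auto simp: tau_def assignments_def PiE_def extensional_def)
 then show ?thesis using sga r2 by (simp add: planted_solution_def)
 next
 case False
 then have e1: "e = -1" "even (length ps')" using e odd by auto
 have "tau = restrict (%i. - sga i) {1..n}" using e1 by (auto simp: tau_def)
 then show ?thesis using planted_uminus[OF Q kn sga even_case[OF e1(2)]] r2 by (simp add: planted_solution_def)
 qed
 then show ?thesis by (simp add: va)
qed

text \<open>The accepted vector has correlation of order \<open>n\<close>, against which random
  values on the remaining variables and the demanded \<open>t * sqrt n\<close> are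
  negligible.\<close>

lemma mv_1:
 assumes orc: "orc \<in> mvstat_oracles k (n ^ a) s n D" and h: "h \<in> set_pmf (transcript (mvask n s) orc mvcalls)" and r1: "r = 1"
 and big: "2 * t * sqrt (real n) < real n / 8"
 shows "prb (mvguess n s h) {tau. ~ planted_solution k Q r t n sga tau} <= real n / (real n / 8 - 2 * t * sqrt (real n))\<^sup>2"
proof -
 define y where "y = mvstate n s h 1"
 have c1: "mvcalls = 1" unfolding mvcalls_def using r1 by simp
 have ab1: "a = 1" "b = 0" unfolding a_def b_def using r1 by auto
 have J: "AT n = (%v. [v]) ` rng n RA"
 unfolding AT_def ab1(1) by (auto simp: tuples_def One_nat_def length_Suc_conv)
 have cJ: "card (AT n) = n div 3" unfolding J by (subst card_image) (auto simp: rng_simps inj_on_def)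
 have e01: "e0 = 1" by (simp add: e0_def ab1(2) aprod_def)
 have y: "!!K. y K \<in> {-1, 1}" "real (card (AT n)) / 2 <= ri (tcor sga (AT n) y)"
 using MI_transcript[OF orc h] unfolding c1 by (auto simp: MI_def e01 y_def)
 define out where "out v = (if v \<in> rng n RA then y [v] else 0)" for v
 have sub: "rng n RA \<subseteq> {1..n}" by (auto simp: rng_simps)
 have sy: "sgn (y K) = y K" for K using y(1)[of K] by auto
 have "tcor sga (AT n) y = (\<Sum>v\<in>rng n RA. sga v * y [v])"
 unfolding tcor_def J by (subst sum.reindex) (auto simp: inj_on_def aprod_def sy)
 also have "... = (\<Sum>v\<in>{1..n}. sga v * out v)"
 using sub by (intro sum.mono_neutral_cong_left) (auto simp: out_def)
 finally have S: "tcor sga (AT n) y = (\<Sum>v\<in>{1..n}. sga v * out v)" .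
 have "real n / 8 <= real (n div 3) / 2"
 proof -
 have "real n / 3 - 1 <= real (n div 3)" by linarith
 moreover have "24 <= real n" using n_mv(2) by simp
 ultimately show ?thesis by linarith
 qed
 then have A: "real n / 8 <= ri (\<Sum>v\<in>{1..n}. sga v * out v)" using y(2) unfolding cJ S[symmetric] by linarith
 have g: "mvguess n s h = complete_answer n out" unfolding mvguess_def out_def y_def using r1 by simp
 have "prb (complete_answer n out)
 {tau. ~ (tau \<in> assignments n & real n / 2 + t * sqrt (real n) <= real (card {i \<in> {1..n}. tau i = sga i}))}
 <= real n / (ri (\<Sum>v\<in>{1..n}. sga v * out v) - 2 * t * sqrt (real n))\<^sup>2"
 proof (rule complete_answer_tail[OF sga])
 show "out v \<in> {-1, 0, 1}" for v using y(1)[of "[v]"] by (auto simp: out_def)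
 show "2 * t * sqrt (real n) < ri (\<Sum>v\<in>{1..n}. sga v * out v)" using A big by linarith
 qed
 also have "... <= real n / (real n / 8 - 2 * t * sqrt (real n))\<^sup>2"
 using A big by (intro frac_le power_mono zero_less_power) auto
 finally show ?thesis unfolding g planted_solution_def using r1 by simp
qed

end

lemma (in sampler) votes_by_mvstat:
 assumes large: "\<forall>\<^sub>F n in sequentially. mv_large n (s n)"
 shows "solved_by_MVSTAT k Q r t (%n. n ^ a) s (%_. mvcalls)"
proof -
 define err where "err n = real n / (real n / 8 - 2 * t * sqrt (real n))\<^sup>2" for n
 have lim: "err \<longlonglongrightarrow> 0" unfolding err_def by real_asymp
 have "filterlim (%n. real n / 8 - 2 * t * sqrt (real n)) at_top sequentially" by real_asymp
 then have ev: "\<forall>\<^sub>F n in sequentially. 1 <= real n / 8 - 2 * t * sqrt (real n)" by (simp add: filterlim_at_top)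
 have "\<forall>\<^sub>F n in sequentially. (\<forall>h. set_pmf (mvask n (s n) h) \<subseteq> mvstat_queries k (n ^ a) n) &
 (\<forall>sga\<in>assignments n. \<forall>orc\<in>mvstat_oracles k (n ^ a) (s n) n (planted k Q n sga).
 prb (bind_pmf (transcript (mvask n (s n)) orc mvcalls) (mvguess n (s n)))
 {tau. planted_solution k Q r t n sga tau} \<ge> 1 - err n)"
 using large ev
 proof eventually_elim
 case (elim n)
 have n: "24 <= n" using elim(1) by (auto simp: mv_large_def)
 show ?case
 proof (intro conjI allI ballI)
 show "set_pmf (mvask n (s n) h) \<subseteq> mvstat_queries k (n ^ a) n" for h by (rule mvask_queries[OF n])
 fix sga orc assume sga: "sga \<in> assignments n" and orc: "orc \<in> mvstat_oracles k (n ^ a) (s n) n (planted k Q n sga)"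
 interpret mv_at k Q r ps ps' K1 K2 n sga "s n"
 by unfold_locales (use elim(1) sga Q in \<open>auto simp: mv_large_def\<close>)
 let ?p = "bind_pmf (transcript (mvask n (s n)) orc mvcalls) (mvguess n (s n))"
 let ?bad = "{tau. ~ planted_solution k Q r t n sga tau}"
 have "prb ?p ?bad <= 0 + err n"
 proof (rule prob_bind_le)
 define G where "G h \<longleftrightarrow> h \<in> set_pmf (transcript (mvask n (s n)) orc mvcalls)" for h
 show "prb (transcript (mvask n (s n)) orc mvcalls) {h. ~ G h} <= 0"
 by (subst measure_Int_set_pmf[symmetric]) (simp add: G_def Int_def)
 fix h assume h: "G h"
 show "prb (mvguess n (s n) h) ?bad <= err n"
 proof (cases "r = 1")
 case True
 then show ?thesis unfolding err_def using elim(2) h by (intro mv_1[OF orc]) (auto simp: G_def)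
 next
 case False
 then have "2 <= r" using r by simp
 from mv_ge2[OF orc _ this, of h t] h have "prb (mvguess n (s n) h) ?bad <= 0" by (simp add: G_def)
 moreover have "0 <= err n" by (simp add: err_def)
 ultimately show ?thesis by linarith
 qed
 qed (simp add: err_def)
 moreover have "prb ?p ?bad = 1 - prb ?p {tau. planted_solution k Q r t n sga tau}"
 using measure_pmf.prob_compl[of "{tau. planted_solution k Q r t n sga tau}" ?p]
 by (simp add: Compl_eq_Diff_UNIV[symmetric] Collect_neg_eq)
 ultimately show "prb ?p {tau. planted_solution k Q r t n sga tau} \<ge> 1 - err n" by linarith
 qed
 qed
 then show ?thesis
 unfolding solved_by_MVSTAT_def solved_by_statistical_algorithm_def using lim
 by (intro exI[of _ "%n. mvask n (s n)"] exI[of _ "%n. mvguess n (s n)"] exI[of _ err]) auto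
qed

section \<open>Deterministic runs of coin-free programs\<close>

text \<open>Memory, answer, number of clauses drawn, and the clauses still to come: the randomness
  is moved into a stream fixed in advance, which makes programs without coins deterministic.\<close>

type_synonym st = "(nat => int) \<times> (nat => int) \<times> nat \<times> clause list"

fun dexec :: "instr => st => st" where
 "dexec (Const d v) (m, A, t, xs) = (m(d := v), A, t, xs)"
| "dexec (Add d a b) (m, A, t, xs) = (m(d := m a + m b), A, t, xs)"
| "dexec (Sub d a b) (m, A, t, xs) = (m(d := m a - m b), A, t, xs)"
| "dexec (Mul d a b) (m, A, t, xs) = (m(d := m a * m b), A, t, xs)"
| "dexec (Div d a b) (m, A, t, xs) = (m(d := m a div m b), A, t, xs)"
| "dexec (Load d a) (m, A, t, xs) = (m(d := m (nat (m a))), A, t, xs)"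
| "dexec (Store a b) (m, A, t, xs) = (m(nat (m a) := m b), A, t, xs)"
| "dexec (Draw d) (m, A, t, xs) = (case xs of [] => (m, A, t, xs)
 | C # ys => (write_block d (map lit_code C) m, A, Suc t, ys))"
| "dexec (Assign a b) (m, A, t, xs) = (m, A(nat (m a) := sgn (m b)), t, xs)"
| "dexec (JumpPos a l) s = s"
| "dexec (Coin d) s = s"

definition dstep :: "instr list => nat \<times> st => nat \<times> st" where
 "dstep P x = (case x of (l, s) => if length P <= l then x else
 (case P ! l of JumpPos a l' => (if fst s a > 0 then l' else Suc l, s) | i => (Suc l, dexec i s)))"

definition cfg :: "nat \<times> st => config" where
 "cfg x = (case x of (l, m, A, t, xs) => \<lparr>pc = l, mem = m, answer = A, drawn = t\<rparr>)"

fun coinfree :: "instr => bool" where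
 "coinfree (Coin d) = False"
| "coinfree _ = True"

text \<open>\<open>run\<close> unfolds at the last step; this version unfolds at the first, where
  the stream is consumed.\<close>

primrec runc :: "instr list => clause pmf => nat => config => config pmf" where
 "runc P D 0 c = return_pmf c"
| "runc P D (Suc s) c = bind_pmf (step P D c) (runc P D s)"

lemma runc_Suc2: "runc P D (Suc s) c = bind_pmf (runc P D s c) (step P D)"
proof (induction s arbitrary: c)
 case 0
 have "runc P D 0 = return_pmf" by (rule ext) simp
 then show ?case by (simp add: bind_return_pmf bind_return_pmf')
next
 case (Suc s)
 have "runc P D (Suc (Suc s)) c = bind_pmf (step P D c) (%c'. bind_pmf (runc P D s c') (step P D))"
 by (subst runc.simps(2)) (intro bind_pmf_cong refl Suc.IH)
 also have "... = bind_pmf (runc P D (Suc s) c) (step P D)" by (simp add: bind_assoc_pmf)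
 finally show ?case .
qed

lemma run_eq_runc: "run P D n s = runc P D s (init_config n)"
proof (induction s)
 case (Suc s)
 then show ?case unfolding runc_Suc2 by simp
qed simp

lemma step_Draw:
 assumes "~ length P <= l" "P ! l = Draw d"
 shows "step P D (cfg (l, m, A, t, xs)) = map_pmf (%C. cfg (dstep P (l, m, A, t, C # ys))) D"
proof -
 have "dstep P (l, m, A, t, C # ys) = (Suc l, write_block d (map lit_code C) m, A, Suc t, ys)" for C
 using assms by (simp add: dstep_def)
 then show ?thesis using assms by (simp add: step_def halted_def cfg_def)
qed

lemma step_other:
 assumes "\<forall>i\<in>set P. coinfree i" "length P <= l \<or> (\<forall>d. P ! l ~= Draw d)"
 shows "step P D (cfg (l, m, A, t, xs)) = return_pmf (cfg (dstep P (l, m, A, t, xs)))"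
 "\<exists>l' m' A' t'. \<forall>ys. dstep P (l, m, A, t, ys) = (l', m', A', t', ys)"
proof -
 consider "length P <= l" | "~ length P <= l" "P ! l \<in> set P" by fastforce
 note c = this
 from c show "step P D (cfg (l, m, A, t, xs)) = return_pmf (cfg (dstep P (l, m, A, t, xs)))"
 proof cases
 case 1
 then show ?thesis by (simp add: step_def halted_def dstep_def cfg_def)
 next
 case 2
 then have "coinfree (P ! l)" "\<forall>d. P ! l ~= Draw d" using assms by auto
 then show ?thesis using 2(1) by (cases "P ! l") (auto simp: step_def halted_def cfg_def dstep_def set_cell_def)
 qed
 from c show "\<exists>l' m' A' t'. \<forall>ys. dstep P (l, m, A, t, ys) = (l', m', A', t', ys)"
 proof cases
 case 1
 then show ?thesis by (simp add: dstep_def)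
 next
 case 2
 then have "coinfree (P ! l)" "\<forall>d. P ! l ~= Draw d" using assms by auto
 then show ?thesis using 2(1) by (cases "P ! l") (auto simp: dstep_def)
 qed
qed

text \<open>\<open>s\<close> steps draw at most \<open>s\<close> clauses, so a stream of any length
  \<open>N >= s\<close> suffices; its unread rest has no effect on the law of the
  configuration.\<close>

lemma runc_det:
 assumes P: "\<forall>i\<in>set P. coinfree i"
 shows "s <= N ==> runc P D s (cfg (l, m, A, t, zs))
 = map_pmf (%xs. cfg ((dstep P ^^ s) (l, m, A, t, xs))) (replicate_pmf N D)"
proof (induction s arbitrary: N l m A t zs)
 case 0
 then show ?case by (simp add: cfg_def)
next
 case (Suc s)
 have pow: "(dstep P ^^ Suc s) x = (dstep P ^^ s) (dstep P x)" for x by (simp add: funpow_swap1)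
 show ?case
 proof (cases "length P <= l \<or> (\<forall>d. P ! l ~= Draw d)")
 case True
 obtain l' m' A' t' where e: "!!ys. dstep P (l, m, A, t, ys) = (l', m', A', t', ys)"
 using step_other(2)[OF P True] by blast
 show ?thesis using Suc.prems
 by (simp add: step_other(1)[OF P True] bind_return_pmf pow e Suc.IH[of N] del: funpow.simps)
 next
 case False
 then obtain d where d: "~ length P <= l" "P ! l = Draw d" by blast
 obtain N' where N: "N = Suc N'" "s <= N'" using Suc.prems by (cases N) auto
 have dr: "dstep P (l, m, A, t, C # ys) = (Suc l, write_block d (map lit_code C) m, A, Suc t, ys)" for C ys
 using d by (simp add: dstep_def)
 have "runc P D (Suc s) (cfg (l, m, A, t, zs))
 = bind_pmf D (%C. map_pmf (%ys. cfg ((dstep P ^^ s) (Suc l, write_block d (map lit_code C) m, A, Suc t, ys))) (replicate_pmf N' D))"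
 unfolding runc.simps step_Draw[OF d, where ys="[]"] by (simp add: bind_map_pmf dr Suc.IH[OF N(2)])
 also have "... = map_pmf (%xs. cfg ((dstep P ^^ Suc s) (l, m, A, t, xs))) (replicate_pmf N D)"
 unfolding N(1) by (simp add: map_bind_pmf pow dr map_pmf_def[symmetric] pmf.map_comp comp_def bind_assoc_pmf bind_return_pmf del: funpow.simps)
 finally show ?thesis .
 qed
qed

definition mem0 :: "nat => nat => int" where "mem0 n = (%_. 0)(0 := int n)"

lemma run_det:
 assumes "\<forall>i\<in>set P. coinfree i" "s <= N"
 shows "run P D n s = map_pmf (%xs. cfg ((dstep P ^^ s) (0, mem0 n, %_. 0, 0, xs))) (replicate_pmf N D)"
proof -
 have "init_config n = cfg (0, mem0 n, %_. 0, 0, [])" by (simp add: init_config_def cfg_def mem0_def)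
 then show ?thesis unfolding run_eq_runc using runc_det[OF assms, of D 0 "mem0 n" "%_. 0" 0 "[]"] by simp
qed

section \<open>Word size along straight-line code\<close>

fun straight :: "instr => bool" where
 "straight (Coin d) = False"
| "straight (JumpPos a l) = False"
| "straight _ = True"

definition code_at :: "instr list => nat => instr list => bool" where
 "code_at P l is \<longleftrightarrow> (\<exists>pre post. P = pre @ is @ post & length pre = l)"

lemma code_at_nth: "code_at P l is ==> j < length is ==> l + j < length P & P ! (l + j) = is ! j"
 by (auto simp: code_at_def nth_append)

lemma code_at_append: "code_at P l (xs @ ys) \<longleftrightarrow> code_at P l xs & code_at P (l + length xs) ys"
proof
 assume "code_at P l (xs @ ys)"
 then obtain pre post where P: "P = pre @ (xs @ ys) @ post" "length pre = l" by (auto simp: code_at_def)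
 then show "code_at P l xs & code_at P (l + length xs) ys"
 unfolding code_at_def by (intro conjI exI[of _ pre] exI[of _ "ys @ post"] exI[of _ "pre @ xs"] exI[of _ post]) auto
next
 assume "code_at P l xs & code_at P (l + length xs) ys"
 then obtain p q p' q' where P: "P = p @ xs @ q" "length p = l" "P = p' @ ys @ q'" "length p' = l + length xs"
 unfolding code_at_def by blast
 then have "(p @ xs) @ q = p' @ (ys @ q')" by simp
 then have "q = ys @ q'" using P(2,4) by (subst (asm) append_eq_append_conv) auto
 then show "code_at P l (xs @ ys)" using P by (auto simp: code_at_def)
qed

lemma straight_steps:
 assumes "code_at P l is" "\<forall>i\<in>set is. straight i"
 shows "j <= length is ==> (dstep P ^^ j) (l, s) = (l + j, fold dexec (take j is) s)"
proof (induction j)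
 case (Suc j)
 then have j: "j < length is" by simp
 have "straight (is ! j)" using assms(2) j by simp
 then have "dstep P (l + j, s') = (Suc (l + j), dexec (is ! j) s')" for s'
 using code_at_nth[OF assms(1) j] by (cases "is ! j") (auto simp: dstep_def)
 then show ?case using Suc j by (simp add: take_Suc_conv_app_nth)
qed simp

definition wbd :: "int => st => bool" where "wbd W s \<longleftrightarrow> (\<forall>a. \<bar>fst s a\<bar> <= W)"

definition words_ok :: "int => st => bool" where
 "words_ok W s \<longleftrightarrow> (\<forall>C\<in>set (snd (snd (snd s))). \<forall>l\<in>set C. int (lit_var l) <= W)"

fun const_ok :: "int => instr => bool" where
 "const_ok W (Const d v) \<longleftrightarrow> \<bar>v\<bar> <= W"
| "const_ok W _ \<longleftrightarrow> True"

text \<open>Multiplication is the worst case. Division never increases absolute values, which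
  includes division by zero with result zero.\<close>

lemma wbd_dexec:
 assumes W: "2 <= W" and s: "wbd W s" "words_ok W0 s" and i: "const_ok W0 i" and W0: "W0 <= W"
 shows "wbd (W\<^sup>2) (dexec i s) & words_ok W0 (dexec i s)"
proof -
 obtain m A t xs where e: "s = (m, A, t, xs)" by (cases s)
 have m: "\<bar>m a\<bar> <= W" for a using s(1) by (simp add: wbd_def e)
 have W2: "2 * W <= W\<^sup>2" "W <= W\<^sup>2" using W by (auto simp: power2_eq_square intro: mult_right_mono)
 have m2: "\<bar>m a\<bar> <= W\<^sup>2" for a using m[of a] W2 by linarith
 have add: "\<bar>m a + m b\<bar> <= W\<^sup>2" "\<bar>m a - m b\<bar> <= W\<^sup>2" for a b using m[of a] m[of b] W2 by linarith+
 have mul: "\<bar>m a * m b\<bar> <= W\<^sup>2" for a b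
 unfolding abs_mult power2_eq_square using m W by (intro mult_mono) auto
 have div: "\<bar>m a div m b\<bar> <= W\<^sup>2" for a b
 proof -
 have pos: "\<bar>x div y\<bar> <= \<bar>x\<bar>" if "0 < y" for x y :: int
 proof (cases "0 <= x")
 case True
 have "x div y <= x" using zdiv_mono2[of x 1 y] True that by simp
 moreover have "0 <= x div y" using True that by (simp add: pos_imp_zdiv_nonneg_iff)
 ultimately show ?thesis by simp
 next
 case False
 have "x <= x div y" using zdiv_mono2_neg[of x 1 y] False that by simp
 moreover have "x div y < 0" using False that by (simp add: div_neg_pos_less0)
 ultimately show ?thesis by simp
 qed
 have "\<bar>x div y\<bar> <= \<bar>x\<bar>" for x y :: int
 using pos[of y x] pos[of "- y" "- x"] by (cases "y = 0") (auto simp: neq_iff)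
 then show ?thesis using m2[of a] by (meson order_trans)
 qed
 show ?thesis
 proof (cases i)
 case (Draw d)
 show ?thesis
 proof (cases xs)
 case Nil
 then show ?thesis using s(2) m2 Draw by (simp add: e wbd_def)
 next
 case (Cons C ys)
 have "\<bar>map lit_code C ! j\<bar> <= W\<^sup>2" if "j < length C" for j
 proof -
 have "int (lit_var (C ! j)) <= W0" using s(2) that by (auto simp: words_ok_def e Cons)
 moreover have "\<bar>lit_code (C ! j)\<bar> = int (lit_var (C ! j))" by (cases "C ! j") auto
 ultimately show ?thesis using that W2 W0 by simp
 qed
 then show ?thesis using s(2) m2 Draw Cons by (auto simp: e wbd_def words_ok_def write_block_def)
 qed
 next
 case (Const d v)
 then show ?thesis using i s(2) m2 W0 W2 by (auto simp: e wbd_def words_ok_def)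
 qed (use s(2) m2 add mul div in \<open>auto simp: e wbd_def words_ok_def\<close>)
qed

lemma wbd_mono: "wbd W s ==> W <= W' ==> wbd W' s"
 by (auto simp: wbd_def intro: order_trans)

text \<open>The bound is doubly exponential in the length, but a block has constant length, so a
  polynomial \<open>W\<close> gives a polynomial bound. Between blocks the invariant brings the
  bound back to its initial value.\<close>

lemma wbd_fold:
 assumes W: "2 <= W" and s: "wbd W s" "words_ok W s" and "is": "\<forall>i\<in>set is. const_ok W i"
 shows "j <= length is ==> wbd (W ^ 2 ^ j) (fold dexec (take j is) s) & words_ok W (fold dexec (take j is) s)"
proof (induction j)
 case (Suc j)
 then have j: "j < length is" by simp
 have ge: "W <= W ^ 2 ^ j" using W by (intro self_le_power) auto
 have "wbd ((W ^ 2 ^ j)\<^sup>2) (dexec (is ! j) (fold dexec (take j is) s)) & words_ok W (dexec (is ! j) (fold dexec (take j is) s))"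
 using Suc j "is" ge W by (intro wbd_dexec) auto
 moreover have "(W ^ 2 ^ j)\<^sup>2 = W ^ 2 ^ Suc j" by (simp add: power_mult[symmetric] mult.commute)
 ultimately show ?case using j by (simp add: take_Suc_conv_app_nth)
qed (use s in simp)

section \<open>A structured language with counted loops\<close>

text \<open>Cells \<open>0, \<dots>, 10\<close> are registers, the next \<open>k\<close> cells receive clauses, then come \<open>20\<close> cells of
 an evaluation stack, and the vote arrays start at \<open>TOP k\<close>.\<close>

definition "CL = (11::nat)"
definition "TP k = (11::nat) + k"
definition "TOP k = (31::nat) + k"

datatype expr = Cst int | Cell nat | Plus expr expr | Minus expr expr | Times expr expr | Quot expr expr | Deref expr

primrec eval :: "expr => (nat => int) => int" where
 "eval (Cst c) m = c"
| "eval (Cell r) m = m r"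
| "eval (Plus e f) m = eval e m + eval f m"
| "eval (Minus e f) m = eval e m - eval f m"
| "eval (Times e f) m = eval e m * eval f m"
| "eval (Quot e f) m = eval e m div eval f m"
| "eval (Deref e) m = m (nat (eval e m))"

primrec depth :: "expr => nat" where
 "depth (Cst c) = 1"
| "depth (Cell r) = 1"
| "depth (Plus e f) = max (depth e) (1 + depth f)"
| "depth (Minus e f) = max (depth e) (1 + depth f)"
| "depth (Times e f) = max (depth e) (1 + depth f)"
| "depth (Quot e f) = max (depth e) (1 + depth f)"
| "depth (Deref e) = depth e"

text \<open>Reads avoid the evaluation stack: \<open>Cell\<close> reaches registers and clause
  buffer, \<open>Deref\<close> the arrays. Values are then independent of what the stack
  contains.\<close>

primrec safe :: "nat => expr => (nat => int) => bool" where
 "safe k (Cst c) m \<longleftrightarrow> True"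
| "safe k (Cell r) m \<longleftrightarrow> r < TP k"
| "safe k (Plus e f) m \<longleftrightarrow> safe k e m & safe k f m"
| "safe k (Minus e f) m \<longleftrightarrow> safe k e m & safe k f m"
| "safe k (Times e f) m \<longleftrightarrow> safe k e m & safe k f m"
| "safe k (Quot e f) m \<longleftrightarrow> safe k e m & safe k f m"
| "safe k (Deref e) m \<longleftrightarrow> safe k e m & int (TOP k) <= eval e m"

primrec ecomp :: "expr => nat => instr list" where
 "ecomp (Cst c) d = [Const d c]"
| "ecomp (Cell r) d = [Const d 0, Add d d r]"
| "ecomp (Plus e f) d = ecomp e d @ ecomp f (d + 1) @ [Add d d (d + 1)]"
| "ecomp (Minus e f) d = ecomp e d @ ecomp f (d + 1) @ [Sub d d (d + 1)]"
| "ecomp (Times e f) d = ecomp e d @ ecomp f (d + 1) @ [Mul d d (d + 1)]"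
| "ecomp (Quot e f) d = ecomp e d @ ecomp f (d + 1) @ [Div d d (d + 1)]"
| "ecomp (Deref e) d = ecomp e d @ [Load d d]"

definition eqz :: "nat => (nat => int) => (nat => int) => bool" where
 "eqz k m m' \<longleftrightarrow> (\<forall>a. a < TP k \<or> TOP k <= a --> m a = m' a)"

lemma eqz_eval: "eqz k m m' ==> safe k e m ==> eval e m' = eval e m & safe k e m'"
 by (induction e) (auto simp: eqz_def)

lemma ecomp_correct:
 assumes "safe k e m" "TP k <= d" "d + depth e <= TOP k"
 shows "\<exists>m'. fold dexec (ecomp e d) (m, A, t, xs) = (m', A, t, xs) & eqz k m m' & m' d = eval e m & (\<forall>a<d. m' a = m a)"
proof -
 have bin: "\<exists>m'. fold dexec (ecomp e d @ ecomp f (d + 1) @ [i]) (m, A, t, xs) = (m', A, t, xs) & eqz k m m' &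
 m' d = v & (\<forall>a<d. m' a = m a)"
 if ih: "!!m d. safe k e m ==> TP k <= d ==> d + depth e <= TOP k ==>
 \<exists>m'. fold dexec (ecomp e d) (m, A, t, xs) = (m', A, t, xs) & eqz k m m' & m' d = eval e m & (\<forall>a<d. m' a = m a)"
 "!!m d. safe k f m ==> TP k <= d ==> d + depth f <= TOP k ==>
 \<exists>m'. fold dexec (ecomp f d) (m, A, t, xs) = (m', A, t, xs) & eqz k m m' & m' d = eval f m & (\<forall>a<d. m' a = m a)"
 and p: "safe k e m" "safe k f m" "TP k <= d" "d + max (depth e) (1 + depth f) <= TOP k"
 and i: "!!m'. m' d = eval e m ==> m' (d + 1) = eval f m ==> dexec i (m', A, t, xs) = (m'(d := v), A, t, xs)"
 for e f m d i v
 proof -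
 have de: "d + depth e <= TOP k" "d + 1 + depth f <= TOP k" "TP k <= d + 1" using p(3,4) by auto
 obtain m1 where m1: "fold dexec (ecomp e d) (m, A, t, xs) = (m1, A, t, xs)" "eqz k m m1" "m1 d = eval e m" "\<forall>a<d. m1 a = m a"
 using ih(1)[OF p(1,3) de(1)] by blast
 have f: "safe k f m1" "eval f m1 = eval f m" using eqz_eval[OF m1(2) p(2)] by auto
 obtain m2 where m2: "fold dexec (ecomp f (d + 1)) (m1, A, t, xs) = (m2, A, t, xs)" "eqz k m1 m2" "m2 (d + 1) = eval f m1" "\<forall>a<d + 1. m2 a = m1 a"
 using ih(2)[OF f(1) de(3,2)] by blast
 have "d < TOP k" using p(4) by simp
 then have "eqz k m (m2(d := v))" using m1(2) m2(2) p(3) by (auto simp: eqz_def)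
 moreover have "dexec i (m2, A, t, xs) = (m2(d := v), A, t, xs)" using m1(3) m2(3,4) f(2) by (intro i) auto
 ultimately show ?thesis using m1 m2 by auto
 qed
 show ?thesis using assms
 proof (induction e arbitrary: m d)
 case (Deref e)
 obtain m1 where m1: "fold dexec (ecomp e d) (m, A, t, xs) = (m1, A, t, xs)" "eqz k m m1" "m1 d = eval e m" "\<forall>a<d. m1 a = m a"
 using Deref.IH[of m d] Deref.prems by auto
 have dp: "1 <= depth e" by (induction e) auto
 have "m1 (nat (eval e m)) = m (nat (eval e m))" using m1(2) Deref.prems by (auto simp: eqz_def)
 moreover have "eqz k m (m1(d := v))" for v using m1(2) Deref.prems dp by (auto simp: eqz_def)
 ultimately show ?case using m1 by auto
 next
 case (Plus e f)
 then show ?case using bin[of e f m d "Add d d (d + 1)" "eval e m + eval f m"] by simp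
 next
 case (Minus e f)
 then show ?case using bin[of e f m d "Sub d d (d + 1)" "eval e m - eval f m"] by simp
 next
 case (Times e f)
 then show ?case using bin[of e f m d "Mul d d (d + 1)" "eval e m * eval f m"] by simp
 next
 case (Quot e f)
 then show ?case using bin[of e f m d "Div d d (d + 1)" "eval e m div eval f m"] by simp
 qed (auto simp: eqz_def)
qed

datatype stmt = Upd expr expr | Drw | Out expr expr

fun ssem :: "stmt => st => st" where
 "ssem (Upd e f) (m, A, t, xs) = (m(nat (eval e m) := eval f m), A, t, xs)"
| "ssem Drw (m, A, t, xs) = (case xs of [] => (m, A, t, xs) | C # ys => (write_block CL (map lit_code C) m, A, Suc t, ys))"
| "ssem (Out e f) (m, A, t, xs) = (m, A(nat (eval e m) := sgn (eval f m)), t, xs)"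

fun sok :: "nat => stmt => st => bool" where
 "sok k (Upd e f) (m, A, t, xs) \<longleftrightarrow> safe k e m & safe k f m & depth e <= 20 & depth f <= 19 &
 (nat (eval e m) < TP k \<or> TOP k <= nat (eval e m))"
| "sok k Drw (m, A, t, xs) \<longleftrightarrow> xs ~= [] & (\<forall>C\<in>set xs. length C = k)"
| "sok k (Out e f) (m, A, t, xs) \<longleftrightarrow> safe k e m & safe k f m & depth e <= 20 & depth f <= 19"

fun scode :: "nat => stmt => instr list" where
 "scode k (Upd e f) = ecomp e (TP k) @ ecomp f (TP k + 1) @ [Store (TP k) (TP k + 1)]"
| "scode k Drw = [Draw CL]"
| "scode k (Out e f) = ecomp e (TP k) @ ecomp f (TP k + 1) @ [Assign (TP k) (TP k + 1)]"

definition req :: "nat => st => st => bool" where "req k s s' \<longleftrightarrow> eqz k (fst s) (fst s') & snd s = snd s'"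

lemma scode_correct:
 assumes r: "req k s s'" and ok: "sok k i s"
 shows "req k (ssem i s) (fold dexec (scode k i) s')"
proof -
 obtain m A t xs where s: "s = (m, A, t, xs)" by (cases s)
 obtain m' where s': "s' = (m', A, t, xs)" and e: "eqz k m m'" using r by (cases s') (auto simp: req_def s)
 have two: "\<exists>m2. fold dexec (ecomp f (TP k + 1)) (fold dexec (ecomp e (TP k)) (m', A, t, xs)) = (m2, A, t, xs) &
 eqz k m m2 & m2 (TP k) = eval e m & m2 (TP k + 1) = eval f m"
 if "safe k e m" "safe k f m" "depth e <= 20" "depth f <= 19" for e f
 proof -
 have le: "TP k + depth e <= TOP k" "TP k + 1 + depth f <= TOP k" "TP k <= TP k + 1" using that by (auto simp: TP_def TOP_def)
 have ee: "safe k e m'" "eval e m' = eval e m" using eqz_eval[OF e that(1)] by auto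
 obtain m1 where m1: "fold dexec (ecomp e (TP k)) (m', A, t, xs) = (m1, A, t, xs)" "eqz k m' m1" "m1 (TP k) = eval e m'"
 using ecomp_correct[OF ee(1) order_refl le(1), of A t xs] by blast
 have em1: "eqz k m m1" using e m1(2) by (auto simp: eqz_def)
 have ff: "safe k f m1" "eval f m1 = eval f m" using eqz_eval[OF em1 that(2)] by auto
 obtain m2 where m2: "fold dexec (ecomp f (TP k + 1)) (m1, A, t, xs) = (m2, A, t, xs)" "eqz k m1 m2" "m2 (TP k + 1) = eval f m1" "\<forall>a<TP k + 1. m2 a = m1 a"
 using ecomp_correct[OF ff(1) le(3,2), of A t xs] by blast
 have "eqz k m m2" using em1 m2(2) by (auto simp: eqz_def)
 then show ?thesis using m1 m2 ee ff by auto
 qed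
 show ?thesis
 proof (cases i)
 case (Upd e f)
 obtain m2 where "fold dexec (ecomp f (TP k + 1)) (fold dexec (ecomp e (TP k)) (m', A, t, xs)) = (m2, A, t, xs)"
 "eqz k m m2" "m2 (TP k) = eval e m" "m2 (TP k + 1) = eval f m" using two[of e f] ok by (auto simp: Upd s)
 then show ?thesis by (auto simp: Upd s s' req_def eqz_def)
 next
 case (Out e f)
 obtain m2 where "fold dexec (ecomp f (TP k + 1)) (fold dexec (ecomp e (TP k)) (m', A, t, xs)) = (m2, A, t, xs)"
 "eqz k m m2" "m2 (TP k) = eval e m" "m2 (TP k + 1) = eval f m" using two[of e f] ok by (auto simp: Out s)
 then show ?thesis by (auto simp: Out s s' req_def eqz_def)
 next
 case Drw
 then show ?thesis using ok e by (cases xs) (auto simp: s s' req_def eqz_def write_block_def)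
 qed
qed

primrec soks :: "nat => stmt list => st => bool" where
 "soks k [] s \<longleftrightarrow> True"
| "soks k (i # is) s \<longleftrightarrow> sok k i s & soks k is (ssem i s)"

text \<open>Clause buffer and stack are cleared at the end of a block, so that large intermediate
  values left there cannot accumulate over the iterations of a loop.\<close>

definition bcode :: "nat => stmt list => instr list" where
 "bcode k ss = concat (map (scode k) ss) @ map (%d. Const d 0) [CL..<TOP k]"

definition zap :: "nat => st => st" where
 "zap k s = (%a. if CL <= a & a < TOP k then 0 else fst s a, snd s)"

lemma fold_zero: "fold dexec (map (%d. Const d 0) [i..<j]) (m, s) = (%a. if i <= a & a < j then 0 else m a, s)"
proof (induction j)
 case 0
 then show ?case by simp
next
 case (Suc j)
 obtain A t xs where s: "s = (A, t, xs)" by (cases s)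
 show ?case using Suc by (cases "i <= j") (auto simp: s fun_eq_iff le_less_Suc_eq)
qed

lemma bcode_correct:
 assumes "soks k ss s"
 shows "fold dexec (bcode k ss) s = zap k (fold ssem ss s)"
proof -
 have "req k (fold ssem ss s) (fold dexec (concat (map (scode k) ss)) s')" if "req k s s'" for s'
 using assms that
 proof (induction ss arbitrary: s s')
 case (Cons i ss)
 then show ?case using scode_correct[of k s s' i] by simp
 qed simp
 from this[of s] have r: "req k (fold ssem ss s) (fold dexec (concat (map (scode k) ss)) s)" by (simp add: req_def eqz_def)
 obtain m' p' where p: "fold dexec (concat (map (scode k) ss)) s = (m', p')" by (cases "fold dexec (concat (map (scode k) ss)) s")
 show ?thesis using r unfolding bcode_def
 by (auto simp: p fold_zero zap_def req_def eqz_def TP_def CL_def fun_eq_iff)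
qed

section \<open>Commands, their assembly and a calculus of triples\<close>

datatype cmd = Blk "stmt list" | Seq cmd cmd (infixr ";;" 60) | Loop nat cmd

primrec asm :: "nat => nat => cmd => instr list" where
 "asm k l (Blk ss) = bcode k ss"
| "asm k l (Seq c c') = asm k l c @ asm k (l + length (asm k l c)) c'"
| "asm k l (Loop r c) = asm k l c @ [JumpPos r l]"

primrec csize :: "nat => cmd => nat" where
 "csize k (Blk ss) = length (bcode k ss)"
| "csize k (Seq c c') = csize k c + csize k c'"
| "csize k (Loop r c) = csize k c + 1"

primrec cconst :: "cmd => nat => nat" where
 "cconst (Blk ss) k = sum_list (map (%i. case i of Const d v => nat \<bar>v\<bar> | _ => 0) (bcode k ss))"
| "cconst (Seq c c') k = cconst c k + cconst c' k"
| "cconst (Loop r c) k = cconst c k"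

lemma length_asm: "length (asm k l c) = csize k c"
 by (induction c arbitrary: l) auto

lemma straight_bcode: "i \<in> set (bcode k ss) ==> straight i"
proof -
 have c: "i \<in> set (ecomp e d) ==> straight i" for e d by (induction e arbitrary: d) auto
 have "i \<in> set (scode k x) ==> straight i" for x by (cases x) (auto dest: c)
 then show "i \<in> set (bcode k ss) ==> straight i" by (auto simp: bcode_def)
qed

lemma coinfree_asm: "i \<in> set (asm k l c) ==> coinfree i"
proof (induction c arbitrary: l)
 case (Blk ss)
 then have "straight i" using straight_bcode[of i k ss] by simp
 then show ?case by (cases i) auto
qed auto

text \<open>Time, result and word size belong to one triple because the word bound is required at
  every intermediate step and not only at the end.\<close>

definition hoare :: "nat => int => cmd => nat => (st => bool) => (st => bool) => bool" where
 "hoare k W c B I J \<longleftrightarrow> (\<forall>P l s. code_at P l (asm k l c) --> I s -->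
 (\<exists>tau\<le>B. \<exists>s'. (dstep P ^^ tau) (l, s) = (l + csize k c, s') & J s' & (\<forall>j\<le>tau. wbd W (snd ((dstep P ^^ j) (l, s))))))"

lemma hoare_conseq: "hoare k W c B I J ==> (!!s. I' s ==> I s) ==> (!!s. J s ==> J' s) ==> B <= B' ==> hoare k W c B' I' J'"
 unfolding hoare_def
proof (intro allI impI)
 fix P l s
 assume h: "\<forall>P l s. code_at P l (asm k l c) --> I s --> (\<exists>tau\<le>B. \<exists>s'. (dstep P ^^ tau) (l, s) = (l + csize k c, s') & J s' & (\<forall>j\<le>tau. wbd W (snd ((dstep P ^^ j) (l, s)))))"
 and I: "!!s. I' s ==> I s" "!!s. J s ==> J' s" "B <= B'" and c: "code_at P l (asm k l c)" "I' s"
 obtain tau s' where t: "tau <= B" "(dstep P ^^ tau) (l, s) = (l + csize k c, s')" "J s'" "\<forall>j\<le>tau. wbd W (snd ((dstep P ^^ j) (l, s)))"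
 using h c(1) I(1)[OF c(2)] by blast
 have "tau <= B'" using t(1) I(3) by simp
 then show "\<exists>tau\<le>B'. \<exists>s'. (dstep P ^^ tau) (l, s) = (l + csize k c, s') & J' s' & (\<forall>j\<le>tau. wbd W (snd ((dstep P ^^ j) (l, s))))"
 using t(2,4) I(2)[OF t(3)] by blast
qed

lemma hoare_seq:
 assumes 1: "hoare k W c B I J" and 2: "hoare k W c' B' J K"
 shows "hoare k W (c ;; c') (B + B') I K"
 unfolding hoare_def
proof (intro allI impI)
 fix P l s assume c: "code_at P l (asm k l (c ;; c'))" and I: "I s"
 then have cc: "code_at P l (asm k l c)" "code_at P (l + csize k c) (asm k (l + csize k c) c')"
 by (auto simp: code_at_append length_asm)
 obtain t1 s1 where t1: "t1 <= B" "(dstep P ^^ t1) (l, s) = (l + csize k c, s1)" "J s1" "\<forall>j\<le>t1. wbd W (snd ((dstep P ^^ j) (l, s)))"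
 using 1 cc(1) I unfolding hoare_def by blast
 obtain t2 s2 where t2: "t2 <= B'" "(dstep P ^^ t2) (l + csize k c, s1) = (l + csize k c + csize k c', s2)" "K s2"
 "\<forall>j\<le>t2. wbd W (snd ((dstep P ^^ j) (l + csize k c, s1)))"
 using 2 cc(2) t1(3) unfolding hoare_def by blast
 have pw: "(dstep P ^^ (j + t1)) (l, s) = (dstep P ^^ j) (l + csize k c, s1)" for j
 by (simp add: funpow_add t1(2))
 have "wbd W (snd ((dstep P ^^ j) (l, s)))" if "j <= t2 + t1" for j
 proof (cases "j <= t1")
 case False
 then have "wbd W (snd ((dstep P ^^ ((j - t1) + t1)) (l, s)))" unfolding pw using t2(4) that by simp
 then show ?thesis using False by simp
 qed (use t1 in simp)
 moreover have "(dstep P ^^ (t2 + t1)) (l, s) = (l + csize k (c ;; c'), s2)" unfolding pw t2(2) by simp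
 ultimately show "\<exists>tau\<le>B + B'. \<exists>s'. (dstep P ^^ tau) (l, s) = (l + csize k (c ;; c'), s') & K s' & (\<forall>j\<le>tau. wbd W (snd ((dstep P ^^ j) (l, s))))"
 using t1 t2 by (intro exI[of _ "t2 + t1"] conjI exI[of _ s2]) auto
qed

text \<open>The test stands behind the body, so the loop runs at least once: hence
  \<open>0 < N\<close>, and \<open>test\<close> speaks of the state after a pass. Each pass costs
  one extra step for the jump.\<close>

lemma hoare_loop:
 assumes body: "!!j. j < N ==> hoare k W c B (I j) (I (Suc j))" and N: "0 < N"
 and test: "!!j s. j < N ==> I (Suc j) s ==> fst s r > 0 \<longleftrightarrow> Suc j < N"
 shows "hoare k W (Loop r c) (N * (B + 1)) (I 0) (I N)"
 unfolding hoare_def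
proof (intro allI impI)
 fix P l s assume c: "code_at P l (asm k l (Loop r c))" and I: "I 0 s"
 then have cc: "code_at P l (asm k l c)" "code_at P (l + csize k c) [JumpPos r l]" by (auto simp: code_at_append length_asm)
 have jmp: "dstep P (l + csize k c, s') = (if fst s' r > 0 then l else Suc (l + csize k c), s')" for s'
 using code_at_nth[OF cc(2), of 0] by (simp add: dstep_def)
 have "\<exists>tau\<le>j * (B + 1). \<exists>s'. (dstep P ^^ tau) (l, s) = (if j < N then l else l + csize k (Loop r c), s') & I j s' & (\<forall>j\<le>tau. j = 0 \<or> wbd W (snd ((dstep P ^^ j) (l, s))))"
 if "j <= N" for j using that
 proof (induction j)
 case 0
 show ?case using I N by (intro exI[of _ 0] conjI exI[of _ s]) auto
 next
 case (Suc j)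
 have jN: "j < N" using Suc.prems by simp
 from Suc.IH[OF less_imp_le[OF jN]] obtain t1 s1 where t1: "t1 <= j * (B + 1)" "(dstep P ^^ t1) (l, s) = (l, s1)" "I j s1" "\<forall>j\<le>t1. j = 0 \<or> wbd W (snd ((dstep P ^^ j) (l, s)))"
 unfolding if_P[OF jN] by blast
 obtain t2 s2 where t2: "t2 <= B" "(dstep P ^^ t2) (l, s1) = (l + csize k c, s2)" "I (Suc j) s2" "\<forall>j\<le>t2. wbd W (snd ((dstep P ^^ j) (l, s1)))"
 using body[OF jN] cc(1) t1(3) unfolding hoare_def by blast
 have pw: "(dstep P ^^ (i + t1)) (l, s) = (dstep P ^^ i) (l, s1)" for i by (simp add: funpow_add t1(2))
 have e1: "(dstep P ^^ (Suc t2 + t1)) (l, s) = (if Suc j < N then l else l + csize k (Loop r c), s2)"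
 unfolding pw using test[of j s2] Suc.prems t2(3) by (auto simp: t2(2) jmp)
 have "wbd W (snd ((dstep P ^^ i) (l, s)))" if ii: "i <= Suc t2 + t1" "i ~= 0" for i
 proof -
 consider "i <= t1" | "t1 < i" "i <= t2 + t1" | "i = Suc t2 + t1" using ii by linarith
 then show ?thesis
 proof cases
 case 1
 then show ?thesis using t1(4) ii by blast
 next
 case 2
 then have "wbd W (snd ((dstep P ^^ ((i - t1) + t1)) (l, s)))" unfolding pw using t2(4) by simp
 then show ?thesis using 2 by simp
 next
 case 3
 have "wbd W (snd ((dstep P ^^ t2) (l, s1)))" using t2(4) by blast
 then have "wbd W s2" unfolding t2(2) by simp
 then show ?thesis unfolding 3 e1 by simp
 qed
 qed
 moreover have "Suc t2 + t1 <= Suc j * (B + 1)" using t1(1) t2(1) by simp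
 ultimately show ?case using e1 t2(3) by (intro exI[of _ "Suc t2 + t1"] conjI exI[of _ s2]) auto
 qed
 from this[OF order_refl] have "\<exists>tau\<le>N * (B + 1). \<exists>s'. (dstep P ^^ tau) (l, s) = (l + csize k (Loop r c), s') & I N s' &
 (\<forall>j\<le>tau. j = 0 \<or> wbd W (snd ((dstep P ^^ j) (l, s))))"
 by (simp only: less_irrefl if_False)
 then obtain tau s' where t: "tau <= N * (B + 1)" "(dstep P ^^ tau) (l, s) = (l + csize k (Loop r c), s')" "I N s'"
 "\<forall>j\<le>tau. j = 0 \<or> wbd W (snd ((dstep P ^^ j) (l, s)))" by (elim exE conjE)
 \<comment> \<open>The assertions contain no word bound, so the induction claims nothing at step 0;
   the bound for the initial state comes from the first run of the body.\<close>
 obtain tau0 where "\<forall>j\<le>tau0. wbd W (snd ((dstep P ^^ j) (l, s)))" using body[OF N] cc(1) I unfolding hoare_def by blast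
 then have "wbd W (snd ((dstep P ^^ 0) (l, s)))" by blast
 then have "wbd W s" by simp
 then have "\<forall>j\<le>tau. wbd W (snd ((dstep P ^^ j) (l, s)))" using t(4) by force
 then show "\<exists>tau\<le>N * (B + 1). \<exists>s'. (dstep P ^^ tau) (l, s) = (l + csize k (Loop r c), s') & I N s' & (\<forall>j\<le>tau. wbd W (snd ((dstep P ^^ j) (l, s))))"
 using t by blast
qed

lemma hoare_blk:
 assumes I: "!!s. I s ==> wbd W0 s & words_ok W0 s & soks k ss s & J (zap k (fold ssem ss s))"
 and W: "2 <= W0" "int (cconst (Blk ss) k) <= W0" "csize k (Blk ss) <= L"
 shows "hoare k (W0 ^ 2 ^ L) (Blk ss) (csize k (Blk ss)) I J"
 unfolding hoare_def
proof (intro allI impI)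
 fix P l s assume c: "code_at P l (asm k l (Blk ss))" and Is: "I s"
 let ?is = "bcode k ss"
 have c: "code_at P l ?is" using c by simp
 have st: "\<forall>i\<in>set ?is. straight i" using straight_bcode by blast
 note steps = straight_steps[OF c st]
 have co: "\<forall>i\<in>set ?is. const_ok W0 i"
 proof
 fix i assume i: "i \<in> set ?is"
 show "const_ok W0 i"
 proof (cases i)
 case (Const d v)
 have "nat \<bar>v\<bar> <= cconst (Blk ss) k"
 using member_le_sum_list[of "nat \<bar>v\<bar>" "map (%i. case i of Const d v => nat \<bar>v\<bar> | _ => 0) ?is"] i Const by (force simp: image_iff)
 then show ?thesis using W(2) Const by simp
 qed auto
 qed
 have w: "wbd (W0 ^ 2 ^ L) (snd ((dstep P ^^ j) (l, s)))" if "j <= length ?is" for j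
 proof -
 have "wbd (W0 ^ 2 ^ j) (fold dexec (take j ?is) s)" using wbd_fold[OF W(1) _ _ co that] I[OF Is] by blast
 moreover have "W0 ^ 2 ^ j <= W0 ^ 2 ^ L" using W that by (intro power_increasing) auto
 ultimately show ?thesis unfolding steps[OF that] using wbd_mono by simp
 qed
 have "(dstep P ^^ length ?is) (l, s) = (l + length ?is, zap k (fold ssem ss s))"
 using steps[OF order_refl] bcode_correct[of k ss s] I[OF Is] by simp
 then show "\<exists>tau\<le>csize k (Blk ss). \<exists>s'. (dstep P ^^ tau) (l, s) = (l + csize k (Blk ss), s') & J s' & (\<forall>j\<le>tau. wbd (W0 ^ 2 ^ L) (snd ((dstep P ^^ j) (l, s))))"
 using w I[OF Is] by (intro exI[of _ "length ?is"] conjI exI[of _ "zap k (fold ssem ss s)"]) auto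
qed

lemma dstep_halted: "length P <= l ==> (dstep P ^^ j) (l, s) = (l, s)"
 by (induction j) (auto simp: dstep_def)

lemma hoare_run:
 assumes h: "hoare k W c B I J" and I: "I s" and T: "B <= T"
 defines "P \<equiv> asm k 0 c"
 shows "\<exists>s'. (dstep P ^^ T) (0, s) = (length P, s') & J s' & (\<forall>j\<le>T. wbd W (snd ((dstep P ^^ j) (0, s))))"
proof -
 have "code_at P 0 (asm k 0 c)" by (simp add: code_at_def P_def)
 then obtain tau s' where t: "tau <= B" "(dstep P ^^ tau) (0, s) = (length P, s')" "J s'" "\<forall>j\<le>tau. wbd W (snd ((dstep P ^^ j) (0, s)))"
 proof -
 assume a: "!!tau s'. tau <= B ==> (dstep P ^^ tau) (0, s) = (length P, s') ==> J s' ==> \<forall>j\<le>tau. wbd W (snd ((dstep P ^^ j) (0, s))) ==> thesis"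
 assume "code_at P 0 (asm k 0 c)"
 then have "\<exists>tau\<le>B. \<exists>s'. (dstep P ^^ tau) (0, s) = (0 + csize k c, s') & J s' & (\<forall>j\<le>tau. wbd W (snd ((dstep P ^^ j) (0, s))))"
 using h I unfolding hoare_def by blast
 moreover have "0 + csize k c = length P" by (simp add: P_def length_asm)
 ultimately show thesis using a by metis
 qed
 have late: "(dstep P ^^ j) (0, s) = (length P, s')" if "tau <= j" for j
 proof -
 have "(dstep P ^^ ((j - tau) + tau)) (0, s) = (length P, s')" by (simp only: funpow_add comp_apply t(2)) (simp add: dstep_halted)
 then show ?thesis using that by simp
 qed
 have "wbd W (snd ((dstep P ^^ j) (0, s)))" for j
 proof (cases "j <= tau")
 case False
 then have "(dstep P ^^ j) (0, s) = (dstep P ^^ tau) (0, s)" using late t(2) by simp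
 then show ?thesis using t(4) by simp
 qed (use t in simp)
 then show ?thesis using late[of T] t T by auto
qed

section \<open>Branch-free votes\<close>

text \<open>With floor division, \<open>x div (x\<^sup>2 + 1)\<close> is \<open>-1\<close> for negative \<open>x\<close> and \<open>0\<close> otherwise.\<close>

lemma div_square_Suc: "x div (x * x + 1) = (if x < 0 then - 1 else 0)" for x :: int
proof (cases "x < 0")
 case True
 have "x div (x * x + 1) = - 1"
 proof (rule int_div_pos_eq)
 show "x = (x * x + 1) * - 1 + (x * x + x + 1)" by (simp add: algebra_simps)
 have "0 <= x * (x + 1)" using True by (intro mult_nonpos_nonpos) auto
 then show "0 <= x * x + x + 1" by (simp add: algebra_simps)
 qed (use True in auto)
 then show ?thesis using True by simp
next
 case False
 then have "x < x * x + 1"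
 proof (cases "x = 0")
 case False2: False
 then have "1 * x <= x * x" using False by (intro mult_right_mono) auto
 then show ?thesis by simp
 qed simp
 then show ?thesis using False by (simp add: div_pos_pos_trivial)
qed

definition "sgnE e = Minus (Quot e (Plus (Times e e) (Cst 1))) (Quot (Minus (Cst 0) e) (Plus (Times e e) (Cst 1)))"
definition "ltE e = Minus (Cst 0) (Quot e (Plus (Times e e) (Cst 1)))"
definition "leE e f = ltE (Minus (Minus e f) (Cst 1))"
definition "varE p = Times (Cell (CL + p)) (sgnE (Cell (CL + p)))"
definition "idxE es = foldl (%x e. Plus (Times x (Plus (Cell 0) (Cst 1))) e) (Cst 0) es"
definition "bndE z = (case z of (i, j, l) => Plus (Plus (Cst (int i)) (Times (Cst (int j)) (Cell 1))) (Times (Cst (int l)) (Cell 0)))" for z :: bound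

definition idx :: "nat => nat list => nat" where "idx n K = foldl (%x v. x * (n + 1) + v) 0 K"

lemma depth_ge: "1 <= depth e" by (induction e) auto

lemma eval_sgnE: "eval (sgnE e) m = sgn (eval e m)"
 using div_square_Suc[of "eval e m"] div_square_Suc[of "- eval e m"] by (auto simp: sgnE_def sgn_if)

lemma eval_leE: "eval (leE e f) m = (if eval e m <= eval f m then 1 else 0)"
 unfolding leE_def ltE_def eval.simps div_square_Suc by simp

lemma safe_E: "safe k (sgnE e) m = safe k e m" "safe k (leE e f) m \<longleftrightarrow> safe k e m & safe k f m"
 "safe k (varE p) m \<longleftrightarrow> p < k" "safe k (bndE z) m"
 by (auto simp: sgnE_def leE_def ltE_def varE_def bndE_def CL_def TP_def split: prod.split)

lemma depth_E: "depth (sgnE e) <= 3 + depth e" "depth (varE p) <= 5" "depth (bndE z) <= 3" "depth (leE e f) <= 4 + max (depth e) (2 + depth f)"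
proof -
 show s: "depth (sgnE e) <= 3 + depth e" for e using depth_ge[of e] by (simp add: sgnE_def)
 show "depth (varE p) <= 5" using s[of "Cell (CL + p)"] by (simp add: varE_def)
 show "depth (bndE z) <= 3" by (simp add: bndE_def split: prod.split)
 show "depth (leE e f) <= 4 + max (depth e) (2 + depth f)" using depth_ge[of e] depth_ge[of f] by (auto simp: leE_def ltE_def max_def)
qed

lemma foldl_Times: "eval (foldl Times e es) m = eval e m * prod_list (map (%e. eval e m) es)"
 "safe k (foldl Times e es) m \<longleftrightarrow> safe k e m & (\<forall>e\<in>set es. safe k e m)"
 "depth e <= z ==> \<forall>e\<in>set es. depth e + 1 <= z ==> depth (foldl Times e es) <= z"
 by (induction es arbitrary: e) (auto simp: mult_ac)

lemma idxE_props:
 "m 0 = int n ==> map (%e. eval e m) es = map int K ==> eval (idxE es) m = int (idx n K)"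
 "safe k (idxE es) m \<longleftrightarrow> (\<forall>e\<in>set es. safe k e m)"
 "\<forall>e\<in>set es. depth e <= 5 ==> depth (idxE es) <= 6"
proof -
 show "m 0 = int n ==> map (%e. eval e m) es = map int K ==> eval (idxE es) m = int (idx n K)"
 proof (induction es arbitrary: K rule: rev_induct)
 case (snoc e es)
 then obtain K' v where K: "K = K' @ [v]" by (cases K rule: rev_cases) auto
 have "eval (idxE es) m = int (idx n K')" using snoc by (intro snoc.IH) (auto simp: K)
 moreover have "eval e m = int v" using snoc.prems by (simp add: K)
 ultimately show ?case using snoc.prems(1) by (simp add: K idxE_def idx_def)
 qed (simp add: idxE_def idx_def)
 show "safe k (idxE es) m \<longleftrightarrow> (\<forall>e\<in>set es. safe k e m)"
 by (induction es rule: rev_induct) (auto simp: idxE_def TP_def)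
 show "\<forall>e\<in>set es. depth e <= 5 ==> depth (idxE es) <= 6"
 by (induction es rule: rev_induct) (auto simp: idxE_def)
qed

lemma idx_snoc: "idx n (K @ [v]) = idx n K * (n + 1) + v" by (simp add: idx_def)

lemma idx_less: "set K \<subseteq> {1..n} ==> idx n K < (n + 1) ^ length K"
proof (induction K rule: rev_induct)
 case (snoc v K)
 then have "Suc (idx n K) <= (n + 1) ^ length K" "v <= n" by auto
 then have "Suc (idx n K) * (n + 1) <= (n + 1) ^ length K * (n + 1)" by (intro mult_right_mono) auto
 moreover have "idx n (K @ [v]) < Suc (idx n K) * (n + 1)" using \<open>v <= n\<close> by (simp add: idx_snoc)
 ultimately show ?case by (simp add: mult.commute)
qed (simp add: idx_def)

text \<open>\<open>idx\<close> reads a tuple as a number in base \<open>n + 1\<close>. Its digits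
  are nonzero, so there are no leading zeros and tuples of different lengths also have different
  codes.\<close>

lemma idx_inj: "set K \<subseteq> {1..n} ==> set K' \<subseteq> {1..n} ==> idx n K = idx n K' ==> K = K'"
proof (induction K arbitrary: K' rule: rev_induct)
 case Nil
 then show ?case by (cases K' rule: rev_cases) (auto simp: idx_snoc, simp add: idx_def)
next
 case (snoc v K)
 have "K' ~= []"
 proof
 assume "K' = []"
 then show False using snoc.prems by (simp add: idx_snoc) (simp add: idx_def)
 qed
 then obtain L w where K': "K' = L @ [w]" by (cases K' rule: rev_cases) auto
 have e: "idx n K * (n + 1) + v = idx n L * (n + 1) + w" using snoc.prems(3) by (simp only: K' idx_snoc)
 have "v < n + 1" "w < n + 1" using snoc.prems by (auto simp: K')
 then have "(idx n K * (n + 1) + v) div (n + 1) = idx n K" "(idx n L * (n + 1) + w) div (n + 1) = idx n L" by simp_all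
 then have i: "idx n K = idx n L" using e by simp
 then have "v = w" using e by simp
 then show ?case using snoc.IH[of L] snoc.prems i by (simp add: K')
qed

lemma prod_list_ind: "prod_list (map (%x. if P x then 1 else 0) xs) = (if \<forall>x\<in>set xs. P x then 1 else (0::int))"
 by (induction xs) auto

definition srcE :: "nat list \<times> nat list => expr" where
 "srcE x = sgnE (Deref (Plus (Cell 7) (idxE (map varE (fst x) @ map (%v. Cst (int v)) (snd x)))))"

text \<open>All case distinctions become factors 0 or 1, so a vote is straight-line code of fixed
  length; a clause outside the ranges still writes to its key, but adds 0.\<close>

definition voteE :: "vspec => expr" where
 "voteE sp = foldl Times (Cst (vsg sp)) (map (%p. sgnE (Cell (CL + p))) (apos sp) @ map srcE (srcs sp)
 @ map (%p. leE (bndE (fst (trng sp))) (varE p)) (tpos sp) @ map (%p. leE (varE p) (bndE (snd (trng sp)))) (tpos sp)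
 @ map (%p. leE (bndE (fst (srng sp))) (varE p)) (spos sp) @ map (%p. leE (varE p) (bndE (snd (srng sp)))) (spos sp))"

lemma gsrc_prod: "gsrc xs u (cvars (concat (map fst xs)) C) = prod_list (map (%x. sgn (u (cvars (fst x) C @ snd x))) xs)"
proof (induction xs)
 case (Cons x xs)
 then show ?case by (cases x) (simp add: cvars_append)
qed simp

lemma depth_srcE: "depth (srcE x) <= 10"
proof -
 have "depth (idxE (map varE (fst x) @ map (%v. Cst (int v)) (snd x))) <= 6"
 by (rule idxE_props(3)) (auto intro: depth_E)
 then show ?thesis using depth_E(1)[of "Deref (Plus (Cell 7) (idxE (map varE (fst x) @ map (%v. Cst (int v)) (snd x))))"]
 by (simp add: srcE_def)
qed

lemma depth_voteE: "depth (voteE sp) <= 15"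
 unfolding voteE_def
proof (rule foldl_Times(3))
 have 1: "depth (leE (bndE z) (varE p)) + 1 <= 15" for z p
 using depth_E(4)[of "bndE z" "varE p"] depth_E(2)[of p] depth_E(3)[of z] by linarith
 have 2: "depth (leE (varE p) (bndE z)) + 1 <= 15" for z p
 using depth_E(4)[of "varE p" "bndE z"] depth_E(2)[of p] depth_E(3)[of z] by linarith
 have 3: "depth (sgnE (Cell q)) + 1 <= 15" for q using depth_E(1)[of "Cell q"] by simp
 have 4: "depth (srcE x) + 1 <= 15" for x using depth_srcE[of x] by simp
 show "\<forall>e\<in>set (map (%p. sgnE (Cell (CL + p))) (apos sp) @ map srcE (srcs sp)
 @ map (%p. leE (bndE (fst (trng sp))) (varE p)) (tpos sp) @ map (%p. leE (varE p) (bndE (snd (trng sp)))) (tpos sp)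
 @ map (%p. leE (bndE (fst (srng sp))) (varE p)) (spos sp) @ map (%p. leE (varE p) (bndE (snd (srng sp)))) (spos sp)). depth e + 1 <= 15"
 unfolding set_append set_map ball_Un ball_simps using 1 2 3 4 by blast
qed simp

lemma voteE_correct:
 assumes C: "C \<in> clauses k n" and pos: "set (apos sp) \<subseteq> {..<k}"
 and m: "m 0 = int n" "m 1 = int (n div 3)" "!!p. p < k ==> m (CL + p) = lit_code (C ! p)"
 and src: "int (TOP k) <= m 7" "!!x. x \<in> set (srcs sp) ==> m (nat (m 7) + idx n (cvars (fst x) C @ snd x)) = u (cvars (fst x) C @ snd x)"
 shows "eval (voteE sp) m = vval n sp u C" "safe k (voteE sp) m"
 "!!q L. set q \<subseteq> {..<k} ==> eval (idxE (map varE q @ map (%v. Cst (int v)) L)) m = int (idx n (cvars q C @ L))"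
 "!!q L. set q \<subseteq> {..<k} ==> safe k (idxE (map varE q @ map (%v. Cst (int v)) L)) m"
proof -
 have vs: "1 <= lit_var (C ! p)" if "p < k" for p
 proof -
 have "C ! p \<in> set C" "lit_var ` set C \<subseteq> {1..n}" using C that by (auto simp: clauses_def)
 then have "lit_var (C ! p) \<in> {1..n}" by blast
 then show ?thesis by simp
 qed
 have sg: "eval (sgnE (Cell (CL + p))) m = lit_sign (C ! p)" if "p < k" for p
 using vs[OF that] m(3)[OF that] by (cases "C ! p") (auto simp: eval_sgnE lit_sign_def)
 have var: "eval (varE p) m = int (lit_var (C ! p))" if "p < k" for p
 using sg[OF that] m(3)[OF that] by (cases "C ! p") (auto simp: varE_def lit_sign_def)
 show ix: "eval (idxE (map varE q @ map (%v. Cst (int v)) L)) m = int (idx n (cvars q C @ L))" if "set q \<subseteq> {..<k}" for q L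
 using that var by (intro idxE_props(1) m) (auto simp: cvars_def)
 show sx: "safe k (idxE (map varE q @ map (%v. Cst (int v)) L)) m" if "set q \<subseteq> {..<k}" for q L
 using that by (auto simp: idxE_props(2) safe_E)
 have q: "set (fst x) \<subseteq> {..<k}" if "x \<in> set (srcs sp)" for x using pos that by (force simp: apos_def spos_def)
 have tp: "p \<in> set (tpos sp) ==> p < k" "p \<in> set (spos sp) ==> p < k" for p using pos by (auto simp: apos_def)
 have bd: "eval (bndE z) m = int (bnd n z)" for z by (simp add: bndE_def bnd_def m split: prod.split)
 have se: "eval (srcE x) m = sgn (u (cvars (fst x) C @ snd x))" if x: "x \<in> set (srcs sp)" for x
 proof -
 have "nat (m 7 + int (idx n (cvars (fst x) C @ snd x))) = nat (m 7) + idx n (cvars (fst x) C @ snd x)"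
 using src(1) by (simp add: nat_add_distrib)
 then show ?thesis using src(2)[OF x] ix[OF q[OF x], of "snd x"] by (simp add: srcE_def eval_sgnE)
 qed
 have ss: "safe k (srcE x) m" if x: "x \<in> set (srcs sp)" for x
 using sx[OF q[OF x], of "snd x"] ix[OF q[OF x], of "snd x"] src(1) by (simp add: srcE_def safe_E TP_def)
 have p1: "prod_list (map (%p. eval (sgnE (Cell (CL + p))) m) (apos sp)) = csign (apos sp) C"
 unfolding csign_def using pos sg by (intro arg_cong[of _ _ prod_list] map_cong) auto
 have p2: "prod_list (map (%x. eval (srcE x) m) (srcs sp)) = gsrc (srcs sp) u (cvars (spos sp) C)"
 unfolding spos_def gsrc_prod using se by (intro arg_cong[of _ _ prod_list] map_cong) auto
 have p3: "prod_list (map (%p. eval (leE (bndE z) (varE p)) m) L) = (if \<forall>p\<in>set L. bnd n z <= lit_var (C ! p) then 1 else 0)"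
 "prod_list (map (%p. eval (leE (varE p) (bndE z)) m) L) = (if \<forall>p\<in>set L. lit_var (C ! p) <= bnd n z then 1 else 0)"
 if "!!p. p \<in> set L ==> p < k" for z L
 unfolding prod_list_ind[symmetric] using that var by (auto intro!: arg_cong[of _ _ prod_list] map_cong simp: eval_leE bd)
 have vr: "vrel n sp C \<longleftrightarrow> (\<forall>p\<in>set (tpos sp). bnd n (fst (trng sp)) <= lit_var (C ! p)) & (\<forall>p\<in>set (tpos sp). lit_var (C ! p) <= bnd n (snd (trng sp)))
 & (\<forall>p\<in>set (spos sp). bnd n (fst (srng sp)) <= lit_var (C ! p)) & (\<forall>p\<in>set (spos sp). lit_var (C ! p) <= bnd n (snd (srng sp)))"
 by (auto simp: vrel_def rng_def cvars_def)
 show "eval (voteE sp) m = vval n sp u C"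
 unfolding voteE_def foldl_Times(1) vval_def vr
 by (simp add: comp_def p1 p2 p3 tp)
 show "safe k (voteE sp) m"
 unfolding voteE_def foldl_Times(2) using ss tp pos by (auto simp: safe_E CL_def TP_def apos_def)
qed

section \<open>Voting programs\<close>

primrec pureE :: "expr => bool" where
 "pureE (Cst x) \<longleftrightarrow> True"
| "pureE (Cell i) \<longleftrightarrow> i < 11"
| "pureE (Plus e f) \<longleftrightarrow> pureE e & pureE f"
| "pureE (Minus e f) \<longleftrightarrow> pureE e & pureE f"
| "pureE (Times e f) \<longleftrightarrow> pureE e & pureE f"
| "pureE (Quot e f) \<longleftrightarrow> pureE e & pureE f"
| "pureE (Deref e) \<longleftrightarrow> False"

lemma pureE_eval: "pureE e ==> \<forall>i<11. m i = rg ! i ==> eval e m = eval e ((!) rg) & safe k e m"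
 by (induction e) (auto simp: TP_def)

definition "keyE sp = Plus (Plus (Cell 7) (Cell 2)) (idxE (map varE (tpos sp)))"

text \<open>With \<open>fl\<close> set the answer is rewritten after every vote, which avoids a
  concluding pass over all \<open>n\<close> variables; for \<open>r = 1\<close> such a pass would
  exceed the time bound.\<close>

definition body :: "vspec => bool => stmt list" where
 "body sp fl = [Drw, Upd (keyE sp) (Plus (Deref (keyE sp)) (voteE sp))]
 @ (if fl then [Out (idxE (map varE (tpos sp))) (Deref (keyE sp))] else []) @ [Upd (Cst 8) (Minus (Cell 8) (Cst 1))]"

definition rblk :: "(nat \<times> expr) list => cmd" where
 "rblk us = Blk (map (%(i, e). Upd (Cst (int i)) e) us)"

definition rsem :: "(nat \<times> expr) list => int list => int list" where
 "rsem us rg = fold (%(i, e) rg. rg[i := eval e ((!) rg)]) us rg"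

definition phC :: "vspec => bool => nat => cmd" where
 "phC sp fl i = rblk [(8, Cell i)] ;; Loop 8 (Blk (body sp fl))"

definition initC :: "nat => nat list => cmd" where
 "initC k J = Blk [Upd (Plus (Cst (int (TOP k))) (idxE (map (%v. Cst (int v)) J))) (Cst 1)]"

locale ram =
 fixes k w n out :: nat and full :: "clause list" and A0 :: arrays and W0 :: int and L :: nat
 assumes full: "!!C. C \<in> set full ==> C \<in> clauses k n" and w: "1 <= w"
 and W0: "2 <= W0" "int n <= W0" "1 + int (length full) <= W0"
begin

definition "vkey K \<longleftrightarrow> length K <= w & set K \<subseteq> {1..n}"
definition "adr p K = TOP k + p * (n + 1) ^ w + idx n K"

lemma idx_vkey: "vkey K ==> idx n K < (n + 1) ^ w"
proof -
 assume K: "vkey K"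
 have "(n + 1) ^ length K <= (n + 1) ^ w" using K by (intro power_increasing) (auto simp: vkey_def)
 then show ?thesis using idx_less[of K n] K by (simp add: vkey_def)
qed

lemma adr_inj: "vkey K ==> vkey K' ==> adr p K = adr p' K' \<longleftrightarrow> p = p' & K = K'"
proof
 assume K: "vkey K" "vkey K'" and e: "adr p K = adr p' K'"
 let ?s = "(n + 1) ^ w"
 have l: "idx n K < ?s" "idx n K' < ?s" using K idx_vkey by auto
 have e': "p * ?s + idx n K = p' * ?s + idx n K'" using e by (simp add: adr_def)
 have "p = (p * ?s + idx n K) div ?s" "p' = (p' * ?s + idx n K') div ?s" using l by simp_all
 then have p: "p = p'" using e' by simp
 then have "idx n K = idx n K'" using e' by simp
 then show "p = p' & K = K'" using p idx_inj[of K n K'] K by (auto simp: vkey_def)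
qed simp

text \<open>Array cells are bounded by one plus the number of clauses drawn: the initial entry is 1,
  and each clause changes one vote sum by at most one. Together with the bounded registers and the
  cleared scratch cells this restores the word bound at every block boundary.\<close>

definition Rep :: "arrays => nat => int list => st => bool" where
 "Rep arr t rg s \<longleftrightarrow> (case s of (m, A, t', xs) => t' = t & xs = drop t full & (\<forall>i<11. m i = rg ! i) &
 (\<forall>x. CL <= x & x < TOP k --> m x = 0) & (\<forall>x\<ge>TOP k. \<bar>m x\<bar> <= 1 + int t) &
 (\<forall>p K. vkey K --> m (adr p K) = arr p K) & (\<forall>v\<in>{1..n}. A v = sgn (arr out [v])))"

definition "rgok rg \<longleftrightarrow> length rg = 11 & (\<forall>x\<in>set rg. \<bar>x\<bar> <= W0)"

lemma Rep_words:
 assumes R: "Rep arr t rg s" and rg: "rgok rg" and t: "t <= length full"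
 shows "wbd W0 s & words_ok W0 s"
proof -
 obtain m A xs where s: "s = (m, A, t, xs)" using R by (cases s) (auto simp: Rep_def)
 have "\<bar>m x\<bar> <= W0" for x
 proof -
 consider "x < 11" | "CL <= x" "x < TOP k" | "TOP k <= x" unfolding CL_def by linarith
 then show ?thesis
 proof cases
 case 1
 then have "m x = rg ! x" "rg ! x \<in> set rg" using R rg by (auto simp: Rep_def s rgok_def)
 then show ?thesis using rg by (simp add: rgok_def)
 next
 case 2
 then show ?thesis using R W0 by (auto simp: Rep_def s)
 next
 case 3
 then have "\<bar>m x\<bar> <= 1 + int t" using R by (auto simp: Rep_def s)
 then show ?thesis using W0(3) t by linarith
 qed
 qed
 moreover have "int (lit_var l) <= W0" if "C \<in> set xs" "l \<in> set C" for C l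
 proof -
 have "C \<in> set full" using that R by (auto simp: Rep_def s dest: in_set_dropD)
 from full[OF this] have "lit_var l \<in> {1..n}" using that(2) by (auto simp: clauses_def)
 then show ?thesis using W0(2) by simp
 qed
 ultimately show ?thesis by (auto simp: wbd_def words_ok_def s)
qed

lemma Rep_zap: "Rep arr t rg s ==> Rep arr t rg (zap k s)"
 by (auto simp: Rep_def zap_def CL_def adr_def split: prod.splits)

text \<open>The conditions on constants and code size pass from a program to its parts, so they are
  discharged once, for the whole program.\<close>

definition "ht c B I J \<longleftrightarrow> (int (cconst c k) <= W0 & csize k c <= L --> hoare k (W0 ^ 2 ^ L) c B I J)"

lemma ht_seq: "ht c B I J ==> ht c' B' J J' ==> ht (c ;; c') (B + B') I J'"
 unfolding ht_def by (auto intro: hoare_seq)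

lemma ht_conseq: "ht c B I J ==> (!!s. I' s ==> I s) ==> (!!s. J s ==> J' s) ==> B <= B' ==> ht c B' I' J'"
 unfolding ht_def using hoare_conseq by blast

lemma ht_loop:
 assumes "!!j. j < N ==> ht c B (I j) (I (Suc j))" "0 < N" "!!j s. j < N ==> I (Suc j) s ==> fst s i > 0 \<longleftrightarrow> Suc j < N"
 shows "ht (Loop i c) (N * (B + 1)) (I 0) (I N)"
 unfolding ht_def
proof
 assume "int (cconst (Loop i c) k) <= W0 & csize k (Loop i c) <= L"
 then have o: "int (cconst c k) <= W0 & csize k c <= L" by simp
 show "hoare k (W0 ^ 2 ^ L) (Loop i c) (N * (B + 1)) (I 0) (I N)"
 by (rule hoare_loop[OF _ assms(2,3)]) (use assms(1) o in \<open>auto simp: ht_def\<close>)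
qed

lemma ht_blk:
 assumes "!!s. I s ==> wbd W0 s & words_ok W0 s & soks k ss s & J (zap k (fold ssem ss s))"
 shows "ht (Blk ss) L I J"
 unfolding ht_def
proof
 assume o: "int (cconst (Blk ss) k) <= W0 & csize k (Blk ss) <= L"
 have h: "hoare k (W0 ^ 2 ^ L) (Blk ss) (csize k (Blk ss)) I J"
 by (rule hoare_blk[OF assms W0(1)]) (use o in blast)+
 show "hoare k (W0 ^ 2 ^ L) (Blk ss) L I J"
 by (rule hoare_conseq[OF h]) (use o in blast)+
qed

lemma ht_regs:
 assumes us: "\<forall>(i, e)\<in>set us. i < 11 & pureE e & depth e <= 19" and rg: "rgok rg" and t: "t <= length full"
 shows "ht (rblk us) L (Rep arr t rg) (Rep arr t (rsem us rg))"
 unfolding rblk_def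
proof (rule ht_blk)
 fix s assume R: "Rep arr t rg s"
 have "soks k (map (%(i, e). Upd (Cst (int i)) e) us) s & Rep arr t (rsem us rg) (fold ssem (map (%(i, e). Upd (Cst (int i)) e) us) s)"
 if "length rg = 11" using us R that
 proof (induction us arbitrary: s rg)
 case Nil
 then show ?case by (simp add: rsem_def)
 next
 case (Cons u us)
 obtain i e where u: "u = (i, e)" by (cases u)
 obtain m A xs where s: "s = (m, A, t, xs)" using Cons.prems by (cases s) (auto simp: Rep_def)
 have p: "eval e m = eval e ((!) rg)" "safe k e m"
 using pureE_eval[of e m rg k] Cons.prems by (auto simp: u Rep_def s)
 have ie: "i < 11" "depth e <= 19" using Cons.prems(1) by (auto simp: u)
 have ok: "sok k (Upd (Cst (int i)) e) s" using p ie by (simp add: s TP_def)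
 have "Rep arr t (rg[i := eval e ((!) rg)]) (ssem (Upd (Cst (int i)) e) s)"
 using Cons.prems ie by (auto simp: Rep_def s p CL_def TOP_def adr_def nth_list_update)
 from Cons.IH[OF _ this] Cons.prems ok show ?case by (simp add: u rsem_def)
 qed
 then show "wbd W0 s & words_ok W0 s & soks k (map (%(i, e). Upd (Cst (int i)) e) us) s &
 Rep arr t (rsem us rg) (zap k (fold ssem (map (%(i, e). Upd (Cst (int i)) e) us) s))"
 using Rep_words[OF R rg t] rg Rep_zap by (simp add: rgok_def)
qed

definition "spec_ok sp \<longleftrightarrow> set (apos sp) \<subseteq> {..<k} & length (tpos sp) <= w &
 (\<forall>x\<in>set (srcs sp). length (fst x) + length (snd x) <= w & set (snd x) \<subseteq> {1..n}) & (\<forall>u C. vval n sp u C \<in> {-1, 0, 1})"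

lemma ht_body:
 assumes sp: "spec_ok sp" and rg: "rgok rg" "rg ! 0 = int n" "rg ! 1 = int (n div 3)" "rg ! 2 = int ((n + 1) ^ w)"
 "rg ! 7 = int (TOP k + p * (n + 1) ^ w)"
 and t: "t < length full" and fl: "fl \<longleftrightarrow> p + 1 = out" "fl ==> length (tpos sp) = 1"
 shows "ht (Blk (body sp fl)) L (Rep arr t rg) (Rep (vstep n (sp, p, p + 1) (full ! t) arr) (t + 1) (rg[8 := rg ! 8 - 1]))"
proof (rule ht_blk)
 fix s assume R: "Rep arr t rg s"
 obtain m A xs where s: "s = (m, A, t, xs)" using R by (cases s) (auto simp: Rep_def)
 define C where "C = full ! t"
 have "drop t full = full ! t # drop (t + 1) full" using Cons_nth_drop_Suc[OF t] by (simp only: Suc_eq_plus1)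
 then have xs: "xs = C # drop (t + 1) full" using R by (simp add: Rep_def s C_def)
 have C: "C \<in> clauses k n" using full t by (simp add: C_def)
 have len: "length C = k" using C by (simp add: clauses_def)
 have lenxs: "\<forall>C\<in>set xs. length C = k"
 using R full by (auto simp: Rep_def s clauses_def dest!: in_set_dropD)
 have Rm: "\<forall>i<11. m i = rg ! i" "\<forall>x\<ge>TOP k. \<bar>m x\<bar> <= 1 + int t" "!!p K. vkey K ==> m (adr p K) = arr p K"
 "\<forall>v\<in>{1..n}. A v = sgn (arr out [v])" using R by (auto simp: Rep_def s)
 define m1 where "m1 = write_block CL (map lit_code C) m"
 have m1: "!!i. i < 11 ==> m1 i = rg ! i" "!!x. TOP k <= x ==> m1 x = m x" "!!q. q < k ==> m1 (CL + q) = lit_code (C ! q)"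
 using Rm(1) len by (auto simp: m1_def write_block_def CL_def TOP_def)
 have pos: "set (apos sp) \<subseteq> {..<k}" "set (tpos sp) \<subseteq> {..<k}" using sp by (auto simp: spec_ok_def apos_def)
 have cv: "set (cvars q C) \<subseteq> {1..n}" if "set q \<subseteq> {..<k}" for q
 proof
 fix v assume "v \<in> set (cvars q C)"
 then obtain j where j: "j \<in> set q" "v = lit_var (C ! j)" by (auto simp: cvars_def)
 then have "j < k" using that by blast
 moreover then have "C ! j \<in> set C" using len by simp
 moreover have "lit_var ` set C \<subseteq> {1..n}" using C by (simp add: clauses_def)
 ultimately show "v \<in> {1..n}" unfolding j(2) by blast
 qed
 define K where "K = cvars (tpos sp) C"
 have K: "vkey K" using sp cv[OF pos(2)] by (simp add: vkey_def K_def spec_ok_def)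
 have m7: "m1 7 = int (TOP k + p * (n + 1) ^ w)" "m1 2 = int ((n + 1) ^ w)" "m1 0 = int n" "m1 1 = int (n div 3)" "m1 8 = rg ! 8"
 using m1(1)[of 7] m1(1)[of 2] m1(1)[of 0] m1(1)[of 1] m1(1)[of 8] rg by simp_all
 have src: "m1 (nat (m1 7) + idx n (cvars (fst x) C @ snd x)) = arr p (cvars (fst x) C @ snd x)" if x: "x \<in> set (srcs sp)" for x
 proof -
 have "set (fst x) \<subseteq> {..<k}" using pos x by (force simp: apos_def spos_def)
 then have "vkey (cvars (fst x) C @ snd x)" using sp x cv by (auto simp: vkey_def spec_ok_def)
 from Rm(3)[OF this, of p] show ?thesis
 unfolding m7 nat_int using m1(2) by (simp add: adr_def)
 qed
 note v = voteE_correct[OF C pos(1) m7(3,4) m1(3) _ src]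
 have m7': "int (TOP k) <= m1 7" using m7(1) by simp
 define vv where "vv = vval n sp (arr p) C"
 have vt: "vv \<in> {-1, 0, 1}" using sp by (simp add: spec_ok_def vv_def)
 have ev: "eval (voteE sp) m1 = vv" "safe k (voteE sp) m1" using v(1,2)[OF _ m7'] by (auto simp: vv_def)
 have ix: "eval (idxE (map varE (tpos sp))) m1 = int (idx n K)" "safe k (idxE (map varE (tpos sp))) m1"
 using v(3,4)[OF _ m7' _ pos(2), of "[]"] by (auto simp: K_def)
 have ix2: "depth (idxE (map varE (tpos sp))) <= 6" by (rule idxE_props(3)) (auto intro: depth_E)
 define ad where "ad = adr (p + 1) K"
 have ad: "TOP k <= ad" by (simp add: ad_def adr_def)
 have key: "eval (keyE sp) m1 = int ad"
 by (simp add: keyE_def ix m7 ad_def adr_def algebra_simps)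
 define m2 where "m2 = m1(ad := m1 ad + vv)"
 have m2lo: "m2 x = m1 x" if "x < TOP k" for x using that ad by (auto simp: m2_def)
 have keyd: "depth (keyE sp) <= 7" "safe k (keyE sp) m1" using ix ix2 by (auto simp: keyE_def TP_def)
 have m2b: "m2 0 = int n" "m2 7 = m1 7" "m2 2 = m1 2" "m2 8 = rg ! 8" using m2lo m7 by (auto simp: TOP_def)
 have ixm2: "eval (idxE (map varE (tpos sp))) m2 = int (idx n K)" "safe k (idxE (map varE (tpos sp))) m2"
 proof -
 have eq: "eval (varE q) m2 = eval (varE q) m1" if "q < k" for q
 using m2lo[of "CL + q"] that by (simp add: varE_def eval_sgnE CL_def TOP_def)
 have "map (%e. eval e m1) (map varE (tpos sp)) = map int K"
 proof -
 have "eval (varE q) m1 = int (lit_var (C ! q))" if "q < k" for q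
 using m1(3)[OF that] by (cases "C ! q") (auto simp: varE_def eval_sgnE sgn_if)
 then show ?thesis using pos(2) by (auto simp: K_def cvars_def)
 qed
 moreover have "map (%e. eval e m2) (map varE (tpos sp)) = map (%e. eval e m1) (map varE (tpos sp))" using pos(2) eq by auto
 ultimately have "map (%e. eval e m2) (map varE (tpos sp)) = map int K" by simp
 then show "eval (idxE (map varE (tpos sp))) m2 = int (idx n K)" by (intro idxE_props(1) m2b)
 show "safe k (idxE (map varE (tpos sp))) m2" using pos(2) by (auto simp: idxE_props(2) safe_E)
 qed
 have key2: "eval (keyE sp) m2 = int ad" "safe k (keyE sp) m2"
 using ixm2 by (auto simp: keyE_def m2b m7 ad_def adr_def TP_def algebra_simps)
 define A' where "A' = (if fl then A(idx n K := sgn (m2 ad)) else A)"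
 define m3 where "m3 = m2(8 := rg ! 8 - 1)"
 have st1: "ssem Drw s = (m1, A, t + 1, drop (t + 1) full)" by (simp add: s xs m1_def)
 have st2: "ssem (Upd (keyE sp) (Plus (Deref (keyE sp)) (voteE sp))) (m1, A, t + 1, drop (t + 1) full) = (m2, A, t + 1, drop (t + 1) full)"
 by (simp add: key ev m2_def)
 have st3: "ssem (Out (idxE (map varE (tpos sp))) (Deref (keyE sp))) (m2, A, t + 1, drop (t + 1) full) = (m2, A(idx n K := sgn (m2 ad)), t + 1, drop (t + 1) full)"
 by (simp add: key2 ixm2)
 have st4: "ssem (Upd (Cst 8) (Minus (Cell 8) (Cst 1))) (m2, B, t + 1, drop (t + 1) full) = (m3, B, t + 1, drop (t + 1) full)" for B
 by (simp add: m3_def m2b)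
 have fin: "fold ssem (body sp fl) s = (m3, A', t + 1, drop (t + 1) full)"
 unfolding body_def A'_def by (cases fl) (simp_all only: append.simps fold_simps if_True if_False st1 st2 st3 st4)
 have ok4: "sok k (Upd (Cst 8) (Minus (Cell 8) (Cst 1))) (m2, B, t + 1, drop (t + 1) full)" for B by (simp add: TP_def)
 have ok3: "sok k (Out (idxE (map varE (tpos sp))) (Deref (keyE sp))) (m2, A, t + 1, drop (t + 1) full)"
 using ixm2 ix2 key2 keyd ad by simp
 have ok2: "sok k (Upd (keyE sp) (Plus (Deref (keyE sp)) (voteE sp))) (m1, A, t + 1, drop (t + 1) full)"
 using key ev keyd depth_voteE[of sp] ad by simp
 have ok1: "sok k Drw s" using lenxs xs by (simp add: s)
 have oks: "soks k (body sp fl) s"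
 unfolding body_def by (cases fl) (simp_all only: append.simps soks.simps if_True if_False st1 st2 st3 ok1 ok2 ok3 ok4 simp_thms)
 have arr': "vstep n (sp, p, p + 1) C arr q K' = arr q K' + (if q = p + 1 & K = K' then vv else 0)" for q K'
 by (auto simp: vstep_def vx_def K_def vv_def)
 have m1ad: "m1 (adr q K') = arr q K'" if "vkey K'" for q K' using m1(2)[of "adr q K'"] Rm(3)[OF that] by (simp add: adr_def)
 have m3ad: "m3 (adr q K') = vstep n (sp, p, p + 1) C arr q K'" if K': "vkey K'" for q K'
 proof -
 have "adr q K' ~= 8" by (simp add: adr_def TOP_def)
 moreover have "adr q K' = ad \<longleftrightarrow> q = p + 1 & K = K'" unfolding ad_def using adr_inj[OF K' K] by auto
 ultimately show ?thesis using m1ad[OF K', of q] by (auto simp: m3_def m2_def arr')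
 qed
 have hi: "\<bar>m3 x\<bar> <= 1 + int (t + 1)" if "TOP k <= x" for x
 proof -
 have "\<bar>m x\<bar> <= 1 + int t" using Rm(2) that by blast
 then have "\<bar>m1 x\<bar> <= 1 + int t" using m1(2)[OF that] by simp
 moreover have "x ~= 8" using that by (simp add: TOP_def)
 ultimately show ?thesis using vt by (auto simp: m3_def m2_def)
 qed
 have ans: "A' v = sgn (vstep n (sp, p, p + 1) C arr out [v])" if v: "v \<in> {1..n}" for v
 proof (cases fl)
 case True
 then obtain u where u: "K = [u]" using fl(2) by (auto simp: K_def cvars_def One_nat_def length_Suc_conv)
 have o: "out = p + 1" using fl(1) True by simp
 have "m2 ad = arr out K + vv" using m1ad[OF K, of "p + 1"] by (simp add: m2_def ad_def o)
 moreover have "idx n K = u" by (simp add: u idx_def)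
 ultimately show ?thesis using Rm(4) v True by (auto simp: A'_def arr' o u)
 next
 case False
 then show ?thesis using Rm(4) v fl(1) by (auto simp: A'_def arr')
 qed
 have lo: "\<forall>i<11. m3 i = rg[8 := rg ! 8 - 1] ! i"
 proof (intro allI impI)
 fix i :: nat assume i: "i < 11"
 then have "m2 i = rg ! i" using m2lo[of i] m1(1)[OF i] by (simp add: TOP_def)
 then show "m3 i = rg[8 := rg ! 8 - 1] ! i" using rg(1) i by (auto simp: m3_def rgok_def nth_list_update)
 qed
 have "Rep (vstep n (sp, p, p + 1) C arr) (t + 1) (rg[8 := rg ! 8 - 1]) (zap k (m3, A', t + 1, drop (t + 1) full))"
 unfolding Rep_def zap_def using lo hi m3ad ans by (auto simp: CL_def adr_def)
 then show "wbd W0 s & words_ok W0 s & soks k (body sp fl) s &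
 Rep (vstep n (sp, p, p + 1) (full ! t) arr) (t + 1) (rg[8 := rg ! 8 - 1]) (zap k (fold ssem (body sp fl) s))"
 using Rep_words[OF R rg(1)] t oks by (simp add: fin C_def)
qed

definition "RepT ts rg = Rep (valg n ts full A0) (length ts) rg"

lemma valg_snoc: "length ts < length full ==> valg n (ts @ [x]) full A0 = vstep n x (full ! length ts) (valg n ts full A0)"
proof -
 assume l: "length ts < length full"
 define A B y where "A = take (length ts) full" and "B = drop (Suc (length ts)) full" and "y = full ! length ts"
 have f: "full = A @ y # B" "length A = length ts" using id_take_nth_drop[OF l] l by (simp_all add: A_def B_def y_def)
 have "zip (ts @ [x]) (A @ y # B) = zip ts A @ [(x, y)]" "zip ts (A @ y # B) = zip ts A" using f(2) by (simp_all add: zip_append2)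
 then have "zip (ts @ [x]) full = zip ts full @ [(x, y)]" unfolding f(1)[symmetric] by simp
 then show ?thesis by (simp add: valg_def y_def)
qed

lemma ht_phase:
 assumes sp: "spec_ok sp" and rg: "rgok rg" "rg ! 0 = int n" "rg ! 1 = int (n div 3)" "rg ! 2 = int ((n + 1) ^ w)"
 "rg ! 7 = int (TOP k + p * (n + 1) ^ w)" "rg ! i = int N" "i < 8" and N: "0 < N"
 and t: "length ts + N <= length full" and fl: "fl \<longleftrightarrow> p + 1 = out" "fl ==> length (tpos sp) = 1"
 shows "ht (phC sp fl i) (2 * (L + 1) * N) (RepT ts rg) (RepT (ts @ replicate N (sp, p, p + 1)) (rg[8 := 0]))"
proof -
 have l11: "length rg = 11" using rg(1) by (simp add: rgok_def)
 have ok: "rgok (rg[8 := int j])" if "j <= N" for j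
 proof -
 have "rg ! i \<in> set rg" using l11 rg(7) by simp
 then have "\<bar>int N\<bar> <= W0" using rg(1,6) by (auto simp: rgok_def)
 then have "\<bar>int j\<bar> <= W0" using that by simp
 then show ?thesis using rg(1) set_update_subset_insert[of rg 8 "int j"] by (auto simp: rgok_def)
 qed
 define I where "I j = RepT (ts @ replicate j (sp, p, p + 1)) (rg[8 := int (N - j)])" for j
 have rs: "rsem [(8, Cell i)] rg = rg[8 := int N]" using rg(6) by (simp add: rsem_def)
 have "ht (rblk [(8, Cell i)]) L (RepT ts rg) (RepT ts (rg[8 := int N]))"
 unfolding RepT_def rs[symmetric] using rg t by (intro ht_regs) auto
 then have 1: "ht (rblk [(8, Cell i)]) L (RepT ts rg) (I 0)" by (simp add: I_def)
 have 2: "ht (Loop 8 (Blk (body sp fl))) (N * (L + 1)) (I 0) (I N)"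
 proof (rule ht_loop[OF _ N])
 fix j assume j: "j < N"
 have lt: "length (ts @ replicate j (sp, p, p + 1)) < length full" using j t by simp
 have ll: "length (ts @ replicate (Suc j) (sp, p, p + 1)) = length (ts @ replicate j (sp, p, p + 1)) + 1" by simp
 have e: "(ts @ replicate j (sp, p, p + 1)) @ [(sp, p, p + 1)] = ts @ replicate (Suc j) (sp, p, p + 1)"
 by (simp add: replicate_append_same)
 have rg8: "(rg[8 := int (N - j)])[8 := rg[8 := int (N - j)] ! 8 - 1] = rg[8 := int (N - Suc j)]"
 using j l11 by (simp add: of_nat_diff algebra_simps)
 show "ht (Blk (body sp fl)) L (I j) (I (Suc j))"
 using ht_body[OF sp ok[of "N - j"] _ _ _ _ lt fl, where arr="valg n (ts @ replicate j (sp, p, p + 1)) full A0"] rg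
 unfolding I_def RepT_def ll valg_snoc[OF lt, symmetric] e rg8 by (simp add: l11)
 fix s assume "I (Suc j) s"
 then have "fst s 8 = int (N - Suc j)" using l11 by (cases s) (auto simp: I_def RepT_def Rep_def)
 then show "fst s 8 > 0 \<longleftrightarrow> Suc j < N" by auto
 qed
 have "L + N * (L + 1) <= N * (L + 1) + N * (L + 1)" using N by (cases N) auto
 then have "L + N * (L + 1) <= 2 * (L + 1) * N" by (simp add: algebra_simps)
 then show ?thesis
 unfolding phC_def by (rule ht_conseq[OF ht_seq[OF 1 2], rotated 2]) (auto simp: I_def)
qed

lemma ht_init:
 assumes A0: "A0 = (%p K. if p = 0 & K = J then 1 else 0)" and J: "vkey J" and o: "out ~= 0"
 shows "ht (initC k J) L (%s. s = (mem0 n, %_. 0, 0, full)) (RepT [] (int n # replicate 10 0))"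
 unfolding initC_def
proof (rule ht_blk)
 fix s :: st assume s: "s = (mem0 n, %_. 0, 0, full)"
 let ?e = "Plus (Cst (int (TOP k))) (idxE (map (%v. Cst (int v)) J))"
 have ix: "eval (idxE (map (%v. Cst (int v)) J)) (mem0 n) = int (idx n J)"
 by (rule idxE_props(1)) (auto simp: mem0_def)
 have e: "eval ?e (mem0 n) = int (adr 0 J)" using ix by (simp add: adr_def)
 have de: "depth (idxE (map (%v. Cst (int v)) J)) <= 6" by (rule idxE_props(3)) auto
 have ok: "soks k [Upd ?e (Cst 1)] s"
 using e de by (auto simp: s idxE_props(2) adr_def ix nat_add_distrib)
 have fin: "fold ssem [Upd ?e (Cst 1)] s = ((mem0 n)(adr 0 J := 1), %_. 0, 0, full)" by (simp only: s fold_simps ssem.simps e eval.simps(1) nat_int)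
 have ne: "adr p K ~= 0" for p K by (simp add: adr_def TOP_def)
 have ad: "((mem0 n)(adr 0 J := 1)) (adr p K) = A0 p K" if "vkey K" for p K
 using adr_inj[OF that J, of p 0] ne[of p K] by (auto simp: A0 mem0_def)
 have hi: "TOP k <= adr 0 J" by (simp add: adr_def)
 have "Rep A0 0 (int n # replicate 10 0) (zap k ((mem0 n)(adr 0 J := 1), %_. 0, 0, full))"
 unfolding Rep_def zap_def using ad hi o
 by (auto simp: CL_def TOP_def adr_def mem0_def A0 nth_Cons' numeral_eq_Suc)
 moreover have "wbd W0 s & words_ok W0 s"
 proof -
 have "int (lit_var l) <= W0" if "C \<in> set full" "l \<in> set C" for C l
 proof -
 have "lit_var l \<in> {1..n}" using full[OF that(1)] that(2) by (auto simp: clauses_def)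
 then show ?thesis using W0(2) by simp
 qed
 then show ?thesis using W0 by (auto simp: s wbd_def words_ok_def mem0_def)
 qed
 moreover have "valg n [] full A0 = A0" by (simp add: valg_def)
 ultimately show "wbd W0 s & words_ok W0 s & soks k [Upd ?e (Cst 1)] s &
 RepT [] (int n # replicate 10 0) (zap k (fold ssem [Upd ?e (Cst 1)] s))"
 using ok unfolding fin RepT_def by simp
qed

end

section \<open>The sampling program\<close>

primrec pwE :: "expr => nat => expr" where
 "pwE e 0 = Cst 1"
| "pwE e (Suc j) = Times (pwE e j) e"

lemma pwE_props: "eval (pwE e j) m = eval e m ^ j" "pureE e ==> pureE (pwE e j)" "depth (pwE e j) <= 1 + depth e"
 using depth_ge[of e] by (induction j) (auto simp: mult.commute)

lemma lst11:
 "[x0, x1, x2, x3, x4, x5, x6, x7, x8, x9, x10] ! 0 = x0" "[x0, x1, x2, x3, x4, x5, x6, x7, x8, x9, x10] ! 1 = x1" "[x0, x1, x2, x3, x4, x5, x6, x7, x8, x9, x10] ! 2 = x2" "[x0, x1, x2, x3, x4, x5, x6, x7, x8, x9, x10] ! 3 = x3" "[x0, x1, x2, x3, x4, x5, x6, x7, x8, x9, x10] ! 4 = x4" "[x0, x1, x2, x3, x4, x5, x6, x7, x8, x9, x10] ! 5 = x5" "[x0, x1, x2, x3, x4, x5, x6, x7, x8, x9, x10] ! 6 = x6" "[x0, x1, x2, x3, x4, x5, x6, x7, x8, x9, x10] ! 7 = x7" "[x0, x1, x2, x3, x4, x5, x6, x7, x8, x9, x10] ! 8 = x8" "[x0, x1,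 x2, x3, x4, x5, x6, x7, x8, x9, x10] ! 9 = x9" "[x0, x1, x2, x3, x4, x5, x6, x7, x8, x9, x10] ! 10 = x10"
 "[x0, x1, x2, x3, x4, x5, x6, x7, x8, x9, x10][0 := y] = [y, x1, x2, x3, x4, x5, x6, x7, x8, x9, x10]" "[x0, x1, x2, x3, x4, x5, x6, x7, x8, x9, x10][1 := y] = [x0, y, x2, x3, x4, x5, x6, x7, x8, x9, x10]" "[x0, x1, x2, x3, x4, x5, x6, x7, x8, x9, x10][2 := y] = [x0, x1, y, x3, x4, x5, x6, x7, x8, x9, x10]" "[x0, x1, x2, x3, x4, x5, x6, x7, x8, x9, x10][3 := y] = [x0, x1, x2, y, x4, x5, x6, x7, x8, x9, x10]" "[x0, x1, x2, x3, x4, x5, x6, x7, x8, x9, x10][4 := y] = [x0, x1, x2, x3, y, x5, x6, x7, x8, x9, x10]" "[x0, x1, x2, x3, x4, x5, x6, x7, x8, x9, x10][5 := y] = [x0, x1, x2, x3, x4, y, x6, x7, x8, x9, x10]" "[x0, x1, x2, x3, x4, x5, x6, x7, x8, x9, x10][6 := y] = [x0, x1, x2, x3, x4, x5, y, x7, x8, x9, x10]" "[x0, x1, x2, x3, x4, x5, x6, x7, x8, x9, x10][7 := y] = [x0, x1, x2, x3, x4, x5, x6, y, x8, x9, x10]" "[x0, x1, x2, x3, x4, x5, x6, x7, x8, x9, x10][8 := y] = [x0, x1, x2, x3, x4, x5, x6, x7, y, x9, x10]" "[x0, x1, x2, x3, x4, x5, x6, x7, x8, x9, x10][9 := y] = [x0,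 x1, x2, x3, x4, x5, x6, x7, x8, y, x10]" "[x0, x1, x2, x3, x4, x5, x6, x7, x8, x9, x10][10 := y] = [x0, x1, x2, x3, x4, x5, x6, x7, x8, x9, y]"
 "x # replicate 10 y = [x, y, y, y, y, y, y, y, y, y, y]"
 by (simp_all add: numeral_eq_Suc One_nat_def)

declare list_update.simps [simp del]

context sampler
begin

text \<open>\<open>sq n\<close> and \<open>lg n\<close> are found by counting up until the square or
  the power of two reaches \<open>n\<close>. By \<open>M_pos\<close> this takes at most
  \<open>Mb n\<close> passes each, within the time spent on clauses.\<close>

definition "sqB = rblk [(3, Plus (Cell 3) (Cst 1)), (8, Minus (Cell 0) (Times (Cell 3) (Cell 3)))]"
definition "lgB = rblk [(4, Plus (Cell 4) (Cst 1)), (10, Times (Cell 10) (Cst 2)), (8, Minus (Cell 0) (Cell 10))]"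
definition "startB = rblk [(1, Quot (Cell 0) (Cst 3)), (2, pwE (Plus (Cell 0) (Cst 1)) a), (7, Cst (int (TOP k))), (10, Cst 1)]"
definition "countB = rblk [(5, Times (Times (Cst (int K1)) (pwE (Cell 0) b)) (if odd r then Cell 3 else Cst 1)),
 (6, Times (Times (Cst (int K2)) (Cell 5)) (Cell 4)), (9, Times (Cst (int r)) (Cell 4)), (8, Cst 0)]"
definition "nextB = rblk [(7, Plus (Cell 7) (Cell 2))]"
definition "decB = rblk [(9, Minus (Cell 9) (Cst 1))]"

definition "preC = initC k [1..<b + 1] ;; startB ;; Loop 8 sqB ;; Loop 8 lgB ;; countB"
definition "roundC = phC T1 False 5 ;; nextB ;; phC T2 False 5 ;; nextB ;; decB"
definition "restC = nextB ;; phC T2 False 5 ;; nextB ;; Loop 9 roundC ;; phC T1 False 5 ;; nextB ;; phC T2 False 6 ;; nextB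
 ;; phC (FS RA) False 6 ;; phC (FS RB) False 6 ;; phC (FS RC) False 6 ;; nextB
 ;; phC (GS RA) True 6 ;; phC (GS RB) True 6 ;; phC (GS RC) True 6"
definition "prog = preC ;; phC T1 (r = 1) 6 ;; (if r = 1 then rblk [] else restC)"

definition "Zc = csize k prog + 1"
definition "mcl n = length (tasks (phases n))"

text \<open>Cell 7 holds the base address of the array being read, the destination lying one stride
  (cell 2) further. Cell 8, the loop counter, is zero between phases; cell 9 counts the remaining
  rounds.\<close>

definition regs :: "nat => nat => nat => int list" where
 "regs n p rc = [int n, int (n div 3), int ((n + 1) ^ a), int (sq n), int (lg n), int (M n), int (Mb n),
 int (TOP k + p * (n + 1) ^ a), 0, int rc, int (2 ^ lg n)]"

text \<open>One number above everything held at block boundaries, the constants of the program and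
  the length of the stream.\<close>

definition Wsum :: "nat => nat" where
 "Wsum n = 2 + n + (n + 1) ^ a + sq n * sq n + lg n + 2 ^ lg n + M n + Mb n + (TOP k + (8 + 2 * R n) * (n + 1) ^ a) + R n
 + cconst prog k + 100 * Zc * mcl n"

lemma tasks_simps: "tasks [] = []" "tasks (x # phs) = (case x of (sp, src, dst, m) => replicate m (sp, src, dst)) @ tasks phs"
 "tasks (phs @ phs') = tasks phs @ tasks phs'"
 by (auto simp: tasks_def)

lemma rounds_snoc: "rounds n q (Suc j) = rounds n q j @ [(T1, q + 2 * j, q + 2 * j + 1, M n), (T2, q + 2 * j + 1, q + 2 * j + 2, M n)]"
proof (induction j arbitrary: q)
 case (Suc j)
 show ?case unfolding rounds.simps(2)[of n q "Suc j"] Suc.IH[of "q + 2"] by simp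
qed simp

lemma length_rounds: "length (tasks (rounds n q j)) = 2 * j * M n"
 by (induction j arbitrary: q) (auto simp: tasks_simps)

lemma mcl_eq: "mcl n = (if r = 1 then Mb n else Mb n + M n + 2 * R n * M n + M n + 7 * Mb n)"
 by (simp add: mcl_def phases_def final_phases_def tasks_simps length_rounds)

lemma M_pos: "1 <= n ==> 1 <= M n" "1 <= n ==> M n <= Mb n" "1 <= n ==> lg n <= Mb n" "1 <= n ==> sq n <= Mb n" "1 <= R n"
proof -
 have pos1: "1 <= x * y" if "1 <= x" "1 <= y" for x y :: nat using mult_mono[of 1 x 1 y] that by simp
 show "1 <= R n" unfolding R_def by (intro pos1 r lg_ge(1))
 assume n: "1 <= n"
 have "M n ~= 0" using n K sq_ge(1)[of n] by (auto simp: M_def)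
 then show M1: "1 <= M n" by linarith
 have "M n * 1 <= M n * (K2 * lg n)" by (intro mult_left_mono pos1 K lg_ge(1)) simp
 then show M2: "M n <= Mb n" by (simp add: Mb_def mult_ac)
 have "1 * lg n <= (K2 * M n) * lg n" by (intro mult_right_mono pos1 K M1) simp
 then show "lg n <= Mb n" by (simp add: Mb_def)
 have "sq n <= M n"
 proof (cases "odd r")
 case True
 have "1 * sq n <= (K1 * n ^ b) * sq n" using n by (intro mult_right_mono pos1 K one_le_power) auto
 then show ?thesis using True by (simp add: M_def)
 next
 case False
 then have "1 <= b" using r by (auto simp: b_def elim!: evenE)
 have "sq n <= n"
 proof (rule ccontr)
 assume "~ sq n <= n"
 then have "n * n < n" using sq_least[of n n] n by simp
 then show False using n by simp
 qed
 also have "n <= n ^ b" using n \<open>1 <= b\<close> by (intro self_le_power) auto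
 also have "n ^ b <= M n"
 proof -
 have "1 * n ^ b <= K1 * n ^ b" by (intro mult_right_mono K) simp
 then show ?thesis using False by (simp add: M_def)
 qed
 finally show ?thesis .
 qed
 then show "sq n <= Mb n" using M2 by simp
qed

text \<open>The stream is as long as the time bound, so that the deterministic description covers
  every step; the program reads only its first \<open>mcl n\<close> clauses.\<close>

lemma prog_correct:
 assumes n: "24 * (r + length ps' + 2) <= n" and full: "!!C. C \<in> set full ==> C \<in> clauses k n"
 and len: "length full = 100 * Zc * mcl n" and W: "int (Wsum n) <= W0"
 shows "hoare k (W0 ^ 2 ^ (csize k prog)) prog (100 * Zc * mcl n) (%s. s = (mem0 n, %_. 0, 0, full))
 (%s. fst (snd (snd s)) = mcl n & (\<forall>v\<in>{1..n}. fst (snd s) v = sgn (valg n (tasks (phases n)) full arr0 (outp n) [v])))"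
proof -
 have n1: "24 <= n" "1 <= n" "3 <= n" using n by auto
 define st s2 l2 tp where "st = (n + 1) ^ a" and "s2 = sq n * sq n" and "l2 = (2::nat) ^ lg n" and "tp = TOP k + (8 + 2 * R n) * (n + 1) ^ a"
 define ml where "ml = 100 * Zc * mcl n"
 have "Wsum n = 2 + n + st + s2 + lg n + l2 + M n + Mb n + tp + R n + cconst prog k + ml"
 by (simp only: Wsum_def st_def s2_def l2_def tp_def ml_def)
 then have Ws: "2 + int n + int st + int s2 + int (lg n) + int l2 + int (M n) + int (Mb n) + int tp + int (R n) + int (cconst prog k) + int ml <= W0"
 using W by simp
 have "length full = ml" using len by (simp add: ml_def)
 then have W': "int n <= W0" "2 + int (length full) <= W0" using Ws by linarith+
 define L where "L = csize k prog"
 have Z: "Zc = L + 1" by (simp add: Zc_def L_def)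
 interpret ram k a n "outp n" full arr0 W0 L
 by unfold_locales (use full ab(3) W' in auto)
 have ge': "\<bar>int (n div 3)\<bar> <= W0" "\<bar>int st\<bar> <= W0" "\<bar>int (lg n)\<bar> <= W0" "\<bar>int (M n)\<bar> <= W0" "\<bar>int (Mb n)\<bar> <= W0"
 "\<bar>int l2\<bar> <= W0" "int n + int s2 <= W0" "int n + int l2 <= W0" "\<bar>int n\<bar> <= W0" "int (R n) <= W0" "0 <= W0" "int tp <= W0"
 using Ws by linarith+
 have ge: "\<bar>int (n div 3)\<bar> <= W0" "\<bar>int ((n + 1) ^ a)\<bar> <= W0" "\<bar>int (lg n)\<bar> <= W0" "\<bar>int (M n)\<bar> <= W0" "\<bar>int (Mb n)\<bar> <= W0"
 "\<bar>int (2 ^ lg n)\<bar> <= W0" "int (n + sq n * sq n) <= W0" "int (n + 2 ^ lg n) <= W0" "\<bar>int n\<bar> <= W0" "int (R n) <= W0" "0 <= W0"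
 "int (TOP k + (8 + 2 * R n) * (n + 1) ^ a) <= W0"
 using ge' unfolding tp_def[symmetric] unfolding st_def[symmetric] l2_def[symmetric] s2_def[symmetric] by simp_all
 have sq1: "sq n <= sq n * sq n" using sq_ge(1)[of n] by simp
 have sqW: "\<bar>int (sq n)\<bar> <= W0" using ge(7) sq1 by linarith
 have top: "\<bar>int (TOP k + p * (n + 1) ^ a)\<bar> <= W0" if "p <= 8 + 2 * R n" for p
 proof -
 have "p * (n + 1) ^ a <= (8 + 2 * R n) * (n + 1) ^ a" using that by (intro mult_right_mono) auto
 then have "int (TOP k + p * (n + 1) ^ a) <= int (TOP k + (8 + 2 * R n) * (n + 1) ^ a)" by (simp only: of_nat_le_iff)
 then show ?thesis using ge(12) by linarith
 qed
 have rok: "rgok (regs n p rc)" if "p <= 8 + 2 * R n" "rc <= R n" for p rc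
 proof -
 have "\<bar>int rc\<bar> <= W0" using ge(10) that by linarith
 then show ?thesis using ge sqW top[OF that(1)] unfolding rgok_def regs_def
 by (simp only: list.set insert_iff ball_simps list.size) (simp del: of_nat_add of_nat_mult of_nat_power of_nat_Suc)
 qed
 have rgn: "regs n p rc ! 0 = int n" "regs n p rc ! 1 = int (n div 3)" "regs n p rc ! 2 = int ((n + 1) ^ a)"
 "regs n p rc ! 5 = int (M n)" "regs n p rc ! 6 = int (Mb n)" "regs n p rc ! 7 = int (TOP k + p * (n + 1) ^ a)"
 "(regs n p rc)[8 := 0] = regs n p rc" for p rc
 by (simp_all add: regs_def lst11)
 have abs2: "\<bar>int x - int y\<bar> <= int (x + y)" for x y by (simp add: abs_le_iff)
 have reg: "fst s i = rg ! i" if "RepT ts rg s" "i < 11" for ts rg s i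
 using that by (cases s) (auto simp: RepT_def Rep_def)
 define S where "S phs p rc = RepT (tasks phs) (regs n p rc)" for phs p rc
 have bn: "b <= n" "length ps' <= n" using n ab(1) by auto
 have sT: "spec_ok T1" "spec_ok T2"
 using wf_T1[OF n1(3)] wf_T2[OF n1(3)] vval_tern[OF wf_T1[OF n1(3)]] vval_tern[OF wf_T2[OF n1(3)]] lengths ab(2)
 unfolding spec_ok_def by (simp_all add: wf_spec_def) (simp_all add: T1_def T2_def two_spec_def)
 have sF: "spec_ok (FS X)" if "rng n X \<subseteq> {1..n}" "1 <= b" for X
 using wf_FS[OF that(2,1)] vval_tern[OF wf_FS[OF that(2,1)]] ab(2,3) that bn
 unfolding spec_ok_def by (simp add: wf_spec_def) (auto simp: FS_def one_spec_def)
 have sG: "spec_ok (GS X)" if "rng n X \<subseteq> {1..n}" for X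
 using wf_GS[OF that] vval_tern[OF wf_GS[OF that]] ab(3)
 unfolding spec_ok_def by (simp add: wf_spec_def) (auto simp: GS_def one_spec_def)
 have Mbm: "Mb n <= mcl n" unfolding mcl_eq by simp
 have mf: "mcl n <= length full" unfolding len Zc_def by simp
 have ph: "ht (phC sp fl i) (2 * Zc * N) (S phs p rc) (S (phs @ [(sp, p, p + 1, N)]) p rc)"
 if "spec_ok sp" "p <= 6 + 2 * R n" "rc <= R n" "i = 5 & N = M n \<or> i = 6 & N = Mb n" "length (tasks phs) + N <= mcl n"
 "fl \<longleftrightarrow> p + 1 = outp n" "fl ==> length (tpos sp) = 1" for sp fl i N phs p rc
 proof -
 have N: "0 < N" using that(4) M_pos[of n] n1 by auto
 have "ht (phC sp fl i) (2 * (L + 1) * N) (RepT (tasks phs) (regs n p rc)) (RepT (tasks phs @ replicate N (sp, p, p + 1)) ((regs n p rc)[8 := 0]))"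
 by (rule ht_phase[OF that(1) _ _ _ _ _ _ _ N]) (use that rok[of p rc] rgn mf in auto)
 then show ?thesis by (simp add: S_def Z rgn tasks_simps)
 qed
 have sl: "length (tasks phs) <= length full" if "length (tasks phs) <= mcl n" for phs using that mf by simp
 have nx: "ht nextB Zc (S phs p rc) (S phs (p + 1) rc)" if "p <= 6 + 2 * R n" "rc <= R n" "length (tasks phs) <= mcl n" for phs p rc
 proof -
 have "rsem [(7, Plus (Cell 7) (Cell 2))] (regs n p rc) = regs n (p + 1) rc"
 by (simp add: rsem_def regs_def lst11 algebra_simps)
 then have "ht nextB L (S phs p rc) (S phs (p + 1) rc)"
 unfolding nextB_def S_def RepT_def using ht_regs[OF _ rok[of p rc] sl[OF that(3)], of "[(7, Plus (Cell 7) (Cell 2))]"] that by auto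
 then show ?thesis by (rule ht_conseq) (auto simp: Z)
 qed
 have dc: "ht decB Zc (S phs p (Suc rc)) (S phs p rc)" if "p <= 6 + 2 * R n" "Suc rc <= R n" "length (tasks phs) <= mcl n" for phs p rc
 proof -
 have "rsem [(9, Minus (Cell 9) (Cst 1))] (regs n p (Suc rc)) = regs n p rc"
 by (simp add: rsem_def regs_def lst11)
 then have "ht decB L (S phs p (Suc rc)) (S phs p rc)"
 unfolding decB_def S_def RepT_def using ht_regs[OF _ rok[of p "Suc rc"] sl[OF that(3)], of "[(9, Minus (Cell 9) (Cst 1))]"] that by auto
 then show ?thesis by (rule ht_conseq) (auto simp: Z)
 qed
 define rgA where "rgA x y z u = [int n, int (n div 3), int ((n + 1) ^ a), int x, int y, 0, 0, int (TOP k), z, 0, int u]" for x y z u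
 have rokA: "rgok (rgA x y z u)" if "x <= sq n" "y <= lg n" "\<bar>z\<bar> <= W0" "u <= 2 ^ lg n" for x y z u
 proof -
 have "\<bar>int x\<bar> <= W0" "\<bar>int y\<bar> <= W0" using that sqW ge(3) by linarith+
 moreover have "\<bar>int u\<bar> <= int (2 ^ lg n)" using that(4) by (simp only: abs_of_nat of_nat_le_iff)
 then have "\<bar>int u\<bar> <= W0" using ge(6) by linarith
 moreover have "\<bar>int (TOP k)\<bar> <= W0" using top[of 0] by simp
 ultimately show ?thesis using ge that(3) unfolding rgok_def rgA_def
 by (simp only: list.set insert_iff ball_simps list.size) (simp del: of_nat_add of_nat_mult of_nat_power of_nat_Suc)
 qed
 have p0: "ht (initC k [1..<b + 1]) L (%s. s = (mem0 n, %_. 0, 0, full)) (RepT [] (int n # replicate 10 0))"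
 by (rule ht_init) (use ab(2) bn in \<open>auto simp: arr0_def vkey_def outp_def\<close>)
 have p1: "ht startB L (RepT [] (int n # replicate 10 0)) (RepT [] (rgA 0 0 0 1))"
 proof -
 have "rsem [(1, Quot (Cell 0) (Cst 3)), (2, pwE (Plus (Cell 0) (Cst 1)) a), (7, Cst (int (TOP k))), (10, Cst 1)] (int n # replicate 10 0) = rgA 0 0 0 1"
 by (simp add: rsem_def rgA_def pwE_props lst11 zdiv_int)
 moreover have "rgok (int n # replicate 10 0)" using ge by (auto simp: rgok_def)
 moreover have "depth (pwE (Plus (Cell 0) (Cst 1)) a) <= 19" using pwE_props(3)[of "Plus (Cell 0) (Cst 1)" a] by simp
 ultimately show ?thesis unfolding startB_def RepT_def
 using ht_regs[of "[(1, Quot (Cell 0) (Cst 3)), (2, pwE (Plus (Cell 0) (Cst 1)) a), (7, Cst (int (TOP k))), (10, Cst 1)]" "int n # replicate 10 0" "length ([]::task list)"]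
 by (auto simp: pwE_props)
 qed
 have p2: "ht (Loop 8 sqB) (sq n * (L + 1)) (RepT [] (rgA 0 0 0 1)) (RepT [] (rgA (sq n) 0 (int n - int (sq n) * int (sq n)) 1))"
 proof -
 \<comment> \<open>Cell 8 holds \<open>n - j * j\<close> after \<open>j\<close> passes, and 0 before
   the first pass, when nothing has been tested yet.\<close>
 define I where "I j = RepT [] (rgA j 0 (if j = 0 then 0 else int n - int j * int j) 1)" for j
 have "ht (Loop 8 sqB) (sq n * (L + 1)) (I 0) (I (sq n))"
 proof (rule ht_loop)
 fix j assume j: "j < sq n"
 let ?z = "if j = 0 then 0 else int n - int j * int j"
 have "j * j <= sq n * sq n" using j by (intro mult_mono) auto
 then have "int (n + j * j) <= int (n + sq n * sq n)" by (simp only: of_nat_le_iff add_le_cancel_left)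
 with abs2[of n "j * j"] have "\<bar>int n - int (j * j)\<bar> <= int (n + sq n * sq n)" by (rule order_trans)
 then have "\<bar>?z\<bar> <= int (n + sq n * sq n)" by (cases "j = 0") simp_all
 then have z: "\<bar>?z\<bar> <= W0" using ge(7) by linarith
 have rk: "rgok (rgA j 0 ?z 1)" by (rule rokA[OF less_imp_le[OF j] le0 z]) simp
 have "rsem [(3, Plus (Cell 3) (Cst 1)), (8, Minus (Cell 0) (Times (Cell 3) (Cell 3)))] (rgA j 0 ?z 1) = rgA (Suc j) 0 (int n - int (Suc j) * int (Suc j)) 1"
 by (simp add: rsem_def rgA_def lst11 algebra_simps)
 then show "ht sqB L (I j) (I (Suc j))" unfolding sqB_def I_def RepT_def
 using ht_regs[OF _ rk, of "[(3, Plus (Cell 3) (Cst 1)), (8, Minus (Cell 0) (Times (Cell 3) (Cell 3)))]" "length ([]::task list)"] by auto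
 fix s assume "I (Suc j) s"
 then have "fst s 8 = int n - int (Suc j) * int (Suc j)"
 using reg[of "[]" "rgA (Suc j) 0 (if Suc j = 0 then 0 else int n - int (Suc j) * int (Suc j)) 1" s 8] unfolding I_def by (simp add: rgA_def lst11)
 moreover have "Suc j * Suc j < n" if "Suc j < sq n" using sq_least[of "Suc j" n] that by simp
 moreover have "n <= Suc j * Suc j" if "~ Suc j < sq n"
 proof -
 have "Suc j = sq n" using that j by simp
 then show ?thesis using sq_ge(2)[of n] by simp
 qed
 ultimately show "fst s 8 > 0 \<longleftrightarrow> Suc j < sq n" by (cases "Suc j < sq n") (simp_all flip: of_nat_mult del: of_nat_Suc mult_Suc mult_Suc_right)
 qed (use sq_ge(1)[of n] in simp)
 moreover have "sq n ~= 0" using sq_ge(1)[of n] by simp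
 ultimately show ?thesis by (simp add: I_def)
 qed
 define zs where "zs = int n - int (sq n) * int (sq n)"
 have zsW: "\<bar>zs\<bar> <= W0"
 proof -
 have "\<bar>zs\<bar> <= int (n + sq n * sq n)" using abs2[of n "sq n * sq n"] by (simp add: zs_def)
 then show ?thesis using ge(7) by linarith
 qed
 have p3: "ht (Loop 8 lgB) (lg n * (L + 1)) (RepT [] (rgA (sq n) 0 zs 1)) (RepT [] (rgA (sq n) (lg n) (int n - int (2 ^ lg n)) (2 ^ lg n)))"
 proof -
 define I where "I j = RepT [] (rgA (sq n) j (if j = 0 then zs else int n - int (2 ^ j)) (2 ^ j))" for j
 have "ht (Loop 8 lgB) (lg n * (L + 1)) (I 0) (I (lg n))"
 proof (rule ht_loop)
 fix j assume j: "j < lg n"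
 let ?z = "if j = 0 then zs else int n - int (2 ^ j)"
 have pj: "(2::nat) ^ j <= 2 ^ lg n" using j by (intro power_increasing) auto
 then have "int (n + 2 ^ j) <= int (n + 2 ^ lg n)" by (simp only: of_nat_le_iff add_le_cancel_left)
 with abs2[of n "2 ^ j"] have "\<bar>int n - int (2 ^ j)\<bar> <= int (n + 2 ^ lg n)" by (rule order_trans)
 then have z: "\<bar>?z\<bar> <= W0" using ge(8) zsW by auto
 have "rsem [(4, Plus (Cell 4) (Cst 1)), (10, Times (Cell 10) (Cst 2)), (8, Minus (Cell 0) (Cell 10))] (rgA (sq n) j ?z (2 ^ j)) = rgA (sq n) (Suc j) (int n - int (2 ^ Suc j)) (2 ^ Suc j)"
 by (simp add: rsem_def rgA_def lst11 algebra_simps)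
 then show "ht lgB L (I j) (I (Suc j))" unfolding lgB_def I_def RepT_def
 using ht_regs[OF _ rokA[OF order_refl less_imp_le[OF j] z pj], of "[(4, Plus (Cell 4) (Cst 1)), (10, Times (Cell 10) (Cst 2)), (8, Minus (Cell 0) (Cell 10))]" "length ([]::task list)"] by auto
 fix s assume "I (Suc j) s"
 then have "fst s 8 = int n - int (2 ^ Suc j)"
 using reg[of "[]" "rgA (sq n) (Suc j) (if Suc j = 0 then zs else int n - int (2 ^ Suc j)) (2 ^ Suc j)" s 8] unfolding I_def by (simp add: rgA_def lst11)
 moreover have "2 ^ Suc j < n" if "Suc j < lg n" using lg_least[of "Suc j" n] that by simp
 moreover have "n <= 2 ^ Suc j" if "~ Suc j < lg n"
 proof -
 have "Suc j = lg n" using that j by simp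
 then show ?thesis using lg_ge(2)[of n] by simp
 qed
 ultimately show "fst s 8 > 0 \<longleftrightarrow> Suc j < lg n" by (cases "Suc j < lg n") (simp_all del: of_nat_power power_Suc)
 qed (use lg_ge(1)[of n] in simp)
 moreover have "lg n ~= 0" using lg_ge(1)[of n] by simp
 ultimately show ?thesis by (simp add: I_def)
 qed
 define zl where "zl = int n - int (2 ^ lg n)"
 have p4: "ht countB L (RepT [] (rgA (sq n) (lg n) zl (2 ^ lg n))) (S [] 0 (R n))"
 proof -
 have "\<bar>zl\<bar> <= int (n + 2 ^ lg n)" using abs2[of n "2 ^ lg n"] by (simp add: zl_def)
 then have z: "\<bar>zl\<bar> <= W0" using ge(8) by linarith
 define us :: "(nat \<times> expr) list" where "us = [(5, Times (Times (Cst (int K1)) (pwE (Cell 0) b)) (if odd r then Cell 3 else Cst 1)),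
 (6, Times (Times (Cst (int K2)) (Cell 5)) (Cell 4)), (9, Times (Cst (int r)) (Cell 4)), (8, Cst 0)]"
 have "rsem us (rgA (sq n) (lg n) zl (2 ^ lg n)) = regs n 0 (R n)"
 by (auto simp: us_def rsem_def rgA_def regs_def pwE_props lst11 M_def Mb_def R_def)
 moreover have "\<forall>(i, e)\<in>set us. i < 11 & pureE e & depth e <= 19"
 using pwE_props(3)[of "Cell 0" b] by (auto simp: us_def pwE_props)
 ultimately show ?thesis unfolding countB_def us_def[symmetric] S_def RepT_def tasks_simps
 using ht_regs[OF _ rokA[OF order_refl order_refl z order_refl], of us "length ([]::task list)"] by simp
 qed
 have pre: "ht preC (L + (L + (sq n * (L + 1) + (lg n * (L + 1) + L)))) (%s. s = (mem0 n, %_. 0, 0, full)) (S [] 0 (R n))"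
 unfolding preC_def by (rule ht_seq[OF p0 ht_seq[OF p1 ht_seq[OF p2[folded zs_def] ht_seq[OF p3[folded zl_def] p4]]]])
 have ph1: "ht (phC T1 (r = 1) 6) (2 * Zc * Mb n) (S [] 0 (R n)) (S ([] @ [(T1, 0, 0 + 1, Mb n)]) 0 (R n))"
 proof (rule ph[OF sT(1)])
 show "(r = 1) = (0 + 1 = outp n)" unfolding outp_def by simp
 show "length (tpos T1) = 1" if "r = 1"
 proof -
 have "tpos T1 = take a ps" by (simp add: T1_def two_spec_def)
 moreover have "a = 1" unfolding a_def using that by simp
 ultimately show ?thesis using lengths(1) by simp
 qed
 show "length (tasks []) + Mb n <= mcl n" using Mbm by (simp add: tasks_simps)
 qed simp_all
 have rest: "\<exists>B. ht (if r = 1 then rblk [] else restC) B (S [(T1, 0, 1, Mb n)] 0 (R n)) (S (phases n) (if r = 1 then 0 else 5 + 2 * R n) (if r = 1 then R n else 0))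
 & B <= 40 * Zc * mcl n"
 proof (cases "r = 1")
 case True
 have ph_eq: "phases n = [(T1, 0, 1, Mb n)]" unfolding phases_def using True by simp
 have "ht (rblk []) L (S [(T1, 0, 1, Mb n)] 0 (R n)) (S [(T1, 0, 1, Mb n)] 0 (R n))"
 using ht_regs[of "[]" "regs n 0 (R n)" "length (tasks [(T1, 0, 1, Mb n)])"] rok[of 0 "R n"] sl[of "[(T1, 0, 1, Mb n)]"] mcl_eq[of n]
 unfolding S_def RepT_def by (auto simp: rsem_def tasks_simps)
 moreover have "L <= 40 * Zc * mcl n"
 proof -
 have "1 <= mcl n" using M_pos[of n] n1 mcl_eq[of n] by auto
 then have "Zc * 1 <= Zc * mcl n" by (intro mult_left_mono) auto
 moreover have "L <= Zc" "40 * Zc * mcl n = 40 * (Zc * mcl n)" by (simp_all add: Z)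
 ultimately show ?thesis by linarith
 qed
 ultimately show ?thesis unfolding if_P[OF True] ph_eq by blast
 next
 case False
 then have r2: "2 <= r" using r by simp
 have m: "mcl n = Mb n + M n + 2 * R n * M n + M n + 7 * Mb n" using mcl_eq[of n] False by simp
 have o: "outp n = 6 + 2 * R n" unfolding outp_def using False by simp
 have b1: "1 <= b" by (rule ab(4)[OF r2])
 have rX: "rng n RA \<subseteq> {1..n}" "rng n RB \<subseteq> {1..n}" "rng n RC \<subseteq> {1..n}" using rng_T n1 by auto
 define f where "f j = [(T1, 0, 1, Mb n), (T2, 1, 2, M n)] @ rounds n 2 j" for j
 have lf: "length (tasks (f j)) = Mb n + M n + 2 * j * M n" for j by (simp add: f_def tasks_simps length_rounds)
 have h1: "ht nextB Zc (S [(T1, 0, 1, Mb n)] 0 (R n)) (S [(T1, 0, 1, Mb n)] (0 + 1) (R n))"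
 by (rule nx) (auto simp: m tasks_simps)
 have h2: "ht (phC T2 False 5) (2 * Zc * M n) (S [(T1, 0, 1, Mb n)] (0 + 1) (R n)) (S ([(T1, 0, 1, Mb n)] @ [(T2, 0 + 1, 0 + 1 + 1, M n)]) (0 + 1) (R n))"
 by (rule ph[OF sT(2)]) (auto simp: m tasks_simps o)
 have e2: "[(T1, 0, 1, Mb n)] @ [(T2, 0 + 1, 0 + 1 + 1, M n)] = f 0" by (simp add: f_def)
 have h3: "ht nextB Zc (S (f 0) (0 + 1) (R n)) (S (f 0) (2 + 2 * 0) (R n - 0))"
 using nx[of "0 + 1" "R n" "f 0"] by (simp add: m lf)
 define I where "I j = S (f j) (2 + 2 * j) (R n - j)" for j
 have h4: "ht (Loop 9 roundC) (R n * ((2 * Zc * M n + (Zc + (2 * Zc * M n + (Zc + Zc)))) + 1)) (I 0) (I (R n))"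
 proof (rule ht_loop)
 fix j assume j: "j < R n"
 have "(j + 1) * M n <= R n * M n" using j by (intro mult_right_mono) auto
 moreover have "(j + 1) * M n = j * M n + M n" "2 * j * M n = 2 * (j * M n)" "2 * R n * M n = 2 * (R n * M n)" by (simp_all add: distrib_right)
 ultimately have jm: "2 * j * M n + 2 * M n <= 2 * R n * M n" by linarith
 have g1: "ht (phC T1 False 5) (2 * Zc * M n) (I j) (S (f j @ [(T1, 2 + 2 * j, 2 + 2 * j + 1, M n)]) (2 + 2 * j) (R n - j))"
 unfolding I_def by (rule ph[OF sT(1)]) (use j jm in \<open>auto simp: m lf o\<close>)
 have g2: "ht nextB Zc (S (f j @ [(T1, 2 + 2 * j, 2 + 2 * j + 1, M n)]) (2 + 2 * j) (R n - j)) (S (f j @ [(T1, 2 + 2 * j, 2 + 2 * j + 1, M n)]) (2 + 2 * j + 1) (R n - j))"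
 by (rule nx) (use j jm in \<open>auto simp: m lf tasks_simps\<close>)
 have g3: "ht (phC T2 False 5) (2 * Zc * M n) (S (f j @ [(T1, 2 + 2 * j, 2 + 2 * j + 1, M n)]) (2 + 2 * j + 1) (R n - j))
 (S ((f j @ [(T1, 2 + 2 * j, 2 + 2 * j + 1, M n)]) @ [(T2, 2 + 2 * j + 1, 2 + 2 * j + 1 + 1, M n)]) (2 + 2 * j + 1) (R n - j))"
 by (rule ph[OF sT(2)]) (use j jm in \<open>auto simp: m lf o tasks_simps\<close>)
 have e3: "(f j @ [(T1, 2 + 2 * j, 2 + 2 * j + 1, M n)]) @ [(T2, 2 + 2 * j + 1, 2 + 2 * j + 1 + 1, M n)] = f (Suc j)"
 unfolding f_def rounds_snoc by simp
 have lfj: "length (tasks (f (Suc j))) <= mcl n" using jm by (simp add: m lf)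
 have Rj: "R n - j = Suc (R n - Suc j)" using j by simp
 have g4: "ht nextB Zc (S (f (Suc j)) (2 + 2 * j + 1) (R n - j)) (S (f (Suc j)) (2 + 2 * j + 1 + 1) (R n - j))"
 by (rule nx[OF _ _ lfj]) (use j in auto)
 have g5: "ht decB Zc (S (f (Suc j)) (2 + 2 * j + 1 + 1) (R n - j)) (I (Suc j))"
 unfolding Rj I_def using dc[OF _ _ lfj, of "2 + 2 * j + 1 + 1" "R n - Suc j"] j by simp
 show "ht roundC (2 * Zc * M n + (Zc + (2 * Zc * M n + (Zc + Zc)))) (I j) (I (Suc j))"
 unfolding roundC_def by (rule ht_seq[OF g1 ht_seq[OF g2 ht_seq[OF g3[unfolded e3] ht_seq[OF g4 g5]]]])
 fix s assume "I (Suc j) s"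
 then have "fst s 9 = int (R n - Suc j)"
 using reg[of "tasks (f (Suc j))" "regs n (2 + 2 * Suc j) (R n - Suc j)" s 9] unfolding I_def S_def by (simp add: regs_def lst11)
 then show "fst s 9 > 0 \<longleftrightarrow> Suc j < R n" by auto
 qed (use M_pos(5)[of n] in simp)
 define q where "q = 2 + 2 * R n"
 define g0 where "g0 = f (R n)"
 define g1 where "g1 = g0 @ [(T1, q, q + 1, M n)]"
 define g2 where "g2 = g1 @ [(T2, q + 1, q + 1 + 1, Mb n)]"
 define g3 where "g3 = g2 @ [(FS RA, q + 1 + 1, q + 1 + 1 + 1, Mb n)]"
 define g4 where "g4 = g3 @ [(FS RB, q + 1 + 1, q + 1 + 1 + 1, Mb n)]"
 define g5 where "g5 = g4 @ [(FS RC, q + 1 + 1, q + 1 + 1 + 1, Mb n)]"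
 define g6 where "g6 = g5 @ [(GS RA, q + 1 + 1 + 1, q + 1 + 1 + 1 + 1, Mb n)]"
 define g7 where "g7 = g6 @ [(GS RB, q + 1 + 1 + 1, q + 1 + 1 + 1 + 1, Mb n)]"
 define g8 where "g8 = g7 @ [(GS RC, q + 1 + 1 + 1, q + 1 + 1 + 1 + 1, Mb n)]"
 note gl = g8_def g7_def g6_def g5_def g4_def g3_def g2_def g1_def g0_def lf tasks_simps
 have i4: "I (R n) = S g0 q 0" by (simp add: I_def g0_def q_def)
 have k1: "ht (phC T1 False 5) (2 * Zc * M n) (S g0 q 0) (S g1 q 0)"
 unfolding g1_def by (rule ph[OF sT(1)]) (auto simp: m gl o q_def)
 have k2: "ht nextB Zc (S g1 q 0) (S g1 (q + 1) 0)" by (rule nx) (auto simp: m gl q_def)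
 have k3: "ht (phC T2 False 6) (2 * Zc * Mb n) (S g1 (q + 1) 0) (S g2 (q + 1) 0)"
 unfolding g2_def by (rule ph[OF sT(2)]) (auto simp: m gl o q_def)
 have k4: "ht nextB Zc (S g2 (q + 1) 0) (S g2 (q + 1 + 1) 0)" by (rule nx) (auto simp: m gl q_def)
 have k5: "ht (phC (FS RA) False 6) (2 * Zc * Mb n) (S g2 (q + 1 + 1) 0) (S g3 (q + 1 + 1) 0)"
 unfolding g3_def by (rule ph[OF sF[OF rX(1) b1]]) (auto simp: m gl o q_def)
 have k6: "ht (phC (FS RB) False 6) (2 * Zc * Mb n) (S g3 (q + 1 + 1) 0) (S g4 (q + 1 + 1) 0)"
 unfolding g4_def by (rule ph[OF sF[OF rX(2) b1]]) (auto simp: m gl o q_def)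
 have k7: "ht (phC (FS RC) False 6) (2 * Zc * Mb n) (S g4 (q + 1 + 1) 0) (S g5 (q + 1 + 1) 0)"
 unfolding g5_def by (rule ph[OF sF[OF rX(3) b1]]) (auto simp: m gl o q_def)
 have k8: "ht nextB Zc (S g5 (q + 1 + 1) 0) (S g5 (q + 1 + 1 + 1) 0)" by (rule nx) (auto simp: m gl q_def)
 have k9: "ht (phC (GS RA) True 6) (2 * Zc * Mb n) (S g5 (q + 1 + 1 + 1) 0) (S g6 (q + 1 + 1 + 1) 0)"
 unfolding g6_def by (rule ph[OF sG[OF rX(1)]]) (auto simp: m gl o q_def GS_def one_spec_def)
 have k10: "ht (phC (GS RB) True 6) (2 * Zc * Mb n) (S g6 (q + 1 + 1 + 1) 0) (S g7 (q + 1 + 1 + 1) 0)"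
 unfolding g7_def by (rule ph[OF sG[OF rX(2)]]) (auto simp: m gl o q_def GS_def one_spec_def)
 have k11: "ht (phC (GS RC) True 6) (2 * Zc * Mb n) (S g7 (q + 1 + 1 + 1) 0) (S g8 (q + 1 + 1 + 1) 0)"
 unfolding g8_def by (rule ph[OF sG[OF rX(3)]]) (auto simp: m gl o q_def GS_def one_spec_def)
 have g8: "g8 = phases n" unfolding phases_def if_not_P[OF False] by (simp add: gl f_def final_phases_def q_def add.assoc)
 have I0: "S (f 0) (2 + 2 * 0) (R n - 0) = I 0" by (simp add: I_def)
 note H = ht_seq[OF h1 ht_seq[OF h2[unfolded e2] ht_seq[OF h3[unfolded I0] ht_seq[OF h4[unfolded i4] ht_seq[OF k1 ht_seq[OF k2 ht_seq[OF k3 ht_seq[OF k4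
 ht_seq[OF k5 ht_seq[OF k6 ht_seq[OF k7 ht_seq[OF k8 ht_seq[OF k9 ht_seq[OF k10 k11]]]]]]]]]]]]]]
 have qe: "q + 1 + 1 + 1 = 5 + 2 * R n" by (simp add: q_def)
 have bound: "Zc + (2 * Zc * M n + (Zc + (R n * ((2 * Zc * M n + (Zc + (2 * Zc * M n + (Zc + Zc)))) + 1) + (2 * Zc * M n + (Zc + (2 * Zc * Mb n + (Zc
 + (2 * Zc * Mb n + (2 * Zc * Mb n + (2 * Zc * Mb n + (Zc + (2 * Zc * Mb n + (2 * Zc * Mb n + 2 * Zc * Mb n))))))))))))) <= 40 * Zc * mcl n"
 proof -
 define x y where "x = Zc * M n" and "y = Zc * Mb n"
 have "Zc * 1 <= Zc * M n" using M_pos(1)[of n] n1 by (intro mult_left_mono) auto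
 then have zx: "Zc <= x" by (simp add: x_def)
 have xy: "x <= y" unfolding x_def y_def using M_pos(2)[of n] n1 by (intro mult_left_mono) auto
 have "1 <= Zc" by (simp add: Zc_def)
 moreover have "2 * Zc * M n = 2 * x" by (simp add: x_def)
 ultimately have "(2 * Zc * M n + (Zc + (2 * Zc * M n + (Zc + Zc)))) + 1 <= 8 * x" using zx by linarith
 then have "R n * ((2 * Zc * M n + (Zc + (2 * Zc * M n + (Zc + Zc)))) + 1) <= R n * (8 * x)" by (rule mult_left_mono) simp
 moreover have "40 * Zc * mcl n = 320 * y + 80 * x + 80 * (R n * x)" unfolding m x_def y_def by (simp add: algebra_simps)
 moreover have "2 * Zc * M n = 2 * x" "2 * Zc * Mb n = 2 * y" by (auto simp: x_def y_def)
 ultimately show ?thesis using zx xy by linarith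
 qed
 show ?thesis unfolding if_not_P[OF False] restC_def using H[unfolded g8 qe] bound by blast
 qed
 then obtain B where B: "ht (if r = 1 then rblk [] else restC) B (S [(T1, 0, 1, Mb n)] 0 (R n)) (S (phases n) (if r = 1 then 0 else 5 + 2 * R n) (if r = 1 then R n else 0))"
 "B <= 40 * Zc * mcl n" by blast
 have e1: "[] @ [(T1, 0 :: nat, 0 + 1 :: nat, Mb n)] = [(T1, 0, 1, Mb n)]" by simp
 have tot: "ht prog (L + (L + (sq n * (L + 1) + (lg n * (L + 1) + L))) + (2 * Zc * Mb n + B)) (%s. s = (mem0 n, %_. 0, 0, full))
 (S (phases n) (if r = 1 then 0 else 5 + 2 * R n) (if r = 1 then R n else 0))"
 unfolding prog_def by (rule ht_seq[OF pre ht_seq[OF ph1[unfolded e1] B(1)]])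
 have cc: "int (cconst prog k) <= W0" using Ws by linarith
 have le: "L + (L + (sq n * (L + 1) + (lg n * (L + 1) + L))) + (2 * Zc * Mb n + B) <= 100 * Zc * mcl n"
 proof -
 have "Mb n <= mcl n" using mcl_eq[of n] by auto
 then have y: "Zc * Mb n <= Zc * mcl n" by (intro mult_left_mono) auto
 have "sq n * Zc <= Mb n * Zc" "lg n * Zc <= Mb n * Zc" using M_pos[of n] n1 by (auto intro: mult_right_mono)
 moreover have "1 * Zc <= Mb n * Zc" using M_pos[of n] n1 by (intro mult_right_mono) auto
 moreover have "Mb n * Zc = Zc * Mb n" by simp
 moreover have "L <= Zc" by (simp add: Z)
 moreover have "2 * Zc * Mb n = 2 * (Zc * Mb n)" "100 * Zc * mcl n = 100 * (Zc * mcl n)" "40 * Zc * mcl n = 40 * (Zc * mcl n)" by simp_all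
 ultimately show ?thesis using B(2) y unfolding Z[symmetric] by linarith
 qed
 have "hoare k (W0 ^ 2 ^ L) prog (L + (L + (sq n * (L + 1) + (lg n * (L + 1) + L))) + (2 * Zc * Mb n + B)) (%s. s = (mem0 n, %_. 0, 0, full))
 (S (phases n) (if r = 1 then 0 else 5 + 2 * R n) (if r = 1 then R n else 0))"
 using tot cc unfolding ht_def by (simp add: L_def)
 then show ?thesis unfolding L_def[symmetric]
 by (rule hoare_conseq[OF _ _ _ le]) (auto simp: S_def RepT_def Rep_def mcl_def)
qed

end

section \<open>Polynomially bounded functions\<close>

text \<open>From \<open>n = 2\<close> on, constants and sums are absorbed by a higher power of
  \<open>n\<close>, so the class is closed under all operations that occur in
  \<open>Wsum\<close>.\<close>

definition pb :: "(nat => nat) => bool" where "pb f \<longleftrightarrow> (\<exists>e. \<forall>n\<ge>2. f n <= n ^ e)"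

lemma pb_const: "pb (%_. x)"
 unfolding pb_def
proof (intro exI allI impI)
 fix n :: nat assume "2 <= n"
 have "x <= 2 ^ x" using less_exp[of x] by simp
 also have "... <= n ^ x" using \<open>2 <= n\<close> by (intro power_mono) auto
 finally show "x <= n ^ x" .
qed

lemma pb_id: "pb (%n. n)" unfolding pb_def by (rule exI[of _ 1]) simp

lemma pb_mult: "pb f ==> pb g ==> pb (%n. f n * g n)"
proof -
 assume "pb f" "pb g"
 then obtain e e' where "\<forall>n\<ge>2. f n <= n ^ e" "\<forall>n\<ge>2. g n <= n ^ e'" by (auto simp: pb_def)
 then have "\<forall>n\<ge>2. f n * g n <= n ^ (e + e')" by (auto simp: power_add intro: mult_mono)
 then show ?thesis by (auto simp: pb_def)
qed

lemma pb_le: "pb g ==> (!!n. 2 <= n ==> f n <= g n) ==> pb f"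
 unfolding pb_def by (meson order_trans)

lemma pb_add: "pb f ==> pb g ==> pb (%n. f n + g n)"
proof -
 assume "pb f" "pb g"
 then obtain e e' where e: "\<forall>n\<ge>2. f n <= n ^ e" "\<forall>n\<ge>2. g n <= n ^ e'" by (auto simp: pb_def)
 have "f n + g n <= n ^ (e + e' + 1)" if n: "2 <= n" for n
 proof -
 have "n ^ e <= n ^ (e + e')" "n ^ e' <= n ^ (e + e')" using n by (auto intro: power_increasing)
 moreover have "f n <= n ^ e" "g n <= n ^ e'" using e n by auto
 ultimately have "f n + g n <= 2 * n ^ (e + e')" by linarith
 also have "... <= n * n ^ (e + e')" using n by (intro mult_right_mono) auto
 finally show ?thesis by (simp add: power_add mult_ac)
 qed
 then show ?thesis by (auto simp: pb_def)
qed

lemma pb_pow: "pb f ==> pb (%n. f n ^ j)"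
 by (induction j) (auto intro: pb_const pb_mult)

lemma pb_sq2: "pb (%n. sq n * sq n)"
 by (rule pb_le[OF pb_mult[OF pb_const[of 4] pb_id]]) (use sq_le in auto)

lemma pb_sq: "pb sq"
 by (rule pb_le[OF pb_sq2]) (use sq_ge(1) in auto)

lemma pb_lg2: "pb (%n. 2 ^ lg n)"
proof (rule pb_le[OF pb_mult[OF pb_const[of 2] pb_id]])
 fix n :: nat assume n: "2 <= n"
 show "2 ^ lg n <= 2 * n"
 proof (cases "lg n = 1")
 case False
 then have l: "1 <= lg n - 1" "lg n - 1 < lg n" using lg_ge(1)[of n] by auto
 then have "2 ^ (lg n - 1) < n" by (rule lg_least)
 moreover have "(2::nat) ^ lg n = 2 * 2 ^ (lg n - 1)" using l by (cases "lg n") auto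
 ultimately show ?thesis by simp
 qed (use n in simp)
qed

lemma pb_lg: "pb lg"
 by (rule pb_le[OF pb_lg2]) (use less_exp less_imp_le in blast)

section \<open>Solving from samples\<close>

lemma map_take_replicate_pmf: "map_pmf (take m) (replicate_pmf (m + j) D) = replicate_pmf m D"
proof -
 have "map_pmf (take m) (replicate_pmf (m + j) D)
 = bind_pmf (replicate_pmf m D) (%xs. bind_pmf (replicate_pmf j D) (%ys. return_pmf (take m (xs @ ys))))"
 by (simp add: replicate_pmf_distrib map_bind_pmf)
 also have "... = bind_pmf (replicate_pmf m D) (%xs. return_pmf xs)"
 proof (rule bind_pmf_cong[OF refl])
 fix xs assume "xs \<in> set_pmf (replicate_pmf m D)"
 then have "length xs = m" by (simp add: set_replicate_pmf)
 then show "bind_pmf (replicate_pmf j D) (%ys. return_pmf (take m (xs @ ys))) = return_pmf xs" by simp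
 qed
 finally show ?thesis by (simp add: bind_return_pmf')
qed

context sampler
begin

lemma pb_M: "pb M"
 unfolding M_def by (cases "odd r") (auto intro!: pb_mult pb_pow pb_const pb_id pb_sq)

lemma pb_Mb: "pb Mb" unfolding Mb_def by (intro pb_mult pb_const pb_M pb_lg)

lemma pb_R: "pb R" unfolding R_def by (intro pb_mult pb_const pb_lg)

lemma pb_mcl: "pb mcl"
proof (rule pb_le)
 show "pb (%n. Mb n + M n + 2 * R n * M n + M n + 7 * Mb n)"
 by (intro pb_add pb_mult pb_const pb_M pb_Mb pb_R)
qed (auto simp: mcl_eq)

lemma pb_Wsum: "pb Wsum"
 unfolding Wsum_def
 by (intro pb_add pb_mult pb_pow pb_const pb_id pb_M pb_Mb pb_R pb_mcl pb_sq pb_lg2 pb_lg)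

lemma mcl_le: "2 <= n ==> real (mcl n) <= (10 + 2 * real r) * (6 * real K1 * real K2 * (real n powr (real r / 2) * ln (real n)))"
proof -
 assume n: "2 <= n"
 have "M n * lg n * 1 <= M n * lg n * K2" using K by (intro mult_left_mono) auto
 then have "r * (M n * lg n) <= r * Mb n" unfolding Mb_def by (intro mult_left_mono) (auto simp: mult_ac)
 then have "R n * M n <= r * Mb n" by (simp add: R_def mult_ac)
 moreover have "M n <= Mb n" using M_pos(2)[of n] n by simp
 ultimately have "mcl n <= (10 + 2 * r) * Mb n" by (simp add: mcl_eq algebra_simps)
 then have "real (mcl n) <= real ((10 + 2 * r) * Mb n)" by (simp only: of_nat_le_iff)
 also have "... = (10 + 2 * real r) * real (Mb n)" by simp
 also have "... <= (10 + 2 * real r) * (6 * real K1 * real K2 * (real n powr (real r / 2) * ln (real n)))"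
 by (intro mult_left_mono Mb_le n) simp
 finally show ?thesis .
qed

theorem votes_by_ram:
 assumes Kl: K1_large K2_large
 shows "solved_from_samples k Q r t mcl (%n. 100 * Zc * mcl n)"
proof -
 obtain err where err: "err \<longlonglongrightarrow> 0"
 "\<forall>\<^sub>F n in sequentially. \<forall>sga\<in>assignments n. prb (bind_pmf (vrun (planted k Q n sga) n (phases n) arr0) (votes_answer n))
 {tau. planted_solution k Q r t n sga tau} \<ge> 1 - err n"
 using votes_solve[OF Kl] by blast
 obtain \<beta> where \<beta>: "!!n. 2 <= n ==> Wsum n <= n ^ \<beta>" using pb_Wsum unfolding pb_def by blast
 define P where "P = asm k 0 prog"
 \<comment> \<open>The exponent of the bound for \<open>Wsum\<close> times the factor
   \<open>2 ^ csize k prog\<close> by which straight-line code of that length can raise it; it does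
   not depend on \<open>n\<close>.\<close>
 define E where "E = \<beta> * 2 ^ csize k prog"
 have "\<forall>\<^sub>F n in sequentially. \<forall>sga\<in>assignments n.
 (\<forall>s\<le>100 * Zc * mcl n. \<forall>c\<in>set_pmf (run P (planted k Q n sga) n s). \<forall>a. \<bar>mem c a\<bar> <= int n ^ E) &
 (\<forall>c\<in>set_pmf (run P (planted k Q n sga) n (100 * Zc * mcl n)). halted P c & drawn c <= mcl n) &
 prb
 (bind_pmf (run P (planted k Q n sga) n (100 * Zc * mcl n)) (%c. complete_answer n (answer c)))
 {tau. planted_solution k Q r t n sga tau} \<ge> 1 - err n"
 using err(2) eventually_ge_at_top[of "k + 24 * (r + length ps' + 2)"]
 proof eventually_elim
 case (elim n)
 have n: "k <= n" "24 * (r + length ps' + 2) <= n" "2 <= n" using elim(2) by auto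
 show ?case
 proof
 fix sga assume sga: "sga \<in> assignments n"
 define D where "D = planted k Q n sga"
 define N where "N = 100 * Zc * mcl n"
 define s0 where "s0 xs = (mem0 n, (%_. 0) :: nat => int, 0 :: nat, xs)" for xs :: "clause list"
 have cf: "\<forall>i\<in>set P. coinfree i" using coinfree_asm by (auto simp: P_def)
 have rd: "run P D n s = map_pmf (%xs. cfg ((dstep P ^^ s) (0, s0 xs))) (replicate_pmf N D)" if "s <= N" for s
 unfolding s0_def by (rule run_det[OF cf that])
 have ex: "\<exists>s'. (dstep P ^^ N) (0, s0 xs) = (length P, s') & (fst (snd (snd s')) = mcl n &
 (\<forall>v\<in>{1..n}. fst (snd s') v = sgn (valg n (tasks (phases n)) xs arr0 (outp n) [v]))) &
 (\<forall>j\<le>N. wbd ((int n ^ \<beta>) ^ 2 ^ csize k prog) (snd ((dstep P ^^ j) (0, s0 xs))))"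
 if xs: "xs \<in> set_pmf (replicate_pmf N D)" for xs
 proof -
 have x: "length xs = N" "!!C. C \<in> set xs ==> C \<in> clauses k n"
 using xs set_planted[OF Q n(1) sga] by (auto simp: set_replicate_pmf D_def lists_eq_set)
 have W0: "int (Wsum n) <= int n ^ \<beta>" using \<beta>[OF n(3)] by (simp flip: of_nat_power)
 have I: "s0 xs = (mem0 n, %_. 0, 0, xs)" and le: "100 * Zc * mcl n <= N" by (simp_all add: s0_def N_def)
 show ?thesis unfolding P_def by (rule hoare_run[OF prog_correct[OF n(2) x(2) x(1)[unfolded N_def] W0] I le])
 qed
 have mem_cfg: "mem (cfg x) = fst (snd x)" "drawn (cfg x) = fst (snd (snd (snd x)))" "answer (cfg x) = fst (snd (snd x))" "pc (cfg x) = fst x" for x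
 by (auto simp: cfg_def split: prod.splits)
 have W: "(int n ^ \<beta>) ^ 2 ^ csize k prog = int n ^ E" by (simp add: E_def power_mult)
 have 1: "\<bar>mem c x\<bar> <= int n ^ E" if "s <= N" "c \<in> set_pmf (run P D n s)" for s c x
 proof -
 from that obtain xs where "xs \<in> set_pmf (replicate_pmf N D)" "c = cfg ((dstep P ^^ s) (0, s0 xs))" by (auto simp: rd)
 moreover have "wbd (int n ^ E) (snd ((dstep P ^^ s) (0, s0 xs)))" using ex[OF calculation(1)] that(1) unfolding W by blast
 ultimately show ?thesis by (simp add: mem_cfg wbd_def)
 qed
 have 2: "halted P c & drawn c <= mcl n" if "c \<in> set_pmf (run P D n N)" for c
 proof -
 from that obtain xs where xs: "xs \<in> set_pmf (replicate_pmf N D)" "c = cfg ((dstep P ^^ N) (0, s0 xs))" by (auto simp: rd)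
 obtain s' where "(dstep P ^^ N) (0, s0 xs) = (length P, s')" "fst (snd (snd s')) = mcl n" using ex[OF xs(1)] by blast
 then show ?thesis unfolding xs(2) by (simp add: mem_cfg halted_def)
 qed
 define ts where "ts = tasks (phases n)"
 have lts: "length ts = mcl n" by (simp add: ts_def mcl_def)
 obtain j where Nj: "N = mcl n + j"
 proof -
 have "mcl n <= N" by (simp add: N_def Zc_def)
 then show thesis using that by (auto simp: le_iff_add)
 qed
 \<comment> \<open>The algorithm zips clauses with tasks, so clauses beyond the number of tasks are
   ignored.\<close>
 have va: "valg n ts xs arr0 = valg n ts (take (mcl n) xs) arr0" for xs
 proof -
 have "zip ts xs = take (length ts) (zip ts xs)" by simp
 also have "... = zip ts (take (mcl n) xs)" by (simp only: take_zip lts take_all_iff) (simp add: lts)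
 finally show ?thesis by (simp add: valg_def)
 qed
 have "bind_pmf (run P D n N) (%c. complete_answer n (answer c))
 = bind_pmf (replicate_pmf N D) (%xs. complete_answer n (answer (cfg ((dstep P ^^ N) (0, s0 xs)))))"
 by (simp add: rd bind_map_pmf)
 also have "... = bind_pmf (replicate_pmf N D) (%xs. votes_answer n (valg n ts (take (mcl n) xs) arr0))"
 proof (rule bind_pmf_cong[OF refl])
 fix xs assume xs: "xs \<in> set_pmf (replicate_pmf N D)"
 obtain s' where s': "(dstep P ^^ N) (0, s0 xs) = (length P, s')" "\<forall>v\<in>{1..n}. fst (snd s') v = sgn (valg n ts xs arr0 (outp n) [v])"
 using ex[OF xs] unfolding ts_def by blast
 show "complete_answer n (answer (cfg ((dstep P ^^ N) (0, s0 xs)))) = votes_answer n (valg n ts (take (mcl n) xs) arr0)"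
 unfolding votes_answer_def complete_answer_def s'(1) mem_cfg snd_conv va[symmetric]
 by (rule Pi_pmf_cong) (use s'(2) in auto)
 qed
 also have "... = bind_pmf (map_pmf (take (mcl n)) (replicate_pmf N D)) (%cs. votes_answer n (valg n ts cs arr0))"
 by (simp add: bind_map_pmf)
 also have "... = bind_pmf (vrun D n (phases n) arr0) (votes_answer n)"
 unfolding Nj map_take_replicate_pmf vrun_eq_valg[OF proper_phases] by (simp add: bind_map_pmf ts_def mcl_def)
 finally have "prb (bind_pmf (run P D n N) (%c. complete_answer n (answer c))) {tau. planted_solution k Q r t n sga tau} \<ge> 1 - err n"
 using elim(1) sga by (simp add: D_def)
 then show "(\<forall>s\<le>100 * Zc * mcl n. \<forall>c\<in>set_pmf (run P (planted k Q n sga) n s). \<forall>a. \<bar>mem c a\<bar> <= int n ^ E) &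
 (\<forall>c\<in>set_pmf (run P (planted k Q n sga) n (100 * Zc * mcl n)). halted P c & drawn c <= mcl n) &
 prb
 (bind_pmf (run P (planted k Q n sga) n (100 * Zc * mcl n)) (%c. complete_answer n (answer c)))
 {tau. planted_solution k Q r t n sga tau} \<ge> 1 - err n"
 using 1 2 unfolding D_def N_def by blast
 qed
 qed
 then show ?thesis unfolding solved_from_samples_def using err(1) by blast
qed

lemma mv_largeI:
 assumes "k <= n" "24 * (r + length ps' + 2) <= n" and s: "(256 * c / d\<^sup>2 + 256 * 4 ^ length ps' / d'\<^sup>2) * real n ^ b <= s"
 shows "mv_large n s"
proof -
 define X Y p where "X = 256 * c / d\<^sup>2" and "Y = 256 * 4 ^ length ps' / d'\<^sup>2" and "p = real n ^ b"
 have n1: "1 <= real n" using assms(2) by simp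
 have x: "0 < X" "0 < Y" "0 < p" using d_pos c_ge n1 by (auto simp: X_def Y_def p_def)
 have "(X + Y) * p <= s" using s by (simp only: X_def Y_def p_def)
 then have "X * p + Y * p <= s" by (simp only: distrib_right)
 moreover have "0 < X * p" "0 < Y * p" using x by auto
 ultimately have s12: "X * p <= s" "Y * p <= s" "0 < s" by linarith+
 have s34: "X * real n <= s" "Y * real n <= s" if "2 <= r"
 proof -
 have "real n <= p" unfolding p_def using ab(4)[OF that] n1 by (intro self_le_power) auto
 then have "X * real n <= X * p" "Y * real n <= Y * p" using x by (auto intro: mult_left_mono)
 then show "X * real n <= s" "Y * real n <= s" using s12 by linarith+
 qed
 have "256 * c * real n ^ b / d\<^sup>2 = X * p" "256 * c * real n / d\<^sup>2 = X * real n" "256 * 4 ^ length ps' * real n / d'\<^sup>2 = Y * real n"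
 by (simp_all add: X_def Y_def p_def)
 then show ?thesis unfolding mv_large_def using assms(1,2) s12 s34 by simp
qed

end

lemma nat_ceiling_half: "nat \<lceil>real r / 2\<rceil> = (r + 1) div 2"
proof -
 have "\<lceil>real r / 2\<rceil> = int ((r + 1) div 2)"
 proof (rule ceiling_unique)
 show "ri (int ((r + 1) div 2)) - 1 < real r / 2" "real r / 2 <= ri (int ((r + 1) div 2))" by linarith+
 qed
 then show ?thesis by simp
qed

lemma ln_ge_1: "3 <= n ==> 1 <= ln (real n)"
proof -
 assume "3 <= n"
 then have "exp 1 <= real n" using exp_le by linarith
 then show ?thesis using \<open>3 <= n\<close> by (subst ln_ge_iff) auto
qed

theorem theorem3p2:
  fixes k r :: nat and Q :: "int list pmf" and t :: real
  assumes "set_pmf Q \<subseteq> cube k"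
    and "has_distribution_complexity k Q r"
  shows
    "(\<exists>m T :: nat \<Rightarrow> nat.
        (\<lambda>n. real (m n)) \<in> O(\<lambda>n. real n powr (real r / 2) * ln (real n)) \<and>
        (\<lambda>n. real (T n)) \<in> O(\<lambda>n. real (m n)) \<and>
        solved_from_samples k Q r t m T) \<and>
     (\<exists>q :: nat \<Rightarrow> nat.
        (\<lambda>n. real (q n)) \<in> O(\<lambda>n. real n powr (real r / 2) * (ln (real n))\<^sup>2) \<and>
        solved_by_1_MSTAT k Q r t (\<lambda>n. n ^ nat \<lceil>real r / 2\<rceil>) q) \<and>
     (even r \<longrightarrow> (\<exists>q :: nat \<Rightarrow> nat.
        (\<lambda>n. real (q n)) \<in> O(\<lambda>n. ln (real n)) \<and>
        solved_by_MVSTAT k Q r t (\<lambda>n. n ^ (r div 2))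
          (\<lambda>n. real n powr (real r / 2) * ln (ln (real n))) q)) \<and>
     (odd r \<longrightarrow> (\<exists>(L :: nat \<Rightarrow> nat) (s :: nat \<Rightarrow> real) (q :: nat \<Rightarrow> nat).
        (\<lambda>n. real (L n)) \<in> O(\<lambda>n. real n ^ nat \<lceil>real r / 2\<rceil>) \<and>
        (\<forall>n. 0 < s n) \<and> s \<in> O(\<lambda>n. real n powr (real r / 2) * ln (real n)) \<and>
        (\<lambda>n. real (q n)) \<in> O(\<lambda>n. ln (real n)) \<and>
        solved_by_MVSTAT k Q r t L s q))"
proof -
 obtain S where r1: "1 <= r" and S: "S \<subseteq> {..<k}" "card S = r" "fourier k Q S ~= 0"
 using assms(2) unfolding has_distribution_complexity_def by blast
 \<comment> \<open>An odd set is preferred, so an even size of \<open>S'\<close> certifies that no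
   odd coefficient is nonzero.\<close>
 obtain S' where S': "S' \<subseteq> {..<k}" "S' ~= {}" "fourier k Q S' ~= 0"
 "even (card S') ==> \<forall>U\<subseteq>{..<k}. odd (card U) --> fourier k Q U = 0"
 proof (cases "\<exists>U\<subseteq>{..<k}. odd (card U) & fourier k Q U ~= 0")
 case True
 then obtain U where U: "U \<subseteq> {..<k}" "odd (card U)" "fourier k Q U ~= 0" by blast
 show thesis by (rule that[of U]) (use U in auto)
 next
 case False
 show thesis by (rule that[of S]) (use S r1 False in auto)
 qed
 have fin: "finite S" "finite S'" using finite_subset[OF S(1)] finite_subset[OF S'(1)] by auto
 define ps ps' where "ps = sorted_list_of_set S" and "ps' = sorted_list_of_set S'"
 have pp: "distinct ps" "set ps = S" "length ps = r" "distinct ps'" "set ps' = S'" "length ps' = card S'" "ps' ~= []"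
 using fin S(2) S'(2) by (auto simp: ps_def ps'_def)
 have loc: "sampler k Q r ps ps' x y" if "1 <= x" "1 <= y" for x y
 by unfold_locales (use assms(1) r1 S S' pp that in auto)
 \<comment> \<open>\<open>c\<close>, \<open>d\<close>, \<open>d'\<close> and \<open>C5\<close> do
   not depend on the last two parameters; this interpretation makes them available for the choice of
   \<open>K1\<close> and \<open>K2\<close>.\<close>
 interpret S0: sampler k Q r ps ps' 1 1 by (rule loc) auto
 obtain K1 :: nat where K1: "2 * (3200 * S0.c)\<^sup>2 / S0.d ^ 4 <= real K1" "1 <= K1"
 proof -
 obtain x :: nat where "2 * (3200 * S0.c)\<^sup>2 / S0.d ^ 4 <= real x" using real_arch_simple by blast
 then show thesis by (intro that[of "x + 1"]) auto
 qed
 obtain K2 :: nat where K2: "2 * S0.C5 * (real r + 1) / S0.d\<^sup>2 + 4 * S0.c / S0.d\<^sup>2 + 4 * 4 ^ length ps' / S0.d'\<^sup>2 <= real K2" "1 <= K2"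
 proof -
 obtain x :: nat where "2 * S0.C5 * (real r + 1) / S0.d\<^sup>2 + 4 * S0.c / S0.d\<^sup>2 + 4 * 4 ^ length ps' / S0.d'\<^sup>2 <= real x" using real_arch_simple by blast
 then show thesis by (intro that[of "x + 1"]) auto
 qed
 interpret sampler k Q r ps ps' K1 K2 by (rule loc) (use K1 K2 in auto)
 have pos: "0 <= 2 * C5 * (real r + 1) / d\<^sup>2" "0 <= 4 * c / d\<^sup>2" "0 <= 4 * 4 ^ length ps' / d'\<^sup>2"
 using c_ge d_pos by (auto simp: C5_def C4_def C0_def)
 have "real K1 <= (real K1)\<^sup>2" using K1(2) by (simp add: power2_eq_square)
 then have KL: K1_large K2_large using K1(1) K2(1) pos unfolding K1_large_def K2_large_def by linarith+
 have aeq: "nat \<lceil>real r / 2\<rceil> = a" by (simp add: nat_ceiling_half a_def)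
 define g where "g n = real n powr (real r / 2) * ln (real n)" for n
 have mO: "(%n. real (mcl n)) \<in> O(g)"
 proof (rule bigoI)
 show "\<forall>\<^sub>F n in sequentially. norm (real (mcl n)) <= (10 + 2 * real r) * (6 * real K1 * real K2) * norm (g n)"
 using eventually_ge_at_top[of 2]
 proof eventually_elim
 case (elim n)
 then have "0 <= g n" by (simp add: g_def)
 then have "norm (g n) = g n" by simp
 then show ?case using mcl_le[OF elim] unfolding g_def[symmetric] by (simp only: mult.assoc real_norm_def abs_of_nat)
 qed
 qed
 have g2: "g \<in> O(%n. real n powr (real r / 2) * (ln (real n))\<^sup>2)"
 proof (rule bigoI)
 show "\<forall>\<^sub>F n in sequentially. norm (g n) <= 1 * norm (real n powr (real r / 2) * (ln (real n))\<^sup>2)"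
 using eventually_ge_at_top[of 3]
 proof eventually_elim
 case (elim n)
 have "ln (real n) * 1 <= ln (real n) * ln (real n)" using ln_ge_1[OF elim] by (intro mult_left_mono) auto
 then have "real n powr (real r / 2) * ln (real n) <= real n powr (real r / 2) * (ln (real n) * ln (real n))" by (intro mult_left_mono) auto
 then show ?case using ln_ge_1[OF elim] by (simp add: g_def power2_eq_square abs_mult)
 qed
 qed
 have callsO: "(%n. real mvcalls) \<in> O(%n. ln (real n))"
 proof (rule bigoI)
 show "\<forall>\<^sub>F n in sequentially. norm (real mvcalls) <= real mvcalls * norm (ln (real n))"
 using eventually_ge_at_top[of 3]
 proof eventually_elim
 case (elim n)
 have "real mvcalls * 1 <= real mvcalls * \<bar>ln (real n)\<bar>" using ln_ge_1[OF elim] by (intro mult_left_mono) auto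
 then show ?case by simp
 qed
 qed
 define X where "X = 256 * c / d\<^sup>2 + 256 * 4 ^ length ps' / d'\<^sup>2"
 have "filterlim (%n. ln (ln (real n))) at_top sequentially" "filterlim (%n. ln (real n)) at_top sequentially" by real_asymp+
 then have lnln: "\<forall>\<^sub>F n in sequentially. X <= ln (ln (real n))" "\<forall>\<^sub>F n in sequentially. X <= ln (real n)"
 by (auto simp: filterlim_at_top)
 have part1: "\<exists>m T :: nat => nat. (%n. real (m n)) \<in> O(%n. real n powr (real r / 2) * ln (real n)) &
 (%n. real (T n)) \<in> O(%n. real (m n)) & solved_from_samples k Q r t m T"
 proof (intro exI conjI)
 show "(%n. real (mcl n)) \<in> O(%n. real n powr (real r / 2) * ln (real n))" using mO unfolding g_def .
 show "(%n. real (100 * Zc * mcl n)) \<in> O(%n. real (mcl n))"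
 by (rule bigoI[where c="100 * real Zc"]) simp
 show "solved_from_samples k Q r t mcl (%n. 100 * Zc * mcl n)" by (rule votes_by_ram[OF KL])
 qed
 have part2: "\<exists>q :: nat => nat. (%n. real (q n)) \<in> O(%n. real n powr (real r / 2) * (ln (real n))\<^sup>2) &
 solved_by_1_MSTAT k Q r t (%n. n ^ nat \<lceil>real r / 2\<rceil>) q"
 proof (intro exI conjI)
 show "(%n. real (mcl n)) \<in> O(%n. real n powr (real r / 2) * (ln (real n))\<^sup>2)" by (rule landau_o.big_trans[OF mO g2])
 show "solved_by_1_MSTAT k Q r t (%n. n ^ nat \<lceil>real r / 2\<rceil>) mcl" using votes_by_mstat[OF KL, of t] unfolding aeq mcl_def .
 qed
 have part3: "\<exists>q :: nat => nat. (%n. real (q n)) \<in> O(%n. ln (real n)) &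
 solved_by_MVSTAT k Q r t (%n. n ^ (r div 2)) (%n. real n powr (real r / 2) * ln (ln (real n))) q" if ev: "even r"
 proof -
 have ab2: "a = r div 2" "real b = real r / 2" using ev by (auto simp: a_def b_def elim!: evenE)
 \<comment> \<open>For even \<open>r\<close>, \<open>real n powr (r / 2)\<close> is exactly
   \<open>n ^ b\<close>, so \<open>ln (ln n)\<close> has only to outgrow the constant
   \<open>X\<close>.\<close>
 have "\<forall>\<^sub>F n in sequentially. mv_large n (real n powr (real r / 2) * ln (ln (real n)))"
 using lnln(1) eventually_ge_at_top[of "k + 24 * (r + length ps' + 2)"]
 proof eventually_elim
 case (elim n)
 have "real n powr (real r / 2) = real n ^ b" unfolding ab2(2)[symmetric] using elim(2) by (intro powr_realpow) auto
 moreover have "X * real n ^ b <= ln (ln (real n)) * real n ^ b" using elim(1) by (intro mult_right_mono) auto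
 ultimately show ?case using elim(2) by (intro mv_largeI) (auto simp: X_def mult.commute)
 qed
 from votes_by_mvstat[OF this, of t] show ?thesis using callsO unfolding ab2(1) by (intro exI[of _ "%_. mvcalls"]) simp
 qed
 have part4: "\<exists>(L :: nat => nat) (s :: nat => real) (q :: nat => nat). (%n. real (L n)) \<in> O(%n. real n ^ nat \<lceil>real r / 2\<rceil>) &
 (\<forall>n. 0 < s n) & s \<in> O(%n. real n powr (real r / 2) * ln (real n)) &
 (%n. real (q n)) \<in> O(%n. ln (real n)) & solved_by_MVSTAT k Q r t L s q"
 proof -
 \<comment> \<open>The maximum keeps \<open>s\<close> positive for every \<open>n\<close>, also
   where the logarithm vanishes; from \<open>n = 3\<close> on it equals \<open>g\<close>.\<close>
 define s where "s n = max 1 (g n)" for n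
 have g1: "1 <= g n" if "3 <= n" for n
 proof -
 have "1 * 1 <= real n powr (real r / 2) * ln (real n)" using ln_ge_1[OF that] that by (intro mult_mono ge_one_powr_ge_zero) auto
 then show ?thesis by (simp add: g_def)
 qed
 have "\<forall>\<^sub>F n in sequentially. mv_large n (s n)"
 using lnln(2) eventually_ge_at_top[of "k + 24 * (r + length ps' + 2)"]
 proof eventually_elim
 case (elim n)
 have X0: "0 <= X" using c_ge d_pos by (simp add: X_def)
 have "real b <= real r / 2" by (simp add: b_def)
 then have "real n powr real b <= real n powr (real r / 2)" using elim(2) by (intro powr_mono) auto
 moreover have "real n powr real b = real n ^ b" using elim(2) by (intro powr_realpow) auto
 ultimately have "X * real n ^ b <= ln (real n) * real n powr (real r / 2)" using elim(1) X0 by (intro mult_mono) auto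
 then have "X * real n ^ b <= s n" by (simp add: s_def g_def mult.commute)
 then show ?case using elim(2) by (intro mv_largeI) (auto simp: X_def)
 qed
 from votes_by_mvstat[OF this, of t] have sol: "solved_by_MVSTAT k Q r t (%n. n ^ a) s (%_. mvcalls)" .
 have sO: "s \<in> O(%n. real n powr (real r / 2) * ln (real n))"
 proof (rule bigoI)
 show "\<forall>\<^sub>F n in sequentially. norm (s n) <= 1 * norm (real n powr (real r / 2) * ln (real n))"
 using eventually_ge_at_top[of 3]
 proof eventually_elim
 case (elim n)
 have "s n = g n" using g1[OF elim] by (simp add: s_def)
 then show ?case by (simp add: g_def)
 qed
 qed
 show ?thesis
 proof (intro exI conjI)
 show "(%n. real (n ^ a)) \<in> O(%n. real n ^ nat \<lceil>real r / 2\<rceil>)" unfolding aeq by simp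
 show "\<forall>n. 0 < s n" by (simp add: s_def less_max_iff_disj)
 qed (use sO callsO sol in auto)
 qed
 show ?thesis using part1 part2 part3 part4 by blast
qed

end
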